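(* Let $X$ be a connected, oriented $C^\infty$ Riemannian manifold with volume element $m$; let $\sigma=\rho\cdot m$ with $\rho\ge0$, $\rho\in L^1_{loc}(X;m)$, $\rho^{1/2}\in H^{1,2}_{loc}(X;m)$; let $\Phi$ be a potential on $\Gamma_X$, and let $\mu\in\mathcal{G}^1_{gc}(\sigma,\Phi)$, i.e. $\mu$ is a grand canonical Gibbs measure with interaction potential $\Phi$ and intensity measure $\sigma$ such that $\int\gamma(K)\,\mu(d\gamma)<\infty$ for all compact $K\subset X$. For $\gamma\in\Gamma_X$ put $$\rho_\gamma(x):=e^{-E^\Phi_{\{x\}}(\gamma+\varepsilon_x)}\rho(x),\quad x\in X.$$ Suppose that for $\mu$-a.e. $\gamma\in\Gamma_X$ the function $\rho_1:=\rho_\gamma$ satisfies $$\rho_1=0\quad m\text{-a.e. on }X\setminus\Big\{x\in X\;\Big|\;\int_{\Lambda_x}\frac1{\rho_1}\,dm<\infty\text{ for some open neighbourhood }\Lambda_x\text{ of }x\Big\}$$ or, in the case $X=\mathbb{R}^d$ (Euclidean metric), that for $\mu$-a.e. $\gamma$ the function $\rho_1:=\rho_\gamma$ satisfies the following: for every $1\le i\le d$ and $\lambda^{d-1}$-a.e. $x\in\{y\in\mathbb{R}^{d-1}\mid\int_{\mathbb{R}}\rho^{(i)}_{1,y}(s)\,\lambda^1(ds)>0\}$ one has $\rho^{(i)}_{1,x}=0$ $\lambda^1$-a.e. on $\mathbb{R}\setminus R(\rho^{(i)}_{1,x})$. Then the form $(\mathcal{E}_\mu^\Gamma,\mathcal{F}C_b^{\infty,\mu})$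 is closable on $L^2(\Gamma_X;\mu)$.
   Context: $\Gamma_X$: locally finite subsets $\gamma\subset X$, identified with the Radon measures $\sum_{x\in\gamma}\varepsilon_x$, with vague topology and Borel $\sigma$-algebra $\mathcal{B}(\Gamma_X)$; $\gamma_\Lambda:=\gamma\cap\Lambda$; $N_B(\gamma):=\gamma(B)$; $\mathcal{B}_A(\Gamma_X):=\sigma(N_B\mid B\subset A\text{ Borel, relatively compact})$; $\mathcal{O}_c(X)$, $\mathcal{B}_c(X)$: open, resp. Borel, relatively compact subsets of $X$. $\pi_\sigma$: Poisson measure with intensity $\sigma$, i.e. $\int e^{\langle f,\gamma\rangle}\pi_\sigma(d\gamma)=\exp(\int(e^f-1)\,d\sigma)$ for $f\in C_0^\infty(X)$, where $\langle f,\gamma\rangle:=\sum_{x\in\gamma}f(x)$. A potential is a function $\Phi:\Gamma_X\to\mathbb{R}\cup\{+\infty\}$ with $\Phi=1_{\{N_X<\infty\}}\Phi$, $\Phi(\emptyset)=0$, and $\gamma\mapsto\Phi(\gamma_\Lambda)$ $\mathcal{B}_\Lambda(\Gamma_X)$-measurable for all $\Lambda\in\mathcal{B}_c(X)$. For $\Lambda\in\mathcal{B}_c(X)$, $E_\Lambda^\Phi(\gamma):=\sum_{\gamma'\subset\gamma,\gamma'(\Lambda)>0}\Phi(\gamma')$ if this series converges absolutely, $:=+\infty$ otherwise. For $x\in X$, $E^\Phi_{\{x\}}(\gamma+\varepsilon_x):=\sum_{\{x\}\subset\gamma'\subset\gamma\cup\{x\}}\Phi(\gamma')$ if absolutely convergent,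 $:=+\infty$ otherwise. For $\Lambda\in\mathcal{O}_c(X)$, $\gamma\in\Gamma_X$, $\Delta\in\mathcal{B}(\Gamma_X)$: $Z_\Lambda^{\sigma,\Phi}(\gamma):=\int\exp[-E_\Lambda^\Phi(\gamma_{X\setminus\Lambda}+\gamma'_\Lambda)]\,\pi_\sigma(d\gamma')$ and $$\Pi_\Lambda^{\sigma,\Phi}(\gamma,\Delta):=1_{\{Z_\Lambda^{\sigma,\Phi}<\infty\}}(\gamma)[Z_\Lambda^{\sigma,\Phi}(\gamma)]^{-1}\int1_\Delta(\gamma_{X\setminus\Lambda}+\gamma'_\Lambda)\exp[-E_\Lambda^\Phi(\gamma_{X\setminus\Lambda}+\gamma'_\Lambda)]\,\pi_\sigma(d\gamma').$$ A probability measure $\mu$ on $\Gamma_X$ is a grand canonical Gibbs measure ($\mu\in\mathcal{G}_{gc}(\sigma,\Phi)$) if $\int\Pi_\Lambda^{\sigma,\Phi}(\gamma,\cdot)\,\mu(d\gamma)=\mu$ for all $\Lambda\in\mathcal{O}_c(X)$. $\lambda^k$ is Lebesgue measure on $\mathbb{R}^k$. For $\rho_1:\mathbb{R}^d\to\mathbb{R}_+$, $x=(x_1,\ldots,x_{d-1})\in\mathbb{R}^{d-1}$: $\rho^{(i)}_{1,x}(s):=\rho_1(x_1,\ldots,x_{i-1},s,x_i,\ldots,x_{d-1})$, and $R(\rho^{(i)}_{1,x}):=\{t\in\mathbb{R}\mid\int_{t-\varepsilon}^{t+\varepsilon}\rho^{(i)}_{1,x}(s)^{-1}\lambda^1(ds)<\infty\text{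 for some }\varepsilon>0\}$. $\mathcal{F}C_b^\infty$: functions $F(\gamma)=g(\langle f_1,\gamma\rangle,\ldots,\langle f_N,\gamma\rangle)$, $N\in\mathbb{N}$, $g\in C_b^\infty(\mathbb{R}^N)$, $f_i\in C_0^\infty(X)$; $\mathcal{F}C_b^{\infty,\mu}$: the corresponding $\mu$-classes. $\nabla^\Gamma F(\gamma)=\sum_i\partial_ig(\langle f_1,\gamma\rangle,\ldots,\langle f_N,\gamma\rangle)\nabla^Xf_i\in T_\gamma\Gamma_X:=L^2(X\to TX;\gamma)$; $\mathcal{E}_\mu^\Gamma(F,G):=\int\int_X\langle\nabla^\Gamma F(\gamma),\nabla^\Gamma G(\gamma)\rangle_{TX}\,d\gamma\,\mu(d\gamma)$, which is well defined on $\mu$-classes for $\mu\in\mathcal{G}^1_{gc}(\sigma,\Phi)$. Closable on $L^2(\Gamma_X;\mu)$ means: if $F_n\in\mathcal{F}C_b^{\infty,\mu}$, $F_n\to0$ in $L^2(\Gamma_X;\mu)$ and $\mathcal{E}_\mu^\Gamma(F_n-F_k,F_n-F_k)\to0$ as $n,k\to\infty$, then $\mathcal{E}_\mu^\Gamma(F_n,F_n)\to0$. *)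

theory Defs
  imports "HOL-Probability.Probability"
begin

section \<open>Smooth functions on open subsets of Euclidean space\<close>

primrec Ck_on :: "nat \<Rightarrow> 'e::euclidean_space set \<Rightarrow> ('e \<Rightarrow> 'b::real_normed_vector) \<Rightarrow> bool" where
  "Ck_on 0 U f \<longleftrightarrow> continuous_on U f"
| "Ck_on (Suc k) U f \<longleftrightarrow> (\<forall>x\<in>U. f differentiable (at x)) \<and>
     (\<forall>v. Ck_on k U (\<lambda>x. frechet_derivative f (at x) v))"

definition smooth_on :: "'e::euclidean_space set \<Rightarrow> ('e \<Rightarrow> 'b::real_normed_vector) \<Rightarrow> bool" where
  "smooth_on U f \<longleftrightarrow> (\<forall>k. Ck_on k U f)"

definition compact_support :: "('a::topological_space \<Rightarrow> real) \<Rightarrow> bool" where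
  "compact_support f \<longleftrightarrow> compact (closure {x. f x \<noteq> 0})"

definition test_functions :: "'e::euclidean_space set \<Rightarrow> ('e \<Rightarrow> real) set" where
  "test_functions \<Omega> = {\<psi>. smooth_on UNIV \<psi> \<and> compact_support \<psi> \<and> closure {y. \<psi> y \<noteq> 0} \<subseteq> \<Omega>}"


section \<open>Oriented Riemannian manifolds\<close>

text \<open>
  The manifold is the whole type \<open>'a\<close>, with its given topology, and it is modelled on
  \<open>real ^ 'n\<close>. A chart is a pair of a domain and a map; values of the map outside the domain
  are irrelevant.

  Tangent vectors at \<open>x\<close> are identified with directional derivatives, acting on the functions
  that are differentiable at \<open>x\<close> (a notion which does not depend on the chart) and extended by 0
  to all other functions.
\<close>

type_synonym ('a, 'n) chart = "'a set \<times> ('a \<Rightarrow> real ^ 'n)"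

type_synonym 'a tangent = "('a \<Rightarrow> real) \<Rightarrow> real"

record ('a, 'n) riemannian =
  charts :: "('a, 'n) chart set"
  metric :: "'a \<Rightarrow> 'a tangent \<Rightarrow> 'a tangent \<Rightarrow> real"

definition chart_inv :: "('a, 'n) chart \<Rightarrow> real ^ 'n \<Rightarrow> 'a" where
  "chart_inv c = inv_into (fst c) (snd c)"

definition chart_range :: "('a, 'n) chart \<Rightarrow> (real ^ 'n) set" where
  "chart_range c = snd c ` fst c"

definition is_chart :: "('a::topological_space, 'n::finite) chart \<Rightarrow> bool" where
  "is_chart c \<longleftrightarrow> open (fst c) \<and> open (chart_range c) \<and>
     homeomorphism (fst c) (chart_range c) (snd c) (chart_inv c)"

definition transition :: "('a, 'n) chart \<Rightarrow> ('a, 'n) chart \<Rightarrow> real ^ 'n \<Rightarrow> real ^ 'n" where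
  "transition c c' = snd c' \<circ> chart_inv c"

definition smooth_transition :: "('a, 'n::finite) chart \<Rightarrow> ('a, 'n) chart \<Rightarrow> bool" where
  "smooth_transition c c' \<longleftrightarrow> smooth_on (snd c ` (fst c \<inter> fst c')) (transition c c')"

text \<open>The charts of the maximal smooth atlas generated by \<open>charts M\<close>:\<close>

definition smooth_chart ::
    "('a::topological_space, 'n::finite) riemannian \<Rightarrow> ('a, 'n) chart \<Rightarrow> bool" where
  "smooth_chart M c \<longleftrightarrow> is_chart c \<and>
     (\<forall>c'\<in>charts M. smooth_transition c c' \<and> smooth_transition c' c)"

definition smooth_atlas :: "('a::topological_space, 'n::finite) riemannian \<Rightarrow> bool" where
  "smooth_atlas M \<longleftrightarrow> (\<Union>c\<in>charts M. fst c) = UNIV \<and> (\<forall>c\<in>charts M. smooth_chart M c)"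

text \<open>An orientation is given by an atlas of positively oriented charts.\<close>

definition oriented_atlas :: "('a::topological_space, 'n::finite) riemannian \<Rightarrow> bool" where
  "oriented_atlas M \<longleftrightarrow> (\<forall>c\<in>charts M. \<forall>c'\<in>charts M. \<forall>y\<in>snd c ` (fst c \<inter> fst c').
     0 < det (matrix (frechet_derivative (transition c c') (at y))))"

definition chart_tangent :: "('a, 'n::finite) chart \<Rightarrow> 'a \<Rightarrow> real ^ 'n \<Rightarrow> 'a tangent" where
  "chart_tangent c x v = (\<lambda>f.
     if (f \<circ> chart_inv c) differentiable (at (snd c x))
     then frechet_derivative (f \<circ> chart_inv c) (at (snd c x)) v else 0)"

definition tangent_space ::
    "('a, 'n::finite) riemannian \<Rightarrow> 'a \<Rightarrow> 'a tangent set" where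
  "tangent_space M x = {chart_tangent c x v | c v. c \<in> charts M \<and> x \<in> fst c}"

definition metric_in_chart ::
    "('a, 'n::finite) riemannian \<Rightarrow> ('a, 'n) chart \<Rightarrow> real ^ 'n \<Rightarrow> real ^ 'n \<Rightarrow> real ^ 'n \<Rightarrow> real" where
  "metric_in_chart M c y v w = metric M (chart_inv c y)
     (chart_tangent c (chart_inv c y) v) (chart_tangent c (chart_inv c y) w)"

definition riemannian_metric :: "('a, 'n::finite) riemannian \<Rightarrow> bool" where
  "riemannian_metric M \<longleftrightarrow> (\<forall>c\<in>charts M.
     (\<forall>y\<in>chart_range c.
        bilinear (metric_in_chart M c y) \<and>
        (\<forall>v w. metric_in_chart M c y v w = metric_in_chart M c y w v) \<and>
        (\<forall>v. v \<noteq> 0 \<longrightarrow> 0 < metric_in_chart M c y v v)) \<and>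
     (\<forall>v w. smooth_on (chart_range c) (\<lambda>y. metric_in_chart M c y v w)))"

definition oriented_riemannian_manifold ::
    "('a::{t2_space, second_countable_topology}, 'n::finite) riemannian \<Rightarrow> bool" where
  "oriented_riemannian_manifold M \<longleftrightarrow> smooth_atlas M \<and> oriented_atlas M \<and> riemannian_metric M"

definition gram_det :: "('a, 'n::finite) riemannian \<Rightarrow> ('a, 'n) chart \<Rightarrow> real ^ 'n \<Rightarrow> real" where
  "gram_det M c y = det ((\<chi> i j. metric_in_chart M c y (axis i 1) (axis j 1)) :: real ^ 'n ^ 'n)"

text \<open>The Borel measure with density \<open>sqrt (det g)\<close> with respect to Lebesgue measure in each chart:\<close>

definition volume_element ::
    "('a::topological_space, 'n::finite) riemannian \<Rightarrow> 'a measure \<Rightarrow> bool" where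
  "volume_element M m \<longleftrightarrow> sets m = sets borel \<and>
     (\<forall>c\<in>charts M. \<forall>A\<in>sets borel. A \<subseteq> fst c \<longrightarrow>
        emeasure m A = (\<integral>\<^sup>+y\<in>snd c ` A. ennreal (sqrt (gram_det M c y)) \<partial>lborel))"

text \<open>
  \<open>\<psi>\<close> identifies the manifold with \<open>real ^ 'n\<close> carrying the Euclidean metric. For the type
  \<open>real ^ 'n\<close> itself with its standard structure, \<open>\<psi>\<close> is the identity.
\<close>

definition euclidean_identification ::
    "('a::topological_space, 'n::finite) riemannian \<Rightarrow> ('a \<Rightarrow> real ^ 'n) \<Rightarrow> bool" where
  "euclidean_identification M \<psi> \<longleftrightarrow> smooth_chart M (UNIV, \<psi>) \<and> range \<psi> = UNIV \<and>
     (\<forall>y v w. metric_in_chart M (UNIV, \<psi>) y v w = v \<bullet> w)"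

definition smooth_fun :: "('a, 'n::finite) riemannian \<Rightarrow> ('a \<Rightarrow> real) \<Rightarrow> bool" where
  "smooth_fun M f \<longleftrightarrow> (\<forall>c\<in>charts M. smooth_on (chart_range c) (f \<circ> chart_inv c))"

definition C0_inf :: "('a::topological_space, 'n::finite) riemannian \<Rightarrow> ('a \<Rightarrow> real) set" where
  "C0_inf M = {f. smooth_fun M f \<and> compact_support f}"

definition grad :: "('a, 'n::finite) riemannian \<Rightarrow> ('a \<Rightarrow> real) \<Rightarrow> 'a \<Rightarrow> 'a tangent" where
  "grad M f x =
     (THE v. v \<in> tangent_space M x \<and> (\<forall>w\<in>tangent_space M x. metric M x v w = w f))"


section \<open>Local function spaces\<close>

definition L1_loc :: "'a::topological_space measure \<Rightarrow> ('a \<Rightarrow> real) set" where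
  "L1_loc m = {f \<in> borel_measurable m. \<forall>K. compact K \<longrightarrow> set_integrable m K f}"

definition L2_loc_on :: "(real ^ 'n::finite) set \<Rightarrow> (real ^ 'n \<Rightarrow> real) set" where
  "L2_loc_on \<Omega> = {u. set_borel_measurable lborel \<Omega> u \<and>
     (\<forall>K. compact K \<and> K \<subseteq> \<Omega> \<longrightarrow> set_integrable lborel K (\<lambda>y. (u y)\<^sup>2))}"

definition weak_partial_on ::
    "(real ^ 'n::finite) set \<Rightarrow> 'n \<Rightarrow> (real ^ 'n \<Rightarrow> real) \<Rightarrow> (real ^ 'n \<Rightarrow> real) \<Rightarrow> bool" where
  "weak_partial_on \<Omega> i u v \<longleftrightarrow> (\<forall>\<psi>\<in>test_functions \<Omega>.
     (LINT y:\<Omega>|lborel. u y * frechet_derivative \<psi> (at y) (axis i 1)) =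
     - (LINT y:\<Omega>|lborel. v y * \<psi> y))"

text \<open>
  Membership in the local Sobolev space over the manifold is tested in local coordinates. There,
  \<open>L\<^sup>2_loc\<close> with respect to the volume element and with respect to Lebesgue measure agree, since
  the volume density is continuous and strictly positive.
\<close>

definition H12_loc :: "('a, 'n::finite) riemannian \<Rightarrow> ('a \<Rightarrow> real) set" where
  "H12_loc M = {u. \<forall>c\<in>charts M. u \<circ> chart_inv c \<in> L2_loc_on (chart_range c) \<and>
     (\<forall>i. \<exists>v\<in>L2_loc_on (chart_range c). weak_partial_on (chart_range c) i (u \<circ> chart_inv c) v)}"


section \<open>Configuration space\<close>

definition configs :: "'a::topological_space set set" where
  "configs = {\<gamma>. \<forall>K. compact K \<longrightarrow> finite (\<gamma> \<inter> K)}"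

definition pairing :: "('a \<Rightarrow> real) \<Rightarrow> 'a set \<Rightarrow> real" where
  "pairing f \<gamma> = (\<Sum>\<^sub>\<infinity>x\<in>\<gamma>. f x)"

definition vague_topology :: "'a::topological_space set topology" where
  "vague_topology = topology_generated_by
     {{\<gamma> \<in> configs. pairing f \<gamma> \<in> U} | f U. continuous_on UNIV f \<and> compact_support f \<and> open U}"

definition config_borel :: "'a::topological_space set measure" where
  "config_borel = sigma configs {S. openin vague_topology S}"

definition borel_c :: "'a::topological_space set set" where
  "borel_c = {B \<in> sets borel. compact (closure B)}"

definition open_c :: "'a::topological_space set set" where
  "open_c = {B. open B \<and> compact (closure B)}"

definition local_borel :: "'a::topological_space set \<Rightarrow> 'a set measure" where
  "local_borel A = sigma configs
     {{\<gamma> \<in> configs. card (\<gamma> \<inter> B) \<in> S} | B S. B \<in> borel_c \<and> B \<subseteq> A}"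

definition poisson_measure ::
    "('a::topological_space, 'n::finite) riemannian \<Rightarrow> 'a measure \<Rightarrow> 'a set measure \<Rightarrow> bool" where
  "poisson_measure M \<sigma> \<pi> \<longleftrightarrow> prob_space \<pi> \<and> sets \<pi> = sets config_borel \<and>
     (\<forall>f\<in>C0_inf M. (LINT \<gamma>|\<pi>. exp (pairing f \<gamma>)) = exp (LINT x|\<sigma>. exp (f x) - 1))"


section \<open>Potentials and Gibbs measures\<close>

definition potential :: "('a::topological_space set \<Rightarrow> ereal) \<Rightarrow> bool" where
  "potential \<Phi> \<longleftrightarrow> (\<forall>\<gamma>\<in>configs. \<Phi> \<gamma> \<noteq> - \<infinity>) \<and> (\<forall>\<gamma>\<in>configs. infinite \<gamma> \<longrightarrow> \<Phi> \<gamma> = 0) \<and>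
     \<Phi> {} = 0 \<and> (\<forall>\<Lambda>\<in>borel_c. (\<lambda>\<gamma>. \<Phi> (\<gamma> \<inter> \<Lambda>)) \<in> borel_measurable (local_borel \<Lambda>))"

text \<open>The sum of \<open>\<Phi>\<close> over \<open>S\<close> if it converges absolutely (to a finite value), otherwise \<open>\<infinity>\<close>:\<close>

definition abs_sum :: "('a set \<Rightarrow> ereal) \<Rightarrow> 'a set set \<Rightarrow> ereal" where
  "abs_sum \<Phi> S =
     (if (\<forall>\<eta>\<in>S. \<bar>\<Phi> \<eta>\<bar> \<noteq> \<infinity>) \<and> (\<lambda>\<eta>. \<bar>real_of_ereal (\<Phi> \<eta>)\<bar>) summable_on S
      then ereal (\<Sum>\<^sub>\<infinity>\<eta>\<in>S. real_of_ereal (\<Phi> \<eta>)) else \<infinity>)"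

definition energy :: "('a set \<Rightarrow> ereal) \<Rightarrow> 'a set \<Rightarrow> 'a set \<Rightarrow> ereal" where
  "energy \<Phi> \<Lambda> \<gamma> = abs_sum \<Phi> {\<eta>. \<eta> \<subseteq> \<gamma> \<and> \<eta> \<inter> \<Lambda> \<noteq> {}}"

definition point_energy :: "('a set \<Rightarrow> ereal) \<Rightarrow> 'a \<Rightarrow> 'a set \<Rightarrow> ereal" where
  "point_energy \<Phi> x \<gamma> = abs_sum \<Phi> {\<eta>. {x} \<subseteq> \<eta> \<and> \<eta> \<subseteq> \<gamma> \<union> {x}}"

text \<open>\<open>exp (- e)\<close> with value 0 at \<open>e = \<infinity>\<close>; energies never take the value \<open>- \<infinity>\<close>.\<close>

definition exp_neg :: "ereal \<Rightarrow> real" where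
  "exp_neg e = (if e = \<infinity> then 0 else exp (- real_of_ereal e))"

definition partition_function ::
    "'a set measure \<Rightarrow> ('a set \<Rightarrow> ereal) \<Rightarrow> 'a set \<Rightarrow> 'a set \<Rightarrow> ennreal" where
  "partition_function \<pi> \<Phi> \<Lambda> \<gamma> =
     (\<integral>\<^sup>+\<gamma>'. ennreal (exp_neg (energy \<Phi> \<Lambda> ((\<gamma> - \<Lambda>) \<union> (\<gamma>' \<inter> \<Lambda>)))) \<partial>\<pi>)"

definition specification_kernel ::
    "'a set measure \<Rightarrow> ('a set \<Rightarrow> ereal) \<Rightarrow> 'a set \<Rightarrow> 'a set \<Rightarrow> 'a set set \<Rightarrow> ennreal" where
  "specification_kernel \<pi> \<Phi> \<Lambda> \<gamma> \<Delta> =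
     indicator {\<gamma>. partition_function \<pi> \<Phi> \<Lambda> \<gamma> < \<infinity>} \<gamma> * inverse (partition_function \<pi> \<Phi> \<Lambda> \<gamma>) *
     (\<integral>\<^sup>+\<gamma>'. indicator \<Delta> ((\<gamma> - \<Lambda>) \<union> (\<gamma>' \<inter> \<Lambda>)) *
        ennreal (exp_neg (energy \<Phi> \<Lambda> ((\<gamma> - \<Lambda>) \<union> (\<gamma>' \<inter> \<Lambda>)))) \<partial>\<pi>)"

text \<open>
  The existential quantifier only names the Poisson measure with intensity \<open>\<sigma>\<close>, which is determined
  by its Laplace transform.
\<close>

definition gibbs_gc ::
    "('a::topological_space, 'n::finite) riemannian \<Rightarrow> 'a measure \<Rightarrow> ('a set \<Rightarrow> ereal) \<Rightarrow>
     'a set measure set" where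
  "gibbs_gc M \<sigma> \<Phi> = {\<mu>. prob_space \<mu> \<and> sets \<mu> = sets config_borel \<and>
     (\<exists>\<pi>. poisson_measure M \<sigma> \<pi> \<and>
       (\<forall>\<Lambda>\<in>open_c. \<forall>\<Delta>\<in>sets config_borel.
          (\<integral>\<^sup>+\<gamma>. specification_kernel \<pi> \<Phi> \<Lambda> \<gamma> \<Delta> \<partial>\<mu>) = emeasure \<mu> \<Delta>))}"

definition gibbs_gc1 ::
    "('a::topological_space, 'n::finite) riemannian \<Rightarrow> 'a measure \<Rightarrow> ('a set \<Rightarrow> ereal) \<Rightarrow>
     'a set measure set" where
  "gibbs_gc1 M \<sigma> \<Phi> = {\<mu> \<in> gibbs_gc M \<sigma> \<Phi>.
     \<forall>K. compact K \<longrightarrow> (\<integral>\<^sup>+\<gamma>. of_nat (card (\<gamma> \<inter> K)) \<partial>\<mu>) < \<infinity>}"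

definition rho_conf ::
    "('a set \<Rightarrow> ereal) \<Rightarrow> ('a \<Rightarrow> real) \<Rightarrow> 'a set \<Rightarrow> 'a \<Rightarrow> real" where
  "rho_conf \<Phi> \<rho> \<gamma> x = exp_neg (point_energy \<Phi> x \<gamma>) * \<rho> x"


section \<open>Hamza-type conditions\<close>

text \<open>Reciprocals are taken in \<open>ennreal\<close>, where \<open>inverse 0 = \<infinity>\<close>.\<close>

definition hamza_condition :: "'a::topological_space measure \<Rightarrow> ('a \<Rightarrow> real) \<Rightarrow> bool" where
  "hamza_condition m r \<longleftrightarrow> (AE x in m.
     x \<notin> {x. \<exists>\<Lambda>. open \<Lambda> \<and> x \<in> \<Lambda> \<and> (\<integral>\<^sup>+y\<in>\<Lambda>. inverse (ennreal (r y)) \<partial>m) < \<infinity>} \<longrightarrow> r x = 0)"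

definition regular_points :: "(real \<Rightarrow> real) \<Rightarrow> real set" where
  "regular_points r = {t. \<exists>\<epsilon>>0. (\<integral>\<^sup>+s\<in>{t - \<epsilon>..t + \<epsilon>}. inverse (ennreal (r s)) \<partial>lborel) < \<infinity>}"

definition slice :: "(real ^ 'n \<Rightarrow> real) \<Rightarrow> 'n \<Rightarrow> ('n \<Rightarrow> real) \<Rightarrow> real \<Rightarrow> real" where
  "slice r i x s = r (\<chi> j. if j = i then s else x j)"

text \<open>
  A point of \<open>\<real>\<^sup>d\<^sup>-\<^sup>1\<close> is given by its coordinates with indices different from \<open>i\<close>, and Lebesgue
  measure on \<open>\<real>\<^sup>d\<^sup>-\<^sup>1\<close> is the corresponding product measure (a unit point mass if \<open>d = 1\<close>).
\<close>

definition hamza_condition_lines :: "(real ^ 'n::finite \<Rightarrow> real) \<Rightarrow> bool" where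
  "hamza_condition_lines r \<longleftrightarrow> (\<forall>i. AE x in Pi\<^sub>M (UNIV - {i}) (\<lambda>_. lborel).
     (\<integral>\<^sup>+s. ennreal (slice r i x s) \<partial>lborel) > 0 \<longrightarrow>
     (AE s in lborel. s \<notin> regular_points (slice r i x) \<longrightarrow> slice r i x s = 0))"


section \<open>The Dirichlet form\<close>

text \<open>
  A function on \<open>\<real>\<^sup>N\<close>, with \<open>N\<close> a natural number, is a function on sequences depending only on the
  entries with index less than \<open>N\<close>. For such functions, continuity in the product topology is
  continuity on \<open>\<real>\<^sup>N\<close>.
\<close>

definition partial_deriv :: "nat \<Rightarrow> ((nat \<Rightarrow> real) \<Rightarrow> real) \<Rightarrow> (nat \<Rightarrow> real) \<Rightarrow> real" where
  "partial_deriv i g y = deriv (\<lambda>t. g (y(i := t))) (y i)"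

primrec Ckb :: "nat \<Rightarrow> nat \<Rightarrow> ((nat \<Rightarrow> real) \<Rightarrow> real) \<Rightarrow> bool" where
  "Ckb 0 N g \<longleftrightarrow> continuous_on UNIV g \<and> bounded (range g)"
| "Ckb (Suc k) N g \<longleftrightarrow> continuous_on UNIV g \<and> bounded (range g) \<and>
     (\<forall>i<N. (\<forall>y. (\<lambda>t. g (y(i := t))) field_differentiable (at (y i))) \<and>
            Ckb k N (partial_deriv i g))"

definition Cb_inf :: "nat \<Rightarrow> ((nat \<Rightarrow> real) \<Rightarrow> real) set" where
  "Cb_inf N = {g. (\<forall>y z. (\<forall>i<N. y i = z i) \<longrightarrow> g y = g z) \<and> (\<forall>k. Ckb k N g)}"

definition cylinder_rep ::
    "('a::topological_space, 'n::finite) riemannian \<Rightarrow> ('a set \<Rightarrow> real) \<Rightarrow>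
     nat \<Rightarrow> ((nat \<Rightarrow> real) \<Rightarrow> real) \<Rightarrow> (nat \<Rightarrow> 'a \<Rightarrow> real) \<Rightarrow> bool" where
  "cylinder_rep M F N g f \<longleftrightarrow> g \<in> Cb_inf N \<and> (\<forall>i<N. f i \<in> C0_inf M) \<and>
     (\<forall>\<gamma>\<in>configs. F \<gamma> = g (\<lambda>i. pairing (f i) \<gamma>))"

definition FCb_inf ::
    "('a::topological_space, 'n::finite) riemannian \<Rightarrow> ('a set \<Rightarrow> real) set" where
  "FCb_inf M = {F. \<exists>N g f. cylinder_rep M F N g f}"

text \<open>On the points of \<open>\<gamma>\<close>, the gradient does not depend on the chosen representation of \<open>F\<close>.\<close>

definition grad_conf ::
    "('a::topological_space, 'n::finite) riemannian \<Rightarrow> ('a set \<Rightarrow> real) \<Rightarrow> 'a set \<Rightarrow>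
     'a \<Rightarrow> 'a tangent" where
  "grad_conf M F \<gamma> x =
     (let (N, g, f) = (SOME (N, g, f). cylinder_rep M F N g f)
      in (\<lambda>h. \<Sum>i<N. partial_deriv i g (\<lambda>j. pairing (f j) \<gamma>) * grad M (f i) x h))"

definition dirichlet_form ::
    "('a::topological_space, 'n::finite) riemannian \<Rightarrow> 'a set measure \<Rightarrow>
     ('a set \<Rightarrow> real) \<Rightarrow> ('a set \<Rightarrow> real) \<Rightarrow> real" where
  "dirichlet_form M \<mu> F G =
     (LINT \<gamma>|\<mu>. (\<Sum>\<^sub>\<infinity>x\<in>\<gamma>. metric M x (grad_conf M F \<gamma> x) (grad_conf M G \<gamma> x)))"

text \<open>
  The elements of \<open>D\<close> stand for their \<open>\<mu>\<close>-classes. If \<open>E\<close> is well defined on classes, this is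
  closability of the form on classes, because every term below only depends on classes.
\<close>

definition closable_on_L2 ::
    "'b measure \<Rightarrow> ('b \<Rightarrow> real) set \<Rightarrow> (('b \<Rightarrow> real) \<Rightarrow> ('b \<Rightarrow> real) \<Rightarrow> real) \<Rightarrow> bool" where
  "closable_on_L2 \<mu> D E \<longleftrightarrow> (\<forall>F. (\<forall>n::nat. F n \<in> D) \<longrightarrow>
     (\<lambda>n. LINT \<gamma>|\<mu>. (F n \<gamma>)\<^sup>2) \<longlonglongrightarrow> 0 \<longrightarrow>
     ((\<lambda>(n, k). E (\<lambda>\<gamma>. F n \<gamma> - F k \<gamma>) (\<lambda>\<gamma>. F n \<gamma> - F k \<gamma>)) \<longlongrightarrow> 0) (sequentially \<times>\<^sub>F sequentially) \<longrightarrow>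
     (\<lambda>n. E (F n) (F n)) \<longlonglongrightarrow> 0)"

end

theory Submission
  imports Defs
begin

text \<open>
  By the Georgii--Nguyen--Zessin identity, averaging a function of a configuration \<open>\<gamma>\<close> and one of its
  points \<open>x\<close> amounts to adding to \<open>\<gamma>\<close> a point \<open>x\<close> with distribution \<open>\<rho>\<^sub>\<gamma> m\<close>. For fixed \<open>\<gamma>\<close>, a cylinder
  function of \<open>\<gamma> \<union> {x}\<close> is a smooth function of \<open>x\<close>, so the form is a mixture of classical gradient
  forms with weights \<open>\<rho>\<^sub>\<gamma>\<close>. On a line in a chart such a form is controlled by Hamza's condition: over
  an interval on which \<open>1/\<rho>\<^sub>\<gamma>\<close> is integrable, derivatives which converge in \<open>L\<^sup>2(\<rho>\<^sub>\<gamma>)\<close> converge in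
  \<open>L\<^sup>1\<close>, and the fundamental theorem of calculus identifies their limit. Hence, along a fast
  subsequence \<open>H\<^sub>j\<close> of a null sequence \<open>F\<^sub>n\<close> that is Cauchy for the form, the gradients of \<open>H\<^sub>j\<close> tend to 0
  at all points of almost every configuration, and by Fatou's lemma \<open>E(F\<^sub>n)\<close> is at most
  \<open>2 liminf\<^sub>j E(F\<^sub>n - H\<^sub>j)\<close>.
\<close>

section \<open>Smooth functions on Euclidean space\<close>

text \<open>The Poisson measure is known only through its Laplace transform at \<open>C0_inf\<close>
  functions. Differentiating the transform in direction \<open>g\<close> gives the Mecke identity
  for the functions \<open>g(x) exp <f, \<gamma>>\<close>, and these determine measures on pairs
  \<open>(x, \<gamma>)\<close>. The step to Gibbs measures is a factorisation: for \<open>x\<close>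
  in \<open>\<Lambda>\<close> and off \<open>\<gamma>\<close>, adding \<open>x\<close> multiplies
  \<open>exp(- E_\<Lambda>(\<gamma>))\<close> by \<open>exp(- E_x(\<gamma> + x))\<close>, also when
  a series diverges. It needs energies measurable jointly in \<open>x\<close> and
  \<open>\<gamma>\<close>, while a potential is measurable only after restriction to bounded
  windows. The rates fit together as follows: increments of \<open>H_j\<close> have energy below
  \<open>4^-j\<close>, so their sum with weights \<open>2^j\<close> is finite; by the
  arithmetic-geometric inequality such a weight bounds \<open>|q|\<close> by
  \<open>2^j r q^2 + 2^-j / r\<close>, which makes increments of derivatives absolutely summable.
  The volume element is prescribed in the listed charts, whereas a Euclidean chart is merely
  compatible with them. Only finiteness of integrals and null sets are transported, so one-sided
  bounds on small balls suffice.\<close>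

lemma frechet_derivative_cong_open:
  assumes "open U" "x \<in> U" "\<And>y. y \<in> U \<Longrightarrow> f y = g y"
  shows "f differentiable (at x) \<longleftrightarrow> g differentiable (at x)"
    and "frechet_derivative f (at x) = frechet_derivative g (at x)"
proof -
  have "(f has_derivative D) (at x) \<longleftrightarrow> (g has_derivative D) (at x)" for D
    using has_derivative_transform_within_open[OF _ assms(1,2), of f D UNIV g]
      has_derivative_transform_within_open[OF _ assms(1,2), of g D UNIV f] assms(3) by fastforce
  then show "f differentiable (at x) \<longleftrightarrow> g differentiable (at x)"
    "frechet_derivative f (at x) = frechet_derivative g (at x)"
    unfolding differentiable_def frechet_derivative_def by auto
qed

lemma Ck_on_cong:
  assumes "open U" "\<And>x. x \<in> U \<Longrightarrow> f x = g x" "Ck_on k U f"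
  shows "Ck_on k U g"
  using assms(2,3)
proof (induction k arbitrary: f g)
  case 0
  then show ?case by (auto cong: continuous_on_cong)
next
  case (Suc k)
  have d: "f differentiable (at x) \<longleftrightarrow> g differentiable (at x)"
    "frechet_derivative f (at x) = frechet_derivative g (at x)" if "x \<in> U" for x
    using frechet_derivative_cong_open[OF assms(1) that, of f g] Suc.prems(1) by auto
  show ?case
    using Suc.prems(2) d Suc.IH[of "\<lambda>x. frechet_derivative f (at x) _" "\<lambda>x. frechet_derivative g (at x) _"]
    by auto
qed

lemma Ck_on_subset: "Ck_on k U f \<Longrightarrow> V \<subseteq> U \<Longrightarrow> Ck_on k V f"
  by (induction k arbitrary: f) (auto intro: continuous_on_subset)

text \<open>Continuity and differentiability at a point involve only a neighbourhood. Smoothness on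
  a chart range is established this way, because a change of charts is available only on the overlap
  of two domains.\<close>

lemma Ck_on_local:
  assumes "\<And>x. x \<in> U \<Longrightarrow> \<exists>V. open V \<and> x \<in> V \<and> Ck_on k V f"
  shows "Ck_on k U f"
  using assms
proof (induction k arbitrary: f)
  case 0
  then show ?case
    by (simp add: continuous_on_eq_continuous_within) 
       (meson continuous_at_imp_continuous_at_within continuous_within_open)
next
  case (Suc k)
  then show ?case by fastforce
qed

text \<open>The product and chain rules at order \<open>Suc k\<close> leave undifferentiated factors
  behind, which are then needed at order \<open>k\<close>.\<close>

lemma Ck_on_Suc_imp: "Ck_on (Suc k) U f \<Longrightarrow> Ck_on k U f"
proof (induction k arbitrary: f)
  case 0
  then show ?case
    by (auto intro!: continuous_at_imp_continuous_on differentiable_imp_continuous_within)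
next
  case (Suc k)
  have "f differentiable at x" if "x \<in> U" for x
    using Suc.prems that unfolding Ck_on.simps(2)[of "Suc k"] by blast
  moreover have "Ck_on k U (\<lambda>x. frechet_derivative f (at x) v)" for v
    using Suc.IH Suc.prems unfolding Ck_on.simps(2)[of "Suc k"] by blast
  ultimately show ?case by simp
qed

lemma Ck_on_const [simp]: "Ck_on k U (\<lambda>x. c)"
  by (induction k arbitrary: c) (auto simp: frechet_derivative_const)

lemma Ck_on_bounded_linear: "bounded_linear f \<Longrightarrow> Ck_on k U f"
proof (cases k)
  case (Suc j)
  assume f: "bounded_linear f"
  have "frechet_derivative f (at x) = f" for x
    using frechet_derivative_at[OF bounded_linear_imp_has_derivative[OF f]] by metis
  then show ?thesis
    using Suc f by (auto intro: bounded_linear_imp_differentiable)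
qed (auto intro: linear_continuous_on)

lemma Ck_on_add:
  assumes "open U" "Ck_on k U f" "Ck_on k U g"
  shows "Ck_on k U (\<lambda>x. f x + g x)"
  using assms(2,3)
proof (induction k arbitrary: f g)
  case 0
  then show ?case by (auto intro: continuous_intros)
next
  case (Suc k)
  have d: "((\<lambda>x. f x + g x) has_derivative
      (\<lambda>v. frechet_derivative f (at x) v + frechet_derivative g (at x) v)) (at x)"
    if "x \<in> U" for x
    using Suc.prems that by (intro has_derivative_add) (auto simp flip: frechet_derivative_works)
  have "Ck_on k U (\<lambda>x. frechet_derivative (\<lambda>x. f x + g x) (at x) v)" for v
  proof (rule Ck_on_cong[OF assms(1)])
    show "Ck_on k U (\<lambda>x. frechet_derivative f (at x) v + frechet_derivative g (at x) v)"
      using Suc by simp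
    show "frechet_derivative f (at x) v + frechet_derivative g (at x) v =
      frechet_derivative (\<lambda>x. f x + g x) (at x) v" if "x \<in> U" for x
      using frechet_derivative_at[OF d[OF that]] by metis
  qed
  then show ?case using Suc.prems by auto
qed

lemma Ck_on_sum:
  assumes "open U" "finite I" "\<And>i. i \<in> I \<Longrightarrow> Ck_on k U (f i)"
  shows "Ck_on k U (\<lambda>x. \<Sum>i\<in>I. f i x)"
  using assms(2,3) by (induction I rule: finite_induct) (auto intro: Ck_on_add assms(1))

lemma Ck_on_mult:
  fixes f g :: "_ \<Rightarrow> real"
  assumes "open U" "Ck_on k U f" "Ck_on k U g"
  shows "Ck_on k U (\<lambda>x. f x * g x)"
  using assms(2,3)
proof (induction k arbitrary: f g)
  case 0
  then show ?case by (auto intro: continuous_intros)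
next
  case (Suc k)
  have d: "((\<lambda>x. f x * g x) has_derivative
      (\<lambda>v. f x * frechet_derivative g (at x) v + frechet_derivative f (at x) v * g x)) (at x)"
    if "x \<in> U" for x
  proof -
    have "(f has_derivative frechet_derivative f (at x)) (at x)"
      "(g has_derivative frechet_derivative g (at x)) (at x)"
      using Suc.prems that by (auto simp flip: frechet_derivative_works)
    then show ?thesis by (rule has_derivative_mult)
  qed
  have "Ck_on k U (\<lambda>x. frechet_derivative (\<lambda>x. f x * g x) (at x) v)" for v
  proof (rule Ck_on_cong[OF assms(1)])
    show "Ck_on k U (\<lambda>x. f x * frechet_derivative g (at x) v + frechet_derivative f (at x) v * g x)"
      using Suc.prems Ck_on_Suc_imp[OF Suc.prems(1)] Ck_on_Suc_imp[OF Suc.prems(2)]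
      by (intro Ck_on_add Suc.IH assms(1)) simp_all
    show "f x * frechet_derivative g (at x) v + frechet_derivative f (at x) v * g x =
      frechet_derivative (\<lambda>x. f x * g x) (at x) v" if "x \<in> U" for x
      using frechet_derivative_at[OF d[OF that]] by metis
  qed
  then show ?case using d by (auto simp: differentiable_def)
qed

lemma Ck_on_inner:
  assumes "open U" "Ck_on k U g"
  shows "Ck_on k U (\<lambda>x. g x \<bullet> b)"
  using assms(2)
proof (induction k arbitrary: g)
  case 0
  then show ?case by (auto intro: continuous_intros)
next
  case (Suc k)
  have d: "((\<lambda>x. g x \<bullet> b) has_derivative (\<lambda>v. frechet_derivative g (at x) v \<bullet> b)) (at x)"
    if "x \<in> U" for x
    using has_derivative_inner_left[of g _ "at x" b] Suc.prems that frechet_derivative_works by auto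
  have "Ck_on k U (\<lambda>x. frechet_derivative (\<lambda>x. g x \<bullet> b) (at x) v)" for v
  proof (rule Ck_on_cong[OF assms(1)])
    show "Ck_on k U (\<lambda>x. frechet_derivative g (at x) v \<bullet> b)"
      using Suc by auto
    show "frechet_derivative g (at x) v \<bullet> b = frechet_derivative (\<lambda>x. g x \<bullet> b) (at x) v"
      if "x \<in> U" for x
      using frechet_derivative_at[OF d[OF that]] by metis
  qed
  then show ?case using d by (auto simp: differentiable_def)
qed

lemma Ck_on_compose:
  fixes f :: "'e::euclidean_space \<Rightarrow> real" and g :: "'d::euclidean_space \<Rightarrow> 'e"
  assumes "open U" "open V" "g ` U \<subseteq> V" "Ck_on k V f" "Ck_on k U g"
  shows "Ck_on k U (f \<circ> g)"
  using assms(4,5)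
proof (induction k arbitrary: f)
  case 0
  then show ?case using assms(3) continuous_on_compose[of U g f] continuous_on_subset[of V f] by auto
next
  case (Suc k)
  have fd: "(f has_derivative frechet_derivative f (at y)) (at y)" if "y \<in> V" for y
    using Suc.prems that frechet_derivative_works by auto
  have d: "((f \<circ> g) has_derivative
      frechet_derivative f (at (g x)) \<circ> frechet_derivative g (at x)) (at x)"
    if "x \<in> U" for x
    using that assms(3) Suc.prems
    by (intro diff_chain_at fd) (auto simp flip: frechet_derivative_works)
  \<comment> \<open>The direction \<open>w\<close> will be a derivative of \<open>g\<close> and
    varies with the point, whereas \<open>Ck_on\<close> for \<open>f\<close> speaks of fixed
    directions. Expanding \<open>w\<close> in the basis leaves fixed directions \<open>b\<close>
    with coefficients of class \<open>Ck_on k\<close>.\<close>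
  have e: "frechet_derivative f (at y) w = (\<Sum>b\<in>Basis. (w \<bullet> b) * frechet_derivative f (at y) b)"
    if "y \<in> V" for y w
    using linear_sum[OF has_derivative_linear[OF fd[OF that]], of "\<lambda>b. (w \<bullet> b) *\<^sub>R b" Basis]
      linear_scale[OF has_derivative_linear[OF fd[OF that]]]
    by (simp add: euclidean_representation)
  have "Ck_on k U (\<lambda>x. frechet_derivative (f \<circ> g) (at x) v)" for v
  proof (rule Ck_on_cong[OF assms(1)])
    have "Ck_on k U ((\<lambda>y. frechet_derivative f (at y) b) \<circ> g)" for b
      using Suc.prems Ck_on_Suc_imp by (intro Suc.IH) auto
    then show "Ck_on k U (\<lambda>x. \<Sum>b\<in>Basis. (frechet_derivative g (at x) v \<bullet> b) *
        frechet_derivative f (at (g x)) b)"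
      using Suc.prems by (intro Ck_on_sum Ck_on_mult Ck_on_inner assms(1)) (auto simp: o_def)
    show "(\<Sum>b\<in>Basis. (frechet_derivative g (at x) v \<bullet> b) * frechet_derivative f (at (g x)) b) =
      frechet_derivative (f \<circ> g) (at x) v"
      if "x \<in> U" for x
      using frechet_derivative_at[OF d[OF that]] e[of "g x"] that assms(3)
      by (metis comp_apply image_subset_iff)
  qed
  then show ?case using d unfolding Ck_on.simps differentiable_def by blast
qed

section \<open>Smooth bump functions\<close>

definition flat_fun :: "real poly \<Rightarrow> real \<Rightarrow> real" where
  "flat_fun p t = (if t > 0 then poly p (1 / t) * exp (- (1 / t)) else 0)"

lemma poly_exp_tendsto_0: "((\<lambda>u::real. poly p u * exp (- u)) \<longlongrightarrow> 0) at_top"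
proof -
  have "((\<lambda>u. \<Sum>i\<le>degree p. coeff p i * (u ^ i / exp u)) \<longlongrightarrow> (\<Sum>i\<le>degree p. coeff p i * 0)) at_top"
    by (intro tendsto_intros tendsto_power_div_exp_0)
  then show ?thesis
    by (simp add: poly_altdef sum_distrib_right exp_minus divide_inverse mult.assoc)
qed

text \<open>The polynomial parameter closes the family under differentiation: with
  \<open>u = 1/t\<close> the derivative of \<open>p(u) exp(-u)\<close> is
  \<open>u^2 (p - p')(u) exp(-u)\<close>, the factor \<open>u^2\<close> being
  \<open>[:0, 0, 1:]\<close>. All orders of smoothness then follow by one induction over every
  \<open>p\<close> at once.\<close>

lemma flat_fun_has_derivative:
  "(flat_fun p has_real_derivative flat_fun ([:0, 0, 1:] * (p - pderiv p)) t) (at t)"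
proof -
  consider "t < 0" | "t = 0" | "t > 0" by linarith
  then show ?thesis
  proof cases
    case 1
    have "(flat_fun p has_real_derivative 0) (at t)"
      by (rule has_field_derivative_transform_within_open[of "\<lambda>_. 0" _ _ "{..<0}"])
         (use 1 in \<open>auto simp: flat_fun_def\<close>)
    then show ?thesis using 1 by (simp add: flat_fun_def)
  next
    case 3
    have "((\<lambda>t. poly p (1 / t) * exp (- (1 / t))) has_real_derivative
       flat_fun ([:0, 0, 1:] * (p - pderiv p)) t) (at t)"
      using 3 by (auto intro!: derivative_eq_intros DERIV_chain2[OF poly_DERIV] 
        simp: flat_fun_def field_simps power2_eq_square)
    then show ?thesis
      by (rule has_field_derivative_transform_within_open[of _ _ _ "{0<..}"])
         (use 3 in \<open>auto simp: flat_fun_def\<close>)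
  next
    case 2
    have "((\<lambda>h. flat_fun p h / h) \<longlongrightarrow> 0) (at_right 0)"
    proof -
      \<comment> \<open>With \<open>u = 1/h\<close> the difference quotient at 0 from the right is
        \<open>u p(u) exp(-u)\<close>, which is the decaying expression for the polynomial
        \<open>pCons 0 p\<close>.\<close>
      have "(((\<lambda>u::real. poly (pCons 0 p) u * exp (- u)) \<circ> inverse) \<longlongrightarrow> 0) (at_right 0)"
        unfolding o_def
        by (rule filterlim_compose[OF poly_exp_tendsto_0 filterlim_inverse_at_top_right])
      then show ?thesis
        by (rule tendsto_cong[THEN iffD1, rotated])
           (auto simp: flat_fun_def eventually_at_filter divide_simps)
    qed
    moreover have "((\<lambda>h. flat_fun p h / h) \<longlongrightarrow> 0) (at_left 0)"
      by (rule tendsto_eventually) (auto simp: flat_fun_def eventually_at_filter)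
    ultimately have "((\<lambda>h. flat_fun p h / h) \<longlongrightarrow> 0) (at 0)"
      using filterlim_split_at by blast
    then show ?thesis using 2 by (simp add: DERIV_def flat_fun_def)
  qed
qed

lemma Ck_on_flat_fun: "Ck_on k UNIV (flat_fun p)"
proof (induction k arbitrary: p)
  case 0
  then show ?case
    using flat_fun_has_derivative DERIV_isCont by (fastforce intro!: continuous_at_imp_continuous_on)
next
  case (Suc k)
  have d: "(flat_fun p has_derivative (\<lambda>v. v * flat_fun ([:0, 0, 1:] * (p - pderiv p)) t)) (at t)" for t
    using flat_fun_has_derivative[of p t] unfolding has_field_derivative_def
    by (simp add: mult_commute_abs)
  have "frechet_derivative (flat_fun p) (at t) = (\<lambda>v. v * flat_fun ([:0, 0, 1:] * (p - pderiv p)) t)" for t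
    using frechet_derivative_at[OF d] by metis
  then show ?case
    using Suc d by (auto simp: differentiable_def intro!: Ck_on_mult)
qed

text \<open>For \<open>k > 0\<close> the argument of \<open>flat_fun\<close> is a polynomial in
  \<open>y\<close> that is positive exactly on the ball. The factor \<open>k\<close> flattens the
  bump: \<open>exp(-1/(k s))\<close> tends to 1 wherever \<open>s > 0\<close>. The index
  \<open>k = 0\<close> gives the zero function and does not affect the limit.\<close>

definition ball_bump :: "'e::euclidean_space \<Rightarrow> real \<Rightarrow> nat \<Rightarrow> 'e \<Rightarrow> real" where
  "ball_bump a r k y = flat_fun 1 (real k * (r^2 - (y - a) \<bullet> (y - a)))"

lemma ball_bump_pos_iff:
  assumes "r > 0" "k > 0"
  shows "ball_bump a r k y > 0 \<longleftrightarrow> y \<in> ball a r"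
  using assms norm_lt_square[of "y - a" r]
  by (auto simp: ball_bump_def flat_fun_def dist_norm norm_minus_commute zero_less_mult_iff
      power2_eq_square norm_lt)

lemma ball_bump_bounds: "0 \<le> ball_bump a r k y" "ball_bump a r k y \<le> 1"
  by (auto simp: ball_bump_def flat_fun_def)

lemma ball_bump_tendsto:
  assumes "r > 0"
  shows "(\<lambda>k. ball_bump a r k y) \<longlonglongrightarrow> indicator (ball a r) y"
proof (cases "y \<in> ball a r")
  case True
  define s where "s = r\<^sup>2 - (y - a) \<bullet> (y - a)"
  have s: "s > 0"
    using ball_bump_pos_iff[OF assms, of 1 a y] True by (auto simp: s_def ball_bump_def flat_fun_def split: if_splits)
  have "(\<lambda>k. exp (- (1 / (real k * s)))) \<longlonglongrightarrow> exp (- 0)"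
    by (intro tendsto_intros) (use s in real_asymp)
  moreover have "\<forall>\<^sub>F k in sequentially. ball_bump a r k y = exp (- (1 / (real k * s)))"
    using s by (intro eventually_mono[OF eventually_gt_at_top[of 0]]) (auto simp: ball_bump_def flat_fun_def s_def[symmetric] zero_less_mult_iff)
  ultimately show ?thesis using True by (simp add: tendsto_cong)
next
  case False
  have "ball_bump a r k y = 0" for k
    using ball_bump_pos_iff[OF assms, of k a y] False ball_bump_bounds[of a r k y]
    by (cases "k = 0") (auto simp: ball_bump_def flat_fun_def)
  then show ?thesis using False by simp
qed

lemma Ck_on_ball_bump: "Ck_on k U (ball_bump a r j)"
proof -
  have q: "Ck_on k UNIV (\<lambda>y. real j * (r\<^sup>2 + (- 1) * (\<Sum>b\<in>Basis. (y \<bullet> b + (- (a \<bullet> b))) * (y \<bullet> b + (- (a \<bullet> b))))))"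
    by (intro Ck_on_mult Ck_on_add Ck_on_sum Ck_on_const Ck_on_bounded_linear bounded_linear_inner_left) auto
  have eq: "(y - a) \<bullet> (y - a) = (\<Sum>b\<in>Basis. (y \<bullet> b - a \<bullet> b) * (y \<bullet> b - a \<bullet> b))" for y
    unfolding euclidean_inner[of "y - a" "y - a"] by (simp add: inner_diff_left)
  have "ball_bump a r j = flat_fun 1 \<circ>
     (\<lambda>y. real j * (r\<^sup>2 + (- 1) * (\<Sum>b\<in>Basis. (y \<bullet> b + (- (a \<bullet> b))) * (y \<bullet> b + (- (a \<bullet> b))))))"
    by (auto simp: ball_bump_def fun_eq_iff eq)
  then show ?thesis
    using Ck_on_subset[OF Ck_on_compose[OF open_UNIV open_UNIV _ Ck_on_flat_fun q]] by auto
qed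

section \<open>Charts and test functions\<close>

lemma is_chartD:
  assumes "is_chart c"
  shows "open (fst c)" "open (chart_range c)"
    and "continuous_on (fst c) (snd c)" "continuous_on (chart_range c) (chart_inv c)"
    and "x \<in> fst c \<Longrightarrow> chart_inv c (snd c x) = x" "x \<in> fst c \<Longrightarrow> snd c x \<in> chart_range c"
    and "y \<in> chart_range c \<Longrightarrow> snd c (chart_inv c y) = y" "y \<in> chart_range c \<Longrightarrow> chart_inv c y \<in> fst c"
  using assms by (auto simp: is_chart_def homeomorphism_def chart_range_def)

lemma chart_inv_image_eq:
  assumes "is_chart c" "U \<subseteq> chart_range c"
  shows "chart_inv c ` U = fst c \<inter> snd c -` U"
proof (intro equalityI subsetI)
  fix x assume "x \<in> chart_inv c ` U"
  then show "x \<in> fst c \<inter> snd c -` U" using assms is_chartD(7,8)[OF assms(1)] by auto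
next
  fix x assume "x \<in> fst c \<inter> snd c -` U"
  then show "x \<in> chart_inv c ` U" using is_chartD(5)[OF assms(1), of x] by (metis IntD1 IntD2 image_eqI vimageE)
qed

lemma open_chart_inv_image:
  assumes "is_chart c" "U \<subseteq> chart_range c" "open U"
  shows "open (chart_inv c ` U)"
  unfolding chart_inv_image_eq[OF assms(1,2)]
  using continuous_on_open_vimage[OF is_chartD(1)[OF assms(1)], of "snd c"] is_chartD(3)[OF assms(1)] assms(3)
  by (auto simp: Int_commute)

lemma open_chart_vimage:
  assumes "is_chart c" "open V"
  shows "open (chart_range c \<inter> chart_inv c -` V)"
  using continuous_on_open_vimage[OF is_chartD(2)[OF assms(1)], of "chart_inv c"]
    is_chartD(4)[OF assms(1)] assms(2) by (auto simp: Int_commute)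

lemma chart_image_eq:
  assumes "is_chart c" "A \<subseteq> fst c"
  shows "snd c ` A = chart_range c \<inter> chart_inv c -` A"
proof (intro equalityI subsetI)
  fix y assume "y \<in> snd c ` A"
  then show "y \<in> chart_range c \<inter> chart_inv c -` A"
    using assms is_chartD(5,6)[OF assms(1)] by auto
next
  fix y assume "y \<in> chart_range c \<inter> chart_inv c -` A"
  then show "y \<in> snd c ` A" using is_chartD(7)[OF assms(1), of y] by (metis IntD1 IntD2 image_eqI vimageE)
qed

lemma borel_measurable_chart_inv:
  assumes "is_chart c"
  shows "chart_inv c \<in> borel_measurable (restrict_space borel (chart_range c))"
  by (rule borel_measurable_continuous_on_restrict[OF is_chartD(4)[OF assms]])

lemma borel_chart_image:
  assumes "is_chart c" "A \<in> sets borel" "A \<subseteq> fst c"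
  shows "snd c ` A \<in> sets borel"
proof -
  have "chart_inv c -` A \<inter> chart_range c \<in> sets (restrict_space borel (chart_range c))"
    using measurable_sets[OF borel_measurable_chart_inv[OF assms(1)] assms(2)]
    by (simp add: space_restrict_space)
  then have "chart_inv c -` A \<inter> chart_range c \<in> sets borel"
    using is_chartD(2)[OF assms(1)] by (subst (asm) sets_restrict_space_iff) auto
  then show ?thesis unfolding chart_image_eq[OF assms(1,3)] by (simp add: Int_commute)
qed

lemma overlap_image_eq:
  assumes "is_chart c"
  shows "snd c ` (fst c \<inter> fst c') = chart_range c \<inter> chart_inv c -` fst c'"
  using chart_image_eq[OF assms, of "fst c \<inter> fst c'"] is_chartD(8)[OF assms] by auto

text \<open>\<open>W\<close> is the set on which \<open>h\<close> can be evaluated after changing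
  from \<open>c\<close> to \<open>c'\<close>. It may be smaller than the overlap, since
  \<open>h\<close> is only given on \<open>V\<close>.\<close>

lemma smooth_compose_transition:
  fixes h :: "real ^ 'n::finite \<Rightarrow> real"
  assumes "is_chart c" "is_chart c'" "smooth_transition c c'"
    and "open V" "V \<subseteq> chart_range c'" "Ck_on k V h"
    and W: "W = {y \<in> chart_range c. chart_inv c y \<in> fst c' \<and> snd c' (chart_inv c y) \<in> V}"
  shows "open W" "Ck_on k W (h \<circ> transition c c')"
proof -
  have "W = chart_range c \<inter> chart_inv c -` (chart_inv c' ` V)"
    unfolding W chart_inv_image_eq[OF assms(2,5)] by auto
  then show W': "open W"
    using open_chart_vimage[OF assms(1) open_chart_inv_image[OF assms(2,5,4)]] by simp
  have "W \<subseteq> snd c ` (fst c \<inter> fst c')"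
    unfolding overlap_image_eq[OF assms(1)] W by auto
  then have "Ck_on k W (transition c c')"
    using assms(3) Ck_on_subset unfolding smooth_transition_def smooth_on_def by blast
  then show "Ck_on k W (h \<circ> transition c c')"
    using Ck_on_compose[of W V "transition c c'" k h] assms(4,6) W' by (force simp: W transition_def)
qed

lemma smooth_atlasD:
  assumes "smooth_atlas M"
  shows "\<exists>c\<in>charts M. x \<in> fst c" "c \<in> charts M \<Longrightarrow> smooth_chart M c" "c \<in> charts M \<Longrightarrow> is_chart c"
  using assms unfolding smooth_atlas_def smooth_chart_def by blast+

text \<open>Smoothness of functions is tested in the listed charts, while the Euclidean chart is
  only known to be compatible with them. Near each point one changes to a listed chart.\<close>

lemma smooth_fun_chart:
  assumes "smooth_atlas M" "smooth_chart M c" "smooth_fun M f"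
  shows "Ck_on k (chart_range c) (f \<circ> chart_inv c)"
proof (rule Ck_on_local)
  fix y assume y: "y \<in> chart_range c"
  obtain c' where c': "c' \<in> charts M" "chart_inv c y \<in> fst c'"
    using smooth_atlasD(1)[OF assms(1)] by blast
  have ch: "is_chart c" "is_chart c'" "smooth_transition c c'"
    using assms c' smooth_atlasD(3) unfolding smooth_chart_def by blast+
  define W where "W = {y \<in> chart_range c. chart_inv c y \<in> fst c' \<and> snd c' (chart_inv c y) \<in> chart_range c'}"
  have W: "open W" "Ck_on k W (f \<circ> chart_inv c' \<circ> transition c c')"
    using smooth_compose_transition[OF ch is_chartD(2)[OF ch(2)] order_refl _ W_def]
      assms(3) c'(1) unfolding smooth_fun_def smooth_on_def by blast+
  have "Ck_on k W (f \<circ> chart_inv c)"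
    by (rule Ck_on_cong[OF W(1) _ W(2)]) (use is_chartD(5)[OF ch(2)] in \<open>auto simp: W_def transition_def\<close>)
  moreover have "y \<in> W"
    using y c' is_chartD(6)[OF ch(2)] by (auto simp: W_def)
  ultimately show "\<exists>V. open V \<and> y \<in> V \<and> Ck_on k V (f \<circ> chart_inv c)"
    using W(1) by blast
qed

lemma smooth_fun_continuous:
  fixes M :: "('a::t2_space, 'n::finite) riemannian"
  assumes "smooth_atlas M" "smooth_fun M f"
  shows "continuous_on UNIV f"
proof -
  have "isCont f x" for x
  proof -
    obtain c where c: "c \<in> charts M" "x \<in> fst c"
      using smooth_atlasD(1)[OF assms(1)] by blast
    note ch = smooth_atlasD(3)[OF assms(1) c(1)]
    have "continuous_on (chart_range c) (f \<circ> chart_inv c)"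
      using smooth_fun_chart[OF assms(1) smooth_atlasD(2)[OF assms(1) c(1)] assms(2), of 0] by simp
    then have "continuous_on (fst c) ((f \<circ> chart_inv c) \<circ> snd c)"
      using continuous_on_compose[OF is_chartD(3)[OF ch]] unfolding chart_range_def by blast
    then have "continuous_on (fst c) f"
      by (rule continuous_on_eq) (use is_chartD(5)[OF ch] in auto)
    then show ?thesis
      using c(2) is_chartD(1)[OF ch] continuous_on_eq_continuous_at by blast
  qed
  then show ?thesis by (simp add: continuous_on_eq_continuous_at)
qed

lemma compact_supportI:
  fixes f :: "'a::t2_space \<Rightarrow> real"
  assumes "compact K" "\<And>x. x \<notin> K \<Longrightarrow> f x = 0"
  shows "compact_support f"
proof -
  have "closure {x. f x \<noteq> 0} \<subseteq> K"
    by (rule closure_minimal) (use assms compact_imp_closed in auto)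
  then show ?thesis
    unfolding compact_support_def using compact_Int_closed[OF assms(1) closed_closure] 
    by (metis inf.absorb_iff2)
qed

lemma compact_supportE:
  assumes "compact_support f"
  obtains K where "compact K" "\<And>x. x \<notin> K \<Longrightarrow> f x = 0"
  using assms closure_subset[of "{x. f x \<noteq> 0}"] unfolding compact_support_def by blast

lemma C0_inf_const_mult: "smooth_atlas M \<Longrightarrow> f \<in> C0_inf M \<Longrightarrow> (\<lambda>x. a * f x) \<in> C0_inf M"
  for M :: "('a::t2_space, 'n::finite) riemannian"
proof -
  assume M: "smooth_atlas M" and f: "f \<in> C0_inf M"
  have "Ck_on k (chart_range c) (\<lambda>y. a * (f \<circ> chart_inv c) y)" if "c \<in> charts M" for c k
    using f that is_chartD(2)[OF smooth_atlasD(3)[OF M that]]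
    unfolding C0_inf_def smooth_fun_def smooth_on_def o_def by (auto intro!: Ck_on_mult)
  moreover have "compact_support (\<lambda>x. a * f x)"
    using f unfolding C0_inf_def by (auto elim!: compact_supportE intro!: compact_supportI)
  ultimately show ?thesis by (auto simp: C0_inf_def smooth_fun_def smooth_on_def o_def)
qed

lemma C0_inf_add: "smooth_atlas M \<Longrightarrow> f \<in> C0_inf M \<Longrightarrow> g \<in> C0_inf M \<Longrightarrow> (\<lambda>x. f x + g x) \<in> C0_inf M"
  for M :: "('a::t2_space, 'n::finite) riemannian"
proof -
  assume M: "smooth_atlas M" and f: "f \<in> C0_inf M" and g: "g \<in> C0_inf M"
  have "Ck_on k (chart_range c) (\<lambda>y. (f \<circ> chart_inv c) y + (g \<circ> chart_inv c) y)" if "c \<in> charts M" for c k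
    using f g that is_chartD(2)[OF smooth_atlasD(3)[OF M that]]
    unfolding C0_inf_def smooth_fun_def smooth_on_def o_def by (auto intro!: Ck_on_add)
  moreover have "compact_support (\<lambda>x. f x + g x)"
  proof -
    obtain K L where "compact K" "\<And>x. x \<notin> K \<Longrightarrow> f x = 0" "compact L" "\<And>x. x \<notin> L \<Longrightarrow> g x = 0"
      using f g unfolding C0_inf_def by (auto elim!: compact_supportE)
    then show ?thesis by (intro compact_supportI[of "K \<union> L"]) auto
  qed
  ultimately show ?thesis by (auto simp: C0_inf_def smooth_fun_def smooth_on_def o_def)
qed

lemma C0_inf_mult: "smooth_atlas M \<Longrightarrow> f \<in> C0_inf M \<Longrightarrow> g \<in> C0_inf M \<Longrightarrow> (\<lambda>x. f x * g x) \<in> C0_inf M"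
  for M :: "('a::t2_space, 'n::finite) riemannian"
proof -
  assume M: "smooth_atlas M" and f: "f \<in> C0_inf M" and g: "g \<in> C0_inf M"
  have "Ck_on k (chart_range c) (\<lambda>y. (f \<circ> chart_inv c) y * (g \<circ> chart_inv c) y)" if "c \<in> charts M" for c k
    using f g that is_chartD(2)[OF smooth_atlasD(3)[OF M that]]
    unfolding C0_inf_def smooth_fun_def smooth_on_def o_def by (auto intro!: Ck_on_mult)
  moreover have "compact_support (\<lambda>x. f x * g x)"
    using f unfolding C0_inf_def by (auto elim!: compact_supportE intro!: compact_supportI)
  ultimately show ?thesis by (auto simp: C0_inf_def smooth_fun_def smooth_on_def o_def)
qed

lemma C0_inf_continuous: "smooth_atlas M \<Longrightarrow> f \<in> C0_inf M \<Longrightarrow> continuous_on UNIV f"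
  for M :: "('a::t2_space, 'n::finite) riemannian"
  using smooth_fun_continuous by (auto simp: C0_inf_def)

lemma C0_inf_bounded:
  fixes M :: "('a::t2_space, 'n::finite) riemannian"
  assumes "smooth_atlas M" "f \<in> C0_inf M"
  obtains b where "b > 0" "\<And>x. \<bar>f x\<bar> \<le> b"
proof -
  obtain K where K: "compact K" "\<And>x. x \<notin> K \<Longrightarrow> f x = 0"
    using assms by (auto simp: C0_inf_def elim: compact_supportE)
  have "compact (f ` K)"
    using K C0_inf_continuous[OF assms] compact_continuous_image continuous_on_subset by blast
  then obtain b where b: "b > 0" "\<forall>y\<in>f ` K. norm y \<le> b"
    using compact_imp_bounded bounded_pos by blast
  have "\<bar>f x\<bar> \<le> b" for x
    using b K(2)[of x] by (cases "x \<in> K") auto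
  then show ?thesis using that b by blast
qed

section \<open>Chart balls as a base of the topology\<close>

definition chart_balls :: "('a::topological_space, 'n::finite) riemannian \<Rightarrow> 'a set set" where
  "chart_balls M = {chart_inv c ` ball a r | c a r. c \<in> charts M \<and> 0 < r \<and> cball a r \<subseteq> chart_range c}"

lemma chart_ball_closure:
  fixes c :: "('a::t2_space, 'n::finite) chart"
  assumes "is_chart c" "cball a r \<subseteq> chart_range c"
  shows "compact (chart_inv c ` cball a r)" "compact (closure (chart_inv c ` ball a r))"
proof -
  show K: "compact (chart_inv c ` cball a r)"
    by (rule compact_continuous_image[OF continuous_on_subset[OF is_chartD(4)[OF assms(1)] assms(2)]]) simp
  have "closure (chart_inv c ` ball a r) \<subseteq> chart_inv c ` cball a r"
    by (rule closure_minimal) (use compact_imp_closed[OF K] in auto)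
  then show "compact (closure (chart_inv c ` ball a r))"
    using compact_Int_closed[OF K closed_closure] by (metis inf.absorb_iff2)
qed

lemma chart_balls_open_c:
  fixes M :: "('a::t2_space, 'n::finite) riemannian"
  assumes "smooth_atlas M" "B \<in> chart_balls M"
  shows "B \<in> open_c" "open B"
proof -
  obtain c a r where c: "c \<in> charts M" "cball a r \<subseteq> chart_range c" "B = chart_inv c ` ball a r"
    using assms(2) unfolding chart_balls_def by blast
  note ch = smooth_atlasD(3)[OF assms(1) c(1)]
  have "ball a r \<subseteq> chart_range c" using c(2) by auto
  then show "open B" "B \<in> open_c"
    using open_chart_inv_image[OF ch] chart_ball_closure[OF ch c(2)] c(3) unfolding open_c_def by auto
qed

lemma chart_balls_basis:
  fixes M :: "('a::t2_space, 'n::finite) riemannian"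
  assumes "smooth_atlas M" "open U" "x \<in> U"
  obtains B where "B \<in> chart_balls M" "x \<in> B" "B \<subseteq> U"
proof -
  obtain c where c: "c \<in> charts M" "x \<in> fst c"
    using smooth_atlasD(1)[OF assms(1)] by blast
  note ch = smooth_atlasD(3)[OF assms(1) c(1)]
  have "open (chart_range c \<inter> chart_inv c -` U)" "snd c x \<in> chart_range c \<inter> chart_inv c -` U"
    using open_chart_vimage[OF ch assms(2)] is_chartD(5,6)[OF ch c(2)] assms(3) by auto
  then obtain r where r: "r > 0" "cball (snd c x) r \<subseteq> chart_range c \<inter> chart_inv c -` U"
    using open_contains_cball by blast
  have "chart_inv c ` ball (snd c x) r \<in> chart_balls M"
    unfolding chart_balls_def using c r by blast
  moreover have "x \<in> chart_inv c ` ball (snd c x) r"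
    using is_chartD(5)[OF ch c(2)] r(1) by (metis centre_in_ball image_eqI)
  moreover have "chart_inv c ` ball (snd c x) r \<subseteq> U"
    using r(2) ball_subset_cball by blast
  ultimately show ?thesis using that by blast
qed

lemma open_eq_countable_chart_balls:
  fixes M :: "('a::{t2_space,second_countable_topology}, 'n::finite) riemannian"
  assumes "smooth_atlas M" "open U"
  obtains D where "D \<subseteq> chart_balls M" "countable D" "\<Union>D = U"
proof -
  define F where "F = {B \<in> chart_balls M. B \<subseteq> U}"
  have F: "\<Union>F = U"
    using chart_balls_basis[OF assms] unfolding F_def by blast
  obtain D where "D \<subseteq> F" "countable D" "\<Union>D = \<Union>F"
    by (rule Lindelof[of F]) (use chart_balls_open_c[OF assms(1)] in \<open>auto simp: F_def\<close>)
  then show ?thesis using F by (intro that[of D]) (auto simp: F_def)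
qed

text \<open>The Laplace transform is available for \<open>C0_inf\<close> functions only. These bumps
  lead from such functions to indicators of open sets, and thereby to numbers of points.\<close>

lemma chart_ball_bump:
  fixes M :: "('a::t2_space, 'n::finite) riemannian"
  assumes M: "smooth_atlas M" and "B \<in> chart_balls M"
  obtains f where "\<And>k. f k \<in> C0_inf M" "\<And>k x. 0 \<le> f k x" "\<And>k x. f k x \<le> 1"
    "\<And>k x. x \<notin> B \<Longrightarrow> f k x = 0" "\<And>x. (\<lambda>k::nat. f k x) \<longlonglongrightarrow> indicator B x"
proof -
  obtain c a r where c: "c \<in> charts M" "r > 0" "cball a r \<subseteq> chart_range c" "B = chart_inv c ` ball a r"
    using assms(2) unfolding chart_balls_def by blast
  note ch = smooth_atlasD(3)[OF assms(1) c(1)]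
  define f where "f k x = (if x \<in> fst c then ball_bump a r k (snd c x) else 0)" for k x
  define K where "K = chart_inv c ` cball a r"
  have K: "compact K" unfolding K_def by (rule chart_ball_closure[OF ch c(3)])
  have B: "x \<in> B \<longleftrightarrow> x \<in> fst c \<and> snd c x \<in> ball a r" for x
    using chart_inv_image_eq[OF ch, of "ball a r"] c(3,4) ball_subset_cball by blast
  have zero: "ball_bump a r k y = 0" if "y \<notin> ball a r" for k y
    using ball_bump_pos_iff[OF c(2), of k a y] that ball_bump_bounds[of a r k y]
    by (cases "k = 0") (auto simp: ball_bump_def flat_fun_def)
  have Kz: "f k x = 0" if "x \<notin> K" for k x
    using that zero chart_inv_image_eq[OF ch c(3)] ball_subset_cball unfolding f_def K_def by fastforce
  have "Ck_on j (chart_range c') (f k \<circ> chart_inv c')" if c': "c' \<in> charts M" for c' j k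
  proof (rule Ck_on_local)
    fix y assume y: "y \<in> chart_range c'"
    note ch' = smooth_atlasD(3)[OF assms(1) c']
    show "\<exists>V. open V \<and> y \<in> V \<and> Ck_on j V (f k \<circ> chart_inv c')"
    \<comment> \<open>A point of \<open>K\<close> lies in both chart domains, where the bump is read
      through the transition map. Off the closed set \<open>K\<close> the function vanishes
      identically on a neighbourhood, so the extension by 0 is smooth.\<close>
    proof (cases "chart_inv c' y \<in> K")
      case True
      have tr: "smooth_transition c' c"
        using smooth_atlasD(2)[OF M c'] c(1) unfolding smooth_chart_def by blast
      define W where "W = {y \<in> chart_range c'. chart_inv c' y \<in> fst c \<and> snd c (chart_inv c' y) \<in> chart_range c}"
      have W: "open W" "Ck_on j W (ball_bump a r k \<circ> transition c' c)"
        using smooth_compose_transition[OF ch' ch tr is_chartD(2)[OF ch] order_refl Ck_on_ball_bump W_def] by blast+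
      have "Ck_on j W (f k \<circ> chart_inv c')"
        by (rule Ck_on_cong[OF W(1) _ W(2)]) (auto simp: W_def f_def transition_def)
      moreover have "y \<in> W"
        using True y chart_inv_image_eq[OF ch c(3)] is_chartD(6)[OF ch] unfolding W_def K_def by auto
      ultimately show ?thesis using W(1) by blast
    next
      case False
      have o: "open (chart_range c' \<inter> chart_inv c' -` (- K))"
        using open_chart_vimage[OF ch'] compact_imp_closed[OF K] by (simp add: open_Compl)
      have "Ck_on j (chart_range c' \<inter> chart_inv c' -` (- K)) (f k \<circ> chart_inv c')"
        by (rule Ck_on_cong[OF o _ Ck_on_const[of _ _ 0]]) (use Kz in auto)
      then show ?thesis using o y False by blast
    qed
  qed
  then have "f k \<in> C0_inf M" for k
    using compact_supportI[OF K Kz] by (auto simp: C0_inf_def smooth_fun_def smooth_on_def)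
  moreover have "(\<lambda>k. f k x) \<longlonglongrightarrow> indicator B x" for x
    using ball_bump_tendsto[OF c(2), of a "snd c x"] B[of x]
    by (cases "x \<in> fst c") (auto simp: f_def indicator_def)
  moreover have "f k x = 0" if "x \<notin> B" for k x
    using that B[of x] zero by (auto simp: f_def)
  ultimately show ?thesis
    by (intro that[of f]) (use ball_bump_bounds in \<open>auto simp: f_def\<close>)
qed

section \<open>Exhaustion by relatively compact open sets\<close>

definition exhaustion :: "(nat \<Rightarrow> 'a::topological_space set) \<Rightarrow> bool" where
  "exhaustion W \<longleftrightarrow> incseq W \<and> (\<forall>k. W k \<in> open_c) \<and> (\<Union>k. W k) = UNIV \<and> (\<forall>K. compact K \<longrightarrow> (\<exists>k. K \<subseteq> W k))"

lemma exhaustionD: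
  assumes "exhaustion W"
  shows "incseq W" "W k \<in> open_c" "(\<Union>k. W k) = UNIV" "compact K \<Longrightarrow> \<exists>k. K \<subseteq> W k"
  using assms by (auto simp: exhaustion_def)

lemma open_exhaustion:
  fixes M :: "('a::{t2_space,second_countable_topology}, 'n::finite) riemannian"
  assumes "smooth_atlas M"
  obtains W :: "nat \<Rightarrow> 'a set" where "exhaustion W"
proof -
  obtain D where D: "D \<subseteq> chart_balls M" "countable D" "\<Union>D = (UNIV :: 'a set)"
    using open_eq_countable_chart_balls[OF assms open_UNIV] by blast
  have "D \<noteq> {}" using D(3) by auto
  define W where "W k = (\<Union>i<k. from_nat_into D i)" for k
  have b: "from_nat_into D i \<in> open_c" for i
    using from_nat_into[OF \<open>D \<noteq> {}\<close>] D(1) chart_balls_open_c(1)[OF assms] by blast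
  have 1: "incseq W" unfolding W_def incseq_def by fastforce
  have 2: "W k \<in> open_c" for k
  proof (induction k)
    case (Suc k)
    then show ?case
      using b[of k] by (auto simp: open_c_def W_def lessThan_Suc intro!: compact_Un)
  qed (simp add: open_c_def W_def)
  have "range (from_nat_into D) = D"
    by (rule range_from_nat_into[OF \<open>D \<noteq> {}\<close> D(2)])
  then have "x \<in> (\<Union>k. W k)" for x
  proof -
    obtain i where "x \<in> from_nat_into D i"
      using D(3) \<open>range (from_nat_into D) = D\<close> by (metis UNIV_I Union_iff imageE)
    then have "x \<in> W (Suc i)" by (auto simp: W_def)
    then show ?thesis by blast
  qed
  then have 3: "(\<Union>k. W k) = UNIV" by blast
  have "\<exists>k. K \<subseteq> W k" if K: "compact K" for K
  proof -
    obtain I where I: "finite I" "K \<subseteq> (\<Union>i\<in>I. W i)"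
      by (rule compactE_image[OF K, of UNIV W]) (use 2 3 in \<open>auto simp: open_c_def\<close>)
    have "W i \<subseteq> W (Max I)" if "i \<in> I" for i
      using 1 I(1) that by (simp add: incseqD)
    then show ?thesis using I(2) by blast
  qed
  then show ?thesis using that[of W] 1 2 3 unfolding exhaustion_def by blast
qed

section \<open>Gradients in charts\<close>

text \<open>The properties shared by the listed charts and by the global Euclidean chart
  \<open>(UNIV, \<psi>)\<close>, which need not be listed. Everything about gradients is proved for
  such charts, so that both forms of the Hamza condition can be treated alike. Continuity of the
  metric coefficients is all the regularity kept.\<close>

definition nice_chart :: "('a::topological_space, 'n::finite) riemannian \<Rightarrow> ('a, 'n) chart \<Rightarrow> bool" where
  "nice_chart M c \<longleftrightarrow> smooth_chart M c \<and>
     (\<forall>y\<in>chart_range c. bilinear (metric_in_chart M c y) \<and>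
        (\<forall>v w. metric_in_chart M c y v w = metric_in_chart M c y w v) \<and>
        (\<forall>v. v \<noteq> 0 \<longrightarrow> 0 < metric_in_chart M c y v v)) \<and>
     (\<forall>v w. continuous_on (chart_range c) (\<lambda>y. metric_in_chart M c y v w))"

lemma nice_chart_is_chart: "nice_chart M c \<Longrightarrow> is_chart c"
  by (auto simp: nice_chart_def smooth_chart_def)

lemma nice_chart_charts:
  assumes "smooth_atlas M" "riemannian_metric M" "c \<in> charts M"
  shows "nice_chart M c"
proof -
  have "Ck_on 0 (chart_range c) (\<lambda>y. metric_in_chart M c y v w)" for v w
    using assms unfolding riemannian_metric_def smooth_on_def by blast
  then show ?thesis
    using assms smooth_atlasD(2)[OF assms(1,3)] unfolding riemannian_metric_def nice_chart_def by simp
qed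

lemma nice_chart_euclidean:
  assumes "euclidean_identification M \<psi>"
  shows "nice_chart M (UNIV, \<psi>)"
proof -
  have "metric_in_chart M (UNIV, \<psi>) y = (\<bullet>)" for y
    using assms by (simp add: euclidean_identification_def fun_eq_iff)
  moreover have "bilinear ((\<bullet>) :: real ^ 'b \<Rightarrow> _)"
    using bilinear_conv_bounded_bilinear bounded_bilinear_inner by blast
  ultimately show ?thesis
    using assms by (simp add: nice_chart_def euclidean_identification_def inner_commute)
qed

lemma chart_tangent_linear: "linear (\<lambda>v. chart_tangent c x v h)"
proof (cases "(h \<circ> chart_inv c) differentiable (at (snd c x))")
  case True
  then show ?thesis using linear_frechet_derivative[OF True] by (simp add: chart_tangent_def)
next
  case False
  then show ?thesis by (simp add: chart_tangent_def linear_zero)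
qed

lemma transition_differentiable:
  assumes "is_chart c" "smooth_transition c c'" "x \<in> fst c" "x \<in> fst c'"
  shows "(transition c c' has_derivative frechet_derivative (transition c c') (at (snd c x))) (at (snd c x))"
proof -
  have "Ck_on (Suc 0) (snd c ` (fst c \<inter> fst c')) (transition c c')"
    using assms(2) unfolding smooth_transition_def smooth_on_def by blast
  then show ?thesis using assms(3,4) by (auto simp flip: frechet_derivative_works)
qed

lemma transition_has_derivative_compose:
  assumes "is_chart c" "is_chart c'" "smooth_transition c c'" "x \<in> fst c" "x \<in> fst c'"
    and "((h \<circ> chart_inv c') has_derivative D) (at (snd c' x))"
  shows "((h \<circ> chart_inv c) has_derivative
    D \<circ> frechet_derivative (transition c c') (at (snd c x))) (at (snd c x))"
proof -
  have o: "open (snd c ` (fst c \<inter> fst c'))"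
    unfolding overlap_image_eq[OF assms(1)] by (rule open_chart_vimage[OF assms(1) is_chartD(1)[OF assms(2)]])
  have "transition c c' (snd c x) = snd c' x"
    using is_chartD(5)[OF assms(1,4)] by (simp add: transition_def)
  then have d: "(((h \<circ> chart_inv c') \<circ> transition c c') has_derivative
      D \<circ> frechet_derivative (transition c c') (at (snd c x))) (at (snd c x))"
    using assms(6) by (intro diff_chain_at transition_differentiable[OF assms(1,3,4,5)]) simp
  have e: "((h \<circ> chart_inv c') \<circ> transition c c') y = (h \<circ> chart_inv c) y"
    if "y \<in> snd c ` (fst c \<inter> fst c')" for y
    using that is_chartD(5)[OF assms(1)] is_chartD(5)[OF assms(2)] by (auto simp: transition_def)
  show ?thesis
    by (rule has_derivative_transform_within_open[OF d o _ e]) (use assms(4,5) in auto)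
qed

text \<open>Tangent vectors act on all functions, with value 0 on those not differentiable at
  \<open>x\<close>. Equality therefore also requires that differentiability in one chart imply it in
  the other, and this is why smoothness of the transitions in both directions enters.\<close>

lemma chart_tangent_transition:
  assumes "is_chart c" "is_chart c'" "smooth_transition c c'" "smooth_transition c' c"
    and "x \<in> fst c" "x \<in> fst c'"
  shows "chart_tangent c x v = chart_tangent c' x (frechet_derivative (transition c c') (at (snd c x)) v)"
proof
  fix h :: "'a \<Rightarrow> real"
  show "chart_tangent c x v h = chart_tangent c' x (frechet_derivative (transition c c') (at (snd c x)) v) h"
  proof (cases "(h \<circ> chart_inv c') differentiable (at (snd c' x))")
    case True
    note d = transition_has_derivative_compose[OF assms(1-3,5,6)
        True[unfolded frechet_derivative_works]]
    have "(h \<circ> chart_inv c) differentiable (at (snd c x))"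
      using d unfolding differentiable_def by blast
    then show ?thesis
      using True frechet_derivative_at[OF d, symmetric] by (simp add: chart_tangent_def)
  next
    case False
    have "\<not> (h \<circ> chart_inv c) differentiable (at (snd c x))"
      using False transition_has_derivative_compose[OF assms(2,1,4,6,5), of h]
      unfolding differentiable_def by metis
    then show ?thesis using False by (simp add: chart_tangent_def)
  qed
qed

lemma tangent_space_chart:
  assumes "smooth_atlas M" "smooth_chart M c" "x \<in> fst c"
  shows "tangent_space M x = range (chart_tangent c x)"
proof
  have tr: "is_chart c" "smooth_transition c c'" "smooth_transition c' c" if "c' \<in> charts M" for c'
    using assms(2) that unfolding smooth_chart_def by blast+
  show "tangent_space M x \<subseteq> range (chart_tangent c x)"
  proof
    fix t assume "t \<in> tangent_space M x"
    then obtain c' v where c': "c' \<in> charts M" "x \<in> fst c'" "t = chart_tangent c' x v"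
      unfolding tangent_space_def by blast
    then show "t \<in> range (chart_tangent c x)"
      using chart_tangent_transition[OF smooth_atlasD(3)[OF assms(1) c'(1)] tr(1,3,2)[OF c'(1)] c'(2) assms(3)]
      by auto
  qed
  show "range (chart_tangent c x) \<subseteq> tangent_space M x"
  proof
    fix t assume "t \<in> range (chart_tangent c x)"
    then obtain v where t: "t = chart_tangent c x v" by blast
    obtain c' where c': "c' \<in> charts M" "x \<in> fst c'" using smooth_atlasD(1)[OF assms(1)] by blast
    show "t \<in> tangent_space M x"
      using chart_tangent_transition[OF tr(1)[OF c'(1)] smooth_atlasD(3)[OF assms(1) c'(1)] tr(2,3)[OF c'(1)] assms(3) c'(2)]
        c' unfolding tangent_space_def t by blast
  qed
qed

definition gram_matrix :: "('a, 'n::finite) riemannian \<Rightarrow> ('a, 'n) chart \<Rightarrow> real ^ 'n \<Rightarrow> real ^ 'n ^ 'n" where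
  "gram_matrix M c y = (\<chi> i j. metric_in_chart M c y (axis i 1) (axis j 1))"

lemma gram_det_eq: "gram_det M c y = det (gram_matrix M c y)"
  by (simp add: gram_det_def gram_matrix_def)

text \<open>Puts the metric, which is given on functionals, into matrix form, so that gradients
  become inverse matrices applied to partial derivatives.\<close>

lemma bilinear_eq_matrix:
  fixes B :: "real ^ 'n::finite \<Rightarrow> real ^ 'n \<Rightarrow> real"
  assumes "bilinear B"
  shows "B v w = v \<bullet> ((\<chi> i j. B (axis i 1) (axis j 1)) *v w)"
proof -
  have lin: "linear (\<lambda>v. B v w)" "linear (B v)" for v w
    using assms by (auto simp: bilinear_def)
  have "B v w = B (\<Sum>i\<in>UNIV. v $ i *\<^sub>R axis i 1) w"
    using basis_expansion[of v] by (simp add: scalar_mult_eq_scaleR)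
  also have "\<dots> = (\<Sum>i\<in>UNIV. v $ i * B (axis i 1) w)"
    by (simp add: linear_sum[OF lin(1)] linear_scale[OF lin(1)])
  also have "\<dots> = (\<Sum>i\<in>UNIV. v $ i * B (axis i 1) (\<Sum>j\<in>UNIV. w $ j *\<^sub>R axis j 1))"
    using basis_expansion[of w] by (simp add: scalar_mult_eq_scaleR)
  also have "\<dots> = (\<Sum>i\<in>UNIV. \<Sum>j\<in>UNIV. v $ i * (w $ j * B (axis i 1) (axis j 1)))"
    by (simp add: linear_sum[OF lin(2)] linear_scale[OF lin(2)] sum_distrib_left)
  finally show ?thesis
    by (simp add: inner_vec_def matrix_vector_mult_def sum_distrib_left mult_ac)
qed

section \<open>Positive definite matrices\<close>

locale spd_matrix =
  fixes G :: "real ^ 'n::finite ^ 'n"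
  assumes sym: "v \<bullet> (G *v w) = w \<bullet> (G *v v)" and pos: "v \<noteq> 0 \<Longrightarrow> 0 < v \<bullet> (G *v v)"
begin

text \<open>The segment \<open>(1 - t) I + t G\<close> consists of positive definite, hence
  invertible matrices. Its determinant is continuous in \<open>t\<close>, equals 1 at
  \<open>t = 0\<close> and cannot cross 0.\<close>

lemma det_pos: "det G > 0"
proof -
  define A :: "real \<Rightarrow> real ^ 'n ^ 'n" where "A t = (\<chi> i j. (1 - t) * mat 1 $ i $ j + t * G $ i $ j)" for t
  have Av: "A t *v v = (1 - t) *\<^sub>R v + t *\<^sub>R (G *v v)" for t v
  proof -
    have "(\<Sum>j\<in>UNIV. (mat 1 :: real ^ 'n ^ 'n) $ i $ j * v $ j) = v $ i" for i
      using arg_cong[OF matrix_vector_mul_lid[of v], of "\<lambda>w. w $ i"]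
      by (simp add: matrix_vector_mult_def)
    then show ?thesis
      by (simp add: A_def matrix_vector_mult_def vec_eq_iff distrib_right sum.distrib
          mult.assoc sum_distrib_left[symmetric])
  qed
  have nz: "det (A t) \<noteq> 0" if "0 \<le> t" "t \<le> 1" for t
  proof -
    have "v = 0" if "A t *v v = 0" for v
    proof (rule ccontr)
      assume v: "v \<noteq> 0"
      have "(1 - t) * (v \<bullet> v) + t * (v \<bullet> (G *v v)) = v \<bullet> (A t *v v)"
        by (simp add: Av inner_add_right)
      also have "\<dots> = 0" using that by simp
      finally have e: "(1 - t) * (v \<bullet> v) + t * (v \<bullet> (G *v v)) = 0" .
      have "0 \<le> (1 - t) * (v \<bullet> v)" "0 \<le> t * (v \<bullet> (G *v v))"
        using \<open>0 \<le> t\<close> \<open>t \<le> 1\<close> pos[OF v] by auto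
      with e have "(1 - t) * (v \<bullet> v) = 0" "t * (v \<bullet> (G *v v)) = 0" by linarith+
      then show False using v pos[OF v] by auto
    qed
    then show ?thesis
      using matrix_left_invertible_ker invertible_left_inverse invertible_det_nz by blast
  qed
  have cont: "continuous_on {0..1} (\<lambda>t. det (A t))"
    unfolding det_def A_def by (simp, intro continuous_intros)
  have "A 0 = mat 1" "A 1 = G" by (simp_all add: A_def vec_eq_iff)
  then have "det (A 0) = 1" by simp
  show ?thesis
  proof (rule ccontr)
    assume "\<not> 0 < det G"
    then have "det (A 1) \<le> 0" using \<open>A 1 = G\<close> by simp
    then obtain t where "0 \<le> t" "t \<le> 1" "det (A t) = 0"
      using IVT2'[of "\<lambda>t. det (A t)" 1 0 0] cont \<open>det (A 0) = 1\<close> by auto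
    then show False using nz by blast
  qed
qed

lemma inv_apply: "G *v (matrix_inv G *v p) = p" "matrix_inv G *v (G *v p) = p"
proof -
  have "invertible G" using det_pos invertible_det_nz by force
  then have "G ** matrix_inv G = mat 1" "matrix_inv G ** G = mat 1"
    unfolding invertible_def matrix_inv_def using someI_ex[of "\<lambda>A'. G ** A' = mat 1 \<and> A' ** G = mat 1"] by blast+
  then show "G *v (matrix_inv G *v p) = p" "matrix_inv G *v (G *v p) = p"
    by (simp_all add: matrix_vector_mul_assoc)
qed

lemma inv_sym: "p \<bullet> (matrix_inv G *v q) = q \<bullet> (matrix_inv G *v p)"
  using sym[of "matrix_inv G *v q" "matrix_inv G *v p"]
  unfolding inv_apply inner_commute[of p] inner_commute[of q] .

lemma inv_nonneg: "0 \<le> p \<bullet> (matrix_inv G *v p)"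
proof (cases "matrix_inv G *v p = 0")
  case False
  then show ?thesis
    using pos[of "matrix_inv G *v p"] unfolding inv_apply by (simp add: inner_commute[of p])
qed simp

lemma Cauchy_Schwarz: "(v \<bullet> (G *v w))\<^sup>2 \<le> (v \<bullet> (G *v v)) * (w \<bullet> (G *v w))"
proof (cases "w = 0")
  case False
  define b where "b = w \<bullet> (G *v w)"
  define a where "a = v \<bullet> (G *v w)"
  have b: "b > 0" using pos[OF False] by (simp add: b_def)
  \<comment> \<open>Subtracting from \<open>v\<close> its projection on \<open>w\<close> with
    respect to the form \<open>G\<close>; the value of the form at \<open>u\<close> is the defect in
    the inequality divided by \<open>b\<close>.\<close>
  define u where "u = v - (a / b) *\<^sub>R w"
  have "0 \<le> u \<bullet> (G *v u)" using pos[of u] by (cases "u = 0") auto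
  also have "u \<bullet> (G *v u) = v \<bullet> (G *v v) - (a / b) * a - (a / b) * (w \<bullet> (G *v v)) + (a / b) * ((a / b) * b)"
    unfolding u_def a_def b_def
    by (simp add: matrix_vector_mult_diff_distrib matrix_vector_mult_scaleR inner_diff_left inner_diff_right algebra_simps)
  also have "w \<bullet> (G *v v) = a" using sym by (simp add: a_def)
  finally have "0 \<le> v \<bullet> (G *v v) - a * a / b"
    using b by (simp add: field_simps)
  then show ?thesis
    using b unfolding a_def[symmetric] b_def[symmetric] by (simp add: field_simps power2_eq_square)
qed simp

text \<open>Cauchy--Schwarz for the basis vector \<open>e_l\<close> and the vector
  \<open>G^-1 p\<close>, since \<open>p $ l\<close> is their product in the form \<open>G\<close>.
  It bounds a coordinate derivative by the Riemannian length of a gradient, at the price of a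
  diagonal entry of \<open>G\<close>.\<close>

lemma component_bound: "(p $ l)\<^sup>2 \<le> (p \<bullet> (matrix_inv G *v p)) * G $ l $ l"
proof -
  have "G *v axis l 1 = (\<chi> i. G $ i $ l)"
    by (simp add: matrix_vector_mult_def axis_def vec_eq_iff if_distrib cong: if_cong)
  then have "axis l 1 \<bullet> (G *v axis l 1) = G $ l $ l"
    by (simp add: inner_axis')
  then show ?thesis
    using Cauchy_Schwarz[of "axis l 1" "matrix_inv G *v p"]
    by (simp add: inv_apply inner_axis' inner_commute[of "matrix_inv G *v p" p] mult.commute)
qed

text \<open>Cramer's rule writes the inverse with determinants of matrices whose entries depend
  continuously on the base point; this is how the dual metric is seen to be continuous.\<close>

lemma inv_cramer: "matrix_inv G *v q = (\<chi> k. det (\<chi> i j. if j = k then q $ i else G $ i $ j) / det G)"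
  by (rule cramer[THEN iffD1, OF _ inv_apply(1)]) (use det_pos in simp)

end

lemma spd_gram_matrix:
  assumes "nice_chart M c" "y \<in> chart_range c"
  shows "spd_matrix (gram_matrix M c y)"
    and "metric_in_chart M c y v w = v \<bullet> (gram_matrix M c y *v w)"
proof -
  have B: "metric_in_chart M c y v w = v \<bullet> (gram_matrix M c y *v w)" for v w
    using assms bilinear_eq_matrix[of "metric_in_chart M c y" v w]
    unfolding nice_chart_def gram_matrix_def by blast
  show "spd_matrix (gram_matrix M c y)"
    using assms unfolding spd_matrix_def nice_chart_def B[symmetric] by blast
  show "metric_in_chart M c y v w = v \<bullet> (gram_matrix M c y *v w)" by (rule B)
qed

section \<open>The Riemannian gradient in coordinates\<close>

definition chart_gradient :: "('a, 'n::finite) chart \<Rightarrow> ('a \<Rightarrow> real) \<Rightarrow> real ^ 'n \<Rightarrow> real ^ 'n" where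
  "chart_gradient c f y = (\<chi> i. frechet_derivative (f \<circ> chart_inv c) (at y) (axis i 1))"

lemma linear_eq_inner:
  fixes D :: "real ^ 'n::finite \<Rightarrow> real"
  assumes "linear D"
  shows "D v = v \<bullet> (\<chi> i. D (axis i 1))"
proof -
  have "D v = D (\<Sum>i\<in>UNIV. v $ i *\<^sub>R axis i 1)"
    using basis_expansion[of v] by (simp add: scalar_mult_eq_scaleR)
  then show ?thesis
    by (simp add: linear_sum[OF assms] linear_scale[OF assms] inner_vec_def)
qed

lemma chart_gradient_eq:
  assumes "(f \<circ> chart_inv c) differentiable (at y)"
  shows "frechet_derivative (f \<circ> chart_inv c) (at y) v = v \<bullet> chart_gradient c f y"
  unfolding chart_gradient_def by (rule linear_eq_inner[OF linear_frechet_derivative[OF assms]])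

lemma metric_chart_tangent:
  assumes "nice_chart M c" "x \<in> fst c"
  shows "metric M x (chart_tangent c x a) (chart_tangent c x b) = a \<bullet> (gram_matrix M c (snd c x) *v b)"
  using spd_gram_matrix(2)[OF assms(1) is_chartD(6)[OF nice_chart_is_chart[OF assms(1)] assms(2)], of a b]
  unfolding metric_in_chart_def is_chartD(5)[OF nice_chart_is_chart[OF assms(1)] assms(2)] .

text \<open>\<open>grad M f x\<close> is the representative of the differential with respect to the
  metric; in coordinates \<open>G a = df\<close>, so \<open>a = G^-1 df\<close>. Nondegeneracy of
  \<open>G\<close> gives the uniqueness that the \<open>THE\<close> in \<open>grad\<close>
  requires.\<close>

lemma grad_chart:
  assumes M: "smooth_atlas M" and c: "nice_chart M c" and x: "x \<in> fst c"
    and f: "(f \<circ> chart_inv c) differentiable (at (snd c x))"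
  shows "grad M f x = chart_tangent c x (matrix_inv (gram_matrix M c (snd c x)) *v chart_gradient c f (snd c x))"
proof -
  define G where "G = gram_matrix M c (snd c x)"
  define d where "d = chart_gradient c f (snd c x)"
  interpret spd_matrix G
    unfolding G_def by (rule spd_gram_matrix[OF c is_chartD(6)[OF nice_chart_is_chart[OF c] x]])
  have T: "tangent_space M x = range (chart_tangent c x)"
    using tangent_space_chart[OF M _ x] c by (simp add: nice_chart_def)
  have met: "metric M x (chart_tangent c x a) (chart_tangent c x b) = a \<bullet> (G *v b)" for a b
    unfolding G_def by (rule metric_chart_tangent[OF c x])
  have app: "chart_tangent c x v f = v \<bullet> d" for v
    using f chart_gradient_eq[OF f] by (simp add: chart_tangent_def d_def)
  show ?thesis
    unfolding grad_def G_def[symmetric] d_def[symmetric]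
  proof (rule the_equality)
    show "chart_tangent c x (matrix_inv G *v d) \<in> tangent_space M x \<and>
      (\<forall>w\<in>tangent_space M x. metric M x (chart_tangent c x (matrix_inv G *v d)) w = w f)"
      unfolding T using sym inv_apply by (auto simp: met app)
  next
    fix t assume t: "t \<in> tangent_space M x \<and> (\<forall>w\<in>tangent_space M x. metric M x t w = w f)"
    then obtain a where a: "t = chart_tangent c x a" unfolding T by blast
    have "v \<bullet> (G *v a) = v \<bullet> d" for v
      using t sym[of v a] unfolding T by (auto simp: met app a)
    then have "G *v a = d" by (metis inner_eq_zero_iff inner_diff_right right_minus_eq)
    then show "t = chart_tangent c x (matrix_inv G *v d)"
      using inv_apply(2)[of a] a by simp
  qed
qed

text \<open>The gradient of a cylinder function is a pointwise combination of functionals on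
  arbitrary functions \<open>h\<close>. It agrees with the combination of coordinate vectors because
  \<open>chart_tangent\<close> is linear in the vector for every \<open>h\<close>, differentiable or
  not.\<close>

lemma grad_combination:
  assumes M: "smooth_atlas M" and c: "nice_chart M c" and x: "x \<in> fst c"
    and f: "\<And>i. i < N \<Longrightarrow> (f i \<circ> chart_inv c) differentiable (at (snd c x))"
  shows "(\<lambda>h. \<Sum>i<N. b i * grad M (f i) x h) =
    chart_tangent c x (matrix_inv (gram_matrix M c (snd c x)) *v
      (\<Sum>i<N. b i *\<^sub>R chart_gradient c (f i) (snd c x)))"
proof
  fix h
  have "(\<Sum>i<N. b i * grad M (f i) x h) = (\<Sum>i<N. chart_tangent c x
     (b i *\<^sub>R (matrix_inv (gram_matrix M c (snd c x)) *v chart_gradient c (f i) (snd c x))) h)"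
    using grad_chart[OF M c x f] linear_scale[OF chart_tangent_linear[of c x h]] by (intro sum.cong) auto
  also have "\<dots> = chart_tangent c x (\<Sum>i<N. b i *\<^sub>R
      (matrix_inv (gram_matrix M c (snd c x)) *v chart_gradient c (f i) (snd c x))) h"
    using linear_sum[OF chart_tangent_linear[of c x h], of _ "{..<N}"] by simp
  also have "(\<Sum>i<N. b i *\<^sub>R (matrix_inv (gram_matrix M c (snd c x)) *v chart_gradient c (f i) (snd c x))) =
      matrix_inv (gram_matrix M c (snd c x)) *v (\<Sum>i<N. b i *\<^sub>R chart_gradient c (f i) (snd c x))"
    by (simp add: linear_sum[OF matrix_vector_mul_linear] linear_scale[OF matrix_vector_mul_linear])
  finally show "(\<Sum>i<N. b i * grad M (f i) x h) =
    chart_tangent c x (matrix_inv (gram_matrix M c (snd c x)) *v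
      (\<Sum>i<N. b i *\<^sub>R chart_gradient c (f i) (snd c x))) h" .
qed

lemma metric_grad_combination:
  assumes M: "smooth_atlas M" and c: "nice_chart M c" and x: "x \<in> fst c"
    and "\<And>i. i < N \<Longrightarrow> (f i \<circ> chart_inv c) differentiable (at (snd c x))"
    and "\<And>i. i < N' \<Longrightarrow> (f' i \<circ> chart_inv c) differentiable (at (snd c x))"
  shows "metric M x (\<lambda>h. \<Sum>i<N. b i * grad M (f i) x h) (\<lambda>h. \<Sum>i<N'. b' i * grad M (f' i) x h) =
    (\<Sum>i<N. b i *\<^sub>R chart_gradient c (f i) (snd c x)) \<bullet> (matrix_inv (gram_matrix M c (snd c x)) *v
      (\<Sum>i<N'. b' i *\<^sub>R chart_gradient c (f' i) (snd c x)))"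
proof -
  note S = spd_gram_matrix(1)[OF c is_chartD(6)[OF nice_chart_is_chart[OF c] x]]
  define G where "G = gram_matrix M c (snd c x)"
  define p where "p = (\<Sum>i<N. b i *\<^sub>R chart_gradient c (f i) (snd c x))"
  define p' where "p' = (\<Sum>i<N'. b' i *\<^sub>R chart_gradient c (f' i) (snd c x))"
  have "metric M x (\<lambda>h. \<Sum>i<N. b i * grad M (f i) x h) (\<lambda>h. \<Sum>i<N'. b' i * grad M (f' i) x h) =
     metric M x (chart_tangent c x (matrix_inv G *v p)) (chart_tangent c x (matrix_inv G *v p'))"
    unfolding p_def p'_def G_def
    by (intro arg_cong2[where f = "metric M x"] grad_combination[OF M c x] assms(4,5))
  also have "\<dots> = p' \<bullet> (matrix_inv G *v p)"
    using metric_chart_tangent[OF c x] spd_matrix.inv_apply[OF S] unfolding G_def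
    by (simp add: inner_commute[of _ p'])
  also have "\<dots> = p \<bullet> (matrix_inv G *v p')"
    unfolding G_def by (rule spd_matrix.inv_sym[OF S])
  finally show ?thesis unfolding p_def p'_def G_def .
qed

lemma metric_grad:
  assumes M: "smooth_atlas M" and c: "nice_chart M c" and x: "x \<in> fst c"
    and "(f \<circ> chart_inv c) differentiable (at (snd c x))" "(g \<circ> chart_inv c) differentiable (at (snd c x))"
  shows "metric M x (grad M f x) (grad M g x) =
    chart_gradient c f (snd c x) \<bullet> (matrix_inv (gram_matrix M c (snd c x)) *v chart_gradient c g (snd c x))"
  using metric_grad_combination[OF M c x, of "Suc 0" "\<lambda>_. f" "Suc 0" "\<lambda>_. g" "\<lambda>_. 1" "\<lambda>_. 1"] assms(4,5)
  by (simp add: lessThan_Suc del: sum_constant)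

lemma smooth_fun_chart_C1:
  assumes "smooth_atlas M" "nice_chart M c" "smooth_fun M f"
  shows "y \<in> chart_range c \<Longrightarrow> (f \<circ> chart_inv c) differentiable (at y)"
    and "continuous_on (chart_range c) (chart_gradient c f)"
proof -
  have "Ck_on (Suc 0) (chart_range c) (f \<circ> chart_inv c)"
    using smooth_fun_chart[OF assms(1) _ assms(3)] assms(2) unfolding nice_chart_def by blast
  then show "y \<in> chart_range c \<Longrightarrow> (f \<circ> chart_inv c) differentiable (at y)"
    "continuous_on (chart_range c) (chart_gradient c f)"
    unfolding chart_gradient_def by (auto intro!: continuous_on_vec_lambda)
qed

lemma continuous_on_det:
  fixes A :: "'a::topological_space \<Rightarrow> real ^ 'n::finite ^ 'n"
  assumes "\<And>i j. continuous_on S (\<lambda>x. A x $ i $ j)"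
  shows "continuous_on S (\<lambda>x. det (A x))"
  unfolding det_def
  by (intro continuous_on_sum continuous_on_mult continuous_on_prod continuous_on_const) (rule assms)

lemma continuous_on_gram_matrix:
  assumes "nice_chart M c"
  shows "continuous_on (chart_range c) (\<lambda>y. gram_matrix M c y $ i $ j)"
    "continuous_on (chart_range c) (gram_det M c)"
proof -
  show 1: "continuous_on (chart_range c) (\<lambda>y. gram_matrix M c y $ i $ j)" for i j
    using assms by (simp add: gram_matrix_def nice_chart_def)
  show "continuous_on (chart_range c) (gram_det M c)"
    unfolding gram_det_eq by (rule continuous_on_det[OF 1])
qed

lemma continuous_on_metric_grad:
  fixes M :: "('a::t2_space, 'n::finite) riemannian"
  assumes M: "smooth_atlas M" "riemannian_metric M" and f: "smooth_fun M f" and g: "smooth_fun M g"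
  shows "continuous_on UNIV (\<lambda>x. metric M x (grad M f x) (grad M g x))"
proof -
  have "isCont (\<lambda>x. metric M x (grad M f x) (grad M g x)) x" for x
  proof -
    obtain c where c: "c \<in> charts M" "x \<in> fst c"
      using smooth_atlasD(1)[OF M(1)] by blast
    note n = nice_chart_charts[OF M c(1)]
    note ch = nice_chart_is_chart[OF n]
    \<comment> \<open>The product of the two gradients, written in coordinates with Cramer's rule
      for the inverse Gram matrix: only sums, products and a quotient of continuous functions
      remain.\<close>
    define K where "K y = (\<Sum>k\<in>UNIV. chart_gradient c f y $ k *
       (det (\<chi> i j. if j = k then chart_gradient c g y $ i else gram_matrix M c y $ i $ j) / gram_det M c y))" for y
    have eq: "metric M x (grad M f x) (grad M g x) = K (snd c x)" if "x \<in> fst c" for x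
    proof -
      note y = is_chartD(6)[OF ch that]
      interpret spd_matrix "gram_matrix M c (snd c x)"
        by (rule spd_gram_matrix[OF n y])
      show ?thesis
        unfolding metric_grad[OF M(1) n that smooth_fun_chart_C1(1)[OF M(1) n f y] smooth_fun_chart_C1(1)[OF M(1) n g y]]
          inv_cramer by (simp add: K_def inner_vec_def gram_det_eq)
    qed
    have f1: "continuous_on (chart_range c) (\<lambda>y. chart_gradient c f y $ k)"
      and g1: "continuous_on (chart_range c) (\<lambda>y. chart_gradient c g y $ k)" for k
      using smooth_fun_chart_C1(2)[OF M(1) n f] smooth_fun_chart_C1(2)[OF M(1) n g]
      by (auto intro: continuous_on_component)
    have d: "continuous_on (chart_range c)
       (\<lambda>y. det (\<chi> i j. if j = k then chart_gradient c g y $ i else gram_matrix M c y $ i $ j))" for k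
    proof (rule continuous_on_det)
      show "continuous_on (chart_range c)
           (\<lambda>y. (\<chi> i j. if j = k then chart_gradient c g y $ i else gram_matrix M c y $ i $ j) $ i $ j)" for i j
        using g1 continuous_on_gram_matrix(1)[OF n] by (cases "j = k") auto
    qed
    have nz: "\<forall>y\<in>chart_range c. gram_det M c y \<noteq> 0"
      using spd_matrix.det_pos[OF spd_gram_matrix(1)[OF n]] unfolding gram_det_eq by (metis less_irrefl)
    have "continuous_on (chart_range c) K"
      unfolding K_def
      by (rule continuous_on_sum continuous_on_mult continuous_on_divide f1 d continuous_on_gram_matrix[OF n] nz)+
    then have "continuous_on (fst c) (K \<circ> snd c)"
      using continuous_on_compose[OF is_chartD(3)[OF ch]] unfolding chart_range_def by blast
    then have "continuous_on (fst c) (\<lambda>x. metric M x (grad M f x) (grad M g x))"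
      by (rule continuous_on_eq) (simp add: eq)
    then show ?thesis
      using c(2) is_chartD(1)[OF ch] continuous_on_eq_continuous_at by blast
  qed
  then show ?thesis by (simp add: continuous_on_eq_continuous_at)
qed

section \<open>The volume element\<close>

lemma emeasure_subadditive_count_space:
  assumes "countable I" "\<And>i. i \<in> I \<Longrightarrow> X i \<in> sets N"
  shows "emeasure N (\<Union>i\<in>I. X i) \<le> (\<integral>\<^sup>+i. emeasure N (X i) \<partial>count_space I)"
proof -
  have m: "(\<Union>i\<in>I. X i) \<in> sets N"
    using assms by (intro sets.countable_UN'') auto
  have "emeasure N (\<Union>i\<in>I. X i) = (\<integral>\<^sup>+y. indicator (\<Union>i\<in>I. X i) y \<partial>N)"
    using m by simp
  also have "\<dots> \<le> (\<integral>\<^sup>+y. (\<integral>\<^sup>+i. indicator (X i) y \<partial>count_space I) \<partial>N)"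
  proof (rule nn_integral_mono)
    fix y
    show "indicator (\<Union>i\<in>I. X i) y \<le> (\<integral>\<^sup>+i. indicator (X i) y \<partial>count_space I)"
    proof (cases "y \<in> (\<Union>i\<in>I. X i)")
      case True
      then obtain i where i: "i \<in> I" "y \<in> X i" by blast
      then have "1 = (indicator (X i) y :: ennreal)" by simp
      also have "\<dots> \<le> (\<integral>\<^sup>+i. indicator (X i) y \<partial>count_space I)"
        using i(1) by (intro nn_integral_ge_point) auto
      finally show ?thesis using True by simp
    qed simp
  qed
  also have "\<dots> = (\<integral>\<^sup>+i. (\<integral>\<^sup>+y. indicator (X i) y \<partial>N) \<partial>count_space I)"
    using assms by (intro nn_integral_count_space_nn_integral) auto
  also have "\<dots> = (\<integral>\<^sup>+i. emeasure N (X i) \<partial>count_space I)"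
    using assms by (intro nn_integral_cong) auto
  finally show ?thesis .
qed

text \<open>Cover \<open>S\<close> by cubes with disjoint interiors inside an open \<open>W\<close>.
  A cube of side \<open>s\<close> in dimension \<open>d\<close> has all its points within distance
  \<open>d s\<close> of a fixed one, so its image lies in a cube of side \<open>2 L d s\<close>;
  this is the origin of the constant. Outer regularity then replaces \<open>W\<close> by
  \<open>S\<close>.\<close>

lemma emeasure_Lipschitz_image:
  fixes f :: "'e::euclidean_space \<Rightarrow> 'e"
  assumes U: "open U" "bounded U" and L: "L \<ge> 0"
    and lip: "\<And>x y. x \<in> U \<Longrightarrow> y \<in> U \<Longrightarrow> norm (f x - f y) \<le> L * norm (x - y)"
    and S: "S \<subseteq> U" "S \<in> sets borel" "f ` S \<in> sets borel"
  shows "emeasure lborel (f ` S) \<le> ennreal ((2 * L * DIM('e)) ^ DIM('e)) * emeasure lborel S"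
proof -
  define C where "C = (2 * L * DIM('e)) ^ DIM('e)"
  have C: "C \<ge> 0" using L by (simp add: C_def)
  have main: "emeasure lborel (f ` S) \<le> ennreal C * emeasure lborel W"
    if W: "open W" "S \<subseteq> W" "W \<subseteq> U" for W
  proof -
    obtain b where b: "b > 0" "\<And>x. x \<in> U \<Longrightarrow> norm x \<le> b"
      using U(2) bounded_pos by blast
    have Sb: "S \<subseteq> cbox (- (b *\<^sub>R One)) (b *\<^sub>R One)"
    proof
      fix x assume "x \<in> S"
      then have "norm x \<le> b" using S(1) b by blast
      then have "\<bar>x \<bullet> i\<bar> \<le> b" if "i \<in> Basis" for i
        using Basis_le_norm[OF that, of x] by linarith
      then show "x \<in> cbox (- (b *\<^sub>R One)) (b *\<^sub>R One)"
        by (simp add: mem_box abs_le_iff) (metis minus_le_iff)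
    qed
    have bne: "box (- (b *\<^sub>R One)) (b *\<^sub>R One :: 'e) \<noteq> {}"
      using b(1) by (auto simp: box_ne_empty)
    have "\<exists>r>0. ball x r \<subseteq> W" if "x \<in> W" for x using W(1) that open_contains_ball by blast
    then obtain r where r: "\<And>x. x \<in> W \<Longrightarrow> r x > 0 \<and> ball x (r x) \<subseteq> W" by metis
    \<comment> \<open>The gauge forces every covering set, which contains a point of
      \<open>S\<close>, to stay inside \<open>W\<close>. The starting box is the cube with half side
      \<open>b\<close>, so that all sides of a covering box equal \<open>2 b / 2^n\<close> and it is
      a cube.\<close>
    define g where "g x = (if x \<in> W then ball x (r x) else ball x 1)" for x
    have "gauge g" using r by (auto simp: gauge_def g_def)
    obtain \<D> where D: "countable \<D>" "\<And>K. K \<in> \<D> \<Longrightarrow> interior K \<noteq> {} \<and> (\<exists>c d. K = cbox c d)"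
      "pairwise (\<lambda>A B. interior A \<inter> interior B = {}) \<D>"
      "\<And>K. K \<in> \<D> \<Longrightarrow> \<exists>x \<in> S \<inter> K. K \<subseteq> g x"
      "\<And>u v. cbox u v \<in> \<D> \<Longrightarrow> \<exists>n. \<forall>i \<in> Basis. v \<bullet> i - u \<bullet> i = ((b *\<^sub>R One) \<bullet> i - (- (b *\<^sub>R One)) \<bullet> i) / 2^n"
      "S \<subseteq> \<Union>\<D>"
      using covering_lemma[OF Sb bne \<open>gauge g\<close>] by metis
    have KW: "K \<subseteq> W" if "K \<in> \<D>" for K
    proof -
      obtain x where x: "x \<in> S" "K \<subseteq> g x" using D(4)[OF \<open>K \<in> \<D>\<close>] by blast
      then have "g x = ball x (r x)" using W(2) by (auto simp: g_def)
      then show ?thesis using x r[of x] W(2) by blast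
    qed
    have "L-lipschitz_on U f" using lip L by (intro lipschitz_onI) (auto simp: dist_norm)
    then have cont: "continuous_on U f" by (rule lipschitz_on_continuous_on)
    have cubes: "f ` K \<in> sets borel \<and> emeasure lborel (f ` K) \<le> ennreal C * emeasure lborel (interior K)"
      if K: "K \<in> \<D>" for K
    proof
      obtain u v where uv: "K = cbox u v" "box u v \<noteq> {}" using D(2)[OF K] by (metis interior_cbox)
      obtain n where n: "\<And>i. i \<in> Basis \<Longrightarrow> v \<bullet> i - u \<bullet> i = 2 * b / 2 ^ n"
        using D(5)[of u v] K uv by auto
      define s where "s = 2 * b / 2 ^ n"
      have s: "s > 0" using b by (simp add: s_def)
      obtain x0 where x0: "x0 \<in> K" using D(4)[OF K] by blast
      have KU: "K \<subseteq> U" using KW[OF K] W(3) by blast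
      have "compact (f ` K)"
        using uv continuous_on_subset[OF cont KU] by (auto intro: compact_continuous_image)
      then show "f ` K \<in> sets borel" by (rule borel_compact)
      have dist: "norm (f x - f x0) \<le> L * (DIM('e) * s)" if "x \<in> K" for x
      proof -
        have "norm (x - x0) \<le> (\<Sum>i\<in>Basis. \<bar>(x - x0) \<bullet> i\<bar>)" by (rule norm_le_l1)
        also have "\<dots> \<le> (\<Sum>i\<in>(Basis :: 'e set). s)"
        proof (rule sum_mono)
          fix i :: 'e assume i: "i \<in> Basis"
          have "u \<bullet> i \<le> x \<bullet> i" "x \<bullet> i \<le> v \<bullet> i" "u \<bullet> i \<le> x0 \<bullet> i" "x0 \<bullet> i \<le> v \<bullet> i"
            using i that x0 uv(1) by (auto simp: mem_box)
          then show "\<bar>(x - x0) \<bullet> i\<bar> \<le> s" using n[OF i] by (simp add: s_def inner_diff_left)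
        qed
        also have "\<dots> = DIM('e) * s" by simp
        finally have "L * norm (x - x0) \<le> L * (DIM('e) * s)" using L by (simp add: mult_left_mono)
        then show ?thesis using lip[of x x0] that x0 KU by (meson order_trans subsetD)
      qed
      define R where "R = L * (DIM('e) * s)"
      have R: "R \<ge> 0" using L s by (simp add: R_def)
      have "f ` K \<subseteq> cbox (f x0 - R *\<^sub>R One) (f x0 + R *\<^sub>R One)"
      proof
        fix y assume "y \<in> f ` K"
        then have "norm (y - f x0) \<le> R" using dist by (auto simp: R_def)
        then have "\<bar>(y - f x0) \<bullet> i\<bar> \<le> R" if "i \<in> Basis" for i
          using Basis_le_norm[OF that, of "y - f x0"] by linarith
        then have "f x0 \<bullet> i - R \<le> y \<bullet> i \<and> y \<bullet> i \<le> f x0 \<bullet> i + R" if "i \<in> Basis" for i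
          using that by (fastforce simp: inner_diff_left abs_le_iff)
        then show "y \<in> cbox (f x0 - R *\<^sub>R One) (f x0 + R *\<^sub>R One)"
          by (simp add: mem_box inner_diff_left inner_add_left)
      qed
      then have "emeasure lborel (f ` K) \<le> emeasure lborel (cbox (f x0 - R *\<^sub>R One) (f x0 + R *\<^sub>R One))"
        by (rule emeasure_mono) simp
      also have "\<dots> = ennreal ((2 * R) ^ DIM('e))"
        using R by (subst emeasure_lborel_cbox) (auto simp: inner_diff_left inner_add_left)
      also have "(2 * R) ^ DIM('e) = C * s ^ DIM('e)"
        by (simp add: C_def R_def power_mult_distrib mult_ac)
      also have "ennreal (C * s ^ DIM('e)) = ennreal C * ennreal (s ^ DIM('e))"
        using C s by (simp add: ennreal_mult)
      also have "ennreal (s ^ DIM('e)) = emeasure lborel (box u v)"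
      proof -
        have "(\<Prod>i\<in>Basis. (v - u) \<bullet> i) = (\<Prod>i\<in>(Basis :: 'e set). s)"
          by (rule prod.cong) (auto simp: s_def inner_diff_left n)
        moreover have "\<And>i. i \<in> Basis \<Longrightarrow> u \<bullet> i \<le> v \<bullet> i" using n s unfolding s_def by (metis diff_ge_0_iff_ge less_imp_le)
        ultimately show ?thesis by (simp add: emeasure_lborel_box)
      qed
      finally show "emeasure lborel (f ` K) \<le> ennreal C * emeasure lborel (interior K)"
        by (simp add: uv interior_cbox)
    qed
    have "emeasure lborel (f ` S) \<le> emeasure lborel (\<Union>K\<in>\<D>. f ` K)"
    proof (rule emeasure_mono)
      show "f ` S \<subseteq> (\<Union>K\<in>\<D>. f ` K)" using D(6) by blast
      show "(\<Union>K\<in>\<D>. f ` K) \<in> sets lborel" using cubes D(1) by (intro sets.countable_UN'') auto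
    qed
    also have "\<dots> \<le> (\<integral>\<^sup>+K. emeasure lborel (f ` K) \<partial>count_space \<D>)"
      using cubes D(1) by (intro emeasure_subadditive_count_space) auto
    also have "\<dots> \<le> (\<integral>\<^sup>+K. ennreal C * emeasure lborel (interior K) \<partial>count_space \<D>)"
      using cubes by (intro nn_integral_mono) auto
    also have "\<dots> = ennreal C * (\<integral>\<^sup>+K. emeasure lborel (interior K) \<partial>count_space \<D>)"
      by (rule nn_integral_cmult) simp
    also have "(\<integral>\<^sup>+K. emeasure lborel (interior K) \<partial>count_space \<D>) = emeasure lborel (\<Union>K\<in>\<D>. interior K)"
      using D(1,3) by (intro emeasure_UN_countable[symmetric]) (auto simp: disjoint_family_on_def pairwise_def)
    also have "ennreal C * \<dots> \<le> ennreal C * emeasure lborel W"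
      using KW interior_subset W(1) by (intro mult_left_mono emeasure_mono) fastforce+
    finally show ?thesis .
  qed
  show ?thesis
    unfolding C_def[symmetric]
  proof (rule ennreal_le_epsilon)
    fix e :: real assume e: "e > 0"
    \<comment> \<open>The denominator \<open>C + 1\<close> avoids a division by zero, as
      \<open>C\<close> vanishes together with \<open>L\<close>.\<close>
    obtain T where T: "open T" "S \<subseteq> T" "emeasure lborel (T - S) < ennreal (e / (C + 1))"
      using outer_regular_lborel[OF S(2), of "e / (C + 1)"] e C by auto
    have "emeasure lborel (f ` S) \<le> ennreal C * emeasure lborel (T \<inter> U)"
      using main[of "T \<inter> U"] T U S by auto
    also have "\<dots> \<le> ennreal C * (emeasure lborel S + ennreal (e / (C + 1)))"
    proof (rule mult_left_mono)
      have "emeasure lborel (T \<inter> U) \<le> emeasure lborel (S \<union> (T - S))"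
        using T(1) S(2) by (intro emeasure_mono) auto
      also have "\<dots> \<le> emeasure lborel S + emeasure lborel (T - S)"
        using T(1) S(2) by (intro emeasure_subadditive) auto
      also have "\<dots> \<le> emeasure lborel S + ennreal (e / (C + 1))"
        using T(3) by (intro add_left_mono) auto
      finally show "emeasure lborel (T \<inter> U) \<le> emeasure lborel S + ennreal (e / (C + 1))" .
    qed simp
    also have "\<dots> = ennreal C * emeasure lborel S + ennreal (C * (e / (C + 1)))"
      by (subst ennreal_mult) (use C e in \<open>auto simp: distrib_left\<close>)
    also have "\<dots> \<le> ennreal C * emeasure lborel S + ennreal e"
      using C e by (intro add_left_mono ennreal_leI) (simp add: field_simps)
    finally show "emeasure lborel (f ` S) \<le> ennreal C * emeasure lborel S + ennreal e" .
  qed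
qed

text \<open>The closed ball is convex, so the mean value inequality applies. The constant is a sum
  over the basis of bounds for the directional derivatives on the compact ball, which dominates the
  operator norm.\<close>

lemma C1_Lipschitz_cball:
  fixes f :: "'d::euclidean_space \<Rightarrow> 'e::euclidean_space"
  assumes "Ck_on (Suc 0) U f" "cball a r \<subseteq> U"
  obtains L where "L \<ge> 0" "\<And>x y. x \<in> cball a r \<Longrightarrow> y \<in> cball a r \<Longrightarrow> norm (f x - f y) \<le> L * norm (x - y)"
proof -
  have d: "(f has_derivative frechet_derivative f (at x)) (at x)" if "x \<in> cball a r" for x
    using assms that by (auto simp flip: frechet_derivative_works)
  have "\<exists>B. \<forall>x\<in>cball a r. norm (frechet_derivative f (at x) b) \<le> B" for b
  proof -
    have "continuous_on (cball a r) (\<lambda>x. frechet_derivative f (at x) b)"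
      using assms by (intro continuous_on_subset[OF _ assms(2)]) simp
    then have "compact ((\<lambda>x. frechet_derivative f (at x) b) ` cball a r)"
      by (rule compact_continuous_image) simp
    then obtain B where "\<forall>w\<in>(\<lambda>x. frechet_derivative f (at x) b) ` cball a r. norm w \<le> B"
      using compact_imp_bounded[of "(\<lambda>x. frechet_derivative f (at x) b) ` cball a r"]
      unfolding bounded_iff by blast
    then show ?thesis by blast
  qed
  then have "\<forall>b. \<exists>B. \<forall>x\<in>cball a r. norm (frechet_derivative f (at x) b) \<le> B" by blast
  from choice[OF this] obtain B where
    B: "\<And>b x. x \<in> cball a r \<Longrightarrow> norm (frechet_derivative f (at x) b) \<le> B b" by blast
  define L where "L = (\<Sum>b\<in>Basis. \<bar>B b\<bar>)"
  have on: "onorm (frechet_derivative f (at x)) \<le> L" if x: "x \<in> cball a r" for x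
  proof -
    have "onorm (frechet_derivative f (at x)) \<le> (\<Sum>b\<in>Basis. norm (frechet_derivative f (at x) b))"
      by (rule onorm_componentwise[OF has_derivative_bounded_linear[OF d[OF x]]])
    also have "\<dots> \<le> L" unfolding L_def using B[OF x] by (intro sum_mono) (meson abs_ge_self order_trans)
    finally show ?thesis .
  qed
  show ?thesis
  proof (rule that[of L])
    show "L \<ge> 0" by (simp add: L_def sum_nonneg)
    show "norm (f x - f y) \<le> L * norm (x - y)" if "x \<in> cball a r" "y \<in> cball a r" for x y
      using differentiable_bound[OF convex_cball has_derivative_at_withinI[OF d] on that] by simp
  qed
qed

lemma volume_element_chart:
  assumes "volume_element M m" "c \<in> charts M" "A \<in> sets borel" "A \<subseteq> fst c"
  shows "emeasure m A = (\<integral>\<^sup>+y\<in>snd c ` A. ennreal (sqrt (gram_det M c y)) \<partial>lborel)"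
  using assms unfolding volume_element_def by blast

lemma volume_element_null:
  fixes M :: "('a::topological_space, 'n::finite) riemannian"
  assumes M: "smooth_atlas M" "volume_element M m" and c: "c \<in> charts M" and A: "A \<in> sets borel" "A \<subseteq> fst c"
    and "emeasure lborel (snd c ` A) = 0"
  shows "emeasure m A = 0"
proof -
  have "snd c ` A \<in> null_sets lborel"
    using assms(6) borel_chart_image[OF smooth_atlasD(3)[OF M(1) c] A] by auto
  then have "AE y in lborel. y \<notin> snd c ` A" by (rule AE_not_in)
  then have "AE y in lborel. ennreal (sqrt (gram_det M c y)) * indicator (snd c ` A) y = 0"
    by (rule eventually_mono) (simp add: indicator_def)
  then have "(\<integral>\<^sup>+y\<in>snd c ` A. ennreal (sqrt (gram_det M c y)) \<partial>lborel) = integral\<^sup>N lborel (\<lambda>_::real ^ 'n. 0)"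
    by (rule nn_integral_cong_AE)
  then show ?thesis unfolding volume_element_chart[OF M(2) c A] by simp
qed

lemma volume_element_point:
  fixes M :: "('a::t2_space, 'n::finite) riemannian"
  assumes M: "smooth_atlas M" "volume_element M m"
  shows "emeasure m {x} = 0"
proof -
  obtain c where c: "c \<in> charts M" "x \<in> fst c" using smooth_atlasD(1)[OF M(1)] by blast
  show ?thesis by (rule volume_element_null[OF M c(1)]) (use c in auto)
qed

text \<open>The Gram determinant has a positive minimum \<open>\<delta>\<close> on the compact set
  \<open>K\<close>, so the volume density is at least \<open>sqrt \<delta>\<close> there.\<close>

lemma volume_element_lower_bound:
  fixes M :: "('a::t2_space, 'n::finite) riemannian"
  assumes M: "smooth_atlas M" "riemannian_metric M" "volume_element M m" and c: "c \<in> charts M"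
    and K: "compact K" "K \<subseteq> chart_range c"
  obtains C where "C > 0"
    "\<And>A. A \<in> sets borel \<Longrightarrow> A \<subseteq> chart_inv c ` K \<Longrightarrow> emeasure lborel (snd c ` A) \<le> ennreal C * emeasure m A"
proof (cases "K = {}")
  case True
  then show ?thesis by (intro that[of 1]) auto
next
  case False
  note n = nice_chart_charts[OF M(1,2) c]
  note ch = nice_chart_is_chart[OF n]
  obtain y0 where y0: "y0 \<in> K" "\<And>y. y \<in> K \<Longrightarrow> gram_det M c y0 \<le> gram_det M c y"
    using continuous_attains_inf[OF K(1) False, of "gram_det M c"]
      continuous_on_subset[OF continuous_on_gram_matrix(2)[OF n] K(2)] by blast
  define \<delta> where "\<delta> = gram_det M c y0"
  have \<delta>: "\<delta> > 0"
    using spd_matrix.det_pos[OF spd_gram_matrix(1)[OF n, of y0]] y0(1) K(2) unfolding \<delta>_def gram_det_eq by blast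
  show ?thesis
  proof (rule that[of "1 / sqrt \<delta>"])
    show "1 / sqrt \<delta> > 0" using \<delta> by simp
  next
    fix A assume A: "A \<in> sets borel" "A \<subseteq> chart_inv c ` K"
    have Ac: "A \<subseteq> fst c" using A(2) K(2) is_chartD(8)[OF ch] by auto
    have b: "snd c ` A \<in> sets borel" by (rule borel_chart_image[OF ch A(1) Ac])
    have sub: "snd c ` A \<subseteq> K" using A(2) K(2) is_chartD(7)[OF ch] by force
    have "ennreal (sqrt \<delta>) * emeasure lborel (snd c ` A) = (\<integral>\<^sup>+y\<in>snd c ` A. ennreal (sqrt \<delta>) \<partial>lborel)"
      using b by (simp add: nn_integral_cmult_indicator)
    also have "\<dots> \<le> (\<integral>\<^sup>+y\<in>snd c ` A. ennreal (sqrt (gram_det M c y)) \<partial>lborel)"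
      using sub y0(2) by (intro nn_integral_mono) (auto simp: indicator_def \<delta>_def intro!: ennreal_leI)
    also have "\<dots> = emeasure m A" by (rule volume_element_chart[OF M(3) c A(1) Ac, symmetric])
    finally have "ennreal (1 / sqrt \<delta>) * (ennreal (sqrt \<delta>) * emeasure lborel (snd c ` A)) \<le> ennreal (1 / sqrt \<delta>) * emeasure m A"
      by (rule mult_left_mono) simp
    moreover have "ennreal (1 / sqrt \<delta>) * ennreal (sqrt \<delta>) = 1"
      using \<delta> by (simp flip: ennreal_mult)
    ultimately show "emeasure lborel (snd c ` A) \<le> ennreal (1 / sqrt \<delta>) * emeasure m A"
      by (simp add: mult.assoc[symmetric])
  qed
qed

text \<open>The volume is computed in the listed chart \<open>c0\<close>, while the analysis takes
  place in \<open>c\<close>, possibly the Euclidean chart. No change of variables formula is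
  involved: the transition to \<open>c\<close> is Lipschitz on the ball, which bounds Lebesgue
  measure in \<open>c\<close> by a multiple of \<open>m\<close>, and the opposite transition is
  differentiable, which sends null sets back to null sets.\<close>

lemma chart_ball_comparison:
  fixes M :: "('a::t2_space, 'n::finite) riemannian"
  assumes M: "smooth_atlas M" "riemannian_metric M" "volume_element M m" and c0: "c0 \<in> charts M"
    and a: "cball a r \<subseteq> chart_range c0" and c: "nice_chart M c" and sub: "chart_inv c0 ` cball a r \<subseteq> fst c"
  obtains C where "C > 0"
    "\<And>A. A \<in> sets borel \<Longrightarrow> A \<subseteq> chart_inv c0 ` ball a r \<Longrightarrow>
       emeasure lborel (snd c ` A) \<le> ennreal C * emeasure m A"
    "\<And>A. A \<in> sets borel \<Longrightarrow> A \<subseteq> chart_inv c0 ` ball a r \<Longrightarrow> emeasure lborel (snd c ` A) = 0 \<Longrightarrow> emeasure m A = 0"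
    "\<And>x l. x \<in> chart_inv c0 ` ball a r \<Longrightarrow> gram_matrix M c (snd c x) $ l $ l \<le> C"
proof -
  note ch = nice_chart_is_chart[OF c]
  note ch0 = smooth_atlasD(3)[OF M(1) c0]
  have tr: "smooth_transition c0 c" "smooth_transition c c0"
    using c c0 unfolding nice_chart_def smooth_chart_def by blast+
  have img: "snd c ` A = transition c0 c ` (snd c0 ` A)" "A \<subseteq> fst c0" "snd c0 ` A \<subseteq> ball a r" "A \<subseteq> fst c"
    if A: "A \<subseteq> chart_inv c0 ` ball a r" for A
  proof -
    show 1: "A \<subseteq> fst c0"
    proof
      fix x assume "x \<in> A"
      then obtain z where z: "z \<in> ball a r" "x = chart_inv c0 z" using A by blast
      then have "z \<in> chart_range c0" using a by auto
      then show "x \<in> fst c0" using z is_chartD(8)[OF ch0] by simp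
    qed
    have "transition c0 c (snd c0 x) = snd c x" if "x \<in> A" for x
      using is_chartD(5)[OF ch0, of x] that 1 by (auto simp: transition_def)
    then show "snd c ` A = transition c0 c ` (snd c0 ` A)" by (simp add: image_image)
    show "snd c0 ` A \<subseteq> ball a r"
    proof
      fix y assume "y \<in> snd c0 ` A"
      then obtain z where z: "z \<in> ball a r" "y = snd c0 (chart_inv c0 z)" using A by blast
      then have "z \<in> chart_range c0" using a by auto
      then show "y \<in> ball a r" using z is_chartD(7)[OF ch0] by simp
    qed
    show "A \<subseteq> fst c" using A sub ball_subset_cball by blast
  qed
  have cb: "cball a r \<subseteq> snd c0 ` (fst c0 \<inter> fst c)"
    unfolding overlap_image_eq[OF ch0] using a sub by blast
  obtain L where L: "L \<ge> 0"
    "\<And>x y. x \<in> cball a r \<Longrightarrow> y \<in> cball a r \<Longrightarrow> norm (transition c0 c x - transition c0 c y) \<le> L * norm (x - y)"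
    using C1_Lipschitz_cball[OF _ cb, of "transition c0 c"] tr(1) unfolding smooth_transition_def smooth_on_def by blast
  obtain C1 where C1: "C1 > 0" "\<And>A. A \<in> sets borel \<Longrightarrow> A \<subseteq> chart_inv c0 ` cball a r \<Longrightarrow>
      emeasure lborel (snd c0 ` A) \<le> ennreal C1 * emeasure m A"
    using volume_element_lower_bound[OF M c0 compact_cball a] by blast
  define C2 where "C2 = (2 * L * DIM(real ^ 'n)) ^ DIM(real ^ 'n)"
  have C2: "C2 \<ge> 0" using L(1) by (simp add: C2_def)
  define K where "K = snd c ` (chart_inv c0 ` cball a r)"
  have K: "compact K" "K \<subseteq> chart_range c"
    using compact_continuous_image[OF continuous_on_subset[OF is_chartD(3)[OF ch] sub] chart_ball_closure(1)[OF ch0 a]]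
      sub is_chartD(6)[OF ch] by (auto simp: K_def)
  have "\<exists>B. \<forall>y\<in>K. gram_matrix M c y $ l $ l \<le> B" for l
  proof -
    have "compact ((\<lambda>y. gram_matrix M c y $ l $ l) ` K)"
      by (rule compact_continuous_image[OF continuous_on_subset[OF continuous_on_gram_matrix(1)[OF c] K(2)] K(1)])
    then have "bdd_above ((\<lambda>y. gram_matrix M c y $ l $ l) ` K)"
      by (intro bounded_imp_bdd_above compact_imp_bounded)
    then show ?thesis by (auto simp: bdd_above_def)
  qed
  then obtain B where B: "\<And>l y. y \<in> K \<Longrightarrow> gram_matrix M c y $ l $ l \<le> B l" by metis
  define C3 where "C3 = (\<Sum>l\<in>UNIV. \<bar>B l\<bar>)"
  have C3: "B l \<le> C3" "0 \<le> C3" for l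
    using member_le_sum[of l UNIV "\<lambda>l. \<bar>B l\<bar>"] by (auto simp: C3_def sum_nonneg)
  show ?thesis
  \<comment> \<open>One constant serves all three purposes: \<open>C2 * C1\<close> for the
    comparison of measures, \<open>C3\<close> for the diagonal Gram entries, and 1 for
    positivity.\<close>
  proof (rule that[of "C2 * C1 + C3 + 1"])
    show "C2 * C1 + C3 + 1 > 0" using C1 C2 C3(2) by (smt (verit) mult_nonneg_nonneg)
  next
    fix A assume A: "A \<in> sets borel" "A \<subseteq> chart_inv c0 ` ball a r"
    have b: "snd c ` A \<in> sets borel" "snd c0 ` A \<in> sets borel"
      using borel_chart_image[OF ch A(1) img(4)[OF A(2)]] borel_chart_image[OF ch0 A(1) img(2)[OF A(2)]] by auto
    have "emeasure lborel (snd c ` A) \<le> ennreal C2 * emeasure lborel (snd c0 ` A)"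
      unfolding img(1)[OF A(2)] C2_def
      using b L ball_subset_cball img(1,3)[OF A(2)]
      by (intro emeasure_Lipschitz_image[where U = "ball a r"]) auto
    also have "\<dots> \<le> ennreal C2 * (ennreal C1 * emeasure m A)"
      using A ball_subset_cball by (intro mult_left_mono C1(2)) auto
    also have "\<dots> = ennreal (C2 * C1) * emeasure m A"
      using C1(1) C2 by (simp add: ennreal_mult mult.assoc)
    also have "\<dots> \<le> ennreal (C2 * C1 + C3 + 1) * emeasure m A"
      using C3(2) by (intro mult_right_mono ennreal_leI) auto
    finally show "emeasure lborel (snd c ` A) \<le> ennreal (C2 * C1 + C3 + 1) * emeasure m A" .
  next
    fix A assume A: "A \<in> sets borel" "A \<subseteq> chart_inv c0 ` ball a r" "emeasure lborel (snd c ` A) = 0"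
    have b: "snd c ` A \<in> sets borel" "snd c0 ` A \<in> sets borel"
      using borel_chart_image[OF ch A(1) img(4)[OF A(2)]] borel_chart_image[OF ch0 A(1) img(2)[OF A(2)]] by auto
    have neg: "negligible (snd c ` A)"
      using A(3) b(1) negligible_iff_null_sets null_sets_completionI by (metis null_setsI sets_lborel)
    have "snd c0 ` A = transition c c0 ` (snd c ` A)"
    proof -
      have "transition c c0 (snd c x) = snd c0 x" if "x \<in> A" for x
        using is_chartD(5)[OF ch, of x] that img(4)[OF A(2)] by (auto simp: transition_def)
      then show ?thesis by (simp add: image_image)
    qed
    \<comment> \<open>Differentiability alone suffices here: the dimensions agree, so a
      differentiable map takes negligible sets to negligible sets.\<close>
    moreover have "transition c c0 differentiable_on (snd c ` A)"
    proof -
      have "transition c c0 differentiable (at (snd c x))" if "x \<in> A" for x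
        using transition_differentiable[OF ch tr(2), of x] img(2,4)[OF A(2)] that unfolding differentiable_def by blast
      then show ?thesis by (auto intro!: differentiable_at_imp_differentiable_on)
    qed
    ultimately have "negligible (snd c0 ` A)"
      using negligible_differentiable_image_negligible[OF order_refl neg] by simp
    then have "emeasure lborel (snd c0 ` A) = 0"
      using b(2) by (auto simp: negligible_iff_null_sets null_sets_completion_iff)
    then show "emeasure m A = 0"
      by (rule volume_element_null[OF M(1,3) c0 A(1) img(2)[OF A(2)]])
  next
    fix x l assume "x \<in> chart_inv c0 ` ball a r"
    then have "snd c x \<in> K" using ball_subset_cball unfolding K_def by blast
    then show "gram_matrix M c (snd c x) $ l $ l \<le> C2 * C1 + C3 + 1"
      using B[of "snd c x" l] C3(1)[of l] C1(1) C2 by (smt (verit) mult_nonneg_nonneg)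
  qed
qed

section \<open>Configurations\<close>

lemma space_local_borel [simp]: "space (local_borel A) = configs"
  unfolding local_borel_def by (rule space_measure_of) auto

lemma measurable_card_local_borel:
  assumes "B \<in> borel_c" "B \<subseteq> A"
  shows "(\<lambda>\<gamma>. card (\<gamma> \<inter> B)) \<in> local_borel A \<rightarrow>\<^sub>M count_space UNIV"
proof (rule measurableI)
  fix S :: "nat set"
  have "{\<gamma> \<in> configs. card (\<gamma> \<inter> B) \<in> S} \<in> sets (local_borel A)"
    unfolding local_borel_def using assms by (intro in_measure_of) auto
  then show "(\<lambda>\<gamma>. card (\<gamma> \<inter> B)) -` S \<inter> space (local_borel A) \<in> sets (local_borel A)"
    by (simp add: vimage_def Int_def conj_commute)
qed simp

lemma measurable_local_borelI:
  assumes "\<And>x. x \<in> space N \<Longrightarrow> f x \<in> configs"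
    and "\<And>B. B \<in> borel_c \<Longrightarrow> B \<subseteq> A \<Longrightarrow> (\<lambda>x. card (f x \<inter> B)) \<in> N \<rightarrow>\<^sub>M count_space UNIV"
  shows "f \<in> N \<rightarrow>\<^sub>M local_borel A"
  unfolding local_borel_def
proof (rule measurable_measure_of)
  fix Y assume "Y \<in> {{\<gamma> \<in> configs. card (\<gamma> \<inter> B) \<in> S} |B S. B \<in> borel_c \<and> B \<subseteq> A}"
  then obtain B S where Y: "Y = {\<gamma> \<in> configs. card (\<gamma> \<inter> B) \<in> S}" "B \<in> borel_c" "B \<subseteq> A" by blast
  have "(\<lambda>x. card (f x \<inter> B)) -` S \<inter> space N \<in> sets N"
    using assms(2)[OF Y(2,3)] by (rule measurable_sets) simp
  moreover have "f -` Y \<inter> space N = (\<lambda>x. card (f x \<inter> B)) -` S \<inter> space N"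
    using assms(1) Y(1) by auto
  ultimately show "f -` Y \<inter> space N \<in> sets N" by simp
qed (use assms(1) in auto)

lemma configs_subset:
  assumes "\<gamma> \<in> configs" "\<eta> \<subseteq> \<gamma>"
  shows "\<eta> \<in> configs"
proof -
  have "finite (\<eta> \<inter> K)" if "compact K" for K
    using assms that finite_subset[of "\<eta> \<inter> K" "\<gamma> \<inter> K"] unfolding configs_def by blast
  then show ?thesis unfolding configs_def by blast
qed

lemma configs_Un: "\<gamma> \<in> configs \<Longrightarrow> \<eta> \<in> configs \<Longrightarrow> \<gamma> \<union> \<eta> \<in> configs"
  by (auto simp: configs_def Int_Un_distrib2)

lemma configs_insert: "\<gamma> \<in> configs \<Longrightarrow> insert x \<gamma> \<in> configs"
  by (auto simp: configs_def Int_insert_left)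

lemma configs_finite_Int: "\<gamma> \<in> configs \<Longrightarrow> B \<in> borel_c \<Longrightarrow> finite (\<gamma> \<inter> B)"
  using finite_subset[of "\<gamma> \<inter> B" "\<gamma> \<inter> closure B"] closure_subset[of B]
  by (auto simp: configs_def borel_c_def)

lemma borel_c_Int: "B \<in> borel_c \<Longrightarrow> A \<in> sets borel \<Longrightarrow> B \<inter> A \<in> borel_c"
  for B :: "'a::t2_space set"
proof -
  assume B: "B \<in> borel_c" and A: "A \<in> sets borel"
  have "closure (B \<inter> A) \<subseteq> closure B" by (rule closure_mono) auto
  then have "compact (closure (B \<inter> A))"
    using B compact_Int_closed[OF _ closed_closure, of "closure B" "B \<inter> A"]
    by (simp add: borel_c_def inf.absorb2)
  then show ?thesis using A B sets.Int[of B borel A] by (simp add: borel_c_def)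
qed

lemma open_c_borel_c: "B \<in> open_c \<Longrightarrow> B \<in> borel_c"
  by (auto simp: open_c_def borel_c_def)

text \<open>With extended values the count is countably additive in \<open>B\<close> for every
  \<open>\<gamma>\<close>, whereas \<open>card\<close> would assign 0 to an infinite set.\<close>

definition ncount :: "'a set \<Rightarrow> 'a set \<Rightarrow> ennreal" where
  "ncount \<gamma> B = emeasure (count_space UNIV) (\<gamma> \<inter> B)"

lemma ncount_eq_card: "finite (\<gamma> \<inter> B) \<Longrightarrow> ncount \<gamma> B = of_nat (card (\<gamma> \<inter> B))"
  by (simp add: ncount_def emeasure_count_space_finite)

lemma ncount_sums:
  assumes "disjoint_family A"
  shows "ncount \<gamma> (\<Union>i. A i) = (\<Sum>i. ncount \<gamma> (A i))"
proof -
  have "disjoint_family (\<lambda>i. \<gamma> \<inter> A i)" using assms by (auto simp: disjoint_family_on_def)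
  then show ?thesis
    unfolding ncount_def Int_UN_distrib by (intro suminf_emeasure[symmetric]) auto
qed

lemma measurable_card_iff_ncount:
  assumes "\<And>x. x \<in> space N \<Longrightarrow> finite (f x \<inter> B)"
  shows "(\<lambda>x. card (f x \<inter> B)) \<in> N \<rightarrow>\<^sub>M count_space UNIV \<longleftrightarrow> (\<lambda>x. ncount (f x) B) \<in> borel_measurable N"
proof -
  have *: "(\<lambda>x. ncount (f x) B) \<in> borel_measurable N \<longleftrightarrow> (\<lambda>x. of_nat (card (f x \<inter> B)) :: ennreal) \<in> borel_measurable N"
    using assms by (intro measurable_cong) (simp add: ncount_eq_card)
  show ?thesis
  proof
    assume "(\<lambda>x. card (f x \<inter> B)) \<in> N \<rightarrow>\<^sub>M count_space UNIV"
    then show "(\<lambda>x. ncount (f x) B) \<in> borel_measurable N"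
      unfolding * by (rule measurable_compose) simp
  next
    assume "(\<lambda>x. ncount (f x) B) \<in> borel_measurable N"
    then have m: "(\<lambda>x. of_nat (card (f x \<inter> B)) :: ennreal) \<in> borel_measurable N" unfolding * .
    show "(\<lambda>x. card (f x \<inter> B)) \<in> N \<rightarrow>\<^sub>M count_space UNIV"
    proof (subst measurable_count_space_eq2_countable, safe)
      fix k :: nat
      have "(\<lambda>x. of_nat (card (f x \<inter> B)) :: ennreal) -` {of_nat k} \<inter> space N \<in> sets N"
        using m by (rule measurable_sets) simp
      then show "(\<lambda>x. card (f x \<inter> B)) -` {k} \<inter> space N \<in> sets N"
        by (simp add: vimage_def)
    qed auto
  qed
qed

text \<open>A monotone class argument for sums over a finite random set \<open>S \<omega>\<close>.
  On a rectangle the sum is an indicator times a number of points; complements are handled by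
  subtraction, legitimate because all sums are finite.\<close>

lemma measurable_sum_count_space:
  fixes f :: "'b \<times> 'c \<Rightarrow> ennreal"
  assumes fin: "\<And>\<omega>. \<omega> \<in> space P \<Longrightarrow> finite (S \<omega>) \<and> S \<omega> \<subseteq> space N"
    and card: "\<And>A. A \<in> sets N \<Longrightarrow> (\<lambda>\<omega>. card (S \<omega> \<inter> A)) \<in> P \<rightarrow>\<^sub>M count_space UNIV"
    and f: "f \<in> borel_measurable (P \<Otimes>\<^sub>M N)"
  shows "(\<lambda>\<omega>. \<integral>\<^sup>+x. f (\<omega>, x) \<partial>count_space (S \<omega>)) \<in> borel_measurable P"
proof -
  have sum: "(\<integral>\<^sup>+x. g x \<partial>count_space (S \<omega>)) = (\<Sum>x\<in>S \<omega>. g x)" if "\<omega> \<in> space P" for g :: "'c \<Rightarrow> ennreal" and \<omega>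
    using fin[OF that] by (simp add: nn_integral_count_space_finite)
  have dynkin: "(\<lambda>\<omega>. \<Sum>x\<in>S \<omega>. indicator Q (\<omega>, x) :: ennreal) \<in> borel_measurable P" if "Q \<in> sets (P \<Otimes>\<^sub>M N)" for Q
    using Int_stable_pair_measure_generator pair_measure_closed that[unfolded sets_pair_measure]
  proof (induction rule: sigma_sets_induct_disjoint)
    case (basic A)
    then obtain a b where A: "A = a \<times> b" "a \<in> sets P" "b \<in> sets N" by blast
    have m: "(\<lambda>\<omega>. of_nat (card (S \<omega> \<inter> b)) :: ennreal) \<in> borel_measurable P"
      by (rule measurable_compose[OF card[OF A(3)]]) simp
    have "(\<Sum>x\<in>S \<omega>. indicator A (\<omega>, x) :: ennreal) = indicator a \<omega> * of_nat (card (S \<omega> \<inter> b))"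
      if "\<omega> \<in> space P" for \<omega>
    proof -
      have "(\<Sum>x\<in>S \<omega>. indicator A (\<omega>, x) :: ennreal) = indicator a \<omega> * (\<Sum>x\<in>S \<omega>. indicator b x)"
        by (simp add: A(1) indicator_times sum_distrib_left)
      moreover have "(\<Sum>x\<in>S \<omega>. indicator b x :: ennreal) = of_nat (card (S \<omega> \<inter> b))"
        using fin[OF that] by (simp add: indicator_def sum.If_cases Int_def)
      ultimately show ?thesis by simp
    qed
    then show "(\<lambda>\<omega>. \<Sum>x\<in>S \<omega>. indicator A (\<omega>, x) :: ennreal) \<in> borel_measurable P"
      using A(2) m by (simp cong: measurable_cong)
  next
    case (compl A)
    have m: "(\<lambda>\<omega>. of_nat (card (S \<omega> \<inter> space N)) :: ennreal) \<in> borel_measurable P"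
      by (rule measurable_compose[OF card[OF sets.top]]) simp
    have "(\<Sum>x\<in>S \<omega>. indicator (space P \<times> space N - A) (\<omega>, x) :: ennreal) =
       of_nat (card (S \<omega> \<inter> space N)) - (\<Sum>x\<in>S \<omega>. indicator A (\<omega>, x))" if w: "\<omega> \<in> space P" for \<omega>
    proof -
      have "(\<Sum>x\<in>S \<omega>. indicator (space P \<times> space N - A) (\<omega>, x) :: ennreal) + (\<Sum>x\<in>S \<omega>. indicator A (\<omega>, x)) =
        (\<Sum>x\<in>S \<omega>. 1)"
        unfolding sum.distrib[symmetric] using fin[OF w] w by (intro sum.cong) (auto simp: indicator_def)
      also have "\<dots> = of_nat (card (S \<omega> \<inter> space N))" using fin[OF w] by (simp add: Int_absorb2[of "S \<omega>"])
      finally have e: "(\<Sum>x\<in>S \<omega>. indicator (space P \<times> space N - A) (\<omega>, x) :: ennreal) +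
        (\<Sum>x\<in>S \<omega>. indicator A (\<omega>, x)) = of_nat (card (S \<omega> \<inter> space N))" .
      have "(\<Sum>x\<in>S \<omega>. indicator A (\<omega>, x) :: ennreal) \<le> (\<Sum>x\<in>S \<omega>. 1)"
        by (intro sum_mono) (simp add: indicator_def)
      also have "\<dots> < \<top>" by (simp add: of_nat_less_top)
      finally show ?thesis
        unfolding e[symmetric] by (simp add: ennreal_add_diff_cancel_right)
    qed
    then show "(\<lambda>\<omega>. \<Sum>x\<in>S \<omega>. indicator (space P \<times> space N - A) (\<omega>, x) :: ennreal) \<in> borel_measurable P"
      using compl m by (simp cong: measurable_cong)
  next
    case (union A)
    have "(\<Sum>x\<in>S \<omega>. indicator (\<Union>i. A i) (\<omega>, x) :: ennreal) = (\<Sum>i. \<Sum>x\<in>S \<omega>. indicator (A i) (\<omega>, x))" for \<omega>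
      using union(1) by (subst suminf_sum) (auto simp: suminf_indicator)
    then show "(\<lambda>\<omega>. \<Sum>x\<in>S \<omega>. indicator (\<Union> (range A)) (\<omega>, x) :: ennreal) \<in> borel_measurable P"
      using union(3) by simp
  qed simp
  show ?thesis using f
  proof (induction rule: borel_measurable_induct)
    case (cong g h)
    have "(\<integral>\<^sup>+x. g (\<omega>, x) \<partial>count_space (S \<omega>)) = (\<integral>\<^sup>+x. h (\<omega>, x) \<partial>count_space (S \<omega>))" if "\<omega> \<in> space P" for \<omega>
      using fin[OF that] cong(3) that by (intro nn_integral_cong) (auto simp: space_pair_measure)
    then show ?case using cong by (simp cong: measurable_cong)
  next
    case (set A)
    then show ?case using dynkin[of A] by (simp add: sum cong: measurable_cong)
  next
    case (mult u c)
    then show ?case by (simp add: nn_integral_cmult)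
  next
    case (add u v)
    then show ?case by (simp add: nn_integral_add)
  next
    case (seq U)
    have "(\<integral>\<^sup>+x. Sup (range U) (\<omega>, x) \<partial>count_space (S \<omega>)) = (\<integral>\<^sup>+x. (SUP i. U i (\<omega>, x)) \<partial>count_space (S \<omega>))" for \<omega>
      by (simp add: image_image)
    moreover have "(\<integral>\<^sup>+x. (SUP i. U i (\<omega>, x)) \<partial>count_space (S \<omega>)) = (SUP i. \<integral>\<^sup>+x. U i (\<omega>, x) \<partial>count_space (S \<omega>))" for \<omega>
      by (rule nn_integral_monotone_convergence_SUP) (use seq(3) in \<open>auto simp: incseq_def le_fun_def\<close>)
    ultimately have "(\<integral>\<^sup>+x. Sup (range U) (\<omega>, x) \<partial>count_space (S \<omega>)) = (SUP i. \<integral>\<^sup>+x. U i (\<omega>, x) \<partial>count_space (S \<omega>))" for \<omega> by simp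
    then show ?case using seq by simp
  qed
qed


section \<open>Measurability of elementary operations on configurations\<close>

lemma configs_closed_discrete:
  fixes M :: "('a::t2_space, 'n::finite) riemannian"
    and x :: 'a
  assumes M: "smooth_atlas M" and \<gamma>: "\<gamma> \<in> configs"
  obtains U where "open U" "x \<in> U" "U \<inter> \<gamma> \<subseteq> {x}"
proof -
  obtain B where B: "B \<in> chart_balls M" "x \<in> B"
    using chart_balls_basis[OF M open_UNIV] by blast
  note Bo = chart_balls_open_c[OF M B(1)]
  have "finite (\<gamma> \<inter> B - {x})" using configs_finite_Int[OF \<gamma> open_c_borel_c[OF Bo(1)]] by simp
  then have "open (B - (\<gamma> \<inter> B - {x}))" using Bo(2) by (intro open_Diff finite_imp_closed)
  then show ?thesis using B(2) by (intro that[of "B - (\<gamma> \<inter> B - {x})"]) auto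
qed

lemma configs_countable:
  fixes M :: "('a::{t2_space,second_countable_topology}, 'n::finite) riemannian" and \<gamma> :: "'a set"
  assumes M: "smooth_atlas M" and \<gamma>: "\<gamma> \<in> configs"
  shows "countable \<gamma>"
proof -
  obtain W :: "nat \<Rightarrow> 'a set" where W: "exhaustion W" by (rule open_exhaustion[OF M])
  note W = exhaustionD[OF W]
  have "countable (\<Union>k. \<gamma> \<inter> W k)"
    using configs_finite_Int[OF \<gamma> open_c_borel_c[OF W(2)]] by (intro countable_UN) (auto intro: countable_finite)
  moreover have "\<gamma> = (\<Union>k. \<gamma> \<inter> W k)" using W(3) by blast
  ultimately show ?thesis by simp
qed

text \<open>Membership is reduced to countably many counts: \<open>x\<close> belongs to
  \<open>\<gamma>\<close> exactly if every basic set, cut down to some \<open>W k\<close>, that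
  contains \<open>x\<close> also contains a point of \<open>\<gamma>\<close>. The nontrivial
  direction uses a neighbourhood of \<open>x\<close> that meets \<open>\<gamma>\<close> at most in
  \<open>x\<close>.\<close>

lemma measurable_mem_config:
  fixes M :: "('a::{t2_space,second_countable_topology}, 'n::finite) riemannian"
  assumes M: "smooth_atlas M"
  shows "Measurable.pred (borel \<Otimes>\<^sub>M local_borel (UNIV :: 'a set)) (\<lambda>(x, \<gamma>). x \<in> \<gamma>)"
proof -
  obtain W :: "nat \<Rightarrow> 'a set" where W: "exhaustion W" by (rule open_exhaustion[OF M])
  note W = exhaustionD[OF W]
  obtain \<B> :: "'a set set" where B: "countable \<B>" "topological_basis \<B>"
    using ex_countable_basis by blast
  have "\<B> \<noteq> {}" using topological_basisE[OF B(2) open_UNIV UNIV_I] by blast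
  then have rng: "range (from_nat_into \<B>) = \<B>" using B(1) by (rule range_from_nat_into)
  define b where "b = from_nat_into \<B>"
  have Bb: "b n \<inter> W k \<in> borel_c" for n k
  proof -
    have "b n \<in> \<B>" using rng unfolding b_def by (metis rangeI)
    then have "b n \<in> sets borel" using topological_basis_open[OF B(2)] by (intro borel_open)
    then show ?thesis using borel_c_Int[OF open_c_borel_c[OF W(2)], of "b n" k] by (simp add: Int_commute)
  qed
  have eq: "x \<in> \<gamma> \<longleftrightarrow> (\<forall>n k. x \<in> b n \<inter> W k \<longrightarrow> card (\<gamma> \<inter> (b n \<inter> W k)) \<noteq> 0)" if \<gamma>: "\<gamma> \<in> configs" for x \<gamma>
  proof
    assume "x \<in> \<gamma>"
    then show "\<forall>n k. x \<in> b n \<inter> W k \<longrightarrow> card (\<gamma> \<inter> (b n \<inter> W k)) \<noteq> 0"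
      using configs_finite_Int[OF \<gamma> Bb] by auto
  next
    assume R: "\<forall>n k. x \<in> b n \<inter> W k \<longrightarrow> card (\<gamma> \<inter> (b n \<inter> W k)) \<noteq> 0"
    obtain U where U: "open U" "x \<in> U" "U \<inter> \<gamma> \<subseteq> {x}"
      by (rule configs_closed_discrete[OF M \<gamma>])
    obtain b' where b': "b' \<in> \<B>" "x \<in> b'" "b' \<subseteq> U" by (rule topological_basisE[OF B(2) U(1,2)])
    then obtain n where n: "b n = b'" using rng unfolding b_def by (metis imageE)
    obtain k where "x \<in> W k" using W(3) by (metis UNIV_I UN_E)
    then have "card (\<gamma> \<inter> (b n \<inter> W k)) \<noteq> 0" using R b'(2) n by blast
    then have "\<gamma> \<inter> (b n \<inter> W k) \<noteq> {}" by (metis card.empty)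
    then show "x \<in> \<gamma>" using U(3) b'(3) n by auto
  qed
  have [measurable]: "(\<lambda>p. card (snd p \<inter> (b n \<inter> W k))) \<in> borel \<Otimes>\<^sub>M local_borel (UNIV :: 'a set) \<rightarrow>\<^sub>M count_space UNIV" for n k
    by (rule measurable_compose[OF measurable_snd measurable_card_local_borel[OF Bb]]) simp
  have [measurable]: "b n \<inter> W k \<in> sets borel" for n k using Bb by (simp add: borel_c_def)
  have m: "Measurable.pred (borel \<Otimes>\<^sub>M local_borel (UNIV :: 'a set))
      (\<lambda>p. \<forall>n k. fst p \<in> b n \<inter> W k \<longrightarrow> card (snd p \<inter> (b n \<inter> W k)) \<noteq> 0)"
    by measurable
  show ?thesis
    by (rule measurable_cong[THEN iffD2, OF _ m]) (clarsimp simp only: space_pair_measure eq space_local_borel mem_Times_iff fst_conv snd_conv)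
qed

text \<open>Configurations are sets, so inserting \<open>x\<close> raises the count of
  \<open>B\<close> only if \<open>x\<close> lies in \<open>B\<close> and not already in
  \<open>\<gamma>\<close>; joint measurability of membership is therefore the essential
  input.\<close>

lemma measurable_insert_config:
  fixes M :: "('a::{t2_space,second_countable_topology}, 'n::finite) riemannian"
  assumes M: "smooth_atlas M"
  shows "(\<lambda>(x, \<gamma>). insert x \<gamma>) \<in> borel \<Otimes>\<^sub>M local_borel (UNIV :: 'a set) \<rightarrow>\<^sub>M local_borel UNIV"
proof (rule measurable_local_borelI)
  show "(case p of (x, \<gamma>) \<Rightarrow> insert x \<gamma>) \<in> configs" if "p \<in> space (borel \<Otimes>\<^sub>M local_borel (UNIV :: 'a set))" for p
    using that configs_insert by (auto simp: space_pair_measure)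
  fix B :: "'a set" assume B: "B \<in> borel_c"
  have [measurable]: "(\<lambda>p. card (snd p \<inter> B)) \<in> borel \<Otimes>\<^sub>M local_borel (UNIV :: 'a set) \<rightarrow>\<^sub>M count_space UNIV"
    by (rule measurable_compose[OF measurable_snd measurable_card_local_borel[OF B]]) simp
  have [measurable]: "Measurable.pred (borel \<Otimes>\<^sub>M local_borel (UNIV :: 'a set)) (\<lambda>p. fst p \<in> snd p)"
    using measurable_mem_config[OF M] by (simp add: case_prod_beta')
  have [measurable]: "B \<in> sets borel" using B by (simp add: borel_c_def)
  have "card ((case p of (x, \<gamma>) \<Rightarrow> insert x \<gamma>) \<inter> B) =
    (if fst p \<in> B \<and> fst p \<notin> snd p then Suc (card (snd p \<inter> B)) else card (snd p \<inter> B))"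
    if "p \<in> space (borel \<Otimes>\<^sub>M local_borel (UNIV :: 'a set))" for p
    using that configs_finite_Int[OF _ B, of "snd p"]
    by (auto simp: space_pair_measure Int_insert_left insert_absorb)
  then show "(\<lambda>p. card ((case p of (x, \<gamma>) \<Rightarrow> insert x \<gamma>) \<inter> B)) \<in> borel \<Otimes>\<^sub>M local_borel (UNIV :: 'a set) \<rightarrow>\<^sub>M count_space UNIV"
    by (rule measurable_cong[THEN iffD2]) measurable
qed

lemma measurable_union_config:
  fixes L :: "'a::t2_space set"
  assumes L: "L \<in> sets borel"
  shows "(\<lambda>(\<gamma>, \<eta>). (\<gamma> - L) \<union> (\<eta> \<inter> L)) \<in> local_borel UNIV \<Otimes>\<^sub>M local_borel UNIV \<rightarrow>\<^sub>M local_borel UNIV"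
proof (rule measurable_local_borelI)
  show "(case p of (\<gamma>, \<eta>) \<Rightarrow> (\<gamma> - L) \<union> (\<eta> \<inter> L)) \<in> configs"
    if "p \<in> space (local_borel UNIV \<Otimes>\<^sub>M local_borel (UNIV :: 'a set))" for p
    using that by (auto simp: space_pair_measure intro!: configs_Un elim: configs_subset)
  fix B :: "'a set" assume B: "B \<in> borel_c"
  have B1: "B \<inter> (- L) \<in> borel_c" "B \<inter> L \<in> borel_c"
    using L by (auto intro!: borel_c_Int[OF B])
  have [measurable]: "(\<lambda>p. card (fst p \<inter> (B \<inter> - L))) \<in> local_borel UNIV \<Otimes>\<^sub>M local_borel (UNIV :: 'a set) \<rightarrow>\<^sub>M count_space UNIV"
    by (rule measurable_compose[OF measurable_fst measurable_card_local_borel[OF B1(1)]]) simp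
  have [measurable]: "(\<lambda>p. card (snd p \<inter> (B \<inter> L))) \<in> local_borel UNIV \<Otimes>\<^sub>M local_borel (UNIV :: 'a set) \<rightarrow>\<^sub>M count_space UNIV"
    by (rule measurable_compose[OF measurable_snd measurable_card_local_borel[OF B1(2)]]) simp
  have "card ((case p of (\<gamma>, \<eta>) \<Rightarrow> (\<gamma> - L) \<union> (\<eta> \<inter> L)) \<inter> B) =
    card (fst p \<inter> (B \<inter> - L)) + card (snd p \<inter> (B \<inter> L))"
    if p: "p \<in> space (local_borel UNIV \<Otimes>\<^sub>M local_borel (UNIV :: 'a set))" for p
  proof -
    have "finite (fst p \<inter> (B \<inter> - L))" "finite (snd p \<inter> (B \<inter> L))"
      using p configs_finite_Int B1 by (auto simp: space_pair_measure)
    then have "card ((fst p \<inter> (B \<inter> - L)) \<union> (snd p \<inter> (B \<inter> L))) = card (fst p \<inter> (B \<inter> - L)) + card (snd p \<inter> (B \<inter> L))"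
      by (rule card_Un_disjoint) auto
    moreover have "(case p of (\<gamma>, \<eta>) \<Rightarrow> (\<gamma> - L) \<union> (\<eta> \<inter> L)) \<inter> B = (fst p \<inter> (B \<inter> - L)) \<union> (snd p \<inter> (B \<inter> L))"
      by (auto split: prod.splits)
    ultimately show ?thesis by simp
  qed
  then show "(\<lambda>p. card ((case p of (\<gamma>, \<eta>) \<Rightarrow> (\<gamma> - L) \<union> (\<eta> \<inter> L)) \<inter> B)) \<in>
      local_borel UNIV \<Otimes>\<^sub>M local_borel (UNIV :: 'a set) \<rightarrow>\<^sub>M count_space UNIV"
    by (rule measurable_cong[THEN iffD2]) measurable
qed

section \<open>Measurability of energies\<close>

lemma nn_integral_count_space_restrict:
  "(\<integral>\<^sup>+x. f x \<partial>count_space X) = (\<integral>\<^sup>+x. f x * indicator X x \<partial>count_space UNIV)"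
  using nn_integral_count_space_indicator[of X f] by (simp add: NO_MATCH_def)

text \<open>Double counting: a subset with \<open>k + 1\<close> points arises as
  \<open>insert x \<eta>\<close> once for each of its points.\<close>

lemma sum_insert_subsets:
  fixes g :: "'b set \<Rightarrow> ennreal"
  assumes W: "finite W"
  shows "(\<Sum>x\<in>W. \<Sum>\<eta>\<in>{\<eta>. \<eta> \<subseteq> W - {x} \<and> card \<eta> = k}. g (insert x \<eta>)) =
    of_nat (Suc k) * (\<Sum>\<eta>\<in>{\<eta>. \<eta> \<subseteq> W \<and> card \<eta> = Suc k}. g \<eta>)"
proof -
  have fin: "finite {\<eta>. \<eta> \<subseteq> W \<and> card \<eta> = Suc k}" "finite {\<eta>. \<eta> \<subseteq> W - {x} \<and> card \<eta> = k}" for x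
    using W by (auto intro: finite_subset[of _ "Pow W"])
  have sub: "finite \<eta>" if "\<eta> \<subseteq> W" for \<eta> using W that finite_subset by blast
  have "(\<Sum>x\<in>W. \<Sum>\<eta>\<in>{\<eta>. \<eta> \<subseteq> W - {x} \<and> card \<eta> = k}. g (insert x \<eta>)) =
    (\<Sum>(x, \<eta>)\<in>Sigma W (\<lambda>x. {\<eta>. \<eta> \<subseteq> W - {x} \<and> card \<eta> = k}). g (insert x \<eta>))"
    using W fin by (intro sum.Sigma) auto
  also have "\<dots> = (\<Sum>(\<eta>, x)\<in>Sigma {\<eta>. \<eta> \<subseteq> W \<and> card \<eta> = Suc k} (\<lambda>\<eta>. \<eta>). g \<eta>)"
    by (rule sum.reindex_bij_witness[of _ "\<lambda>(\<eta>, x). (x, \<eta> - {x})" "\<lambda>(x, \<eta>). (insert x \<eta>, x)"])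
      (auto simp: card_insert_if sub subset_Diff_insert intro: sub)
  also have "\<dots> = (\<Sum>\<eta>\<in>{\<eta>. \<eta> \<subseteq> W \<and> card \<eta> = Suc k}. \<Sum>x\<in>\<eta>. g \<eta>)"
    using fin sub by (intro sum.Sigma[symmetric]) auto
  also have "\<dots> = of_nat (Suc k) * (\<Sum>\<eta>\<in>{\<eta>. \<eta> \<subseteq> W \<and> card \<eta> = Suc k}. g \<eta>)"
    unfolding sum_distrib_left by (intro sum.cong refl) simp
  finally show ?thesis .
qed

text \<open>
  The sum over the subsets with \<open>k\<close> points is obtained by adding one point after another. Carrying
  the set \<open>\<eta>\<close> of points already chosen reduces measurability to that of sums over single points.
\<close>

lemma measurable_sum_subsets:
  fixes f :: "'b \<times> 'a::{t2_space,second_countable_topology} set \<Rightarrow> ennreal" and M :: "('a, 'n::finite) riemannian"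
  assumes M: "smooth_atlas M" and V: "V \<in> borel_c" and f: "f \<in> borel_measurable (N \<Otimes>\<^sub>M local_borel UNIV)"
  shows "(\<lambda>(z, \<gamma>). \<integral>\<^sup>+\<eta>. f (z, \<eta>) \<partial>count_space (Pow (\<gamma> \<inter> V))) \<in> borel_measurable (N \<Otimes>\<^sub>M local_borel UNIV)"
proof -
  let ?L = "local_borel (UNIV :: 'a set)"
  let ?P = "(N \<Otimes>\<^sub>M ?L) \<Otimes>\<^sub>M ?L"
  note fin = configs_finite_Int[OF _ V]
  define S where "S k z \<eta> \<gamma> = (\<Sum>\<eta>'\<in>{\<eta>'. \<eta>' \<subseteq> \<gamma> \<inter> V - \<eta> \<and> card \<eta>' = k}. f (z, \<eta> \<union> \<eta>'))" for k z \<eta> \<gamma>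
  have S_Suc: "S (Suc k) z \<eta> \<gamma> = inverse (of_nat (Suc k)) * (\<integral>\<^sup>+x. S k z (insert x \<eta>) \<gamma> * indicator (- \<eta>) x \<partial>count_space (\<gamma> \<inter> V))"
    if \<gamma>: "\<gamma> \<in> configs" for k z \<eta> \<gamma>
  proof -
    let ?W = "\<gamma> \<inter> V - \<eta>"
    have "(\<integral>\<^sup>+x. S k z (insert x \<eta>) \<gamma> * indicator (- \<eta>) x \<partial>count_space (\<gamma> \<inter> V)) = (\<Sum>x\<in>?W. S k z (insert x \<eta>) \<gamma>)"
      unfolding nn_integral_count_space_finite[OF fin[OF \<gamma>]]
      by (rule sum.mono_neutral_cong_right) (use fin[OF \<gamma>] in auto)
    also have "\<dots> = (\<Sum>x\<in>?W. \<Sum>\<eta>'\<in>{\<eta>'. \<eta>' \<subseteq> ?W - {x} \<and> card \<eta>' = k}. f (z, \<eta> \<union> insert x \<eta>'))"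
      unfolding S_def by (intro sum.cong) auto
    also have "\<dots> = of_nat (Suc k) * S (Suc k) z \<eta> \<gamma>"
      unfolding S_def using fin[OF \<gamma>] by (intro sum_insert_subsets) auto
    finally show ?thesis
      using ennreal_divide_self[of "of_nat (Suc k)"]
      by (simp add: divide_ennreal_def mult.assoc[symmetric] mult.commute[of "inverse _"] of_nat_less_top del: of_nat_Suc)
  qed
  have S_m: "(\<lambda>p. S k (fst (fst p)) (snd (fst p)) (snd p)) \<in> borel_measurable ?P" for k
  proof (induction k)
    case 0
    have "S 0 z \<eta> \<gamma> = f (z, \<eta>)" if "\<gamma> \<in> configs" for z \<eta> \<gamma>
    proof -
      have "{\<eta>'. \<eta>' \<subseteq> \<gamma> \<inter> V - \<eta> \<and> card \<eta>' = 0} = {{}}"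
        using fin[OF that] by (auto simp: card_eq_0_iff dest: finite_subset)
      then show ?thesis by (simp add: S_def)
    qed
    then show ?case
      using measurable_compose[OF measurable_fst f, of ?L]
      by (subst measurable_cong[of _ _ "\<lambda>p. f (fst p)"]) (auto simp: space_pair_measure)
  next
    case (Suc k)
    have ins: "(\<lambda>q. ((fst (fst (fst q)), insert (snd q) (snd (fst (fst q)))), snd (fst q))) \<in> ?P \<Otimes>\<^sub>M borel \<rightarrow>\<^sub>M ?P"
    proof -
      have "(\<lambda>q. (snd q, snd (fst (fst q)))) \<in> ?P \<Otimes>\<^sub>M borel \<rightarrow>\<^sub>M borel \<Otimes>\<^sub>M ?L" by measurable
      from measurable_compose[OF this measurable_insert_config[OF M]] show ?thesis
        by (intro measurable_Pair) (measurable, simp, measurable)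
    qed
    have mem: "Measurable.pred (?P \<Otimes>\<^sub>M borel) (\<lambda>q. snd q \<in> snd (fst (fst q)))"
    proof -
      have "(\<lambda>q. (snd q, snd (fst (fst q)))) \<in> ?P \<Otimes>\<^sub>M borel \<rightarrow>\<^sub>M borel \<Otimes>\<^sub>M ?L" by measurable
      from measurable_compose[OF this measurable_mem_config[OF M]] show ?thesis by simp
    qed
    \<comment> \<open>The sum over the added point runs over all of
      \<open>\<gamma> \<inter> V\<close>; the indicator discards points that were chosen before,
      which would not enlarge the set.\<close>
    define F where "F q = S k (fst (fst (fst q))) (insert (snd q) (snd (fst (fst q)))) (snd (fst q)) * indicator {q. snd q \<notin> snd (fst (fst q))} q" for q
    have "F \<in> borel_measurable (?P \<Otimes>\<^sub>M borel)"
      unfolding F_def[abs_def] using measurable_compose[OF ins Suc] mem by (intro borel_measurable_times_ennreal) auto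
    then have "(\<lambda>p. \<integral>\<^sup>+x. F (p, x) \<partial>count_space (snd p \<inter> V)) \<in> borel_measurable ?P"
    proof (rule measurable_sum_count_space[rotated 2])
      show "finite (snd p \<inter> V) \<and> snd p \<inter> V \<subseteq> space borel" if "p \<in> space ?P" for p
        using that fin by (auto simp: space_pair_measure)
      show "(\<lambda>p. card (snd p \<inter> V \<inter> A)) \<in> ?P \<rightarrow>\<^sub>M count_space UNIV" if "A \<in> sets borel" for A
        using measurable_compose[OF measurable_snd measurable_card_local_borel[OF borel_c_Int[OF V that] subset_UNIV]]
        by (simp add: Int_assoc)
    qed
    then have "(\<lambda>p. inverse (of_nat (Suc k)) * (\<integral>\<^sup>+x. F (p, x) \<partial>count_space (snd p \<inter> V))) \<in> borel_measurable ?P" by measurable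
    moreover have "S (Suc k) (fst (fst p)) (snd (fst p)) (snd p) = inverse (of_nat (Suc k)) * (\<integral>\<^sup>+x. F (p, x) \<partial>count_space (snd p \<inter> V))"
      if "p \<in> space ?P" for p
      using that by (subst S_Suc) (auto simp: F_def space_pair_measure indicator_def intro!: arg_cong2[where f = "(*)"] nn_integral_cong)
    ultimately show ?case by (subst measurable_cong) auto
  qed
  have eq: "(\<integral>\<^sup>+\<eta>. f (z, \<eta>) \<partial>count_space (Pow (\<gamma> \<inter> V))) = (\<Sum>k. S k z {} \<gamma>)" if \<gamma>: "\<gamma> \<in> configs" for z \<gamma>
  proof -
    have "(\<integral>\<^sup>+\<eta>. f (z, \<eta>) \<partial>count_space (Pow (\<gamma> \<inter> V))) = (\<integral>\<^sup>+\<eta>. (\<Sum>k. f (z, \<eta>) * indicator {\<eta>. card \<eta> = k} \<eta>) \<partial>count_space (Pow (\<gamma> \<inter> V)))"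
      by (intro nn_integral_cong suminf_cmult_indicator[symmetric]) (auto simp: disjoint_family_on_def)
    also have "\<dots> = (\<Sum>k. \<integral>\<^sup>+\<eta>. f (z, \<eta>) * indicator {\<eta>. card \<eta> = k} \<eta> \<partial>count_space (Pow (\<gamma> \<inter> V)))"
      by (rule nn_integral_suminf) simp
    also have "\<dots> = (\<Sum>k. S k z {} \<gamma>)"
    proof (rule arg_cong[where f = suminf], rule ext)
      fix k
      have "(\<integral>\<^sup>+\<eta>. f (z, \<eta>) * indicator {\<eta>. card \<eta> = k} \<eta> \<partial>count_space (Pow (\<gamma> \<inter> V))) =
        (\<Sum>\<eta>\<in>Pow (\<gamma> \<inter> V). f (z, \<eta>) * indicator {\<eta>. card \<eta> = k} \<eta>)"
        by (intro nn_integral_count_space_finite finite_Pow_iff[THEN iffD2] fin \<gamma>)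
      also have "\<dots> = S k z {} \<gamma>"
        unfolding S_def using fin[OF \<gamma>] by (intro sum.mono_neutral_cong_right finite_Pow_iff[THEN iffD2]) auto
      finally show "(\<integral>\<^sup>+\<eta>. f (z, \<eta>) * indicator {\<eta>. card \<eta> = k} \<eta> \<partial>count_space (Pow (\<gamma> \<inter> V))) = S k z {} \<gamma>" .
    qed
    finally show ?thesis .
  qed
  have "(\<lambda>p. ((fst p, {}), snd p)) \<in> N \<Otimes>\<^sub>M ?L \<rightarrow>\<^sub>M ?P"
    by (intro measurable_Pair measurable_fst measurable_snd measurable_const) (simp add: configs_def)
  from measurable_compose[OF this S_m] have "(\<lambda>p. \<Sum>k. S k (fst p) {} (snd p)) \<in> borel_measurable (N \<Otimes>\<^sub>M ?L)" by simp
  then show ?thesis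
    by (subst measurable_cong[of _ _ "\<lambda>p. \<Sum>k. S k (fst p) {} (snd p)"]) (auto simp: eq space_pair_measure simp del: Pow_Int_eq)
qed

text \<open>Infinite subsets contribute 0 and every finite subset lies in some \<open>W k\<close>,
  so the sum is an increasing limit of sums over subsets of \<open>\<gamma> \<inter> W k\<close>.
  The hypothesis on \<open>f\<close> concerns \<open>\<eta> \<inter> V\<close> because a potential
  is measurable only after such a restriction.\<close>

lemma measurable_sum_all_subsets:
  fixes f :: "'b \<times> 'a::{t2_space,second_countable_topology} set \<Rightarrow> ennreal" and M :: "('a, 'n::finite) riemannian"
  assumes M: "smooth_atlas M"
    and f: "\<And>V. V \<in> borel_c \<Longrightarrow> (\<lambda>(z, \<eta>). f (z, \<eta> \<inter> V)) \<in> borel_measurable (N \<Otimes>\<^sub>M local_borel UNIV)"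
    and inf: "\<And>z \<eta>. \<eta> \<in> configs \<Longrightarrow> infinite \<eta> \<Longrightarrow> f (z, \<eta>) = 0"
  shows "(\<lambda>(z, \<gamma>). \<integral>\<^sup>+\<eta>. f (z, \<eta>) \<partial>count_space (Pow \<gamma>)) \<in> borel_measurable (N \<Otimes>\<^sub>M local_borel UNIV)"
proof -
  obtain W :: "nat \<Rightarrow> 'a set" where W: "exhaustion W" by (rule open_exhaustion[OF M])
  note W = exhaustionD[OF W]
  note Wb = open_c_borel_c[OF W(2)]
  have eq: "(\<integral>\<^sup>+\<eta>. f (z, \<eta>) \<partial>count_space (Pow \<gamma>)) =
      (SUP k. \<integral>\<^sup>+\<eta>. f (z, \<eta> \<inter> W k) \<partial>count_space (Pow (\<gamma> \<inter> W k)))" if \<gamma>: "\<gamma> \<in> configs" for z \<gamma>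
  proof -
    have "(\<integral>\<^sup>+\<eta>. f (z, \<eta>) \<partial>count_space (Pow \<gamma>)) =
        (\<integral>\<^sup>+\<eta>. (SUP k. f (z, \<eta>) * indicator (Pow (\<gamma> \<inter> W k)) \<eta>) \<partial>count_space UNIV)"
      unfolding nn_integral_count_space_restrict[where X = "Pow \<gamma>"]
    proof (rule nn_integral_cong)
      fix \<eta>
      show "f (z, \<eta>) * indicator (Pow \<gamma>) \<eta> = (SUP k. f (z, \<eta>) * indicator (Pow (\<gamma> \<inter> W k)) \<eta>)"
      proof (cases "\<eta> \<subseteq> \<gamma> \<and> finite \<eta>")
        case True
        then obtain k where k: "\<eta> \<subseteq> W k" using W(4) finite_imp_compact by blast
        show ?thesis
        proof (rule antisym)
          have "f (z, \<eta>) * indicator (Pow \<gamma>) \<eta> = f (z, \<eta>) * indicator (Pow (\<gamma> \<inter> W k)) \<eta>"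
            using True k by (auto simp: indicator_def)
          also have "\<dots> \<le> (SUP k. f (z, \<eta>) * indicator (Pow (\<gamma> \<inter> W k)) \<eta>)"
            by (rule SUP_upper) simp
          finally show "f (z, \<eta>) * indicator (Pow \<gamma>) \<eta> \<le> (SUP k. f (z, \<eta>) * indicator (Pow (\<gamma> \<inter> W k)) \<eta>)" .
          show "(SUP k. f (z, \<eta>) * indicator (Pow (\<gamma> \<inter> W k)) \<eta>) \<le> f (z, \<eta>) * indicator (Pow \<gamma>) \<eta>"
            by (rule SUP_least) (auto simp: indicator_def)
        qed
      next
        case False
        then have "indicator (Pow \<gamma>) \<eta> = (0 :: ennreal) \<and> (\<forall>k. indicator (Pow (\<gamma> \<inter> W k)) \<eta> = (0 :: ennreal)) \<or> f (z, \<eta>) = 0"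
          using inf[OF configs_subset[OF \<gamma>], of \<eta> z] by (auto simp: indicator_def)
        then show ?thesis by (auto simp del: Pow_Int_eq)
      qed
    qed
    also have "\<dots> = (SUP k. \<integral>\<^sup>+\<eta>. f (z, \<eta>) * indicator (Pow (\<gamma> \<inter> W k)) \<eta> \<partial>count_space UNIV)"
      using incseqD[OF W(1)]
      by (intro nn_integral_monotone_convergence_SUP)
        (fastforce simp: incseq_def le_fun_def indicator_def split: if_splits)+
    also have "\<dots> = (SUP k. \<integral>\<^sup>+\<eta>. f (z, \<eta> \<inter> W k) \<partial>count_space (Pow (\<gamma> \<inter> W k)))"
      unfolding nn_integral_count_space_restrict[where X = "Pow (\<gamma> \<inter> W _)"]
      by (intro SUP_cong refl nn_integral_cong) (auto simp: indicator_def Int_absorb2 intro!: arg_cong[where f = "\<lambda>\<eta>. f (_, \<eta>)"])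
    finally show ?thesis .
  qed
  have "(\<lambda>p. SUP k. \<integral>\<^sup>+\<eta>. f (fst p, \<eta> \<inter> W k) \<partial>count_space (Pow (snd p \<inter> W k))) \<in> borel_measurable (N \<Otimes>\<^sub>M local_borel UNIV)"
    using measurable_sum_subsets[OF M Wb, OF f[OF Wb]] by (intro borel_measurable_SUP) (auto simp: case_prod_beta')
  then show ?thesis
    by (rule measurable_cong[THEN iffD2, rotated]) (auto simp: eq space_pair_measure)
qed

text \<open>Finiteness of the integral of \<open>|\<Phi>|\<close> for counting measure captures both
  parts of the convergence condition: finite terms and absolute summability. The sum becomes a
  difference of two nonnegative integrals, which are accessible to monotone limits;
  \<open>e2ennreal\<close> cuts off negative values.\<close>

lemma abs_sum_eq:
  assumes S: "\<And>\<eta>. \<eta> \<in> S \<Longrightarrow> \<Phi> \<eta> \<noteq> - \<infinity>"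
  shows "abs_sum \<Phi> S = (if (\<integral>\<^sup>+\<eta>. e2ennreal \<bar>\<Phi> \<eta>\<bar> \<partial>count_space S) < \<infinity>
    then ereal (enn2real (\<integral>\<^sup>+\<eta>. e2ennreal (\<Phi> \<eta>) \<partial>count_space S) - enn2real (\<integral>\<^sup>+\<eta>. e2ennreal (- \<Phi> \<eta>) \<partial>count_space S))
    else \<infinity>)"
proof (cases "\<forall>\<eta>\<in>S. \<bar>\<Phi> \<eta>\<bar> \<noteq> \<infinity>")
  case False
  then obtain \<eta> where \<eta>: "\<eta> \<in> S" "\<bar>\<Phi> \<eta>\<bar> = \<infinity>" by auto
  have "e2ennreal \<bar>\<Phi> \<eta>\<bar> \<le> (\<integral>\<^sup>+\<eta>. e2ennreal \<bar>\<Phi> \<eta>\<bar> \<partial>count_space S)"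
    by (rule nn_integral_ge_point[OF \<eta>(1)])
  then have "(\<integral>\<^sup>+\<eta>. e2ennreal \<bar>\<Phi> \<eta>\<bar> \<partial>count_space S) = \<infinity>"
    using \<eta>(2) by (simp add: top_unique)
  then show ?thesis using False by (simp add: abs_sum_def)
next
  case True
  define f where "f \<eta> = real_of_ereal (\<Phi> \<eta>)" for \<eta>
  have \<Phi>: "\<Phi> \<eta> = ereal (f \<eta>)" if "\<eta> \<in> S" for \<eta>
    using True that by (simp add: f_def ereal_real)
  have e: "(\<integral>\<^sup>+\<eta>. e2ennreal \<bar>\<Phi> \<eta>\<bar> \<partial>count_space S) = (\<integral>\<^sup>+\<eta>. ennreal (norm (f \<eta>)) \<partial>count_space S)"
    "(\<integral>\<^sup>+\<eta>. e2ennreal (\<Phi> \<eta>) \<partial>count_space S) = (\<integral>\<^sup>+\<eta>. ennreal (f \<eta>) \<partial>count_space S)"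
    "(\<integral>\<^sup>+\<eta>. e2ennreal (- \<Phi> \<eta>) \<partial>count_space S) = (\<integral>\<^sup>+\<eta>. ennreal (- f \<eta>) \<partial>count_space S)"
    by (intro nn_integral_cong; simp add: \<Phi> e2ennreal_ereal)+
  have s: "(\<lambda>\<eta>. \<bar>real_of_ereal (\<Phi> \<eta>)\<bar>) summable_on S \<longleftrightarrow> integrable (count_space S) f"
    using abs_summable_equivalent[of f S] unfolding abs_summable_on_def by (simp add: f_def)
  have i: "integrable (count_space S) f \<longleftrightarrow> (\<integral>\<^sup>+\<eta>. ennreal (norm (f \<eta>)) \<partial>count_space S) < \<infinity>"
    by (simp add: integrable_iff_bounded)
  show ?thesis
  proof (cases "integrable (count_space S) f")
    case int: True
    have "infsum f S = infsetsum f S"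
      using int abs_summable_equivalent[of f S] by (intro infsetsum_infsum[symmetric]) (simp add: abs_summable_on_def)
    also have "\<dots> = enn2real (\<integral>\<^sup>+\<eta>. ennreal (f \<eta>) \<partial>count_space S) - enn2real (\<integral>\<^sup>+\<eta>. ennreal (- f \<eta>) \<partial>count_space S)"
      unfolding infsetsum_def by (rule real_lebesgue_integral_def[OF int])
    finally show ?thesis
      using True int i s unfolding abs_sum_def e f_def[symmetric] by simp
  next
    case False
    then show ?thesis using i s unfolding abs_sum_def e f_def[symmetric] by simp
  qed
qed

lemma exp_neg_abs_sum:
  assumes S: "\<And>\<eta>. \<eta> \<in> S \<Longrightarrow> \<Phi> \<eta> \<noteq> - \<infinity>"
  shows "exp_neg (abs_sum \<Phi> S) = (if (\<integral>\<^sup>+\<eta>. e2ennreal \<bar>\<Phi> \<eta>\<bar> \<partial>count_space S) < \<infinity>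
    then exp (enn2real (\<integral>\<^sup>+\<eta>. e2ennreal (- \<Phi> \<eta>) \<partial>count_space S) - enn2real (\<integral>\<^sup>+\<eta>. e2ennreal (\<Phi> \<eta>) \<partial>count_space S))
    else 0)"
  using abs_sum_eq[of S \<Phi>] S by (simp add: exp_neg_def)

text \<open>The union converges absolutely if and only if both parts do. If either diverges, both
  sides are 0 by the convention for \<open>exp_neg\<close>, so no convergence is assumed.\<close>

lemma exp_neg_abs_sum_Un:
  assumes "S \<inter> T = {}"
  shows "exp_neg (abs_sum \<Phi> (S \<union> T)) = exp_neg (abs_sum \<Phi> S) * exp_neg (abs_sum \<Phi> T)"
proof -
  define f where "f \<eta> = real_of_ereal (\<Phi> \<eta>)" for \<eta>
  define ok where "ok S \<longleftrightarrow> (\<forall>\<eta>\<in>S. \<bar>\<Phi> \<eta>\<bar> \<noteq> \<infinity>) \<and> (\<lambda>\<eta>. \<bar>f \<eta>\<bar>) summable_on S" for S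
  have e: "exp_neg (abs_sum \<Phi> S) = (if ok S then exp (- infsum f S) else 0)" for S
    unfolding exp_neg_def abs_sum_def ok_def f_def[abs_def] by simp
  have "ok (S \<union> T) \<longleftrightarrow> ok S \<and> ok T"
  proof
    assume "ok (S \<union> T)"
    then show "ok S \<and> ok T"
      using summable_on_subset_banach[of "\<lambda>\<eta>. \<bar>f \<eta>\<bar>" "S \<union> T" S]
        summable_on_subset_banach[of "\<lambda>\<eta>. \<bar>f \<eta>\<bar>" "S \<union> T" T] unfolding ok_def by simp
  next
    assume "ok S \<and> ok T"
    then show "ok (S \<union> T)"
      using summable_on_Un_disjoint[OF _ _ assms, of "\<lambda>\<eta>. \<bar>f \<eta>\<bar>"] unfolding ok_def by auto
  qed
  moreover have "infsum f (S \<union> T) = infsum f S + infsum f T" if "ok S" "ok T"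
    using that abs_summable_summable[of f S] abs_summable_summable[of f T] unfolding ok_def
    by (intro infsum_Un_disjoint assms) simp_all
  ultimately show ?thesis unfolding e by (auto simp: mult_exp_exp)
qed

lemma exp_neg_nonneg: "0 \<le> exp_neg e"
  by (simp add: exp_neg_def)

text \<open>The subsets of \<open>\<gamma> + x\<close> that meet \<open>\<Lambda>\<close> are split
  according to whether they contain \<open>x\<close>; those which do meet \<open>\<Lambda>\<close>
  automatically, as \<open>x \<in> \<Lambda>\<close>. This factorisation turns the Mecke identity
  into the one for Gibbs measures.\<close>

lemma exp_neg_energy_insert:
  assumes "x \<in> \<Lambda>" "x \<notin> \<gamma>"
  shows "exp_neg (energy \<Phi> \<Lambda> (insert x \<gamma>)) = exp_neg (energy \<Phi> \<Lambda> \<gamma>) * exp_neg (point_energy \<Phi> x \<gamma>)"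
proof -
  have "{\<eta>. \<eta> \<subseteq> insert x \<gamma> \<and> \<eta> \<inter> \<Lambda> \<noteq> {}} = {\<eta>. \<eta> \<subseteq> \<gamma> \<and> \<eta> \<inter> \<Lambda> \<noteq> {}} \<union> {\<eta>. {x} \<subseteq> \<eta> \<and> \<eta> \<subseteq> \<gamma> \<union> {x}}"
    using assms by auto
  moreover have "{\<eta>. \<eta> \<subseteq> \<gamma> \<and> \<eta> \<inter> \<Lambda> \<noteq> {}} \<inter> {\<eta>. {x} \<subseteq> \<eta> \<and> \<eta> \<subseteq> \<gamma> \<union> {x}} = {}"
    using assms by auto
  ultimately show ?thesis
    unfolding energy_def point_energy_def using exp_neg_abs_sum_Un[of _ _ \<Phi>] by simp
qed

lemma potential_local_measurable:
  fixes V :: "'a::t2_space set"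
  assumes "potential \<Phi>" "V \<in> borel_c"
  shows "(\<lambda>\<eta>. \<Phi> (\<eta> \<inter> V)) \<in> borel_measurable (local_borel UNIV)"
proof -
  have "(\<lambda>\<eta>. \<eta>) \<in> local_borel UNIV \<rightarrow>\<^sub>M local_borel V"
    by (rule measurable_local_borelI) (auto intro: measurable_card_local_borel)
  then show ?thesis
    using assms measurable_compose[of "\<lambda>\<eta>. \<eta>" "local_borel UNIV" "local_borel V"] unfolding potential_def by blast
qed

text \<open>The predicate \<open>P\<close> selects the subsets in the energy: those meeting
  \<open>\<Lambda>\<close>, or those containing the parameter \<open>z\<close>. Three integrals are
  needed, for the absolute value, the positive and the negative part; in each the function
  \<open>h\<close> vanishes at 0, so that infinite subsets drop out.\<close>

lemma measurable_exp_neg_abs_sum: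
  fixes M :: "('a::{t2_space,second_countable_topology}, 'n::finite) riemannian"
  assumes M: "smooth_atlas M" and \<Phi>: "potential \<Phi>"
    and P: "\<And>V. V \<in> borel_c \<Longrightarrow> Measurable.pred (N \<Otimes>\<^sub>M local_borel (UNIV :: 'a set)) (\<lambda>(z, \<eta>). P z (\<eta> \<inter> V))"
  shows "(\<lambda>(z, \<gamma>). exp_neg (abs_sum \<Phi> {\<eta>. \<eta> \<subseteq> \<gamma> \<and> P z \<eta>})) \<in> borel_measurable (N \<Otimes>\<^sub>M local_borel UNIV)"
proof -
  have c: "(\<integral>\<^sup>+\<eta>. h (\<Phi> \<eta>) \<partial>count_space {\<eta>. \<eta> \<subseteq> \<gamma> \<and> P z \<eta>}) =
      (\<integral>\<^sup>+\<eta>. (\<lambda>(z, \<eta>). h (\<Phi> \<eta>) * indicator {\<eta>. P z \<eta>} \<eta>) (z, \<eta>) \<partial>count_space (Pow \<gamma>))" for h z \<gamma>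
    unfolding nn_integral_count_space_restrict[where X = "Pow \<gamma>"]
      nn_integral_count_space_restrict[where X = "{\<eta>. \<eta> \<subseteq> \<gamma> \<and> P z \<eta>}"]
    by (intro nn_integral_cong) (auto simp: indicator_def)
  have [measurable]: "(\<lambda>(z, \<gamma>). \<integral>\<^sup>+\<eta>. h (\<Phi> \<eta>) \<partial>count_space {\<eta>. \<eta> \<subseteq> \<gamma> \<and> P z \<eta>}) \<in> borel_measurable (N \<Otimes>\<^sub>M local_borel UNIV)"
    if h[measurable]: "h \<in> borel_measurable borel" and h0: "h 0 = 0" for h :: "ereal \<Rightarrow> ennreal"
    unfolding c
  proof (rule measurable_sum_all_subsets[OF M])
    fix V :: "'a set" assume V: "V \<in> borel_c"
    note [measurable] = potential_local_measurable[OF \<Phi> V] P[OF V]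
    show "(\<lambda>(z, \<eta>). (\<lambda>(z, \<eta>). h (\<Phi> \<eta>) * indicator {\<eta>. P z \<eta>} \<eta>) (z, \<eta> \<inter> V)) \<in> borel_measurable (N \<Otimes>\<^sub>M local_borel UNIV)"
      by (simp add: indicator_def of_bool_def[symmetric] case_prod_beta') measurable
  next
    fix z :: 'b and \<eta> :: "'a set" assume "\<eta> \<in> configs" "infinite \<eta>"
    then show "(\<lambda>(z, \<eta>). h (\<Phi> \<eta>) * indicator {\<eta>. P z \<eta>} \<eta>) (z, \<eta>) = 0"
      using \<Phi> h0 unfolding potential_def by simp
  qed
  have nm: "\<Phi> \<eta> \<noteq> - \<infinity>" if "\<gamma> \<in> configs" "\<eta> \<subseteq> \<gamma>" for \<gamma> \<eta>
    using \<Phi> configs_subset[OF that] unfolding potential_def by blast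
  define I where "I h = (\<lambda>(z, \<gamma>). \<integral>\<^sup>+\<eta>. h (\<Phi> \<eta>) \<partial>count_space {\<eta>. \<eta> \<subseteq> \<gamma> \<and> P z \<eta>})" for h :: "ereal \<Rightarrow> ennreal"
  have [measurable]: "I h \<in> borel_measurable (N \<Otimes>\<^sub>M local_borel UNIV)"
    if h: "h \<in> borel_measurable borel" and h0: "h 0 = 0" for h :: "ereal \<Rightarrow> ennreal"
    unfolding I_def using that by measurable
  have m: "I (\<lambda>e. e2ennreal \<bar>e\<bar>) \<in> borel_measurable (N \<Otimes>\<^sub>M local_borel UNIV)"
     "I (\<lambda>e. e2ennreal e) \<in> borel_measurable (N \<Otimes>\<^sub>M local_borel UNIV)"
     "I (\<lambda>e. e2ennreal (- e)) \<in> borel_measurable (N \<Otimes>\<^sub>M local_borel UNIV)"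
    by measurable
  have e: "exp_neg (abs_sum \<Phi> {\<eta>. \<eta> \<subseteq> \<gamma> \<and> P z \<eta>}) =
      (if (\<integral>\<^sup>+\<eta>. e2ennreal \<bar>\<Phi> \<eta>\<bar> \<partial>count_space {\<eta>. \<eta> \<subseteq> \<gamma> \<and> P z \<eta>}) < \<infinity>
       then exp (enn2real (\<integral>\<^sup>+\<eta>. e2ennreal (- \<Phi> \<eta>) \<partial>count_space {\<eta>. \<eta> \<subseteq> \<gamma> \<and> P z \<eta>}) -
         enn2real (\<integral>\<^sup>+\<eta>. e2ennreal (\<Phi> \<eta>) \<partial>count_space {\<eta>. \<eta> \<subseteq> \<gamma> \<and> P z \<eta>}))
       else 0)" if "\<gamma> \<in> configs" for z \<gamma>
    by (rule exp_neg_abs_sum) (use nm[OF that] in auto)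
  have "(\<lambda>p. if I (\<lambda>e. e2ennreal \<bar>e\<bar>) p < \<infinity> then
     exp (enn2real (I (\<lambda>e. e2ennreal (- e)) p) - enn2real (I (\<lambda>e. e2ennreal e) p)) else 0)
     \<in> borel_measurable (N \<Otimes>\<^sub>M local_borel UNIV)"
    using m by measurable
  then show ?thesis
    by (rule measurable_cong[THEN iffD2, rotated])
      (auto simp: space_pair_measure I_def e)
qed

lemma measurable_energy:
  fixes M :: "('a::{t2_space,second_countable_topology}, 'n::finite) riemannian" and \<Lambda> :: "'a set"
  assumes M: "smooth_atlas M" and \<Phi>: "potential \<Phi>" and L: "\<Lambda> \<in> borel_c"
  shows "(\<lambda>\<gamma>. exp_neg (energy \<Phi> \<Lambda> \<gamma>)) \<in> borel_measurable (local_borel UNIV)"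
proof -
  have "Measurable.pred (count_space UNIV \<Otimes>\<^sub>M local_borel (UNIV :: 'a set)) (\<lambda>(z :: unit, \<eta>). (\<eta> \<inter> V) \<inter> \<Lambda> \<noteq> {})"
    if V: "V \<in> borel_c" for V :: "'a set"
  proof -
    have b: "V \<inter> \<Lambda> \<in> borel_c" using borel_c_Int[OF V, of \<Lambda>] L by (simp add: borel_c_def)
    have [measurable]: "(\<lambda>p. card (snd p \<inter> (V \<inter> \<Lambda>))) \<in> count_space (UNIV :: unit set) \<Otimes>\<^sub>M local_borel (UNIV :: 'a set) \<rightarrow>\<^sub>M count_space UNIV"
      by (rule measurable_compose[OF measurable_snd measurable_card_local_borel[OF b]]) simp
    have "Measurable.pred (count_space (UNIV :: unit set) \<Otimes>\<^sub>M local_borel (UNIV :: 'a set)) (\<lambda>p. card (snd p \<inter> (V \<inter> \<Lambda>)) \<noteq> 0)"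
      by measurable
    then show ?thesis
      by (rule measurable_cong[THEN iffD2, rotated])
        (use configs_finite_Int[OF _ b] in \<open>auto simp: space_pair_measure Int_assoc\<close>)
  qed
  from measurable_exp_neg_abs_sum[OF M \<Phi>, where P = "\<lambda>_ \<eta>. \<eta> \<inter> \<Lambda> \<noteq> {}", OF this]
  have "(\<lambda>(z :: unit, \<gamma>). exp_neg (energy \<Phi> \<Lambda> \<gamma>)) \<in> borel_measurable (count_space UNIV \<Otimes>\<^sub>M local_borel UNIV)"
    by (simp add: energy_def)
  then have "(\<lambda>\<gamma>. (\<lambda>(z :: unit, \<gamma>). exp_neg (energy \<Phi> \<Lambda> \<gamma>)) ((), \<gamma>)) \<in> borel_measurable (local_borel UNIV)"
    by (rule measurable_compose[rotated]) simp
  then show ?thesis by simp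
qed

lemma measurable_point_energy:
  fixes M :: "('a::{t2_space,second_countable_topology}, 'n::finite) riemannian"
  assumes M: "smooth_atlas M" and \<Phi>: "potential \<Phi>"
  shows "(\<lambda>(x, \<gamma>). exp_neg (point_energy \<Phi> x \<gamma>)) \<in> borel_measurable (borel \<Otimes>\<^sub>M local_borel (UNIV :: 'a set))"
proof -
  have "Measurable.pred (borel \<Otimes>\<^sub>M local_borel (UNIV :: 'a set)) (\<lambda>(x, \<eta>). x \<in> \<eta> \<inter> V)"
    if "V \<in> borel_c" for V :: "'a set"
  proof -
    have [measurable]: "V \<in> sets borel" using that by (simp add: borel_c_def)
    have [measurable]: "Measurable.pred (borel \<Otimes>\<^sub>M local_borel (UNIV :: 'a set)) (\<lambda>p. fst p \<in> snd p)"
      using measurable_mem_config[OF M] by (simp add: case_prod_beta')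
    have "Measurable.pred (borel \<Otimes>\<^sub>M local_borel (UNIV :: 'a set)) (\<lambda>p. fst p \<in> snd p \<and> fst p \<in> V)" by measurable
    then show ?thesis by (simp add: case_prod_beta')
  qed
  from measurable_exp_neg_abs_sum[OF M \<Phi>, where P = "\<lambda>x \<eta>. x \<in> \<eta>", OF this]
  have m: "(\<lambda>(x, \<gamma>). exp_neg (abs_sum \<Phi> {\<eta>. \<eta> \<subseteq> \<gamma> \<and> x \<in> \<eta>})) \<in> borel_measurable (borel \<Otimes>\<^sub>M local_borel (UNIV :: 'a set))" .
  \<comment> \<open>The point energy sums over subsets of \<open>\<gamma> \<union> {x}\<close>, so
    the measurable sum is evaluated at the configuration with \<open>x\<close> inserted.\<close>
  have "(\<lambda>p. (fst p, insert (fst p) (snd p))) \<in> borel \<Otimes>\<^sub>M local_borel (UNIV :: 'a set) \<rightarrow>\<^sub>M borel \<Otimes>\<^sub>M local_borel (UNIV :: 'a set)"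
    using measurable_insert_config[OF M] by (intro measurable_Pair) (auto simp: case_prod_beta')
  from measurable_compose[OF this m] show ?thesis
    by (simp add: point_energy_def case_prod_beta' conj_commute)
qed

section \<open>Pairings with test functions\<close>

lemma pairing_eq_sum:
  assumes "\<gamma> \<in> configs" "V \<in> borel_c" "\<And>x. x \<notin> V \<Longrightarrow> f x = 0"
  shows "pairing f \<gamma> = (\<Sum>x\<in>\<gamma> \<inter> V. f x)"
proof -
  have "pairing f \<gamma> = infsum f (\<gamma> \<inter> V)"
    unfolding pairing_def by (rule infsum_cong_neutral) (use assms(3) in auto)
  then show ?thesis using configs_finite_Int[OF assms(1,2)] by simp
qed

lemma C0_inf_support:
  fixes M :: "('a::{t2_space,second_countable_topology}, 'n::finite) riemannian"
  assumes "smooth_atlas M" "f \<in> C0_inf M"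
  obtains V where "V \<in> open_c" "\<And>x. x \<notin> V \<Longrightarrow> f x = 0"
proof -
  obtain K where K: "compact K" "\<And>x. x \<notin> K \<Longrightarrow> f x = 0"
    using assms(2) by (auto simp: C0_inf_def elim: compact_supportE)
  obtain W :: "nat \<Rightarrow> 'a set" where W: "exhaustion W" by (rule open_exhaustion[OF assms(1)])
  note W = exhaustionD[OF W]
  obtain k where "K \<subseteq> W k" using W(4)[OF K(1)] by blast
  then show thesis using K(2) W(2) by (intro that[of "W k"]) auto
qed

lemma pairing_add:
  fixes M :: "('a::{t2_space,second_countable_topology}, 'n::finite) riemannian"
  assumes M: "smooth_atlas M" and "f \<in> C0_inf M" "g \<in> C0_inf M" "\<gamma> \<in> configs"
  shows "pairing (\<lambda>x. f x + g x) \<gamma> = pairing f \<gamma> + pairing g \<gamma>"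
proof -
  obtain V where V: "V \<in> open_c" "\<And>x. x \<notin> V \<Longrightarrow> f x = 0" by (rule C0_inf_support[OF M assms(2)]) (rule that; assumption)
  obtain V' where V': "V' \<in> open_c" "\<And>x. x \<notin> V' \<Longrightarrow> g x = 0" by (rule C0_inf_support[OF M assms(3)]) (rule that; assumption)
  have b: "V \<union> V' \<in> borel_c" using V(1) V'(1) by (auto simp: open_c_def borel_c_def compact_Un)
  show ?thesis
    using V(2) V'(2) pairing_eq_sum[OF assms(4) b, of f] pairing_eq_sum[OF assms(4) b, of g]
      pairing_eq_sum[OF assms(4) b, of "\<lambda>x. f x + g x"] by (simp add: sum.distrib)
qed

lemma pairing_cmult: "pairing (\<lambda>x. a * f x) \<gamma> = a * pairing f \<gamma>" for a :: real
  unfolding pairing_def by (rule infsum_cmult_right')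

lemma pairing_nonneg: "(\<And>x. 0 \<le> f x) \<Longrightarrow> 0 \<le> pairing f \<gamma>"
  unfolding pairing_def by (rule infsum_nonneg)

lemma pairing_insert:
  fixes M :: "('a::{t2_space,second_countable_topology}, 'n::finite) riemannian"
  assumes M: "smooth_atlas M" and f: "f \<in> C0_inf M" and "\<gamma> \<in> configs" "x \<notin> \<gamma>"
  shows "pairing f (insert x \<gamma>) = f x + pairing f \<gamma>"
proof -
  obtain V where V: "V \<in> open_c" "\<And>x. x \<notin> V \<Longrightarrow> f x = 0" by (rule C0_inf_support[OF M f]) (rule that; assumption)
  note b = open_c_borel_c[OF V(1)]
  have "pairing f (insert x \<gamma>) = (\<Sum>y\<in>insert x \<gamma> \<inter> V. f y)"
    by (rule pairing_eq_sum[OF configs_insert[OF assms(3)] b V(2)])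
  also have "\<dots> = f x + (\<Sum>y\<in>\<gamma> \<inter> V. f y)"
    using V(2)[of x] assms(4) configs_finite_Int[OF assms(3) b] by (cases "x \<in> V") (auto simp: Int_insert_left)
  finally show ?thesis using pairing_eq_sum[OF assms(3) b V(2)] by simp
qed

lemma ennreal_pairing:
  fixes M :: "('a::{t2_space,second_countable_topology}, 'n::finite) riemannian"
  assumes M: "smooth_atlas M" and f: "f \<in> C0_inf M" "\<And>x. 0 \<le> f x" and "\<gamma> \<in> configs"
  shows "ennreal (pairing f \<gamma>) = (\<integral>\<^sup>+x. ennreal (f x) \<partial>count_space \<gamma>)"
proof -
  obtain V where V: "V \<in> open_c" "\<And>x. x \<notin> V \<Longrightarrow> f x = 0" by (rule C0_inf_support[OF M f(1)]) (rule that; assumption)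
  note b = open_c_borel_c[OF V(1)]
  have "(\<integral>\<^sup>+x. ennreal (f x) \<partial>count_space \<gamma>) = (\<integral>\<^sup>+x. ennreal (f x) \<partial>count_space (\<gamma> \<inter> V))"
    unfolding nn_integral_count_space_restrict[where X = \<gamma>] nn_integral_count_space_restrict[where X = "\<gamma> \<inter> V"]
    using V(2) by (intro nn_integral_cong) (auto simp: indicator_def)
  also have "\<dots> = (\<Sum>x\<in>\<gamma> \<inter> V. ennreal (f x))"
    using configs_finite_Int[OF assms(4) b] by (simp add: nn_integral_count_space_finite)
  also have "\<dots> = ennreal (pairing f \<gamma>)"
    using f(2) pairing_eq_sum[OF assms(4) b V(2)] by (simp add: sum_ennreal)
  finally show ?thesis by simp
qed

lemma measurable_sum_points:
  fixes f :: "'a::{t2_space,second_countable_topology} \<times> 'a set \<Rightarrow> ennreal" and M :: "('a, 'n::finite) riemannian"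
  assumes M: "smooth_atlas M" and f: "f \<in> borel_measurable (borel \<Otimes>\<^sub>M local_borel UNIV)"
  shows "(\<lambda>\<gamma>. \<integral>\<^sup>+x. f (x, \<gamma>) \<partial>count_space \<gamma>) \<in> borel_measurable (local_borel UNIV)"
proof -
  obtain W :: "nat \<Rightarrow> 'a set" where W: "exhaustion W" by (rule open_exhaustion[OF M])
  note W = exhaustionD[OF W]
  note Wb = open_c_borel_c[OF W(2)]
  have fin: "finite (\<gamma> \<inter> W k) \<and> \<gamma> \<inter> W k \<subseteq> space borel" if "\<gamma> \<in> space (local_borel UNIV)" for \<gamma> k
    using configs_finite_Int[OF _ Wb] that by simp
  have c: "(\<lambda>\<gamma>. card (\<gamma> \<inter> W k \<inter> A)) \<in> local_borel UNIV \<rightarrow>\<^sub>M count_space UNIV" if "A \<in> sets borel" for A k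
    using measurable_card_local_borel[OF borel_c_Int[OF Wb that]] by (simp add: Int_assoc)
  have sw: "(\<lambda>(\<gamma>, x). f (x, \<gamma>)) \<in> borel_measurable (local_borel UNIV \<Otimes>\<^sub>M borel)"
    using f by measurable
  have m: "(\<lambda>\<gamma>. \<integral>\<^sup>+x. (\<lambda>(\<gamma>, x). f (x, \<gamma>)) (\<gamma>, x) \<partial>count_space (\<gamma> \<inter> W k)) \<in> borel_measurable (local_borel UNIV)" for k
    by (rule measurable_sum_count_space[OF fin c sw])
  have eq: "(\<integral>\<^sup>+x. f (x, \<gamma>) \<partial>count_space \<gamma>) = (SUP k. \<integral>\<^sup>+x. f (x, \<gamma>) \<partial>count_space (\<gamma> \<inter> W k))" for \<gamma>
  proof -
    have "(SUP k. f (x, \<gamma>) * indicator (\<gamma> \<inter> W k) x) = f (x, \<gamma>) * indicator \<gamma> x" for x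
    proof (rule antisym)
      show "(SUP k. f (x, \<gamma>) * indicator (\<gamma> \<inter> W k) x) \<le> f (x, \<gamma>) * indicator \<gamma> x"
        by (rule SUP_least) (auto simp: indicator_def)
      obtain k where "x \<in> W k" using W(3) by (metis UNIV_I UN_E)
      then have "f (x, \<gamma>) * indicator \<gamma> x = f (x, \<gamma>) * indicator (\<gamma> \<inter> W k) x" by (auto simp: indicator_def)
      also have "\<dots> \<le> (SUP k. f (x, \<gamma>) * indicator (\<gamma> \<inter> W k) x)" by (rule SUP_upper) simp
      finally show "f (x, \<gamma>) * indicator \<gamma> x \<le> (SUP k. f (x, \<gamma>) * indicator (\<gamma> \<inter> W k) x)" .
    qed
    then have "(\<integral>\<^sup>+x. f (x, \<gamma>) \<partial>count_space \<gamma>) = (\<integral>\<^sup>+x. (SUP k. f (x, \<gamma>) * indicator (\<gamma> \<inter> W k) x) \<partial>count_space UNIV)"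
      unfolding nn_integral_count_space_restrict[where X = \<gamma>] by simp
    also have "\<dots> = (SUP k. \<integral>\<^sup>+x. f (x, \<gamma>) * indicator (\<gamma> \<inter> W k) x \<partial>count_space UNIV)"
    proof (rule nn_integral_monotone_convergence_SUP)
      show "incseq (\<lambda>k x. f (x, \<gamma>) * indicator (\<gamma> \<inter> W k) x)"
        using W(1) unfolding incseq_def le_fun_def by (auto simp: indicator_def)
    qed simp
    finally show ?thesis unfolding nn_integral_count_space_restrict[where X = "\<gamma> \<inter> W _"] .
  qed
  show ?thesis unfolding eq using m by (intro borel_measurable_SUP) auto
qed

lemma measurable_pairing_local_borel:
  fixes M :: "('a::{t2_space,second_countable_topology}, 'n::finite) riemannian"
  assumes M: "smooth_atlas M" and f: "f \<in> C0_inf M"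
  shows "pairing f \<in> borel_measurable (local_borel UNIV)"
proof -
  obtain V where V: "V \<in> open_c" "\<And>x. x \<notin> V \<Longrightarrow> f x = 0" by (rule C0_inf_support[OF M f]) (rule that; assumption)
  note b = open_c_borel_c[OF V(1)]
  have [measurable]: "f \<in> borel_measurable borel"
    using C0_inf_continuous[OF M f] by (rule borel_measurable_continuous_onI)
  have m: "(\<lambda>\<gamma>. \<integral>\<^sup>+x. (\<lambda>(x, \<gamma>). ennreal (g x)) (x, \<gamma>) \<partial>count_space \<gamma>) \<in> borel_measurable (local_borel UNIV)"
    if [measurable]: "g \<in> borel_measurable borel" for g :: "'a \<Rightarrow> real"
    by (rule measurable_sum_points[OF M]) measurable
  have s: "(\<integral>\<^sup>+x. ennreal (g x) \<partial>count_space \<gamma>) = (\<Sum>x\<in>\<gamma> \<inter> V. ennreal (g x))"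
    if "\<gamma> \<in> configs" "\<And>x. x \<notin> V \<Longrightarrow> g x = 0" for \<gamma> and g :: "'a \<Rightarrow> real"
  proof -
    have "(\<integral>\<^sup>+x. ennreal (g x) \<partial>count_space \<gamma>) = (\<integral>\<^sup>+x. ennreal (g x) \<partial>count_space (\<gamma> \<inter> V))"
      unfolding nn_integral_count_space_restrict[where X = \<gamma>] nn_integral_count_space_restrict[where X = "\<gamma> \<inter> V"]
      using that(2) by (intro nn_integral_cong) (auto simp: indicator_def)
    then show ?thesis
      using configs_finite_Int[OF that(1) b] by (simp add: nn_integral_count_space_finite)
  qed
  have "pairing f \<gamma> = enn2real (\<integral>\<^sup>+x. ennreal (max 0 (f x)) \<partial>count_space \<gamma>) - enn2real (\<integral>\<^sup>+x. ennreal (max 0 (- f x)) \<partial>count_space \<gamma>)"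
    if "\<gamma> \<in> configs" for \<gamma>
  proof -
    have 1: "enn2real (\<integral>\<^sup>+x. ennreal (max 0 (g x)) \<partial>count_space \<gamma>) = (\<Sum>x\<in>\<gamma> \<inter> V. max 0 (g x))"
      if "\<And>x. x \<notin> V \<Longrightarrow> g x = 0" for g :: "'a \<Rightarrow> real"
    proof -
      have "(\<Sum>x\<in>\<gamma> \<inter> V. ennreal (max 0 (g x))) = ennreal (\<Sum>x\<in>\<gamma> \<inter> V. max 0 (g x))"
        by (rule sum_ennreal) simp
      then show ?thesis
        using s[OF \<open>\<gamma> \<in> configs\<close>, of "\<lambda>x. max 0 (g x)"] that by (simp add: sum_nonneg)
    qed
    have "pairing f \<gamma> = (\<Sum>x\<in>\<gamma> \<inter> V. f x)"
      by (rule pairing_eq_sum[OF that b]) (rule V(2))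
    also have "\<dots> = (\<Sum>x\<in>\<gamma> \<inter> V. max 0 (f x) - max 0 (- f x))"
      by (intro sum.cong) (auto simp: max_def)
    finally show ?thesis
      using 1[of f] 1[of "\<lambda>x. - f x"] V(2) by (simp add: sum_subtractf)
  qed
  note eq = this
  have "(\<lambda>\<gamma>. enn2real (\<integral>\<^sup>+x. ennreal (max 0 (f x)) \<partial>count_space \<gamma>) -
      enn2real (\<integral>\<^sup>+x. ennreal (max 0 (- f x)) \<partial>count_space \<gamma>)) \<in> borel_measurable (local_borel UNIV)"
    using m[of "\<lambda>x. max 0 (f x)"] m[of "\<lambda>x. max 0 (- f x)"] by simp
  then show ?thesis
    by (rule measurable_cong[THEN iffD2, rotated]) (simp add: eq)
qed

text \<open>Chart balls need not be closed under intersection, whereas this larger class is: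
  products of bumps are bumps for the intersection. It is an intersection-stable generator of the
  Borel sets on which counts are limits of pairings.\<close>

definition bump_open :: "('a::topological_space, 'n::finite) riemannian \<Rightarrow> 'a set set" where
  "bump_open M = {U \<in> open_c. \<exists>u::nat \<Rightarrow> 'a \<Rightarrow> real. \<forall>k x. u k \<in> C0_inf M \<and> 0 \<le> u k x \<and> u k x \<le> 1 \<and>
     (x \<notin> U \<longrightarrow> u k x = 0) \<and> (\<lambda>k. u k x) \<longlonglongrightarrow> indicator U x}"

lemma chart_balls_bump_open:
  fixes M :: "('a::t2_space, 'n::finite) riemannian"
  assumes "smooth_atlas M" "B \<in> chart_balls M"
  shows "B \<in> bump_open M"
proof -
  obtain f where f: "\<And>k. f k \<in> C0_inf M" "\<And>k x. 0 \<le> f k x" "\<And>k x. f k x \<le> 1"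
    "\<And>k x. x \<notin> B \<Longrightarrow> f k x = 0" "\<And>x. (\<lambda>k::nat. f k x) \<longlonglongrightarrow> indicator B x"
    by (rule chart_ball_bump[OF assms]) (rule that; assumption)
  then show ?thesis
    unfolding bump_open_def using chart_balls_open_c(1)[OF assms] by (intro CollectI conjI exI[of _ f]) auto
qed

lemma Int_stable_bump_open:
  fixes M :: "('a::t2_space, 'n::finite) riemannian"
  assumes M: "smooth_atlas M"
  shows "Int_stable (bump_open M)"
proof (rule Int_stableI)
  fix U V assume U: "U \<in> bump_open M" and V: "V \<in> bump_open M"
  obtain u where u: "\<And>k x. u k \<in> C0_inf M \<and> 0 \<le> u k x \<and> u k x \<le> 1 \<and> (x \<notin> U \<longrightarrow> u k x = 0) \<and> (\<lambda>k::nat. u k x) \<longlonglongrightarrow> indicator U x"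
    using U unfolding bump_open_def by blast
  obtain v where v: "\<And>k x. v k \<in> C0_inf M \<and> 0 \<le> v k x \<and> v k x \<le> 1 \<and> (x \<notin> V \<longrightarrow> v k x = 0) \<and> (\<lambda>k::nat. v k x) \<longlonglongrightarrow> indicator V x"
    using V unfolding bump_open_def by blast
  have "open U" "open V" "U \<in> open_c" using U V by (auto simp: bump_open_def open_c_def)
  then have "U \<inter> V \<in> open_c"
    using borel_c_Int[OF open_c_borel_c[of U], of V] by (auto simp: open_c_def borel_c_def)
  moreover have "(\<lambda>x. u k x * v k x) \<in> C0_inf M \<and> 0 \<le> u k x * v k x \<and> u k x * v k x \<le> 1 \<and>
     (x \<notin> U \<inter> V \<longrightarrow> u k x * v k x = 0) \<and> (\<lambda>k. u k x * v k x) \<longlonglongrightarrow> indicator (U \<inter> V) x" for k x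
  proof -
    have "(\<lambda>k. u k x * v k x) \<longlonglongrightarrow> indicator U x * indicator V x"
      using u v by (intro tendsto_mult) auto
    then show ?thesis
      using u[of k x] v[of k x] C0_inf_mult[OF M, of "u k" "v k"] by (auto simp: indicator_inter_arith mult_le_one)
  qed
  ultimately show "U \<inter> V \<in> bump_open M"
    unfolding bump_open_def by (intro CollectI conjI exI[of _ "\<lambda>k x. u k x * v k x"]) auto
qed

lemma sigma_sets_bump_open:
  fixes M :: "('a::{t2_space,second_countable_topology}, 'n::finite) riemannian"
  assumes M: "smooth_atlas M"
  shows "sigma_sets UNIV (bump_open M) = sets borel"
proof (rule antisym)
  show "sigma_sets UNIV (bump_open M) \<subseteq> sets borel"
  proof -
    have "bump_open M \<subseteq> sets borel" by (auto simp: bump_open_def open_c_def)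
    from sets.sigma_sets_subset[OF this] show ?thesis by simp
  qed
  have "U \<in> sigma_sets UNIV (bump_open M)" if o: "open U" for U :: "'a set"
  proof -
    obtain D where D: "D \<subseteq> chart_balls M" "countable D" "\<Union>D = U"
      by (rule open_eq_countable_chart_balls[OF M o]) (rule that; assumption)
    have "\<Union>D \<in> sigma_sets UNIV (bump_open M)"
      using D(1) chart_balls_bump_open[OF M]
      by (intro sigma_sets_UNION[OF D(2)] sigma_sets.Basic) auto
    then show ?thesis using D(3) by simp
  qed
  then show "sets borel \<subseteq> sigma_sets UNIV (bump_open M)"
    unfolding borel_def sets_measure_of[OF subset_UNIV[of "{S. open S}", folded Pow_UNIV]]
    by (intro sigma_sets_mono) auto
qed

text \<open>Pairings with nonnegative test functions determine all counts: on sets of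
  \<open>bump_open\<close> by a limit of bumps, on their intersections with Borel sets by a Dynkin
  argument, and on a general \<open>B\<close> by cutting it into countably many such pieces. It is
  applied both to the vague topology and to the measures in the Mecke identity.\<close>

lemma measurable_config_pairing:
  fixes M :: "('a::{t2_space,second_countable_topology}, 'n::finite) riemannian"
  assumes M: "smooth_atlas M" and F: "\<And>\<omega>. \<omega> \<in> space N \<Longrightarrow> F \<omega> \<in> configs"
    and pair: "\<And>f. f \<in> C0_inf M \<Longrightarrow> (\<And>x. 0 \<le> f x) \<Longrightarrow> (\<lambda>\<omega>. pairing f (F \<omega>)) \<in> borel_measurable N"
  shows "F \<in> N \<rightarrow>\<^sub>M local_borel (UNIV :: 'a set)"
proof -
  have nc: "(\<lambda>\<omega>. ncount (F \<omega>) U) \<in> borel_measurable N" if U: "U \<in> bump_open M" for U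
  proof -
    obtain u where u: "\<And>k x. u k \<in> C0_inf M \<and> 0 \<le> u k x \<and> u k x \<le> 1 \<and> (x \<notin> U \<longrightarrow> u k x = 0) \<and> (\<lambda>k::nat. u k x) \<longlonglongrightarrow> indicator U x"
      using U unfolding bump_open_def by blast
    have b: "U \<in> borel_c" using U open_c_borel_c unfolding bump_open_def by blast
    have "(\<lambda>k. pairing (u k) (F \<omega>)) \<longlonglongrightarrow> real (card (F \<omega> \<inter> U))" if "\<omega> \<in> space N" for \<omega>
    proof -
      have "(\<lambda>k. \<Sum>x\<in>F \<omega> \<inter> U. u k x) \<longlonglongrightarrow> (\<Sum>x\<in>F \<omega> \<inter> U. indicator U x)"
        using u by (intro tendsto_sum) blast
      moreover have "(\<Sum>x\<in>F \<omega> \<inter> U. indicator U x) = real (card (F \<omega> \<inter> U))"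
        by (subst sum.cong[OF refl, where h = "\<lambda>_. 1"]) auto
      moreover have "pairing (u k) (F \<omega>) = (\<Sum>x\<in>F \<omega> \<inter> U. u k x)" for k
        by (rule pairing_eq_sum[OF F[OF that] b]) (use u in blast)
      ultimately show ?thesis by simp
    qed
    then have "(\<lambda>\<omega>. real (card (F \<omega> \<inter> U))) \<in> borel_measurable N"
    proof (rule borel_measurable_LIMSEQ_real)
      show "(\<lambda>\<omega>. pairing (u k) (F \<omega>)) \<in> borel_measurable N" for k
        by (rule pair) (use u in auto)
    qed
    then have "(\<lambda>\<omega>. ennreal (real (card (F \<omega> \<inter> U)))) \<in> borel_measurable N" by simp
    then show ?thesis
      by (rule measurable_cong[THEN iffD2, rotated])
        (simp add: ncount_eq_card[OF configs_finite_Int[OF F b]] ennreal_of_nat_eq_real_of_nat)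
  qed
  have ncU: "(\<lambda>\<omega>. ncount (F \<omega>) (A \<inter> U)) \<in> borel_measurable N" if U: "U \<in> bump_open M" and A: "A \<in> sets borel" for U A
  proof -
    have b: "U \<in> borel_c" using U open_c_borel_c unfolding bump_open_def by blast
    have cl: "bump_open M \<subseteq> Pow UNIV" by simp
    show ?thesis
      using Int_stable_bump_open[OF M] cl A[folded sigma_sets_bump_open[OF M]]
    proof (induction rule: sigma_sets_induct_disjoint)
      case (basic A)
      then show ?case using nc[OF Int_stableD[OF Int_stable_bump_open[OF M] basic U]] by simp
    next
      case empty
      then show ?case by (simp add: ncount_def)
    next
      case (compl A)
      have "ncount (F \<omega>) ((UNIV - A) \<inter> U) = ncount (F \<omega>) U - ncount (F \<omega>) (A \<inter> U)" if "\<omega> \<in> space N" for \<omega>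
      proof -
        have "F \<omega> \<inter> ((UNIV - A) \<inter> U) = F \<omega> \<inter> U - F \<omega> \<inter> (A \<inter> U)" by auto
        moreover have "finite (F \<omega> \<inter> (A \<inter> U))"
          using configs_finite_Int[OF F[OF that] b] by (rule rev_finite_subset) auto
        ultimately show ?thesis unfolding ncount_def
          by (simp only:, intro emeasure_Diff) (auto simp: emeasure_count_space_finite)
      qed
      then show ?case
        by (rule measurable_cong[THEN iffD2]) (use borel_measurable_minus_ennreal[OF nc[OF U] compl(2)] in auto)
    next
      case (union A)
      have "disjoint_family (\<lambda>i. A i \<inter> U)" using union(1) by (auto simp: disjoint_family_on_def)
      then have d: "ncount (F \<omega>) (\<Union>i. A i \<inter> U) = (\<Sum>i. ncount (F \<omega>) (A i \<inter> U))" for \<omega>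
        by (rule ncount_sums)
      have u: "\<Union> (range A) \<inter> U = (\<Union>i. A i \<inter> U)" by auto
      show ?case unfolding u d using union(3) by simp
    qed
  qed
  show ?thesis
  proof (rule measurable_local_borelI[OF F])
    fix B :: "'a set" assume B: "B \<in> borel_c"
    obtain D where D: "D \<subseteq> chart_balls M" "countable D" "\<Union>D = (UNIV :: 'a set)"
      by (rule open_eq_countable_chart_balls[OF M open_UNIV]) (rule that; assumption)
    have "D \<noteq> {}" using D(3) by auto
    define U where "U = from_nat_into D"
    have U: "U i \<in> bump_open M" for i
      using from_nat_into[OF \<open>D \<noteq> {}\<close>] D(1) chart_balls_bump_open[OF M] unfolding U_def by blast
    have Ub: "U i \<in> sets borel" for i using U[of i] by (auto simp: bump_open_def open_c_def)
    have "(\<Union>i. U i) = UNIV"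
      using range_from_nat_into[OF \<open>D \<noteq> {}\<close> D(2)] D(3) by (simp add: U_def)
    \<comment> \<open>Each piece lies inside a single set \<open>U i\<close>, for which
      measurability of the count is known.\<close>
    then have Be: "B = (\<Union>i. B \<inter> disjointed U i)"
      using UN_disjointed_eq[of U] by auto
    have "disjoint_family (\<lambda>i. B \<inter> disjointed U i)"
      using disjoint_family_disjointed[of U] by (auto simp: disjoint_family_on_def)
    from ncount_sums[OF this] Be have e: "ncount (F \<omega>) B = (\<Sum>i. ncount (F \<omega>) (B \<inter> disjointed U i))" for \<omega>
      by metis
    have "(\<lambda>\<omega>. ncount (F \<omega>) (B \<inter> disjointed U i)) \<in> borel_measurable N" for i
    proof -
      have "B \<inter> disjointed U i = (B \<inter> disjointed U i) \<inter> U i" using disjointed_subset[of U i] by auto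
      moreover have "disjointed U i \<in> sets borel"
        using sets.range_disjointed_sets[of U borel] Ub by auto
      ultimately show ?thesis
        using ncU[OF U[of i], of "B \<inter> disjointed U i"] B sets.Int[of B borel "disjointed U i"]
        by (simp add: borel_c_def)
    qed
    then have "(\<lambda>\<omega>. ncount (F \<omega>) B) \<in> borel_measurable N" unfolding e by measurable
    then show "(\<lambda>\<omega>. card (F \<omega> \<inter> B)) \<in> N \<rightarrow>\<^sub>M count_space UNIV"
      by (subst measurable_card_iff_ncount) (use configs_finite_Int[OF F B] in auto)
  qed
qed

section \<open>The vague Borel sets and the counting sigma-algebra\<close>

lemma openin_vague_configs: "{S. openin vague_topology S} \<subseteq> Pow (configs :: 'a::topological_space set set)"
proof -
  have "topspace vague_topology \<subseteq> (configs :: 'a set set)"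
    unfolding vague_topology_def topology_generated_by_topspace by auto
  then show ?thesis using openin_subset by fastforce
qed

lemma space_config_borel [simp]: "space config_borel = configs"
  unfolding config_borel_def by (rule space_measure_of[OF openin_vague_configs])

lemma openin_vague_sets: "openin vague_topology S \<Longrightarrow> S \<in> sets config_borel"
  unfolding config_borel_def using openin_vague_configs by (intro in_measure_of) auto

text \<open>Pairings with test functions are vaguely continuous, so counting events are Borel for
  the vague topology. Measurability is accordingly proved for \<open>local_borel\<close> and then
  transported to \<open>\<pi>\<close> and \<open>\<mu>\<close>.\<close>

lemma measurable_config_borel:
  fixes M :: "('a::{t2_space,second_countable_topology}, 'n::finite) riemannian"
  assumes M: "smooth_atlas M"
  shows "(\<lambda>\<gamma>. \<gamma>) \<in> config_borel \<rightarrow>\<^sub>M local_borel (UNIV :: 'a set)"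
proof (rule measurable_config_pairing[OF M])
  fix f :: "'a \<Rightarrow> real" assume f: "f \<in> C0_inf M"
  show "(\<lambda>\<gamma>. pairing f \<gamma>) \<in> borel_measurable config_borel"
  proof (rule borel_measurableI)
    fix U :: "real set" assume "open U"
    then have "openin vague_topology {\<gamma> \<in> configs. pairing f \<gamma> \<in> U}"
      unfolding vague_topology_def using C0_inf_continuous[OF M f] f
      by (intro topology_generated_by_Basis) (auto simp: C0_inf_def)
    then show "pairing f -` U \<inter> space config_borel \<in> sets config_borel"
      using openin_vague_sets by (simp add: vimage_def Int_def conj_commute)
  qed
qed simp

section \<open>The Mecke identity\<close>

text \<open>The moments give equality for polynomials in \<open>h\<close>, and uniform approximation
  on \<open>{0..1}\<close>, where \<open>h\<close> takes its values, extends it to continuous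
  \<open>\<phi>\<close>. The weight \<open>w\<close> is carried along so that several functions can
  be treated one after another.\<close>

lemma integral_polynomial_eq:
  fixes h w :: "'b \<Rightarrow> real"
  assumes fin: "finite_measure P" "finite_measure Q" and S: "sets Q = sets P"
    and h: "h \<in> borel_measurable P" "\<And>x. x \<in> space P \<Longrightarrow> 0 \<le> h x \<and> h x \<le> 1"
    and w: "w \<in> borel_measurable P" "\<And>x. x \<in> space P \<Longrightarrow> 0 \<le> w x \<and> w x \<le> 1"
    and eq: "\<And>i::nat. (\<integral>x. w x * h x ^ i \<partial>P) = (\<integral>x. w x * h x ^ i \<partial>Q)"
    and \<phi>: "continuous_on {0..1} \<phi>" "\<phi> \<in> borel_measurable borel"
  shows "(\<integral>x. w x * \<phi> (h x) \<partial>P) = (\<integral>x. w x * \<phi> (h x) \<partial>Q)"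
proof -
  interpret P: finite_measure P by fact
  interpret Q: finite_measure Q by fact
  have sp: "space Q = space P" using S by (rule sets_eq_imp_space_eq)
  have mQ: "borel_measurable Q = (borel_measurable P :: ('b \<Rightarrow> real) set)"
    by (rule measurable_cong_sets[OF S refl])
  have bd: "\<exists>b. \<forall>x\<in>space P. \<bar>w x * f (h x)\<bar> \<le> b" if "continuous_on {0..1} f" for f :: "real \<Rightarrow> real"
  proof -
    have "compact (f ` {0..1})" using that by (rule compact_continuous_image) simp
    from compact_imp_bounded[OF this] obtain b where b: "\<forall>y\<in>f ` {0..1}. norm y \<le> b"
      unfolding bounded_iff by blast
    have "\<bar>w x * f (h x)\<bar> \<le> b" if "x \<in> space P" for x
    proof -
      have "\<bar>f (h x)\<bar> \<le> b" using b h(2)[OF that] by auto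
      moreover have "\<bar>w x * f (h x)\<bar> \<le> 1 * \<bar>f (h x)\<bar>"
        unfolding abs_mult using w(2)[OF that] by (intro mult_right_mono) auto
      ultimately show ?thesis by linarith
    qed
    then show ?thesis by blast
  qed
  have int: "integrable P (\<lambda>x. w x * f (h x)) \<and> integrable Q (\<lambda>x. w x * f (h x))"
    if f: "continuous_on {0..1} f" "f \<in> borel_measurable borel" for f :: "real \<Rightarrow> real"
  proof -
    obtain b where b: "\<forall>x\<in>space P. \<bar>w x * f (h x)\<bar> \<le> b" using bd[OF f(1)] by blast
    have m: "(\<lambda>x. w x * f (h x)) \<in> borel_measurable P" using w(1) h(1) f(2) by measurable
    then have "integrable P (\<lambda>x. w x * f (h x))"
      by (intro P.integrable_const_bound[where B = b]) (use b in auto)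
    moreover have "integrable Q (\<lambda>x. w x * f (h x))"
      using m b sp by (intro Q.integrable_const_bound[where B = b]) (auto simp: mQ)
    ultimately show ?thesis ..
  qed
  have bound: "\<bar>(\<integral>x. w x * \<phi> (h x) \<partial>P) - (\<integral>x. w x * \<phi> (h x) \<partial>Q)\<bar> \<le> e * (measure P (space P) + measure Q (space P))"
    if e: "e > 0" for e
  proof -
    obtain p where p: "real_polynomial_function p" "\<And>t. t \<in> {0..1} \<Longrightarrow> \<bar>\<phi> t - p t\<bar> < e"
      using Stone_Weierstrass_real_polynomial_function[OF compact_Icc \<phi>(1) e] by auto
    then obtain a and n :: nat where pa: "p = (\<lambda>t. \<Sum>i\<le>n. a i * t ^ i)"
      unfolding real_polynomial_function_iff_sum by blast
    have pc: "continuous_on {0..1} p" "p \<in> borel_measurable borel"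
      unfolding pa by (auto intro!: continuous_intros)
    have ipow: "integrable P (\<lambda>x. w x * h x ^ i)" "integrable Q (\<lambda>x. w x * h x ^ i)" for i
    proof -
      have "continuous_on {0..1} (\<lambda>t :: real. t ^ i)" by (intro continuous_intros)
      then show "integrable P (\<lambda>x. w x * h x ^ i)" "integrable Q (\<lambda>x. w x * h x ^ i)"
        using int[of "\<lambda>t. t ^ i"] by auto
    qed
    have px: "w x * p (h x) = (\<Sum>i\<le>n. a i * (w x * h x ^ i))" for x
      by (simp add: pa sum_distrib_left mult_ac)
    have pe: "(\<integral>x. w x * p (h x) \<partial>P) = (\<integral>x. w x * p (h x) \<partial>Q)"
      unfolding px using ipow by (simp add: Bochner_Integration.integral_sum eq)
    have close: "\<bar>(\<integral>x. w x * \<phi> (h x) \<partial>R) - (\<integral>x. w x * p (h x) \<partial>R)\<bar> \<le> e * measure R (space P)"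
      if R: "finite_measure R" "space R = space P" "integrable R (\<lambda>x. w x * \<phi> (h x))" "integrable R (\<lambda>x. w x * p (h x))" for R
    proof -
      interpret R: finite_measure R by fact
      have "\<bar>(\<integral>x. w x * \<phi> (h x) \<partial>R) - (\<integral>x. w x * p (h x) \<partial>R)\<bar> = \<bar>\<integral>x. w x * \<phi> (h x) - w x * p (h x) \<partial>R\<bar>"
        using R(3,4) by simp
      also have "\<dots> \<le> (\<integral>x. \<bar>w x * \<phi> (h x) - w x * p (h x)\<bar> \<partial>R)" by (rule integral_abs_bound)
      also have "\<dots> \<le> (\<integral>x. e \<partial>R)"
      proof (rule integral_mono)
        fix x assume "x \<in> space R"
        then have x: "x \<in> space P" using R(2) by simp
        have "\<bar>w x * \<phi> (h x) - w x * p (h x)\<bar> = w x * \<bar>\<phi> (h x) - p (h x)\<bar>"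
          using w(2)[OF x] by (simp add: abs_mult right_diff_distrib[symmetric])
        also have "\<dots> \<le> 1 * e"
          using w(2)[OF x] p(2)[of "h x"] h(2)[OF x] e by (intro mult_mono) auto
        finally show "\<bar>w x * \<phi> (h x) - w x * p (h x)\<bar> \<le> e" by simp
      qed (use R in auto)
      finally show ?thesis using R(2) by (simp add: mult.commute)
    qed
    show ?thesis
      using close[OF fin(1) refl] close[OF fin(2) sp] int[OF \<phi>] int[OF pc] pe
      by (auto simp: abs_le_iff distrib_left)
  qed
  have "\<bar>(\<integral>x. w x * \<phi> (h x) \<partial>P) - (\<integral>x. w x * \<phi> (h x) \<partial>Q)\<bar> \<le> e" if "e > 0" for e
  proof -
    \<comment> \<open>The summand 1 keeps the divisor positive even if both measures vanish.\<close>
    define c where "c = measure P (space P) + measure Q (space P) + 1"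
    have c: "c > 0" by (simp add: c_def add_nonneg_pos)
    have "\<bar>(\<integral>x. w x * \<phi> (h x) \<partial>P) - (\<integral>x. w x * \<phi> (h x) \<partial>Q)\<bar> \<le> e / c * (c - 1)"
      using bound[of "e / c"] that c by (simp add: c_def)
    also have "\<dots> \<le> e" using that c by (simp add: field_simps)
    finally show ?thesis .
  qed
  then have "\<bar>(\<integral>x. w x * \<phi> (h x) \<partial>P) - (\<integral>x. w x * \<phi> (h x) \<partial>Q)\<bar> \<le> 0" by (rule field_le_epsilon) auto
  then show ?thesis by simp
qed

text \<open>The indicator of \<open>{a<..}\<close> is the bounded pointwise limit of the continuous
  ramps \<open>\<phi> n\<close>, whose slope is \<open>n\<close>.\<close>

lemma integral_superlevel_eq:
  fixes h w :: "'b \<Rightarrow> real"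
  assumes fin: "finite_measure P" "finite_measure Q" and S: "sets Q = sets P"
    and h: "h \<in> borel_measurable P" "\<And>x. x \<in> space P \<Longrightarrow> 0 \<le> h x \<and> h x \<le> 1"
    and w: "w \<in> borel_measurable P" "\<And>x. x \<in> space P \<Longrightarrow> 0 \<le> w x \<and> w x \<le> 1"
    and eq: "\<And>i::nat. (\<integral>x. w x * h x ^ i \<partial>P) = (\<integral>x. w x * h x ^ i \<partial>Q)"
  shows "(\<integral>x. w x * indicator {a<..} (h x) \<partial>P) = (\<integral>x. w x * indicator {a<..} (h x) \<partial>Q)"
proof -
  define \<phi> where "\<phi> n t = min 1 (max 0 (real n * (t - a)))" for n :: nat and t
  have \<phi>: "continuous_on A (\<phi> n)" for n A unfolding \<phi>_def by (intro continuous_intros)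
  have \<phi>m: "\<phi> n \<in> borel_measurable borel" for n
    using \<phi>[of UNIV n] by (rule borel_measurable_continuous_onI)
  have e: "(\<integral>x. w x * \<phi> n (h x) \<partial>P) = (\<integral>x. w x * \<phi> n (h x) \<partial>Q)" for n
    by (rule integral_polynomial_eq[OF fin S h w eq \<phi> \<phi>m])
  have lim: "(\<lambda>n. \<phi> n t) \<longlonglongrightarrow> indicator {a<..} t" for t
  proof (cases "t > a")
    case True
    obtain N where N: "1 / (t - a) < real N" using reals_Archimedean2 by blast
    have "real n * (t - a) \<ge> 1" if "n \<ge> N" for n
    proof -
      have "1 / (t - a) \<le> real n" using N that by linarith
      then show ?thesis using True by (simp add: field_simps)
    qed
    then have "\<forall>\<^sub>F n in sequentially. real n * (t - a) \<ge> 1" unfolding eventually_sequentially by blast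
    then have "\<forall>\<^sub>F n in sequentially. \<phi> n t = 1" by eventually_elim (simp add: \<phi>_def)
    then show ?thesis using True by (simp add: tendsto_eventually)
  next
    case False
    then have "real n * (t - a) \<le> 0" for n by (simp add: mult_nonneg_nonpos)
    then have "\<phi> n t = 0" for n by (simp add: \<phi>_def)
    then show ?thesis using False by simp
  qed
  have conv: "(\<lambda>n. \<integral>x. w x * \<phi> n (h x) \<partial>R) \<longlonglongrightarrow> (\<integral>x. w x * indicator {a<..} (h x) \<partial>R)"
    if R: "finite_measure R" "sets R = sets P" for R
  proof (rule integral_dominated_convergence[where w = "\<lambda>_. 1"])
    interpret R: finite_measure R by fact
    have [measurable]: "w \<in> borel_measurable R" "h \<in> borel_measurable R"
      using w(1) h(1) measurable_cong_sets[OF R(2) refl] by blast+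
    note [measurable] = \<phi>m
    show "integrable R (\<lambda>_. 1 :: real)" by simp
    show "(\<lambda>x. w x * indicator {a<..} (h x)) \<in> borel_measurable R" by measurable
    show "(\<lambda>x. w x * \<phi> n (h x)) \<in> borel_measurable R" for n by measurable
    show "AE x in R. (\<lambda>n. w x * \<phi> n (h x)) \<longlonglongrightarrow> w x * indicator {a<..} (h x)"
      by (intro AE_I2 tendsto_mult tendsto_const lim)
    have "\<bar>w x * \<phi> n (h x)\<bar> \<le> 1" if "x \<in> space R" for x n
    proof -
      have "0 \<le> w x" "w x \<le> 1" using w(2) that sets_eq_imp_space_eq[OF R(2)] by auto
      moreover have "0 \<le> \<phi> n (h x)" "\<phi> n (h x) \<le> 1" by (auto simp: \<phi>_def)
      ultimately show ?thesis by (simp add: abs_mult mult_le_one)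
    qed
    then show "AE x in R. norm (w x * \<phi> n (h x)) \<le> 1" for n by (intro AE_I2) simp
  qed
  show ?thesis
    using LIMSEQ_unique[OF conv[OF fin(1) refl]] conv[OF fin(2) S] unfolding e by blast
qed

text \<open>A functional monotone class theorem. Finite intersections \<open>E L\<close> of
  superlevel sets of functions in \<open>H\<close> form an intersection-stable generator, and
  equality on them is shown by replacing one factor at a time by an indicator.\<close>

theorem multiplicative_class_measure_eq:
  fixes H :: "('b \<Rightarrow> real) set"
  assumes fin: "finite_measure P" "finite_measure Q" and S: "sets Q = sets P"
    and H: "\<And>h. h \<in> H \<Longrightarrow> h \<in> borel_measurable P" "\<And>h x. h \<in> H \<Longrightarrow> x \<in> space P \<Longrightarrow> 0 \<le> h x \<and> h x \<le> 1"
    and mult: "\<And>h h'. h \<in> H \<Longrightarrow> h' \<in> H \<Longrightarrow> (\<lambda>x. h x * h' x) \<in> H" and one: "(\<lambda>_. 1) \<in> H"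
    and eq: "\<And>h. h \<in> H \<Longrightarrow> (\<integral>x. h x \<partial>P) = (\<integral>x. h x \<partial>Q)"
    and gen: "sets P \<subseteq> sigma_sets (space P) {h -` {a<..} \<inter> space P | h a. h \<in> H}"
  shows "P = Q"
proof -
  interpret P: finite_measure P by fact
  interpret Q: finite_measure Q by fact
  have sp: "space Q = space P" using S by (rule sets_eq_imp_space_eq)
  define E where "E L = {x \<in> space P. \<forall>(h, a)\<in>set L. h x > a}" for L :: "(('b \<Rightarrow> real) \<times> real) list"
  have Em: "E L \<in> sets P" if "fst ` set L \<subseteq> H" for L
    using that
  proof (induction L)
    case (Cons q L)
    have "fst q -` {snd q<..} \<inter> space P \<in> sets P"
      using H(1)[of "fst q"] Cons.prems by (intro measurable_sets[of _ _ borel]) auto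
    moreover have "E (q # L) = (fst q -` {snd q<..} \<inter> space P) \<inter> E L"
      by (auto simp: E_def)
    ultimately show ?case using Cons by auto
  qed (simp add: E_def)
  have main: "(\<integral>x. indicator (E L) x * h x \<partial>P) = (\<integral>x. indicator (E L) x * h x \<partial>Q)"
    if "fst ` set L \<subseteq> H" "h \<in> H" for L h
    using that
  proof (induction L arbitrary: h)
    case Nil
    have "(\<integral>x. indicator (E []) x * h x \<partial>R) = (\<integral>x. h x \<partial>R)" if "space R = space P" for R
      using that by (intro Bochner_Integration.integral_cong) (auto simp: E_def)
    then show ?case using eq[OF Nil(2)] sp by simp
  next
    case (Cons q L)
    obtain g a where q: "q = (g, a)" by fastforce
    have g: "g \<in> H" and L: "fst ` set L \<subseteq> H" using Cons.prems q by auto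
    define w where "w x = indicator (E L) x * h x" for x
    have w: "w \<in> borel_measurable P" "\<And>x. x \<in> space P \<Longrightarrow> 0 \<le> w x \<and> w x \<le> 1"
      using Em[OF L] H[OF Cons.prems(2)] unfolding w_def by (auto simp: indicator_def)
    \<comment> \<open>The induction statement keeps a free factor from \<open>H\<close> precisely so
      that the moments of \<open>g\<close> with weight \<open>h\<close> on \<open>E L\<close> are
      covered by the induction hypothesis; closure under products provides them.\<close>
    have pw: "(\<lambda>x. h x * g x ^ i) \<in> H" for i
    proof (induction i)
      case (Suc i)
      have "(\<lambda>x. h x * g x ^ Suc i) = (\<lambda>x. (h x * g x ^ i) * g x)" by (simp add: fun_eq_iff mult_ac)
      then show ?case using mult[OF Suc g] by simp
    qed (use Cons.prems in simp)
    have "(\<integral>x. w x * indicator {a<..} (g x) \<partial>P) = (\<integral>x. w x * indicator {a<..} (g x) \<partial>Q)"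
      using Cons.IH[OF L pw] by (intro integral_superlevel_eq[OF fin S H(1)[OF g] H(2)[OF g] w]) (auto simp: w_def mult.assoc)
    moreover have "(\<integral>x. indicator (E (q # L)) x * h x \<partial>R) = (\<integral>x. w x * indicator {a<..} (g x) \<partial>R)"
      if "space R = space P" for R
      using that by (intro Bochner_Integration.integral_cong) (auto simp: E_def q w_def indicator_def)
    ultimately show ?case using sp by simp
  qed
  have emE: "emeasure P (E L) = emeasure Q (E L)" if L: "fst ` set L \<subseteq> H" for L
  proof -
    have "measure P (E L) = measure Q (E L)"
      using main[OF L one] Em[OF L] S by simp
    then show ?thesis by (simp add: P.emeasure_eq_measure Q.emeasure_eq_measure)
  qed
  define G where "G = E ` {L. fst ` set L \<subseteq> H}"
  show ?thesis
  proof (rule measure_eqI_generator_eq[where E = G and \<Omega> = "space P" and A = "\<lambda>_. space P"])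
    show "Int_stable G"
    proof (rule Int_stableI)
      fix A B assume "A \<in> G" "B \<in> G"
      then obtain L L' where L: "A = E L" "fst ` set L \<subseteq> H" "B = E L'" "fst ` set L' \<subseteq> H" unfolding G_def by auto
      have "A \<inter> B = E (L @ L')" unfolding L by (auto simp: E_def)
      moreover have "fst ` set (L @ L') \<subseteq> H" using L by auto
      ultimately show "A \<inter> B \<in> G" unfolding G_def by blast
    qed
    show "G \<subseteq> Pow (space P)" unfolding G_def E_def by auto
    show "emeasure P X = emeasure Q X" if "X \<in> G" for X using that emE unfolding G_def by auto
    show sP: "sets P = sigma_sets (space P) G"
    proof (rule antisym)
      have "{h -` {a<..} \<inter> space P | h a. h \<in> H} \<subseteq> G"
      proof safe
        fix h and a :: real assume "h \<in> H"
        then have "h -` {a<..} \<inter> space P = E [(h, a)]" "fst ` set [(h, a)] \<subseteq> H" by (auto simp: E_def)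
        then show "h -` {a<..} \<inter> space P \<in> G" unfolding G_def by blast
      qed
      then show "sets P \<subseteq> sigma_sets (space P) G" using gen sigma_sets_mono'[of _ G "space P"] by blast
      have "G \<subseteq> sets P" using Em unfolding G_def by auto
      then show "sigma_sets (space P) G \<subseteq> sets P" by (rule sets.sigma_sets_subset)
    qed
    then show "sets Q = sigma_sets (space P) G" using S by simp
    have "space P = E []" by (auto simp: E_def)
    then show "range (\<lambda>_. space P) \<subseteq> G" unfolding G_def by auto
    show "(\<Union>i::nat. space P) = space P" by simp
    show "emeasure P (space P) \<noteq> \<infinity>" for i :: nat by simp
  qed
qed

text \<open>Bernoulli's inequality for \<open>1 + (exp (y / n) - 1)\<close>. The upper bound does
  not depend on \<open>n\<close> and serves as dominating function when the Laplace transform is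
  differentiated.\<close>

lemma exp_difference_bounds:
  fixes y :: real
  assumes "0 \<le> y" "n > 0"
  shows "0 \<le> real n * (exp (y / n) - 1)" "real n * (exp (y / n) - 1) \<le> exp y - 1"
proof -
  show "0 \<le> real n * (exp (y / n) - 1)" using assms by simp
  have "1 + real n * (exp (y / n) - 1) \<le> (1 + (exp (y / n) - 1)) ^ n"
    using assms by (intro Bernoulli_inequality) (simp add: order_trans[of "-1" 0])
  also have "\<dots> = exp y" using assms(2) by (simp flip: exp_of_nat_mult)
  finally show "real n * (exp (y / n) - 1) \<le> exp y - 1" by simp
qed

text \<open>Squeezed by \<open>t \<le> exp t - 1 \<le> t exp t\<close>. The sequence
  \<open>d\<close> need not be of the form \<open>y / n\<close>: it will also be the increment of
  the exponent in the Laplace transform.\<close>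

lemma tendsto_exp_difference:
  fixes d :: "nat \<Rightarrow> real"
  assumes d: "\<And>n. 0 \<le> d n" and lim: "(\<lambda>n. real (Suc n) * d n) \<longlonglongrightarrow> L"
  shows "(\<lambda>n. real (Suc n) * (exp (d n) - 1)) \<longlonglongrightarrow> L"
proof -
  have z: "(\<lambda>n. real (Suc n) * d n * inverse (real (Suc n))) \<longlonglongrightarrow> L * 0"
    by (intro tendsto_mult lim LIMSEQ_inverse_real_of_nat)
  have e: "(\<lambda>n. real (Suc n) * d n * inverse (real (Suc n))) = d"
    by (rule ext) (simp del: of_nat_Suc)
  have d0: "d \<longlonglongrightarrow> 0" using z unfolding e by simp
  have "(\<lambda>n. real (Suc n) * d n * exp (d n)) \<longlonglongrightarrow> L * exp 0"
    by (intro tendsto_mult lim tendsto_exp d0)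
  then have up: "(\<lambda>n. real (Suc n) * d n * exp (d n)) \<longlonglongrightarrow> L" by simp
  show ?thesis
  proof (rule tendsto_sandwich[OF _ _ lim up])
    show "\<forall>\<^sub>F n in sequentially. real (Suc n) * d n \<le> real (Suc n) * (exp (d n) - 1)"
      using exp_ge_add_one_self[of "d _"] by (intro always_eventually allI mult_left_mono) (simp_all add: algebra_simps)
    have "exp t - 1 \<le> t * exp t" for t :: real
      using exp_ge_add_one_self[of "- t"] by (simp add: exp_minus field_simps)
    then show "\<forall>\<^sub>F n in sequentially. real (Suc n) * (exp (d n) - 1) \<le> real (Suc n) * d n * exp (d n)"
      by (intro always_eventually allI) (simp add: mult.assoc)
  qed
qed

lemma tendsto_exp_difference_quotient: "(\<lambda>n. real (Suc n) * (exp (y / real (Suc n)) - 1)) \<longlonglongrightarrow> y"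
  if "0 \<le> y" for y :: real
  by (rule tendsto_exp_difference) (use that in \<open>simp_all del: of_nat_Suc\<close>)

section \<open>Iterated integrals as measures\<close>

lemma ex_mixture:
  fixes K :: "'g \<Rightarrow> 'w measure"
  assumes K: "\<And>\<gamma>. \<gamma> \<in> space \<pi> \<Longrightarrow> sets (K \<gamma>) = sets N"
    and m: "\<And>u. u \<in> borel_measurable N \<Longrightarrow> (\<lambda>\<gamma>. nn_integral (K \<gamma>) u) \<in> borel_measurable \<pi>"
  obtains P where "sets P = sets N" "\<And>u. u \<in> borel_measurable N \<Longrightarrow> nn_integral P u = (\<integral>\<^sup>+\<gamma>. nn_integral (K \<gamma>) u \<partial>\<pi>)"
proof -
  define P where "P = measure_of (space N) (sets N) (\<lambda>A. \<integral>\<^sup>+\<gamma>. nn_integral (K \<gamma>) (indicator A) \<partial>\<pi>)"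
  have sP: "sets P = sets N" unfolding P_def by simp
  have Km: "u \<in> borel_measurable (K \<gamma>)" if "u \<in> borel_measurable N" "\<gamma> \<in> space \<pi>" for u :: "'w \<Rightarrow> ennreal" and \<gamma>
    using measurable_cong_sets[OF K[OF that(2)] refl] that(1) by blast
  have Pm: "u \<in> borel_measurable P" if "u \<in> borel_measurable N" for u :: "'w \<Rightarrow> ennreal"
    using measurable_cong_sets[OF sP refl] that by blast
  have em: "emeasure P A = (\<integral>\<^sup>+\<gamma>. nn_integral (K \<gamma>) (indicator A) \<partial>\<pi>)" if A: "A \<in> sets N" for A
    unfolding P_def
  proof (rule emeasure_measure_of_sigma[OF sets.sigma_algebra_axioms _ _ A])
    show "countably_additive (sets N) (\<lambda>A. \<integral>\<^sup>+\<gamma>. nn_integral (K \<gamma>) (indicator A) \<partial>\<pi>)"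
    proof (rule countably_additiveI)
      fix A :: "nat \<Rightarrow> 'w set" assume A: "range A \<subseteq> sets N" "disjoint_family A"
      then have A': "A i \<in> sets N" for i by auto
      have "(\<Sum>i. \<integral>\<^sup>+\<gamma>. nn_integral (K \<gamma>) (indicator (A i)) \<partial>\<pi>) = (\<integral>\<^sup>+\<gamma>. (\<Sum>i. nn_integral (K \<gamma>) (indicator (A i))) \<partial>\<pi>)"
        using A' by (intro nn_integral_suminf[symmetric] m) simp
      also have "\<dots> = (\<integral>\<^sup>+\<gamma>. nn_integral (K \<gamma>) (indicator (\<Union>i. A i)) \<partial>\<pi>)"
        using A A' K by (intro nn_integral_cong) (auto simp: suminf_emeasure)
      finally show "(\<Sum>i. \<integral>\<^sup>+\<gamma>. nn_integral (K \<gamma>) (indicator (A i)) \<partial>\<pi>) = (\<integral>\<^sup>+\<gamma>. nn_integral (K \<gamma>) (indicator (\<Union> (range A))) \<partial>\<pi>)" .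
    qed
  qed (simp add: positive_def)
  have "nn_integral P u = (\<integral>\<^sup>+\<gamma>. nn_integral (K \<gamma>) u \<partial>\<pi>)" if "u \<in> borel_measurable N" for u
    using that
  proof (induction rule: borel_measurable_induct)
    case (cong f g)
    have "nn_integral Q f = nn_integral Q g" if "sets Q = sets N" for Q
      using cong(3) sets_eq_imp_space_eq[OF that] by (intro nn_integral_cong) auto
    with cong(4) sP K show ?case by (simp cong: nn_integral_cong)
  next
    case (set A)
    then show ?case using em[OF set] sP by simp
  next
    case (mult u c)
    then show ?case
      by (simp add: nn_integral_cmult Km Pm m cong: nn_integral_cong)
  next
    case (add u v)
    then show ?case
      by (simp add: nn_integral_add Km Pm m cong: nn_integral_cong)
  next
    case (seq U)
    have S: "nn_integral Q (SUP i. U i) = (SUP i. nn_integral Q (U i))" if "\<And>i. U i \<in> borel_measurable Q" for Q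
      unfolding SUP_apply[abs_def] by (rule nn_integral_monotone_convergence_SUP[OF seq(3) that])
    have "(\<integral>\<^sup>+\<gamma>. nn_integral (K \<gamma>) (SUP i. U i) \<partial>\<pi>) = (\<integral>\<^sup>+\<gamma>. (SUP i. nn_integral (K \<gamma>) (U i)) \<partial>\<pi>)"
      by (intro nn_integral_cong S Km seq(1))
    also have "\<dots> = (SUP i. \<integral>\<^sup>+\<gamma>. nn_integral (K \<gamma>) (U i) \<partial>\<pi>)"
      using seq(3) by (intro nn_integral_monotone_convergence_SUP m seq(1)) (auto simp: incseq_def le_fun_def intro!: nn_integral_mono)
    also have "\<dots> = nn_integral P (SUP i. U i)" unfolding S[OF Pm[OF seq(1)]] seq(5) ..
    finally show ?case unfolding seq(4) ..
  qed
  then show thesis by (rule that[OF sP])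
qed

text \<open>The two sides of the Mecke identity and of the equilibrium equations are iterated
  integrals. Writing each as one measure on \<open>N\<close> makes a uniqueness theorem applicable;
  \<open>w\<close> is a density and \<open>T\<close> produces the point of \<open>N\<close> from the
  inner variable.\<close>

lemma ex_iterated_measure:
  fixes \<kappa> :: "'g \<Rightarrow> 'x measure" and T :: "'x \<Rightarrow> 'g \<Rightarrow> 'w" and w :: "'x \<Rightarrow> 'g \<Rightarrow> ennreal"
  assumes m: "\<And>u. u \<in> borel_measurable N \<Longrightarrow> (\<lambda>\<gamma>. \<integral>\<^sup>+x. w x \<gamma> * u (T x \<gamma>) \<partial>\<kappa> \<gamma>) \<in> borel_measurable \<pi>"
    and w: "\<And>\<gamma>. \<gamma> \<in> space \<pi> \<Longrightarrow> (\<lambda>x. w x \<gamma>) \<in> borel_measurable (\<kappa> \<gamma>)"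
    and T: "\<And>\<gamma>. \<gamma> \<in> space \<pi> \<Longrightarrow> (\<lambda>x. T x \<gamma>) \<in> \<kappa> \<gamma> \<rightarrow>\<^sub>M N"
  obtains P where "sets P = sets N"
    "\<And>u. u \<in> borel_measurable N \<Longrightarrow> (\<integral>\<^sup>+z. u z \<partial>P) = (\<integral>\<^sup>+\<gamma>. \<integral>\<^sup>+x. w x \<gamma> * u (T x \<gamma>) \<partial>\<kappa> \<gamma> \<partial>\<pi>)"
proof -
  define K where "K \<gamma> = distr (density (\<kappa> \<gamma>) (\<lambda>x. w x \<gamma>)) N (\<lambda>x. T x \<gamma>)" for \<gamma>
  have K: "nn_integral (K \<gamma>) u = (\<integral>\<^sup>+x. w x \<gamma> * u (T x \<gamma>) \<partial>\<kappa> \<gamma>)"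
    if "\<gamma> \<in> space \<pi>" "u \<in> borel_measurable N" for u \<gamma>
    unfolding K_def using T[OF that(1)] w[OF that(1)] that(2) measurable_compose[OF T[OF that(1)] that(2)]
    by (simp add: nn_integral_distr nn_integral_density)
  obtain P where P: "sets P = sets N"
    "\<And>u. u \<in> borel_measurable N \<Longrightarrow> nn_integral P u = (\<integral>\<^sup>+\<gamma>. nn_integral (K \<gamma>) u \<partial>\<pi>)"
  proof (rule ex_mixture[of \<pi> K N])
    show "sets (K \<gamma>) = sets N" for \<gamma> by (simp add: K_def)
    show "(\<lambda>\<gamma>. nn_integral (K \<gamma>) u) \<in> borel_measurable \<pi>" if "u \<in> borel_measurable N" for u
      using m[OF that] by (simp add: K[OF _ that] cong: measurable_cong)
  qed (rule that; assumption)
  show thesis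
    by (rule that[OF P(1)]) (simp add: P(2) K cong: nn_integral_cong)
qed

section \<open>The Poisson measure and its Laplace transform\<close>

locale poisson_setup =
  fixes M :: "('a::{t2_space,second_countable_topology}, 'n::finite) riemannian"
    and \<sigma> :: "'a measure" and \<pi> :: "'a set measure"
  assumes M: "smooth_atlas M" and sets_\<sigma>: "sets \<sigma> = sets borel"
    and \<sigma>_point: "\<And>x. emeasure \<sigma> {x} = 0" and \<sigma>_compact: "\<And>K. compact K \<Longrightarrow> emeasure \<sigma> K < \<infinity>"
    and P: "poisson_measure M \<sigma> \<pi>"
begin

abbreviation "BC \<equiv> borel \<Otimes>\<^sub>M local_borel (UNIV :: 'a set)"

sublocale prob_space \<pi>
  using P by (simp add: poisson_measure_def)

lemma sets_\<pi>: "sets \<pi> = sets config_borel" and space_\<pi>: "space \<pi> = configs"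
  using P sets_eq_imp_space_eq[of \<pi> config_borel] by (simp_all add: poisson_measure_def)

lemma measurable_\<pi>: "f \<in> local_borel UNIV \<rightarrow>\<^sub>M N \<Longrightarrow> f \<in> \<pi> \<rightarrow>\<^sub>M N"
proof -
  assume f: "f \<in> local_borel UNIV \<rightarrow>\<^sub>M N"
  have "(\<lambda>\<gamma>. \<gamma>) \<in> \<pi> \<rightarrow>\<^sub>M local_borel UNIV"
    using measurable_config_borel[OF M] measurable_cong_sets[OF sets_\<pi> refl] by blast
  from measurable_compose[OF this f] show ?thesis .
qed

lemma \<sigma>_open_c: "V \<in> open_c \<Longrightarrow> emeasure \<sigma> V < \<infinity>"
proof -
  assume V: "V \<in> open_c"
  have "emeasure \<sigma> V \<le> emeasure \<sigma> (closure V)"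
    using closure_subset by (intro emeasure_mono) (auto simp: sets_\<sigma>)
  also have "\<dots> < \<infinity>" using V by (intro \<sigma>_compact) (simp add: open_c_def)
  finally show ?thesis .
qed

sublocale \<sigma>: sigma_finite_measure \<sigma>
proof
  obtain W :: "nat \<Rightarrow> 'a set" where W: "exhaustion W" by (rule open_exhaustion[OF M])
  note W = exhaustionD[OF W]
  have "space \<sigma> = UNIV" using sets_eq_imp_space_eq[OF sets_\<sigma>] by simp
  moreover have "W k \<in> sets \<sigma>" for k using W(2)[of k] by (simp add: sets_\<sigma> open_c_def)
  moreover have "emeasure \<sigma> (W k) \<noteq> \<infinity>" for k using \<sigma>_open_c[OF W(2)[of k]] by simp
  ultimately show "\<exists>A. countable A \<and> A \<subseteq> sets \<sigma> \<and> \<Union> A = space \<sigma> \<and> (\<forall>a\<in>A. emeasure \<sigma> a \<noteq> \<infinity>)"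
    using W(3) by (intro exI[of _ "range W"]) auto
qed

lemma \<sigma>_not_in_config: "\<gamma> \<in> configs \<Longrightarrow> AE x in \<sigma>. x \<notin> \<gamma>"
proof -
  assume g: "\<gamma> \<in> configs"
  have "AE x in \<sigma>. x \<noteq> y" for y
  proof (rule AE_I[where N = "{y}"])
    show "{x \<in> space \<sigma>. \<not> x \<noteq> y} \<subseteq> {y}" by auto
  qed (auto simp: \<sigma>_point sets_\<sigma>)
  then have "AE x in \<sigma>. \<forall>y\<in>\<gamma>. x \<noteq> y"
    by (intro AE_ball_countable[THEN iffD2] configs_countable[OF M g]) simp
  then show ?thesis by (rule eventually_mono) auto
qed

lemma C0_inf_measurable: "f \<in> C0_inf M \<Longrightarrow> f \<in> borel_measurable borel"
  using C0_inf_continuous[OF M] by (rule borel_measurable_continuous_onI)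

lemma measurable_\<sigma>_iff: "measurable \<sigma> N = measurable borel N"
  by (rule measurable_cong_sets[OF sets_\<sigma> refl])

lemma integrable_\<sigma>:
  fixes u :: "'a \<Rightarrow> real"
  assumes "u \<in> borel_measurable borel" "f \<in> C0_inf M" "\<And>x. f x = 0 \<Longrightarrow> u x = 0" "\<And>x. \<bar>u x\<bar> \<le> b"
  shows "integrable \<sigma> u"
proof -
  obtain V where V: "V \<in> open_c" "\<And>x. x \<notin> V \<Longrightarrow> f x = 0"
    by (rule C0_inf_support[OF M assms(2)]) (rule that; assumption)
  show ?thesis
  proof (rule integrableI_bounded_set[where A = V and B = b])
    show "V \<in> sets \<sigma>" using V(1) by (simp add: sets_\<sigma> open_c_def)
    show "emeasure \<sigma> V < \<infinity>" by (rule \<sigma>_open_c[OF V(1)])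
  qed (use assms V(2) in \<open>auto simp: measurable_\<sigma>_iff\<close>)
qed

lemma pairing_measurable_\<pi>: "f \<in> C0_inf M \<Longrightarrow> pairing f \<in> borel_measurable \<pi>"
  by (rule measurable_\<pi>[OF measurable_pairing_local_borel[OF M]])

text \<open>Integrability comes with the formula: a function that is not integrable has Bochner
  integral 0, whereas the right-hand side is an exponential and hence positive.\<close>

lemma Laplace:
  assumes "f \<in> C0_inf M"
  shows "(\<integral>\<gamma>. exp (pairing f \<gamma>) \<partial>\<pi>) = exp (\<integral>x. exp (f x) - 1 \<partial>\<sigma>)" "integrable \<pi> (\<lambda>\<gamma>. exp (pairing f \<gamma>))"
proof -
  show e: "(\<integral>\<gamma>. exp (pairing f \<gamma>) \<partial>\<pi>) = exp (\<integral>x. exp (f x) - 1 \<partial>\<sigma>)"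
    using P assms unfolding poisson_measure_def by blast
  show "integrable \<pi> (\<lambda>\<gamma>. exp (pairing f \<gamma>))"
  proof (rule ccontr)
    assume "\<not> integrable \<pi> (\<lambda>\<gamma>. exp (pairing f \<gamma>))"
    then have "(\<integral>\<gamma>. exp (pairing f \<gamma>) \<partial>\<pi>) = 0" by (rule not_integrable_integral_eq)
    then show False using e by simp
  qed
qed

lemma integrable_exp_minus_1: "f \<in> C0_inf M \<Longrightarrow> integrable \<sigma> (\<lambda>x. exp (f x) - 1)"
proof -
  assume f: "f \<in> C0_inf M"
  obtain b where b: "b > 0" "\<And>x. \<bar>f x\<bar> \<le> b" by (rule C0_inf_bounded[OF M f]) (rule that; assumption)
  have "\<bar>exp (f x) - 1\<bar> \<le> exp b + 1" for x
  proof -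
    have "exp (f x) \<le> exp b" using b(2)[of x] by simp
    then show ?thesis using exp_gt_zero[of "f x"] exp_gt_zero[of b] unfolding abs_le_iff by linarith
  qed
  then show ?thesis
    using C0_inf_measurable[OF f] by (intro integrable_\<sigma>[OF _ f, where b = "exp b + 1"]) auto
qed

lemma exp_C0_bounded: "f \<in> C0_inf M \<Longrightarrow> \<exists>b>0. \<forall>x. exp (f x) \<le> b"
proof -
  assume f: "f \<in> C0_inf M"
  obtain b where b: "b > 0" "\<And>x. \<bar>f x\<bar> \<le> b" by (rule C0_inf_bounded[OF M f]) (rule that; assumption)
  have "exp (f x) \<le> exp b" for x using b(2)[of x] by simp
  then show ?thesis using exp_gt_zero[of b] by blast
qed

text \<open>The derivative of \<open>s \<mapsto> L(f + s g)\<close> at \<open>s = 0\<close>, taken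
  along \<open>s = 1/n\<close>. On the configuration side the difference quotients are dominated by
  \<open>exp <f + g, \<gamma>> - exp <f, \<gamma>>\<close>, integrable by the formula itself. On the
  other side the limit is taken first under the integral in \<open>\<sigma>\<close> and then in the
  outer exponential.\<close>

lemma Laplace_derivative:
  assumes f: "f \<in> C0_inf M" and g: "g \<in> C0_inf M" "\<And>x. 0 \<le> g x"
  shows "integrable \<pi> (\<lambda>\<gamma>. pairing g \<gamma> * exp (pairing f \<gamma>))"
    and "(\<integral>\<gamma>. pairing g \<gamma> * exp (pairing f \<gamma>) \<partial>\<pi>) =
      (\<integral>\<gamma>. exp (pairing f \<gamma>) \<partial>\<pi>) * (\<integral>x. g x * exp (f x) \<partial>\<sigma>)"
proof -
  define gn where "gn n x = f x + 1 / real (Suc n) * g x" for n x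
  have gn: "gn n \<in> C0_inf M" for n
    unfolding gn_def by (intro C0_inf_add[OF M f] C0_inf_const_mult[OF M g(1)])
  have fg: "(\<lambda>x. f x + g x) \<in> C0_inf M" by (rule C0_inf_add[OF M f g(1)])
  have pg: "pairing (gn n) \<gamma> = pairing f \<gamma> + pairing g \<gamma> / real (Suc n)" if "\<gamma> \<in> configs" for n \<gamma>
    using pairing_add[OF M f C0_inf_const_mult[OF M g(1), of "1 / real (Suc n)"] that]
    unfolding gn_def pairing_cmult by simp
  have pfg: "pairing (\<lambda>x. f x + g x) \<gamma> = pairing f \<gamma> + pairing g \<gamma>" if "\<gamma> \<in> configs" for \<gamma>
    by (rule pairing_add[OF M f g(1) that])
  have p0: "0 \<le> pairing g \<gamma>" for \<gamma> by (rule pairing_nonneg[OF g(2)])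
  define A where "A n \<gamma> = real (Suc n) * (exp (pairing (gn n) \<gamma>) - exp (pairing f \<gamma>))" for n \<gamma>
  have Aeq: "A n \<gamma> = exp (pairing f \<gamma>) * (real (Suc n) * (exp (pairing g \<gamma> / real (Suc n)) - 1))" if "\<gamma> \<in> configs" for n \<gamma>
    unfolding A_def pg[OF that] exp_add by (simp add: algebra_simps)
  note [measurable] = pairing_measurable_\<pi>[OF f] pairing_measurable_\<pi>[OF g(1)] pairing_measurable_\<pi>[OF gn]
  have dom: "integrable \<pi> (\<lambda>\<gamma>. exp (pairing (\<lambda>x. f x + g x) \<gamma>) - exp (pairing f \<gamma>))"
    by (intro Bochner_Integration.integrable_diff Laplace(2) f fg)
  have limA: "AE \<gamma> in \<pi>. (\<lambda>n. A n \<gamma>) \<longlonglongrightarrow> pairing g \<gamma> * exp (pairing f \<gamma>)"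
  proof (rule AE_I2)
    fix \<gamma> assume "\<gamma> \<in> space \<pi>"
    then have c: "\<gamma> \<in> configs" by (simp add: space_\<pi>)
    show "(\<lambda>n. A n \<gamma>) \<longlonglongrightarrow> pairing g \<gamma> * exp (pairing f \<gamma>)"
      unfolding Aeq[OF c] mult.commute[of "pairing g \<gamma>"]
      by (intro tendsto_mult tendsto_const tendsto_exp_difference_quotient p0)
  qed
  have bndA: "AE \<gamma> in \<pi>. norm (A n \<gamma>) \<le> exp (pairing (\<lambda>x. f x + g x) \<gamma>) - exp (pairing f \<gamma>)" for n
  proof (rule AE_I2)
    fix \<gamma> assume "\<gamma> \<in> space \<pi>"
    then have c: "\<gamma> \<in> configs" by (simp add: space_\<pi>)
    have "norm (A n \<gamma>) = exp (pairing f \<gamma>) * (real (Suc n) * (exp (pairing g \<gamma> / real (Suc n)) - 1))"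
      unfolding Aeq[OF c] real_norm_def
      by (rule abs_of_nonneg, rule mult_nonneg_nonneg[OF exp_ge_zero exp_difference_bounds(1)[OF p0]]) simp
    also have "\<dots> \<le> exp (pairing f \<gamma>) * (exp (pairing g \<gamma>) - 1)"
      using exp_difference_bounds(2)[OF p0, of "Suc n" \<gamma>] by (intro mult_left_mono) auto
    finally show "norm (A n \<gamma>) \<le> exp (pairing (\<lambda>x. f x + g x) \<gamma>) - exp (pairing f \<gamma>)"
      unfolding pfg[OF c] exp_add by (simp add: algebra_simps)
  qed
  have mA: "A n \<in> borel_measurable \<pi>" "(\<lambda>\<gamma>. pairing g \<gamma> * exp (pairing f \<gamma>)) \<in> borel_measurable \<pi>" for n
    unfolding A_def[abs_def] by measurable
  show "integrable \<pi> (\<lambda>\<gamma>. pairing g \<gamma> * exp (pairing f \<gamma>))"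
    by (rule integrable_dominated_convergence[OF mA(2,1) dom limA bndA])
  have L1: "(\<lambda>n. \<integral>\<gamma>. A n \<gamma> \<partial>\<pi>) \<longlonglongrightarrow> (\<integral>\<gamma>. pairing g \<gamma> * exp (pairing f \<gamma>) \<partial>\<pi>)"
    by (rule integral_dominated_convergence[OF mA(2,1) dom limA bndA])
  define a where "a = (\<integral>x. exp (f x) - 1 \<partial>\<sigma>)"
  \<comment> \<open>The increment of the exponent; it is of order \<open>1/n\<close> and nonnegative
    because \<open>g\<close> is.\<close>
  define d where "d n = (\<integral>x. exp (gn n x) - 1 \<partial>\<sigma>) - a" for n
  define B where "B n x = exp (f x) * (real (Suc n) * (exp (g x / real (Suc n)) - 1))" for n x
  have Bx: "exp (gn n x) - 1 - (exp (f x) - 1) = B n x / real (Suc n)" for n x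
    unfolding B_def gn_def exp_add by (simp add: field_simps)
  have B0: "0 \<le> B n x" for n x
    unfolding B_def by (rule mult_nonneg_nonneg[OF exp_ge_zero exp_difference_bounds(1)[OF g(2)]]) simp
  have dB: "d n = (\<integral>x. B n x \<partial>\<sigma>) / real (Suc n)" for n
  proof -
    have "d n = (\<integral>x. (exp (gn n x) - 1) - (exp (f x) - 1) \<partial>\<sigma>)"
      unfolding d_def a_def by (intro Bochner_Integration.integral_diff[symmetric] integrable_exp_minus_1 gn f)
    then show ?thesis unfolding Bx by simp
  qed
  have d0: "0 \<le> d n" for n unfolding dB using B0 by (intro divide_nonneg_nonneg integral_nonneg) auto
  have [measurable]: "f \<in> borel_measurable \<sigma>" "g \<in> borel_measurable \<sigma>"
    using C0_inf_measurable f g(1) by (auto simp: measurable_\<sigma>_iff)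
  have "(\<lambda>n. \<integral>x. B n x \<partial>\<sigma>) \<longlonglongrightarrow> (\<integral>x. g x * exp (f x) \<partial>\<sigma>)"
  proof (rule integral_dominated_convergence[where w = "\<lambda>x. (exp (f x + g x) - 1) - (exp (f x) - 1)"])
    show "integrable \<sigma> (\<lambda>x. (exp (f x + g x) - 1) - (exp (f x) - 1))"
      by (intro Bochner_Integration.integrable_diff integrable_exp_minus_1 f fg)
    show "AE x in \<sigma>. (\<lambda>n. B n x) \<longlonglongrightarrow> g x * exp (f x)"
      unfolding B_def mult.commute[of "g _"]
      by (intro AE_I2 tendsto_mult tendsto_const tendsto_exp_difference_quotient g(2))
    show "AE x in \<sigma>. norm (B n x) \<le> (exp (f x + g x) - 1) - (exp (f x) - 1)" for n
    proof (rule AE_I2)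
      fix x
      have "B n x \<le> exp (f x) * (exp (g x) - 1)"
        unfolding B_def using exp_difference_bounds(2)[OF g(2), of "Suc n" x] by (intro mult_left_mono) auto
      then show "norm (B n x) \<le> (exp (f x + g x) - 1) - (exp (f x) - 1)"
        using B0[of n x] by (simp add: exp_add algebra_simps)
    qed
    show "B n \<in> borel_measurable \<sigma>" for n unfolding B_def by measurable
  qed measurable
  then have "(\<lambda>n. real (Suc n) * d n) \<longlonglongrightarrow> (\<integral>x. g x * exp (f x) \<partial>\<sigma>)" unfolding dB by simp
  then have "(\<lambda>n. exp a * (real (Suc n) * (exp (d n) - 1))) \<longlonglongrightarrow> exp a * (\<integral>x. g x * exp (f x) \<partial>\<sigma>)"
    by (intro tendsto_mult tendsto_const tendsto_exp_difference[OF d0])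
  moreover have "exp a * (real (Suc n) * (exp (d n) - 1)) = (\<integral>\<gamma>. A n \<gamma> \<partial>\<pi>)" for n
  proof -
    have "(\<integral>\<gamma>. A n \<gamma> \<partial>\<pi>) = real (Suc n) * ((\<integral>\<gamma>. exp (pairing (gn n) \<gamma>) \<partial>\<pi>) - (\<integral>\<gamma>. exp (pairing f \<gamma>) \<partial>\<pi>))"
      unfolding A_def using Laplace(2)[OF gn] Laplace(2)[OF f] by simp
    also have "\<dots> = real (Suc n) * (exp (a + d n) - exp a)"
      unfolding Laplace(1)[OF gn] Laplace(1)[OF f] d_def a_def by simp
    finally show ?thesis by (simp add: exp_add algebra_simps)
  qed
  ultimately have "(\<lambda>n. \<integral>\<gamma>. A n \<gamma> \<partial>\<pi>) \<longlonglongrightarrow> exp a * (\<integral>x. g x * exp (f x) \<partial>\<sigma>)" by (simp only:)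
  from LIMSEQ_unique[OF L1 this]
  show "(\<integral>\<gamma>. pairing g \<gamma> * exp (pairing f \<gamma>) \<partial>\<pi>) =
      (\<integral>\<gamma>. exp (pairing f \<gamma>) \<partial>\<pi>) * (\<integral>x. g x * exp (f x) \<partial>\<sigma>)"
    unfolding Laplace(1)[OF f] a_def .
qed

end

context poisson_setup
begin

lemma measurable_\<sigma>_integral:
  assumes "u \<in> borel_measurable BC"
  shows "(\<lambda>\<gamma>. \<integral>\<^sup>+x. u (x, \<gamma>) \<partial>\<sigma>) \<in> borel_measurable (local_borel UNIV)"
proof -
  have [measurable_cong]: "sets \<sigma> = sets borel" by (rule sets_\<sigma>)
  have "(\<lambda>(\<gamma>, x). u (x, \<gamma>)) \<in> borel_measurable (local_borel UNIV \<Otimes>\<^sub>M \<sigma>)"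
    using assms by measurable
  from \<sigma>.borel_measurable_nn_integral[OF this] show ?thesis by simp
qed

lemma measurable_insert_point: "(\<lambda>p. (fst p, insert (fst p) (snd p))) \<in> BC \<rightarrow>\<^sub>M BC"
  using measurable_insert_config[OF M] by (intro measurable_Pair) (auto simp: case_prod_beta')

lemma measurable_insert_pair: "u \<in> borel_measurable BC \<Longrightarrow> (\<lambda>(x, \<gamma>). u (x, insert x \<gamma>)) \<in> borel_measurable BC"
  using measurable_compose[OF measurable_insert_point, of u] by (simp add: case_prod_beta')

lemma measurable_section: "u \<in> borel_measurable BC \<Longrightarrow> \<gamma> \<in> configs \<Longrightarrow> (\<lambda>x. u (x, \<gamma>)) \<in> borel_measurable borel"
proof -
  assume u: "u \<in> borel_measurable BC" and g: "\<gamma> \<in> configs"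
  have "(\<lambda>x. (x, \<gamma>)) \<in> borel \<rightarrow>\<^sub>M BC" using g by (intro measurable_Pair2') simp
  from measurable_compose[OF this u] show ?thesis .
qed

lemma C0_inf_0: "(\<lambda>_. 0) \<in> C0_inf M"
proof -
  obtain B where "B \<in> chart_balls M"
    by (rule chart_balls_basis[OF M open_UNIV UNIV_I[of undefined]]) (rule that; assumption)
  obtain f :: "nat \<Rightarrow> 'a \<Rightarrow> real" where "\<And>k. f k \<in> C0_inf M"
    by (rule chart_ball_bump[OF M \<open>B \<in> chart_balls M\<close>]) (rule that; assumption)
  from C0_inf_const_mult[OF M this, of 0] show ?thesis by simp
qed

lemma test_functions_points:
  assumes f: "f \<in> C0_inf M" and g: "g \<in> C0_inf M" "\<And>x. 0 \<le> g x"
  shows "(\<integral>\<^sup>+\<gamma>. \<integral>\<^sup>+x. ennreal (g x) * ennreal (exp (pairing f \<gamma>)) \<partial>count_space \<gamma> \<partial>\<pi>) =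
    ennreal ((\<integral>\<gamma>. exp (pairing f \<gamma>) \<partial>\<pi>) * (\<integral>x. g x * exp (f x) \<partial>\<sigma>))"
proof -
  have p0: "0 \<le> pairing g \<gamma>" for \<gamma> by (rule pairing_nonneg) (rule g(2))
  have "(\<integral>\<^sup>+x. ennreal (g x) * ennreal (exp (pairing f \<gamma>)) \<partial>count_space \<gamma>) = ennreal (pairing g \<gamma> * exp (pairing f \<gamma>))"
    if "\<gamma> \<in> space \<pi>" for \<gamma>
  proof -
    have "(\<integral>\<^sup>+x. ennreal (g x) * ennreal (exp (pairing f \<gamma>)) \<partial>count_space \<gamma>) =
        (\<integral>\<^sup>+x. ennreal (g x) \<partial>count_space \<gamma>) * ennreal (exp (pairing f \<gamma>))"
      by (rule nn_integral_multc) simp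
    then show ?thesis
      using ennreal_pairing[OF M g, of \<gamma>] that by (simp add: space_\<pi> ennreal_mult' p0)
  qed
  then have "(\<integral>\<^sup>+\<gamma>. \<integral>\<^sup>+x. ennreal (g x) * ennreal (exp (pairing f \<gamma>)) \<partial>count_space \<gamma> \<partial>\<pi>) =
      (\<integral>\<^sup>+\<gamma>. ennreal (pairing g \<gamma> * exp (pairing f \<gamma>)) \<partial>\<pi>)"
    by (intro nn_integral_cong) simp
  also have "\<dots> = ennreal (\<integral>\<gamma>. pairing g \<gamma> * exp (pairing f \<gamma>) \<partial>\<pi>)"
    using p0 by (intro nn_integral_eq_integral Laplace_derivative(1) f g) auto
  finally show ?thesis unfolding Laplace_derivative(2)[OF f g] .
qed

text \<open>Since \<open>\<gamma>\<close> is countable and \<open>\<sigma>\<close> has no atoms,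
  \<open>\<sigma>\<close>-almost every \<open>x\<close> lies off \<open>\<gamma>\<close>. There the
  pairing with \<open>insert x \<gamma>\<close> splits into \<open>f x\<close> and the pairing with
  \<open>\<gamma>\<close>, so that the double integral factorises.\<close>

lemma test_functions_insert:
  assumes f: "f \<in> C0_inf M" and g: "g \<in> C0_inf M" "\<And>x. 0 \<le> g x"
  shows "(\<integral>\<^sup>+\<gamma>. \<integral>\<^sup>+x. ennreal (g x) * ennreal (exp (pairing f (insert x \<gamma>))) \<partial>\<sigma> \<partial>\<pi>) =
    ennreal ((\<integral>\<gamma>. exp (pairing f \<gamma>) \<partial>\<pi>) * (\<integral>x. g x * exp (f x) \<partial>\<sigma>))"
proof -
  have [measurable]: "f \<in> borel_measurable \<sigma>" "g \<in> borel_measurable \<sigma>"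
    using C0_inf_measurable f g(1) by (auto simp: measurable_\<sigma>_iff)
  obtain bf where bf: "bf > 0" "\<forall>x. exp (f x) \<le> bf" using exp_C0_bounded[OF f] by blast
  obtain bg where bg: "bg > 0" "\<And>x. \<bar>g x\<bar> \<le> bg" by (rule C0_inf_bounded[OF M g(1)]) (rule that; assumption)
  have int: "integrable \<sigma> (\<lambda>x. g x * exp (f x))"
  proof (rule integrable_\<sigma>[OF _ g(1), where b = "bg * bf"])
    show "(\<lambda>x. g x * exp (f x)) \<in> borel_measurable borel"
      using C0_inf_measurable f g(1) by (intro borel_measurable_times borel_measurable_exp) auto
    show "\<bar>g x * exp (f x)\<bar> \<le> bg * bf" for x
      unfolding abs_mult using bg bf by (intro mult_mono) auto
  qed simp
  have J0: "0 \<le> (\<integral>x. g x * exp (f x) \<partial>\<sigma>)" using g(2) by (intro Bochner_Integration.integral_nonneg) auto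
  have "(\<integral>\<^sup>+x. ennreal (g x) * ennreal (exp (pairing f (insert x \<gamma>))) \<partial>\<sigma>) =
      ennreal (\<integral>x. g x * exp (f x) \<partial>\<sigma>) * ennreal (exp (pairing f \<gamma>))" if "\<gamma> \<in> space \<pi>" for \<gamma>
  proof -
    have c: "\<gamma> \<in> configs" using that by (simp add: space_\<pi>)
    have "(\<integral>\<^sup>+x. ennreal (g x) * ennreal (exp (pairing f (insert x \<gamma>))) \<partial>\<sigma>) =
        (\<integral>\<^sup>+x. ennreal (g x * exp (f x)) * ennreal (exp (pairing f \<gamma>)) \<partial>\<sigma>)"
    proof (rule nn_integral_cong_AE, rule eventually_mono[OF \<sigma>_not_in_config[OF c]])
      fix x assume "x \<notin> \<gamma>"
      then show "ennreal (g x) * ennreal (exp (pairing f (insert x \<gamma>))) = ennreal (g x * exp (f x)) * ennreal (exp (pairing f \<gamma>))"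
        using g(2) by (simp add: pairing_insert[OF M f c] exp_add ennreal_mult' mult.assoc)
    qed
    also have "\<dots> = (\<integral>\<^sup>+x. ennreal (g x * exp (f x)) \<partial>\<sigma>) * ennreal (exp (pairing f \<gamma>))"
      by (rule nn_integral_multc) measurable
    also have "(\<integral>\<^sup>+x. ennreal (g x * exp (f x)) \<partial>\<sigma>) = ennreal (\<integral>x. g x * exp (f x) \<partial>\<sigma>)"
      using g(2) by (intro nn_integral_eq_integral int) auto
    finally show ?thesis .
  qed
  then have "(\<integral>\<^sup>+\<gamma>. \<integral>\<^sup>+x. ennreal (g x) * ennreal (exp (pairing f (insert x \<gamma>))) \<partial>\<sigma> \<partial>\<pi>) =
      (\<integral>\<^sup>+\<gamma>. ennreal (\<integral>x. g x * exp (f x) \<partial>\<sigma>) * ennreal (exp (pairing f \<gamma>)) \<partial>\<pi>)"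
    by (intro nn_integral_cong) simp
  also have "\<dots> = ennreal (\<integral>x. g x * exp (f x) \<partial>\<sigma>) * (\<integral>\<^sup>+\<gamma>. ennreal (exp (pairing f \<gamma>)) \<partial>\<pi>)"
    using pairing_measurable_\<pi>[OF f] by (intro nn_integral_cmult) simp
  also have "(\<integral>\<^sup>+\<gamma>. ennreal (exp (pairing f \<gamma>)) \<partial>\<pi>) = ennreal (\<integral>\<gamma>. exp (pairing f \<gamma>) \<partial>\<pi>)"
    by (intro nn_integral_eq_integral Laplace(2) f) auto
  finally show ?thesis using J0 by (simp add: ennreal_mult'' mult.commute)
qed

definition tests :: "('a \<times> 'a set \<Rightarrow> real) set" where
  "tests = {\<lambda>(x, \<gamma>). a x * exp (pairing f \<gamma>) | a f.
     (a = (\<lambda>_. 1) \<or> a \<in> C0_inf M) \<and> (\<forall>x. 0 \<le> a x \<and> a x \<le> 1) \<and> f \<in> C0_inf M \<and> (\<forall>x. f x \<le> 0)}"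

lemma testsI:
  assumes "a = (\<lambda>_. 1) \<or> a \<in> C0_inf M" "\<And>x. 0 \<le> a x \<and> a x \<le> 1" "f \<in> C0_inf M" "\<And>x. f x \<le> 0"
  shows "(\<lambda>(x, \<gamma>). a x * exp (pairing f \<gamma>)) \<in> tests"
  unfolding tests_def using assms by (intro CollectI exI[of _ a] exI[of _ f]) auto

lemma testsE:
  assumes "h \<in> tests"
  obtains a f where "h = (\<lambda>(x, \<gamma>). a x * exp (pairing f \<gamma>))" "a = (\<lambda>_. 1) \<or> a \<in> C0_inf M"
    "\<And>x. 0 \<le> a x \<and> a x \<le> 1" "f \<in> C0_inf M" "\<And>x. f x \<le> 0"
  using assms unfolding tests_def mem_Collect_eq
  by (elim exE conjE) (rule that, assumption, assumption, blast, assumption, blast)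

lemma tests_measurable: "h \<in> tests \<Longrightarrow> h \<in> borel_measurable BC"
proof -
  assume "h \<in> tests"
  then obtain a f where h: "h = (\<lambda>(x, \<gamma>). a x * exp (pairing f \<gamma>))" "a = (\<lambda>_. 1) \<or> a \<in> C0_inf M"
    "\<And>x. 0 \<le> a x \<and> a x \<le> 1" "f \<in> C0_inf M" "\<And>x. f x \<le> 0" by (rule testsE) (rule that; assumption)
  have [measurable]: "a \<in> borel_measurable borel" using h(2) C0_inf_measurable by auto
  note [measurable] = measurable_pairing_local_borel[OF M h(4)]
  show ?thesis unfolding h(1) by measurable
qed

lemma tests_bounds: "h \<in> tests \<Longrightarrow> 0 \<le> h z \<and> h z \<le> 1"
proof -
  assume "h \<in> tests"
  then obtain a f where h: "h = (\<lambda>(x, \<gamma>). a x * exp (pairing f \<gamma>))" "a = (\<lambda>_. 1) \<or> a \<in> C0_inf M"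
    "\<And>x. 0 \<le> a x \<and> a x \<le> 1" "f \<in> C0_inf M" "\<And>x. f x \<le> 0" by (rule testsE) (rule that; assumption)
  have "0 \<le> pairing (\<lambda>x. - 1 * f x) (snd z)" using h(5) by (intro pairing_nonneg) simp
  then have "pairing f (snd z) \<le> 0" unfolding pairing_cmult by simp
  then show ?thesis using h(3)[of "fst z"] by (simp add: h(1) case_prod_beta' mult_le_one)
qed

text \<open>Products of tests agree with tests only on the space, because pairings are additive only
  on configurations. For this reason the uniqueness theorem is applied to functions that coincide
  with a test on the space.\<close>

lemma tests_mult: "h \<in> tests \<Longrightarrow> h' \<in> tests \<Longrightarrow> u = (\<lambda>z. h z * h' z) \<Longrightarrow> \<exists>v\<in>tests. \<forall>z\<in>space BC. u z = v z"
proof -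
  assume "h \<in> tests" "h' \<in> tests" and u: "u = (\<lambda>z. h z * h' z)"
  obtain a f where h: "h = (\<lambda>(x, \<gamma>). a x * exp (pairing f \<gamma>))" "a = (\<lambda>_. 1) \<or> a \<in> C0_inf M"
    "\<And>x. 0 \<le> a x \<and> a x \<le> 1" "f \<in> C0_inf M" "\<And>x. f x \<le> 0"
    by (rule testsE[OF \<open>h \<in> tests\<close>]) (rule that; assumption)
  obtain a' f' where h': "h' = (\<lambda>(x, \<gamma>). a' x * exp (pairing f' \<gamma>))" "a' = (\<lambda>_. 1) \<or> a' \<in> C0_inf M"
    "\<And>x. 0 \<le> a' x \<and> a' x \<le> 1" "f' \<in> C0_inf M" "\<And>x. f' x \<le> 0"
    by (rule testsE[OF \<open>h' \<in> tests\<close>]) (rule that; assumption)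
  have "(\<lambda>(x, \<gamma>). (a x * a' x) * exp (pairing (\<lambda>x. f x + f' x) \<gamma>)) \<in> tests"
  proof (rule testsI)
    show "(\<lambda>x. a x * a' x) = (\<lambda>_. 1) \<or> (\<lambda>x. a x * a' x) \<in> C0_inf M"
      using h(2) h'(2) C0_inf_mult[OF M, of a a'] by auto
    show "0 \<le> a x * a' x \<and> a x * a' x \<le> 1" for x using h(3)[of x] h'(3)[of x] by (simp add: mult_le_one)
    show "(\<lambda>x. f x + f' x) \<in> C0_inf M" by (rule C0_inf_add[OF M h(4) h'(4)])
    show "f x + f' x \<le> 0" for x using h(5)[of x] h'(5)[of x] by simp
  qed
  moreover have "u z = (\<lambda>(x, \<gamma>). (a x * a' x) * exp (pairing (\<lambda>x. f x + f' x) \<gamma>)) z" if "z \<in> space BC" for z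
    using that pairing_add[OF M h(4) h'(4), of "snd z"]
    by (auto simp: u h(1) h'(1) space_pair_measure exp_add mult_ac)
  ultimately show ?thesis by blast
qed

text \<open>Both coordinates are recovered from the tests: \<open>x\<close> from bumps
  \<open>a\<close> with \<open>f = 0\<close>, and \<open>\<gamma>\<close> from \<open>a = 1\<close>,
  since the pairing with a nonnegative \<open>f\<close> is minus the logarithm of a test.\<close>

lemma sets_BC_tests: "sets BC \<subseteq> sigma_sets (space BC) {h -` {b<..} \<inter> space BC | h b. h \<in> tests}"
proof -
  define N where "N = sigma (space BC) {h -` {b<..} \<inter> space BC | h b. h \<in> tests}"
  have gs: "{h -` {b<..} \<inter> space BC | h b. h \<in> tests} \<subseteq> Pow (space BC)" by auto
  have sN: "space N = space BC" "sets N = sigma_sets (space BC) {h -` {b<..} \<inter> space BC | h b. h \<in> tests}"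
    unfolding N_def using gs by (auto intro: space_measure_of sets_measure_of)
  have hm: "h \<in> borel_measurable N" if "h \<in> tests" for h
  proof (rule borel_measurable_iff_greater[THEN iffD2], intro allI)
    fix b
    have "h -` {b<..} \<inter> space BC \<in> sets N" unfolding sN using that by (intro sigma_sets.Basic) blast
    moreover have "{z \<in> space N. b < h z} = h -` {b<..} \<inter> space BC" using sN by auto
    ultimately show "{z \<in> space N. b < h z} \<in> sets N" by simp
  qed
  have p0: "pairing (\<lambda>_. 0) \<gamma> = 0" for \<gamma> :: "'a set" unfolding pairing_def by simp
  have fst: "fst \<in> N \<rightarrow>\<^sub>M borel"
  proof (rule measurable_sigma_sets[OF sigma_sets_bump_open[OF M, symmetric]])
    fix U assume U: "U \<in> bump_open M"
    then obtain u where u: "\<And>k x. u k \<in> C0_inf M \<and> 0 \<le> u k x \<and> u k x \<le> 1 \<and> (x \<notin> U \<longrightarrow> u k x = 0) \<and> (\<lambda>k::nat. u k x) \<longlonglongrightarrow> indicator U x"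
      unfolding bump_open_def by blast
    have "(\<lambda>(x, \<gamma>). u k x * exp (pairing (\<lambda>_. 0) \<gamma>)) \<in> tests" for k
      by (rule testsI) (use u C0_inf_0 in auto)
    then have uk: "(\<lambda>z. u k (fst z)) \<in> borel_measurable N" for k
      using hm[of "\<lambda>(x, \<gamma>). u k x * exp (pairing (\<lambda>_. 0) \<gamma>)"] by (simp add: p0 case_prod_beta')
    have "(\<lambda>z. indicator U (fst z) :: real) \<in> borel_measurable N"
    proof (rule borel_measurable_LIMSEQ_real)
      show "(\<lambda>k. u k (fst z)) \<longlonglongrightarrow> indicator U (fst z)" for z :: "'a \<times> 'a set" using u by blast
    qed (rule uk)
    then have "(\<lambda>z. indicator U (fst z) :: real) -` {1} \<inter> space N \<in> sets N"
      by (rule measurable_sets) simp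
    moreover have "(\<lambda>z. indicator U (fst z) :: real) -` {1} \<inter> space N = fst -` U \<inter> space N"
      by (auto simp: indicator_def)
    ultimately show "fst -` U \<inter> space N \<in> sets N" by simp
  qed auto
  have snd: "snd \<in> N \<rightarrow>\<^sub>M local_borel (UNIV :: 'a set)"
  proof (rule measurable_config_pairing[OF M])
    show "snd z \<in> configs" if "z \<in> space N" for z using that sN by (auto simp: space_pair_measure)
    fix f assume f: "f \<in> C0_inf M" "\<And>x. 0 \<le> f x"
    have "(\<lambda>(x, \<gamma>). (\<lambda>_. 1) x * exp (pairing (\<lambda>x. - 1 * f x) \<gamma>)) \<in> tests"
      by (rule testsI) (use f C0_inf_const_mult[OF M f(1), of "- 1"] in auto)
    from hm[OF this] have "(\<lambda>z. exp (- pairing f (snd z))) \<in> borel_measurable N"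
      unfolding pairing_cmult by (simp add: case_prod_beta')
    then have "(\<lambda>z. - ln (exp (- pairing f (snd z)))) \<in> borel_measurable N" by measurable
    then show "(\<lambda>z. pairing f (snd z)) \<in> borel_measurable N" by simp
  qed
  have "(\<lambda>z. z) \<in> N \<rightarrow>\<^sub>M BC" using measurable_Pair[OF fst snd] by simp
  then have "A \<in> sets N" if "A \<in> sets BC" for A
    using measurable_sets[OF _ that] sets.sets_into_space[OF that] sN(1) by (metis Int_absorb2 vimage_ident)
  then show ?thesis unfolding sN(2) by blast
qed

text \<open>The compactly supported weight \<open>h0\<close> makes the two measures on pairs finite,
  as their total masses are given by the formulas for test functions. Finiteness is what the
  uniqueness theorem asks for.\<close>

lemma Mecke_weighted:
  assumes h0: "h0 \<in> C0_inf M" "\<And>x. 0 \<le> h0 x" "\<And>x. h0 x \<le> 1" and u: "u \<in> borel_measurable BC"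
  shows "(\<integral>\<^sup>+\<gamma>. \<integral>\<^sup>+x. ennreal (h0 x) * u (x, \<gamma>) \<partial>count_space \<gamma> \<partial>\<pi>) =
    (\<integral>\<^sup>+\<gamma>. \<integral>\<^sup>+x. ennreal (h0 x) * u (x, insert x \<gamma>) \<partial>\<sigma> \<partial>\<pi>)"
proof -
  have hm[measurable]: "h0 \<in> borel_measurable borel" by (rule C0_inf_measurable[OF h0(1)])
  obtain P where P: "sets P = sets BC"
    "\<And>u. u \<in> borel_measurable BC \<Longrightarrow> (\<integral>\<^sup>+z. u z \<partial>P) = (\<integral>\<^sup>+\<gamma>. \<integral>\<^sup>+x. ennreal (h0 x) * u (x, \<gamma>) \<partial>count_space \<gamma> \<partial>\<pi>)"
  proof (rule ex_iterated_measure[where N = BC and \<kappa> = count_space and T = "\<lambda>x \<gamma>. (x, \<gamma>)" and w = "\<lambda>x _. ennreal (h0 x)" and \<pi> = \<pi>])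
    fix u :: "'a \<times> 'a set \<Rightarrow> ennreal" assume [measurable]: "u \<in> borel_measurable BC"
    have "(\<lambda>z. ennreal (h0 (fst z)) * u z) \<in> borel_measurable BC" by measurable
    from measurable_sum_points[OF M this]
    show "(\<lambda>\<gamma>. \<integral>\<^sup>+x. ennreal (h0 x) * u (x, \<gamma>) \<partial>count_space \<gamma>) \<in> borel_measurable \<pi>"
      by (intro measurable_\<pi>) simp
  qed (auto simp: space_\<pi> space_pair_measure intro: that)
  obtain Q where Q: "sets Q = sets BC"
    "\<And>u. u \<in> borel_measurable BC \<Longrightarrow> (\<integral>\<^sup>+z. u z \<partial>Q) = (\<integral>\<^sup>+\<gamma>. \<integral>\<^sup>+x. ennreal (h0 x) * u (x, insert x \<gamma>) \<partial>\<sigma> \<partial>\<pi>)"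
  proof (rule ex_iterated_measure[where N = BC and \<kappa> = "\<lambda>_. \<sigma>" and T = "\<lambda>x \<gamma>. (x, insert x \<gamma>)" and w = "\<lambda>x _. ennreal (h0 x)" and \<pi> = \<pi>])
    fix u :: "'a \<times> 'a set \<Rightarrow> ennreal" assume u: "u \<in> borel_measurable BC"
    note [measurable] = measurable_insert_pair[OF u]
    have m: "(\<lambda>z. ennreal (h0 (fst z)) * (case z of (x, \<gamma>) \<Rightarrow> u (x, insert x \<gamma>))) \<in> borel_measurable BC" by measurable
    from measurable_\<sigma>_integral[OF this]
    show "(\<lambda>\<gamma>. \<integral>\<^sup>+x. ennreal (h0 x) * u (x, insert x \<gamma>) \<partial>\<sigma>) \<in> borel_measurable \<pi>"
      by (intro measurable_\<pi>) simp
  next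
    show "(\<lambda>x. (x, insert x \<gamma>)) \<in> \<sigma> \<rightarrow>\<^sub>M BC" if "\<gamma> \<in> space \<pi>" for \<gamma>
    proof -
      have "(\<lambda>x. (x, \<gamma>)) \<in> borel \<rightarrow>\<^sub>M BC" using that by (intro measurable_Pair2') (simp add: space_\<pi>)
      from measurable_compose[OF this measurable_insert_point] show ?thesis by (simp add: measurable_\<sigma>_iff)
    qed
  qed (auto simp: measurable_\<sigma>_iff intro: that)
  have ah: "\<exists>g\<in>C0_inf M. (\<forall>x. 0 \<le> g x) \<and> (\<forall>x. h0 x * a x = g x)"
    if "a = (\<lambda>_. 1) \<or> a \<in> C0_inf M" "\<And>x. 0 \<le> a x \<and> a x \<le> 1" for a
    using that h0 C0_inf_mult[OF M h0(1), of a] by (intro bexI[of _ "\<lambda>x. h0 x * a x"]) auto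
  have eq: "(\<integral>\<^sup>+z. ennreal (h z) \<partial>P) = (\<integral>\<^sup>+z. ennreal (h z) \<partial>Q) \<and> (\<integral>\<^sup>+z. ennreal (h z) \<partial>P) < \<infinity>" if "h \<in> tests" for h
  proof -
    obtain a f where h: "h = (\<lambda>(x, \<gamma>). a x * exp (pairing f \<gamma>))" "a = (\<lambda>_. 1) \<or> a \<in> C0_inf M"
      "\<And>x. 0 \<le> a x \<and> a x \<le> 1" "f \<in> C0_inf M" "\<And>x. f x \<le> 0"
      by (rule testsE[OF \<open>h \<in> tests\<close>]) (rule that; assumption)
    obtain g where g: "g \<in> C0_inf M" "\<And>x. 0 \<le> g x" "\<And>x. h0 x * a x = g x" using ah[OF h(2,3)] by blast
    have hh: "ennreal (h0 x) * ennreal (h (x, \<gamma>)) = ennreal (g x) * ennreal (exp (pairing f \<gamma>))" for x \<gamma>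
      using h(3)[of x] h0(2)[of x] g(2)[of x] by (simp add: h(1) ennreal_mult'[symmetric] g(3)[symmetric] mult.assoc)
    have m: "(\<lambda>z. ennreal (h z)) \<in> borel_measurable BC" using tests_measurable[OF that] by simp
    show ?thesis
      unfolding P(2)[OF m] Q(2)[OF m] hh test_functions_points[OF h(4) g(1,2)] test_functions_insert[OF h(4) g(1,2)] by simp
  qed
  have one: "(\<lambda>(x, \<gamma>). (\<lambda>_. 1) x * exp (pairing (\<lambda>_. 0) \<gamma>)) \<in> tests" by (rule testsI) (auto simp: C0_inf_0)
  have one': "(\<lambda>(x :: 'a, \<gamma> :: 'a set). (\<lambda>_. 1) x * exp (pairing (\<lambda>_. 0) \<gamma>)) = (\<lambda>_. 1)"
    by (simp add: fun_eq_iff pairing_def)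
  have 1: "(\<lambda>_. 1) \<in> tests" using one unfolding one' .
  have fin: "finite_measure P" "finite_measure Q" using eq[OF 1] by (auto intro!: finite_measureI)
  define H where "H = {h \<in> borel_measurable BC. \<exists>v\<in>tests. \<forall>z\<in>space BC. h z = v z}"
  have sPQ: "space P = space BC" "space Q = space BC" using P(1) Q(1) by (auto dest: sets_eq_imp_space_eq)
  have "P = Q"
  proof (rule multiplicative_class_measure_eq[where H = H, OF fin])
    show "sets Q = sets P" using P(1) Q(1) by simp
    show "h \<in> borel_measurable P" if "h \<in> H" for h
      using that unfolding H_def measurable_cong_sets[OF P(1) refl] by blast
    show "0 \<le> h z \<and> h z \<le> 1" if "h \<in> H" "z \<in> space P" for h z
    proof -
      obtain v where "v \<in> tests" "h z = v z" using \<open>h \<in> H\<close> \<open>z \<in> space P\<close> sPQ(1) unfolding H_def by auto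
      then show ?thesis using tests_bounds[of v z] by simp
    qed
    show "(\<lambda>z. h z * h' z) \<in> H" if "h \<in> H" "h' \<in> H" for h h'
    proof -
      obtain v v' where v: "v \<in> tests" "v' \<in> tests" "\<forall>z\<in>space BC. h z = v z" "\<forall>z\<in>space BC. h' z = v' z"
        using \<open>h \<in> H\<close> \<open>h' \<in> H\<close> unfolding H_def by blast
      obtain v'' where "v'' \<in> tests" "\<forall>z\<in>space BC. v z * v' z = v'' z" using tests_mult[OF v(1,2) refl] by blast
      moreover have "(\<lambda>z. h z * h' z) \<in> borel_measurable BC" using that unfolding H_def by auto
      ultimately show ?thesis unfolding H_def using v(3,4) by auto
    qed
    show "(\<lambda>_. 1) \<in> H" using 1 unfolding H_def by auto
    show "(\<integral>z. h z \<partial>P) = (\<integral>z. h z \<partial>Q)" if "h \<in> H" for h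
    proof -
      obtain v where v: "v \<in> tests" "\<forall>z\<in>space BC. h z = v z" using \<open>h \<in> H\<close> unfolding H_def by blast
      have r: "(\<integral>z. h z \<partial>R) = enn2real (\<integral>\<^sup>+z. ennreal (v z) \<partial>R)" if R: "sets R = sets BC" for R
      proof -
        have "(\<integral>z. h z \<partial>R) = (\<integral>z. v z \<partial>R)"
          using v(2) sets_eq_imp_space_eq[OF R] by (intro Bochner_Integration.integral_cong) auto
        also have "\<dots> = enn2real (\<integral>\<^sup>+z. ennreal (v z) \<partial>R)"
          using tests_measurable[OF v(1)] tests_bounds[OF v(1)]
          by (intro integral_eq_nn_integral) (auto simp: measurable_cong_sets[OF R refl])
        finally show ?thesis .
      qed
      show ?thesis unfolding r[OF P(1)] r[OF Q(1)] using eq[OF v(1)] by simp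
    qed
    have "tests \<subseteq> H" using tests_measurable unfolding H_def by blast
    then have "{h -` {b<..} \<inter> space BC | h b. h \<in> tests} \<subseteq> {h -` {b<..} \<inter> space BC | h b. h \<in> H}" by blast
    from sigma_sets_mono'[OF this] sets_BC_tests
    show "sets P \<subseteq> sigma_sets (space P) {h -` {a<..} \<inter> space P | h a. h \<in> H}"
      unfolding P(1) sPQ(1) by (rule order_trans[rotated])
  qed
  then show ?thesis using P(2)[OF u] Q(2)[OF u] by simp
qed

end

section \<open>The Georgii--Nguyen--Zessin identity\<close>

lemma measurable_ennreal_times:
  fixes f g :: "'b \<Rightarrow> ennreal"
  assumes "f \<in> borel_measurable N" "g \<in> borel_measurable N"
  shows "(\<lambda>x. f x * g x) \<in> borel_measurable N"
  using assms by measurable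

context poisson_setup
begin

text \<open>A partition of unity built from countably many bumps reduces the general case to
  weighted ones; all terms are nonnegative, so sums and integrals may be exchanged.\<close>

theorem Mecke:
  assumes u: "u \<in> borel_measurable BC"
  shows "(\<integral>\<^sup>+\<gamma>. \<integral>\<^sup>+x. u (x, \<gamma>) \<partial>count_space \<gamma> \<partial>\<pi>) = (\<integral>\<^sup>+\<gamma>. \<integral>\<^sup>+x. u (x, insert x \<gamma>) \<partial>\<sigma> \<partial>\<pi>)"
proof -
  obtain D where D: "D \<subseteq> chart_balls M" "countable D" "\<Union>D = (UNIV :: 'a set)"
    by (rule open_eq_countable_chart_balls[OF M open_UNIV]) (rule that; assumption)
  have "D \<noteq> {}" using D(3) by auto
  define B where "B = from_nat_into D"
  have B: "B i \<in> bump_open M" for i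
    using from_nat_into[OF \<open>D \<noteq> {}\<close>] D(1) chart_balls_bump_open[OF M] unfolding B_def by blast
  have "\<exists>v. \<forall>k x. v k \<in> C0_inf M \<and> 0 \<le> v k x \<and> v k x \<le> 1 \<and> (x \<notin> B i \<longrightarrow> v k x = 0) \<and> (\<lambda>k::nat. v k x) \<longlonglongrightarrow> indicator (B i) x" for i
    using B[of i] unfolding bump_open_def by blast
  then have "\<forall>i. \<exists>v. \<forall>k x. v k \<in> C0_inf M \<and> 0 \<le> v k x \<and> v k x \<le> 1 \<and> (x \<notin> B i \<longrightarrow> v k x = 0) \<and> (\<lambda>k::nat. v k x) \<longlonglongrightarrow> indicator (B i) x"
    by blast
  from choice[OF this] obtain v where v: "\<And>i k x. v i k \<in> C0_inf M \<and> 0 \<le> v i k x \<and> v i k x \<le> 1 \<and>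
      (x \<notin> B i \<longrightarrow> v i k x = 0) \<and> (\<lambda>k::nat. v i k x) \<longlonglongrightarrow> indicator (B i) x" by blast
  define h where "h j = v (fst (prod_decode j)) (snd (prod_decode j))" for j
  have h: "h j \<in> C0_inf M" "0 \<le> h j x" "h j x \<le> 1" for j x unfolding h_def using v by auto
  have hpos: "\<exists>j. h j x > 0" for x
  proof -
    have "x \<in> \<Union>D" using D(3) by simp
    then obtain i where "x \<in> B i" using range_from_nat_into[OF \<open>D \<noteq> {}\<close> D(2)] unfolding B_def by blast
    then have "(\<lambda>k. v i k x) \<longlonglongrightarrow> 1" using v[of i _ x] by (simp add: indicator_def)
    from order_tendstoD(1)[OF this, of 0] obtain k where "v i k x > 0"
      unfolding eventually_sequentially by auto
    then show ?thesis by (intro exI[of _ "prod_encode (i, k)"]) (simp add: h_def)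
  qed
  have hm[measurable]: "h j \<in> borel_measurable borel" for j by (rule C0_inf_measurable[OF h(1)])
  define V where "V j = {x. h j x > 0}" for j
  have Vb: "V j \<in> sets borel" for j unfolding V_def by measurable
  have Db[measurable]: "disjointed V j \<in> sets borel" for j
    using sets.range_disjointed_sets[of V borel] Vb by auto
  \<comment> \<open>Chosen so that \<open>h j * w j\<close> is the indicator of the
    \<open>j\<close>-th set of a partition of the space. On that set \<open>h j\<close> is positive,
    so the division is harmless.\<close>
  define w where "w j x = indicator (disjointed V j) x * ennreal (1 / h j x)" for j x
  have wm[measurable]: "w j \<in> borel_measurable borel" for j unfolding w_def by measurable
  have "ennreal (h j x) * w j x = indicator (disjointed V j) x" for j x
  proof (cases "x \<in> disjointed V j")
    case True
    then have "h j x > 0" using disjointed_subset[of V j] by (auto simp: V_def)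
    then show ?thesis using True by (simp add: w_def flip: ennreal_mult)
  qed (simp add: w_def)
  moreover have "(\<Sum>j. indicator (disjointed V j) x) = (1 :: ennreal)" for x
  proof -
    have "x \<in> (\<Union>j. disjointed V j)" using hpos[of x] by (simp add: UN_disjointed_eq V_def)
    then show ?thesis using suminf_indicator[OF disjoint_family_disjointed[of V], of x] by simp
  qed
  ultimately have part: "(\<Sum>j. ennreal (h j x) * (w j x * c)) = c" for x and c :: ennreal
    by (simp add: mult.assoc[symmetric] ennreal_suminf_multc)
  have uj: "(\<lambda>(x, \<gamma>). w j x * u (x, \<gamma>)) \<in> borel_measurable BC" for j using u by measurable
  have hw: "(\<lambda>(x, \<gamma>). ennreal (h j x) * (w j x * u (x, \<gamma>))) \<in> borel_measurable BC" for j using u by measurable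
  have "(\<integral>\<^sup>+\<gamma>. \<integral>\<^sup>+x. u (x, \<gamma>) \<partial>count_space \<gamma> \<partial>\<pi>) =
      (\<integral>\<^sup>+\<gamma>. (\<Sum>j. \<integral>\<^sup>+x. ennreal (h j x) * (w j x * u (x, \<gamma>)) \<partial>count_space \<gamma>) \<partial>\<pi>)"
    by (subst nn_integral_suminf[symmetric]) (simp_all add: part)
  also have "\<dots> = (\<Sum>j. \<integral>\<^sup>+\<gamma>. \<integral>\<^sup>+x. ennreal (h j x) * (w j x * u (x, \<gamma>)) \<partial>count_space \<gamma> \<partial>\<pi>)"
    using measurable_\<pi>[OF measurable_sum_points[OF M hw]] by (intro nn_integral_suminf) simp
  also have "\<dots> = (\<Sum>j. \<integral>\<^sup>+\<gamma>. \<integral>\<^sup>+x. ennreal (h j x) * (w j x * u (x, insert x \<gamma>)) \<partial>\<sigma> \<partial>\<pi>)"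
    using Mecke_weighted[OF h uj] by simp
  also have "\<dots> = (\<integral>\<^sup>+\<gamma>. (\<Sum>j. \<integral>\<^sup>+x. ennreal (h j x) * (w j x * u (x, insert x \<gamma>)) \<partial>\<sigma>) \<partial>\<pi>)"
    using measurable_\<pi>[OF measurable_\<sigma>_integral[OF measurable_insert_pair[OF hw]]]
    by (intro nn_integral_suminf[symmetric]) simp
  also have "\<dots> = (\<integral>\<^sup>+\<gamma>. \<integral>\<^sup>+x. u (x, insert x \<gamma>) \<partial>\<sigma> \<partial>\<pi>)"
  proof (rule nn_integral_cong)
    fix \<gamma> assume "\<gamma> \<in> space \<pi>"
    then have c: "\<gamma> \<in> configs" by (simp add: space_\<pi>)
    have "(\<lambda>x. ennreal (h j x) * (w j x * u (x, insert x \<gamma>))) \<in> borel_measurable \<sigma>" for j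
      using measurable_section[OF measurable_insert_pair[OF hw] c, of j] by (simp add: measurable_\<sigma>_iff)
    then show "(\<Sum>j. \<integral>\<^sup>+x. ennreal (h j x) * (w j x * u (x, insert x \<gamma>)) \<partial>\<sigma>) = (\<integral>\<^sup>+x. u (x, insert x \<gamma>) \<partial>\<sigma>)"
      by (subst nn_integral_suminf[symmetric]) (simp_all add: part)
  qed
  finally show ?thesis .
qed

end

section \<open>Gibbs measures\<close>

locale gibbs_setup = poisson_setup M \<sigma> \<pi>
  for M :: "('a::{t2_space,second_countable_topology}, 'n::finite) riemannian"
    and \<sigma> :: "'a measure" and \<pi> :: "'a set measure" +
  fixes \<Phi> :: "'a set \<Rightarrow> ereal" and \<mu> :: "'a set measure"
  assumes potential: "potential \<Phi>" and prob_\<mu>: "prob_space \<mu>" and sets_\<mu>: "sets \<mu> = sets config_borel"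
    and DLR: "\<And>\<Lambda> \<Delta>. \<Lambda> \<in> open_c \<Longrightarrow> \<Delta> \<in> sets config_borel \<Longrightarrow>
      (\<integral>\<^sup>+\<gamma>. specification_kernel \<pi> \<Phi> \<Lambda> \<gamma> \<Delta> \<partial>\<mu>) = emeasure \<mu> \<Delta>"
begin

lemma space_\<mu>: "space \<mu> = configs"
  using sets_eq_imp_space_eq[OF sets_\<mu>] by simp

lemma measurable_id_\<mu>: "(\<lambda>\<gamma>. \<gamma>) \<in> \<mu> \<rightarrow>\<^sub>M local_borel UNIV"
  using measurable_config_borel[OF M] by (simp add: measurable_cong_sets[OF sets_\<mu> refl])

lemma measurable_\<mu>: "f \<in> local_borel UNIV \<rightarrow>\<^sub>M N \<Longrightarrow> f \<in> \<mu> \<rightarrow>\<^sub>M N"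
  by (rule measurable_compose[OF measurable_id_\<mu>])

lemma sets_local_borel_config_borel: "A \<in> sets (local_borel (UNIV :: 'a set)) \<Longrightarrow> A \<in> sets config_borel"
  using measurable_sets[OF measurable_config_borel[OF M], of A] sets.sets_into_space[of A "local_borel UNIV"]
  by (simp add: vimage_def Int_absorb2)

definition splice :: "'a set \<Rightarrow> 'a set \<Rightarrow> 'a set \<Rightarrow> 'a set" where
  "splice \<Lambda> \<gamma> \<eta> = (\<gamma> - \<Lambda>) \<union> (\<eta> \<inter> \<Lambda>)"

text \<open>The density of the specification kernel in the Poisson variable \<open>\<eta>\<close>.
  The normalisation depends on \<open>\<gamma>\<close> alone and is a constant when the Mecke
  identity is applied in \<open>\<eta>\<close>.\<close>

definition dlr_weight :: "'a set \<Rightarrow> 'a set \<Rightarrow> 'a set \<Rightarrow> ennreal" where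
  "dlr_weight \<Lambda> \<gamma> \<eta> = indicator {\<gamma>. partition_function \<pi> \<Phi> \<Lambda> \<gamma> < \<infinity>} \<gamma> *
     inverse (partition_function \<pi> \<Phi> \<Lambda> \<gamma>) * ennreal (exp_neg (energy \<Phi> \<Lambda> (splice \<Lambda> \<gamma> \<eta>)))"

lemma splice_configs: "\<gamma> \<in> configs \<Longrightarrow> \<eta> \<in> configs \<Longrightarrow> splice \<Lambda> \<gamma> \<eta> \<in> configs"
  unfolding splice_def by (intro configs_Un) (auto intro: configs_subset)

lemma measurable_splice:
  assumes "\<Lambda> \<in> open_c" "u \<in> borel_measurable (local_borel UNIV)"
  shows "(\<lambda>(\<gamma>, \<eta>). u (splice \<Lambda> \<gamma> \<eta>)) \<in> borel_measurable (local_borel UNIV \<Otimes>\<^sub>M local_borel UNIV)"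
proof -
  have "\<Lambda> \<in> sets borel" using assms(1) by (simp add: open_c_def)
  from measurable_compose[OF measurable_union_config[OF this] assms(2)]
  show ?thesis by (simp add: splice_def case_prod_beta')
qed

lemma measurable_\<pi>_integral:
  assumes "f \<in> borel_measurable (local_borel UNIV \<Otimes>\<^sub>M local_borel UNIV)"
  shows "(\<lambda>\<gamma>. \<integral>\<^sup>+\<eta>. f (\<gamma>, \<eta>) \<partial>\<pi>) \<in> borel_measurable (local_borel UNIV)"
proof -
  have "(\<lambda>p. (fst p, snd p)) \<in> local_borel UNIV \<Otimes>\<^sub>M \<pi> \<rightarrow>\<^sub>M local_borel UNIV \<Otimes>\<^sub>M local_borel UNIV"
    using measurable_\<pi>[of "\<lambda>\<gamma>. \<gamma>" "local_borel UNIV"]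
    by (intro measurable_Pair measurable_fst measurable_compose[OF measurable_snd]) simp
  from measurable_compose[OF this assms] have "f \<in> borel_measurable (local_borel UNIV \<Otimes>\<^sub>M \<pi>)" by simp
  from borel_measurable_nn_integral_fst[OF this] show ?thesis .
qed

text \<open>The equilibrium equations speak of events. Both sides are measures on
  \<open>local_borel\<close>, so they agree on nonnegative functions as well.\<close>

lemma DLR_integral:
  assumes L: "\<Lambda> \<in> open_c" and G: "G \<in> borel_measurable (local_borel UNIV)"
  shows "(\<integral>\<^sup>+\<gamma>. G \<gamma> \<partial>\<mu>) = (\<integral>\<^sup>+\<gamma>. \<integral>\<^sup>+\<eta>. dlr_weight \<Lambda> \<gamma> \<eta> * G (splice \<Lambda> \<gamma> \<eta>) \<partial>\<pi> \<partial>\<mu>)"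
proof -
  have em: "(\<lambda>(\<gamma>, \<eta>). ennreal (exp_neg (energy \<Phi> \<Lambda> (splice \<Lambda> \<gamma> \<eta>)))) \<in> borel_measurable (local_borel UNIV \<Otimes>\<^sub>M local_borel UNIV)"
    using measurable_splice[OF L, of "\<lambda>\<gamma>. ennreal (exp_neg (energy \<Phi> \<Lambda> \<gamma>))"]
      measurable_energy[OF M potential open_c_borel_c[OF L]] by simp
  have Zm[measurable]: "partition_function \<pi> \<Phi> \<Lambda> \<in> borel_measurable (local_borel UNIV)"
    unfolding partition_function_def[abs_def] splice_def[symmetric] using measurable_\<pi>_integral[OF em] by simp
  have Zi: "(\<lambda>\<gamma>. indicator {\<gamma>. partition_function \<pi> \<Phi> \<Lambda> \<gamma> < \<infinity>} \<gamma> * inverse (partition_function \<pi> \<Phi> \<Lambda> \<gamma>)) \<in> borel_measurable (local_borel UNIV)"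
  proof -
    have "(\<lambda>\<gamma>. if partition_function \<pi> \<Phi> \<Lambda> \<gamma> < \<infinity> then inverse (partition_function \<pi> \<Phi> \<Lambda> \<gamma>) else 0) \<in> borel_measurable (local_borel UNIV)"
      by measurable
    also have "(\<lambda>\<gamma>. if partition_function \<pi> \<Phi> \<Lambda> \<gamma> < \<infinity> then inverse (partition_function \<pi> \<Phi> \<Lambda> \<gamma>) else 0) =
       (\<lambda>\<gamma>. indicator {\<gamma>. partition_function \<pi> \<Phi> \<Lambda> \<gamma> < \<infinity>} \<gamma> * inverse (partition_function \<pi> \<Phi> \<Lambda> \<gamma>))"
      by (auto simp: fun_eq_iff indicator_def)
    finally show ?thesis .
  qed
  have wm: "(\<lambda>(\<gamma>, \<eta>). dlr_weight \<Lambda> \<gamma> \<eta>) \<in> borel_measurable (local_borel UNIV \<Otimes>\<^sub>M local_borel UNIV)"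
    unfolding dlr_weight_def
    using measurable_ennreal_times[OF measurable_compose[OF measurable_fst Zi, of "local_borel UNIV"] em] by (simp add: case_prod_beta')
  have wum: "(\<lambda>(\<gamma>, \<eta>). dlr_weight \<Lambda> \<gamma> \<eta> * u (splice \<Lambda> \<gamma> \<eta>)) \<in> borel_measurable (local_borel UNIV \<Otimes>\<^sub>M local_borel UNIV)"
    if "u \<in> borel_measurable (local_borel UNIV)" for u
    using measurable_ennreal_times[OF wm measurable_splice[OF L that]] by (simp add: case_prod_beta')
  have sec: "(\<lambda>\<eta>. f (\<gamma>, \<eta>)) \<in> borel_measurable \<pi>"
    if "f \<in> borel_measurable (local_borel UNIV \<Otimes>\<^sub>M local_borel UNIV)" "\<gamma> \<in> configs" for f :: "_ \<Rightarrow> ennreal" and \<gamma>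
  proof (rule measurable_\<pi>)
    have "Pair \<gamma> \<in> local_borel UNIV \<rightarrow>\<^sub>M local_borel UNIV \<Otimes>\<^sub>M local_borel UNIV"
      using that(2) by (intro measurable_Pair1') simp
    from measurable_compose[OF this that(1)] show "(\<lambda>\<eta>. f (\<gamma>, \<eta>)) \<in> borel_measurable (local_borel UNIV)" .
  qed
  obtain P where P: "sets P = sets (local_borel UNIV)"
    "\<And>u. u \<in> borel_measurable (local_borel UNIV) \<Longrightarrow> (\<integral>\<^sup>+z. u z \<partial>P) =
      (\<integral>\<^sup>+\<gamma>. \<integral>\<^sup>+\<eta>. dlr_weight \<Lambda> \<gamma> \<eta> * u (splice \<Lambda> \<gamma> \<eta>) \<partial>\<pi> \<partial>\<mu>)"
  proof (rule ex_iterated_measure[where N = "local_borel UNIV" and \<kappa> = "\<lambda>_. \<pi>" and T = "\<lambda>\<eta> \<gamma>. splice \<Lambda> \<gamma> \<eta>"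
        and w = "\<lambda>\<eta> \<gamma>. dlr_weight \<Lambda> \<gamma> \<eta>" and \<pi> = \<mu>])
    fix u :: "'a set \<Rightarrow> ennreal" assume u: "u \<in> borel_measurable (local_borel UNIV)"
    show "(\<lambda>\<gamma>. \<integral>\<^sup>+\<eta>. dlr_weight \<Lambda> \<gamma> \<eta> * u (splice \<Lambda> \<gamma> \<eta>) \<partial>\<pi>) \<in> borel_measurable \<mu>"
      using measurable_\<pi>_integral[OF wum[OF u]] by (intro measurable_\<mu>) simp
  next
    fix \<gamma> assume "\<gamma> \<in> space \<mu>"
    then have c: "\<gamma> \<in> configs" by (simp add: space_\<mu>)
    show "(\<lambda>\<eta>. dlr_weight \<Lambda> \<gamma> \<eta>) \<in> borel_measurable \<pi>" using sec[OF wm c] by simp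
    have "\<Lambda> \<in> sets borel" using L by (simp add: open_c_def)
    from measurable_compose[OF measurable_Pair1'[of \<gamma> "local_borel UNIV" "local_borel UNIV"] measurable_union_config[OF this]]
    show "(\<lambda>\<eta>. splice \<Lambda> \<gamma> \<eta>) \<in> \<pi> \<rightarrow>\<^sub>M local_borel UNIV"
      using c by (intro measurable_\<pi>) (simp add: splice_def)
  qed (rule that; assumption)
  have "P = distr \<mu> (local_borel UNIV) (\<lambda>\<gamma>. \<gamma>)"
  proof (rule measure_eqI)
    fix A assume "A \<in> sets P"
    then have A: "A \<in> sets (local_borel UNIV)" using P(1) by simp
    have "emeasure P A = (\<integral>\<^sup>+\<gamma>. \<integral>\<^sup>+\<eta>. dlr_weight \<Lambda> \<gamma> \<eta> * indicator A (splice \<Lambda> \<gamma> \<eta>) \<partial>\<pi> \<partial>\<mu>)"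
      using P(2)[of "indicator A"] A P(1) by simp
    also have "\<dots> = (\<integral>\<^sup>+\<gamma>. specification_kernel \<pi> \<Phi> \<Lambda> \<gamma> A \<partial>\<mu>)"
    proof (rule nn_integral_cong)
      fix \<gamma> assume "\<gamma> \<in> space \<mu>"
      then have c: "\<gamma> \<in> configs" by (simp add: space_\<mu>)
      have m: "(\<lambda>\<eta>. indicator A (splice \<Lambda> \<gamma> \<eta>) * ennreal (exp_neg (energy \<Phi> \<Lambda> (splice \<Lambda> \<gamma> \<eta>)))) \<in> borel_measurable \<pi>"
        using sec[OF measurable_ennreal_times[OF measurable_splice[OF L, of "indicator A"] em] c] A by simp
      show "(\<integral>\<^sup>+\<eta>. dlr_weight \<Lambda> \<gamma> \<eta> * indicator A (splice \<Lambda> \<gamma> \<eta>) \<partial>\<pi>) = specification_kernel \<pi> \<Phi> \<Lambda> \<gamma> A"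
        unfolding specification_kernel_def splice_def[symmetric] nn_integral_cmult[OF m, symmetric]
        by (intro nn_integral_cong) (simp add: dlr_weight_def mult_ac)
    qed
    also have "\<dots> = emeasure \<mu> A" by (rule DLR[OF L sets_local_borel_config_borel[OF A]])
    also have "\<dots> = emeasure (distr \<mu> (local_borel UNIV) (\<lambda>\<gamma>. \<gamma>)) A"
      using A sets.sets_into_space[OF A] by (simp add: emeasure_distr[OF measurable_id_\<mu>] space_\<mu> Int_absorb2)
    finally show "emeasure P A = emeasure (distr \<mu> (local_borel UNIV) (\<lambda>\<gamma>. \<gamma>)) A" .
  qed (simp add: P(1))
  then have "(\<integral>\<^sup>+z. G z \<partial>P) = (\<integral>\<^sup>+\<gamma>. G \<gamma> \<partial>\<mu>)"
    using nn_integral_distr[OF measurable_id_\<mu>, of G] G by simp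
  then show ?thesis using P(2)[OF G] by simp
qed

text \<open>By the equilibrium equations the points inside \<open>\<Lambda>\<close> may be taken
  from a Poisson configuration \<open>\<eta>\<close>. The Mecke identity for \<open>\<eta>\<close>
  adds a point \<open>x\<close>, the energy factorisation splits off the point energy of
  \<open>x\<close>, and the equilibrium equations are then used backwards.\<close>

lemma GNZ_local:
  assumes L: "\<Lambda> \<in> open_c" and f: "f \<in> borel_measurable BC" and f0: "\<And>x \<gamma>. x \<notin> \<Lambda> \<Longrightarrow> f (x, \<gamma>) = 0"
  shows "(\<integral>\<^sup>+\<gamma>. \<integral>\<^sup>+x. f (x, \<gamma>) \<partial>count_space \<gamma> \<partial>\<mu>) =
    (\<integral>\<^sup>+\<gamma>. \<integral>\<^sup>+x. f (x, insert x \<gamma>) * ennreal (exp_neg (point_energy \<Phi> x \<gamma>)) \<partial>\<sigma> \<partial>\<mu>)"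
proof -
  define J where "J \<gamma> = (\<integral>\<^sup>+x. f (x, \<gamma>) \<partial>count_space \<gamma>)" for \<gamma>
  define H where "H \<gamma> = (\<integral>\<^sup>+x. f (x, insert x \<gamma>) * ennreal (exp_neg (point_energy \<Phi> x \<gamma>)) \<partial>\<sigma>)" for \<gamma>
  have Jm: "J \<in> borel_measurable (local_borel UNIV)"
    unfolding J_def[abs_def] by (rule measurable_sum_points[OF M f])
  have hm: "(\<lambda>(x, \<gamma>). f (x, insert x \<gamma>) * ennreal (exp_neg (point_energy \<Phi> x \<gamma>))) \<in> borel_measurable BC"
    using measurable_ennreal_times[OF measurable_insert_pair[OF f] measurable_compose[OF measurable_point_energy[OF M potential] measurable_ennreal]]
    by (simp add: case_prod_beta')
  have Hm: "H \<in> borel_measurable (local_borel UNIV)"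
    unfolding H_def[abs_def] using measurable_\<sigma>_integral[OF hm] by simp
  have "(\<integral>\<^sup>+\<eta>. dlr_weight \<Lambda> \<gamma> \<eta> * J (splice \<Lambda> \<gamma> \<eta>) \<partial>\<pi>) = (\<integral>\<^sup>+\<eta>. dlr_weight \<Lambda> \<gamma> \<eta> * H (splice \<Lambda> \<gamma> \<eta>) \<partial>\<pi>)"
    if \<gamma>: "\<gamma> \<in> configs" for \<gamma>
  proof -
    \<comment> \<open>Here \<open>\<gamma>\<close> is fixed and \<open>K\<close> is a function of
      the point and the Poisson configuration. As \<open>f\<close> vanishes for \<open>x\<close> off
      \<open>\<Lambda>\<close>, summing over the points of the spliced configuration is summing
      \<open>K\<close> over the points of \<open>\<eta>\<close>.\<close>
    define K where "K = (\<lambda>(x, \<eta>). dlr_weight \<Lambda> \<gamma> \<eta> * f (x, splice \<Lambda> \<gamma> \<eta>))"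
    have sp: "(\<lambda>\<eta>. splice \<Lambda> \<gamma> \<eta>) \<in> local_borel UNIV \<rightarrow>\<^sub>M local_borel UNIV"
    proof -
      have "\<Lambda> \<in> sets borel" using L by (simp add: open_c_def)
      note u = measurable_union_config[OF this]
      have "Pair \<gamma> \<in> local_borel UNIV \<rightarrow>\<^sub>M local_borel UNIV \<Otimes>\<^sub>M local_borel UNIV"
        using \<gamma> by (intro measurable_Pair1') simp
      from measurable_compose[OF this u] show ?thesis by (simp add: splice_def)
    qed
    have em: "(\<lambda>\<eta>. exp_neg (energy \<Phi> \<Lambda> (splice \<Lambda> \<gamma> \<eta>))) \<in> borel_measurable (local_borel UNIV)"
      by (rule measurable_compose[OF sp measurable_energy[OF M potential open_c_borel_c[OF L]]])
    have wm: "dlr_weight \<Lambda> \<gamma> \<in> borel_measurable (local_borel UNIV)"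
      unfolding dlr_weight_def[abs_def] using em by measurable
    have "(\<lambda>p. (fst p, splice \<Lambda> \<gamma> (snd p))) \<in> BC \<rightarrow>\<^sub>M BC"
      by (intro measurable_Pair measurable_fst measurable_compose[OF measurable_snd sp])
    from measurable_ennreal_times[OF measurable_compose[OF measurable_snd wm] measurable_compose[OF this f]]
    have Km: "K \<in> borel_measurable BC" unfolding K_def by (simp add: case_prod_beta')
    have sec: "(\<lambda>x. f (x, insert x (splice \<Lambda> \<gamma> \<eta>)) * ennreal (exp_neg (point_energy \<Phi> x (splice \<Lambda> \<gamma> \<eta>)))) \<in> borel_measurable \<sigma>"
      if "\<eta> \<in> configs" for \<eta>
      using measurable_section[OF hm splice_configs[OF \<gamma> that, of \<Lambda>]] by (simp add: measurable_\<sigma>_iff)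
    have "(\<integral>\<^sup>+\<eta>. dlr_weight \<Lambda> \<gamma> \<eta> * J (splice \<Lambda> \<gamma> \<eta>) \<partial>\<pi>) = (\<integral>\<^sup>+\<eta>. \<integral>\<^sup>+x. K (x, \<eta>) \<partial>count_space \<eta> \<partial>\<pi>)"
    proof (rule nn_integral_cong)
      fix \<eta>
      have "dlr_weight \<Lambda> \<gamma> \<eta> * J (splice \<Lambda> \<gamma> \<eta>) = (\<integral>\<^sup>+x. dlr_weight \<Lambda> \<gamma> \<eta> * f (x, splice \<Lambda> \<gamma> \<eta>) \<partial>count_space (splice \<Lambda> \<gamma> \<eta>))"
        unfolding J_def by (rule nn_integral_cmult[symmetric]) simp
      also have "\<dots> = (\<integral>\<^sup>+x. K (x, \<eta>) \<partial>count_space \<eta>)"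
        unfolding nn_integral_count_space_restrict[where X = \<eta>] nn_integral_count_space_restrict[where X = "splice \<Lambda> \<gamma> \<eta>"]
      proof (rule nn_integral_cong)
        fix x
        show "dlr_weight \<Lambda> \<gamma> \<eta> * f (x, splice \<Lambda> \<gamma> \<eta>) * indicator (splice \<Lambda> \<gamma> \<eta>) x = K (x, \<eta>) * indicator \<eta> x"
          using f0[of x] by (cases "x \<in> \<Lambda>") (auto simp: K_def splice_def indicator_def)
      qed
      finally show "dlr_weight \<Lambda> \<gamma> \<eta> * J (splice \<Lambda> \<gamma> \<eta>) = (\<integral>\<^sup>+x. K (x, \<eta>) \<partial>count_space \<eta>)" .
    qed
    also have "\<dots> = (\<integral>\<^sup>+\<eta>. \<integral>\<^sup>+x. K (x, insert x \<eta>) \<partial>\<sigma> \<partial>\<pi>)" by (rule Mecke[OF Km])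
    also have "\<dots> = (\<integral>\<^sup>+\<eta>. dlr_weight \<Lambda> \<gamma> \<eta> * H (splice \<Lambda> \<gamma> \<eta>) \<partial>\<pi>)"
    proof (rule nn_integral_cong)
      fix \<eta> assume "\<eta> \<in> space \<pi>"
      then have \<eta>: "\<eta> \<in> configs" by (simp add: space_\<pi>)
      have "(\<integral>\<^sup>+x. K (x, insert x \<eta>) \<partial>\<sigma>) =
        (\<integral>\<^sup>+x. dlr_weight \<Lambda> \<gamma> \<eta> * (f (x, insert x (splice \<Lambda> \<gamma> \<eta>)) * ennreal (exp_neg (point_energy \<Phi> x (splice \<Lambda> \<gamma> \<eta>)))) \<partial>\<sigma>)"
      proof (rule nn_integral_cong_AE, rule eventually_mono[OF \<sigma>_not_in_config[OF \<eta>]])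
        fix x assume x: "x \<notin> \<eta>"
        show "K (x, insert x \<eta>) = dlr_weight \<Lambda> \<gamma> \<eta> * (f (x, insert x (splice \<Lambda> \<gamma> \<eta>)) * ennreal (exp_neg (point_energy \<Phi> x (splice \<Lambda> \<gamma> \<eta>))))"
        proof (cases "x \<in> \<Lambda>")
          case True
          have s: "splice \<Lambda> \<gamma> (insert x \<eta>) = insert x (splice \<Lambda> \<gamma> \<eta>)" using True by (auto simp: splice_def)
          have n: "x \<notin> splice \<Lambda> \<gamma> \<eta>" using True x by (auto simp: splice_def)
          show ?thesis
            unfolding K_def dlr_weight_def
            by (simp add: s exp_neg_energy_insert[OF True n] ennreal_mult exp_neg_nonneg mult_ac)
        qed (simp add: K_def f0)
      qed
      also have "\<dots> = dlr_weight \<Lambda> \<gamma> \<eta> * H (splice \<Lambda> \<gamma> \<eta>)"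
        unfolding H_def by (rule nn_integral_cmult[OF sec[OF \<eta>]])
      finally show "(\<integral>\<^sup>+x. K (x, insert x \<eta>) \<partial>\<sigma>) = dlr_weight \<Lambda> \<gamma> \<eta> * H (splice \<Lambda> \<gamma> \<eta>)" .
    qed
    finally show ?thesis .
  qed
  then have "(\<integral>\<^sup>+\<gamma>. J \<gamma> \<partial>\<mu>) = (\<integral>\<^sup>+\<gamma>. H \<gamma> \<partial>\<mu>)"
    unfolding DLR_integral[OF L Jm] DLR_integral[OF L Hm] by (rule nn_integral_cong) (simp add: space_\<mu>)
  then show ?thesis by (simp add: J_def H_def)
qed

text \<open>The pieces of the disjointed exhaustion are each contained in some \<open>W k\<close>,
  where the local identity applies; nonnegativity allows summation on both sides.\<close>

theorem GNZ:
  assumes f: "f \<in> borel_measurable BC"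
  shows "(\<integral>\<^sup>+\<gamma>. \<integral>\<^sup>+x. f (x, \<gamma>) \<partial>count_space \<gamma> \<partial>\<mu>) =
    (\<integral>\<^sup>+\<gamma>. \<integral>\<^sup>+x. f (x, insert x \<gamma>) * ennreal (exp_neg (point_energy \<Phi> x \<gamma>)) \<partial>\<sigma> \<partial>\<mu>)"
proof -
  obtain W :: "nat \<Rightarrow> 'a set" where W: "exhaustion W" by (rule open_exhaustion[OF M])
  note W = exhaustionD[OF W]
  define D where "D = disjointed W"
  have Db[measurable]: "D k \<in> sets borel" for k
  proof -
    have "W k \<in> sets borel" for k using W(2)[of k] by (simp add: open_c_def)
    then have "range W \<subseteq> sets borel" by auto
    from sets.range_disjointed_sets[OF this] show ?thesis by (auto simp: D_def)
  qed
  have one: "(\<Sum>k. indicator (D k) x) = (1 :: ennreal)" for x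
  proof -
    have "x \<in> (\<Union>k. D k)" using W(3) by (simp add: UN_disjointed_eq D_def)
    then show ?thesis using suminf_indicator[OF disjoint_family_disjointed[of W], of x] by (simp add: D_def)
  qed
  have part: "(\<Sum>k. c * indicator (D k) x) = c" for x and c :: ennreal
    using one by (simp add: ennreal_suminf_cmult)
  have part': "(\<Sum>k. c * indicator (D k) x * e) = c * e" for x and c e :: ennreal
    using part by (simp add: ennreal_suminf_multc)
  define g where "g k = (\<lambda>(x, \<gamma>). f (x, \<gamma>) * indicator (D k) x)" for k
  have gm: "g k \<in> borel_measurable BC" for k unfolding g_def using f by measurable
  have hm: "(\<lambda>(x, \<gamma>). g k (x, insert x \<gamma>) * ennreal (exp_neg (point_energy \<Phi> x \<gamma>))) \<in> borel_measurable BC" for k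
    using measurable_ennreal_times[OF measurable_insert_pair[OF gm] measurable_compose[OF measurable_point_energy[OF M potential] measurable_ennreal]]
    by (simp add: case_prod_beta')
  have loc: "(\<integral>\<^sup>+\<gamma>. \<integral>\<^sup>+x. g k (x, \<gamma>) \<partial>count_space \<gamma> \<partial>\<mu>) =
    (\<integral>\<^sup>+\<gamma>. \<integral>\<^sup>+x. g k (x, insert x \<gamma>) * ennreal (exp_neg (point_energy \<Phi> x \<gamma>)) \<partial>\<sigma> \<partial>\<mu>)" for k
    by (rule GNZ_local[OF W(2) gm]) (use disjointed_subset[of W k] in \<open>auto simp: g_def D_def indicator_def\<close>)
  have "(\<integral>\<^sup>+\<gamma>. \<integral>\<^sup>+x. f (x, \<gamma>) \<partial>count_space \<gamma> \<partial>\<mu>) = (\<integral>\<^sup>+\<gamma>. (\<Sum>k. \<integral>\<^sup>+x. g k (x, \<gamma>) \<partial>count_space \<gamma>) \<partial>\<mu>)"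
    by (subst nn_integral_suminf[symmetric]) (simp_all add: g_def part one)
  also have "\<dots> = (\<Sum>k. \<integral>\<^sup>+\<gamma>. \<integral>\<^sup>+x. g k (x, \<gamma>) \<partial>count_space \<gamma> \<partial>\<mu>)"
    by (intro nn_integral_suminf measurable_\<mu>[OF measurable_sum_points[OF M gm]])
  also have "\<dots> = (\<Sum>k. \<integral>\<^sup>+\<gamma>. \<integral>\<^sup>+x. g k (x, insert x \<gamma>) * ennreal (exp_neg (point_energy \<Phi> x \<gamma>)) \<partial>\<sigma> \<partial>\<mu>)"
    by (simp only: loc)
  also have "\<dots> = (\<integral>\<^sup>+\<gamma>. (\<Sum>k. \<integral>\<^sup>+x. g k (x, insert x \<gamma>) * ennreal (exp_neg (point_energy \<Phi> x \<gamma>)) \<partial>\<sigma>) \<partial>\<mu>)"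
    using measurable_\<mu>[OF measurable_\<sigma>_integral[OF hm]] by (intro nn_integral_suminf[symmetric]) simp
  also have "\<dots> = (\<integral>\<^sup>+\<gamma>. \<integral>\<^sup>+x. f (x, insert x \<gamma>) * ennreal (exp_neg (point_energy \<Phi> x \<gamma>)) \<partial>\<sigma> \<partial>\<mu>)"
  proof (rule nn_integral_cong)
    fix \<gamma> assume "\<gamma> \<in> space \<mu>"
    then have c: "\<gamma> \<in> configs" by (simp add: space_\<mu>)
    have "(\<lambda>x. g k (x, insert x \<gamma>) * ennreal (exp_neg (point_energy \<Phi> x \<gamma>))) \<in> borel_measurable \<sigma>" for k
      using measurable_section[OF hm c, of k] by (simp add: measurable_\<sigma>_iff)
    then show "(\<Sum>k. \<integral>\<^sup>+x. g k (x, insert x \<gamma>) * ennreal (exp_neg (point_energy \<Phi> x \<gamma>)) \<partial>\<sigma>) =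
        (\<integral>\<^sup>+x. f (x, insert x \<gamma>) * ennreal (exp_neg (point_energy \<Phi> x \<gamma>)) \<partial>\<sigma>)"
      by (subst nn_integral_suminf[symmetric]) (simp_all add: g_def part' part one)
  qed
  finally show ?thesis .
qed

end

section \<open>The Hamza condition on lines\<close>

lemma AE_lborel_interval_ex:
  fixes c d :: real
  assumes "AE t in lborel. P t" "c < d"
  obtains t where "c < t" "t < d" "P t"
proof (cases "\<exists>t. c < t \<and> t < d \<and> P t")
  case False
  from AE_E[OF assms(1)] obtain N where N: "{t \<in> space lborel. \<not> P t} \<subseteq> N" "emeasure lborel N = 0" "N \<in> sets lborel" by metis
  have "{c<..<d} \<subseteq> N" using False N(1) by auto
  then have "emeasure lborel {c<..<d} \<le> emeasure lborel N" using N(3) by (intro emeasure_mono)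
  then show thesis using assms(2) N(2) by (simp add: ennreal_eq_0_iff)
qed (use that in blast)

text \<open>The hypothesis gives integrals only between endpoints from the set \<open>A\<close> of
  full measure in the interval. Approximation by such endpoints gives vanishing integrals over all
  half lines, and these determine the positive and negative parts of \<open>w\<close>.\<close>

lemma interval_integrals_zero_AE:
  fixes w :: "real \<Rightarrow> real"
  assumes ab: "a < b" and w: "integrable lborel w" "\<And>t. t \<notin> {a<..<b} \<Longrightarrow> w t = 0"
    and A: "AE t in lborel. a < t \<longrightarrow> t < b \<longrightarrow> t \<in> A"
    and z: "\<And>c d. c \<in> A \<Longrightarrow> d \<in> A \<Longrightarrow> a < c \<Longrightarrow> c < d \<Longrightarrow> d < b \<Longrightarrow> (\<integral>t. w t * indicator {c..d} t \<partial>lborel) = 0"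
  shows "AE t in lborel. w t = 0"
proof -
  have [measurable]: "w \<in> borel_measurable borel" using w(1) by auto
  have half: "(\<integral>t. w t * indicator {x<..} t \<partial>lborel) = 0" for x
  proof (cases "x < b")
    case True
    define x' where "x' = max a x"
    have x': "x' < b" "a \<le> x'" "x \<le> x'" using True ab by (auto simp: x'_def)
    \<comment> \<open>The shift by 3 guarantees \<open>2 * \<delta> n < b - x'\<close>, so that the
      left endpoint stays below the right one for every \<open>n\<close>.\<close>
    define \<delta> where "\<delta> n = (b - x') / real (n + 3)" for n
    have \<delta>: "\<delta> n > 0" "2 * \<delta> n < b - x'" for n
    proof -
      show "\<delta> n > 0" using x'(1) by (simp add: \<delta>_def)
      have "\<delta> n \<le> (b - x') / 3" unfolding \<delta>_def using x'(1) by (intro divide_left_mono) auto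
      then show "2 * \<delta> n < b - x'" using x'(1) by simp
    qed
    have "\<exists>c. x' < c \<and> c < x' + \<delta> n \<and> c \<in> A" for n
    proof -
      obtain t where "x' < t" "t < x' + \<delta> n" "a < t \<longrightarrow> t < b \<longrightarrow> t \<in> A"
        by (rule AE_lborel_interval_ex[OF A, of x' "x' + \<delta> n"]) (use \<delta>[of n] that in auto)
      then show ?thesis using \<delta>[of n] x' by (intro exI[of _ t]) auto
    qed
    then obtain c where c: "\<And>n. x' < c n \<and> c n < x' + \<delta> n \<and> c n \<in> A" by metis
    have "\<exists>d. b - \<delta> n < d \<and> d < b \<and> d \<in> A" for n
    proof -
      obtain t where "b - \<delta> n < t" "t < b" "a < t \<longrightarrow> t < b \<longrightarrow> t \<in> A"
        by (rule AE_lborel_interval_ex[OF A, of "b - \<delta> n" b]) (use \<delta>[of n] that in auto)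
      then show ?thesis using \<delta>[of n] x' by (intro exI[of _ t]) auto
    qed
    then obtain d where d: "\<And>n. b - \<delta> n < d n \<and> d n < b \<and> d n \<in> A" by metis
    have \<delta>0: "\<delta> \<longlonglongrightarrow> 0" unfolding \<delta>_def by real_asymp
    have "(\<lambda>n. \<integral>t. w t * indicator {c n..d n} t \<partial>lborel) \<longlonglongrightarrow> (\<integral>t. w t * indicator {x<..} t \<partial>lborel)"
    proof (rule integral_dominated_convergence[where w = "\<lambda>t. \<bar>w t\<bar>"])
      show "AE t in lborel. (\<lambda>n. w t * indicator {c n..d n} t) \<longlonglongrightarrow> w t * indicator {x<..} t"
      proof (rule AE_I2)
        fix t
        consider "t \<le> x'" | "x' < t" "t < b" | "b \<le> t" by linarith
        then show "(\<lambda>n. w t * indicator {c n..d n} t) \<longlonglongrightarrow> w t * indicator {x<..} t"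
        proof cases
          case 1
          then have "indicator {c n..d n} t = (0 :: real)" for n using c[of n] by (auto simp: indicator_def)
          moreover have "w t * indicator {x<..} t = 0" using 1 w(2)[of t] by (cases "x < t") (auto simp: x'_def max_def split: if_splits)
          ultimately show ?thesis by (simp only: mult_zero_right tendsto_const)
        next
          case 2
          have "\<forall>\<^sub>F n in sequentially. \<delta> n < min (t - x') (b - t)"
            using order_tendstoD(2)[OF \<delta>0, of "min (t - x') (b - t)"] 2 by simp
          then have "\<forall>\<^sub>F n in sequentially. w t * indicator {c n..d n} t = w t * indicator {x<..} t"
          proof (rule eventually_mono)
            fix n assume "\<delta> n < min (t - x') (b - t)"
            then show "w t * indicator {c n..d n} t = w t * indicator {x<..} t"
              using c[of n] d[of n] 2 x'(3) by (auto simp: indicator_def)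
          qed
          then show ?thesis by (rule tendsto_eventually)
        next
          case 3
          then show ?thesis using w(2)[of t] by simp
        qed
      qed
    qed (use w in \<open>auto simp: indicator_def\<close>)
    moreover have "(\<integral>t. w t * indicator {c n..d n} t \<partial>lborel) = 0" for n
      using z[of "c n" "d n"] c[of n] d[of n] \<delta>[of n] x' by auto
    ultimately show ?thesis by (simp add: LIMSEQ_const_iff)
  next
    case False
    then have "(\<lambda>t. w t * indicator {x<..} t) = (\<lambda>_. 0)" using w(2) by (intro ext) (auto simp: indicator_def)
    then show ?thesis by simp
  qed
  \<comment> \<open>Since \<open>ennreal\<close> cuts off at 0, \<open>P 1\<close> and
    \<open>P (- 1)\<close> have the positive and the negative part of \<open>w\<close> as
    densities.\<close>
  define P where "P s = density lborel (\<lambda>t. ennreal (s * w t))" for s :: real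
  have Pm: "emeasure (P s) {x<..} = (\<integral>\<^sup>+t. ennreal (s * (w t * indicator {x<..} t)) \<partial>lborel)" for s x
    unfolding P_def by (subst emeasure_density) (auto intro!: nn_integral_cong simp: indicator_def)
  have int: "integrable lborel (\<lambda>t. w t * indicator {x<..} t)" for x
    using w(1) by (intro integrable_real_mult_indicator) auto
  have Pf: "emeasure (P s) {x<..} < \<infinity>" if "\<bar>s\<bar> = 1" for s x
  proof -
    have "emeasure (P s) {x<..} \<le> (\<integral>\<^sup>+t. ennreal (norm (w t)) \<partial>lborel)"
      unfolding Pm using that by (intro nn_integral_mono ennreal_leI) (auto simp: indicator_def abs_if split: if_splits)
    also have "\<dots> < \<infinity>" using w(1) by (simp add: integrable_iff_bounded)
    finally show ?thesis .
  qed
  have "emeasure (P 1) {x<..} = emeasure (P (- 1)) {x<..}" for x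
  proof -
    have "0 = enn2real (emeasure (P 1) {x<..}) - enn2real (emeasure (P (- 1)) {x<..})"
      using real_lebesgue_integral_def[OF int[of x]] half[of x] by (simp add: Pm)
    then have *: "enn2real (emeasure (P 1) {x<..}) = enn2real (emeasure (P (- 1)) {x<..})" by simp
    have "emeasure (P 1) {x<..} = ennreal (enn2real (emeasure (P 1) {x<..}))" using Pf[of 1 x] by simp
    also have "\<dots> = emeasure (P (- 1)) {x<..}" unfolding * using Pf[of "- 1" x] by simp
    finally show ?thesis .
  qed
  then have "P 1 = P (- 1)"
    using Pf[of 1] Pf[of "- 1"] by (intro measure_eqI_lessThan) (auto simp: P_def)
  then have "AE t in lborel. ennreal (1 * w t) = ennreal (- 1 * w t)"
    unfolding P_def
    by (intro sigma_finite_measure.density_unique[OF lborel.sigma_finite_measure_axioms]) auto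
  then show ?thesis
  proof (rule eventually_mono)
    fix t assume "ennreal (1 * w t) = ennreal (- 1 * w t)"
    then show "w t = 0"
      by (cases "w t \<ge> 0") (auto simp: ennreal_neg ennreal_eq_0_iff)
  qed
qed


text \<open>The factor \<open>2 ^ j\<close> in the hypothesis buys absolute summability: the
  increments of the derivatives are summable almost everywhere, with an integrable sum. So the
  derivatives converge pointwise to some \<open>w\<close> under one integrable majorant. Integrals
  of \<open>w\<close> between almost all pairs of points are limits of differences of
  \<open>\<phi> j\<close>, hence 0.\<close>

lemma Hamza_interval:
  fixes \<phi> d\<phi> :: "nat \<Rightarrow> real \<Rightarrow> real" and r :: "real \<Rightarrow> real"
  assumes ab: "a < b"
    and der: "\<And>j t. t \<in> {a..b} \<Longrightarrow> (\<phi> j has_real_derivative d\<phi> j t) (at t)"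
    and cont: "\<And>j. continuous_on {a..b} (d\<phi> j)"
    and r[measurable]: "r \<in> borel_measurable borel"
    and inv: "(\<integral>\<^sup>+t\<in>{a..b}. inverse (ennreal (r t)) \<partial>lborel) < \<infinity>"
    and S: "(\<integral>\<^sup>+t\<in>{a..b}. (\<Sum>j. ennreal (2 ^ j * (r t * (d\<phi> (Suc j) t - d\<phi> j t)\<^sup>2))) \<partial>lborel) < \<infinity>"
    and lim: "AE t in lborel. t \<in> {a..b} \<longrightarrow> 0 < r t \<longrightarrow> (\<lambda>j. \<phi> j t) \<longlonglongrightarrow> 0"
  shows "AE t in lborel. t \<in> {a..b} \<longrightarrow> (\<lambda>j. d\<phi> j t) \<longlonglongrightarrow> 0"
proof -
  define D where "D j t = indicator {a..b} t *\<^sub>R d\<phi> j t" for j t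
  have D[measurable]: "D j \<in> borel_measurable borel" for j
    unfolding D_def by (intro borel_measurable_continuous_on_indicator cont) auto
  have D_in: "D j t = d\<phi> j t" if "t \<in> {a..b}" for j t using that by (simp add: D_def)
  have D_out: "D j t = 0" if "t \<notin> {a..b}" for j t using that by (simp add: D_def)
  have D_int: "integrable lborel (D j)" for j
    unfolding D_def using borel_integrable_compact[of "{a..b}" "d\<phi> j"] cont[of j]
    by (simp add: indicator_def if_distrib[of "\<lambda>u. u *\<^sub>R _"] cong: if_cong)
  \<comment> \<open>The inverse of 0 is infinite, so integrability of \<open>1/r\<close> excludes
    zeros of \<open>r\<close> up to a null set. Therefore the convergence of
    \<open>\<phi> j\<close>, assumed where \<open>r\<close> is positive, holds almost everywhere on
    the interval.\<close>
  have rpos: "AE t in lborel. t \<in> {a..b} \<longrightarrow> 0 < r t"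
  proof -
    have "AE t in lborel. inverse (ennreal (r t)) * indicator {a..b} t \<noteq> \<infinity>"
      using inv by (intro nn_integral_PInf_AE) (auto simp: top_unique)
    then show ?thesis
      by (rule eventually_mono) (auto simp: indicator_def not_less ennreal_neg ennreal_eq_0_iff not_le[symmetric] split: if_splits)
  qed
  define e where "e t = (\<Sum>j. ennreal \<bar>D (Suc j) t - D j t\<bar>)" for t
  have [measurable]: "e \<in> borel_measurable borel" unfolding e_def by measurable
  have "(\<integral>\<^sup>+t. e t \<partial>lborel) \<le> (\<integral>\<^sup>+t. (\<Sum>j. ennreal (2 ^ j * (r t * (D (Suc j) t - D j t)\<^sup>2))) * indicator {a..b} t +
     (\<Sum>j. ennreal ((1/2) ^ j)) * (inverse (ennreal (r t)) * indicator {a..b} t) \<partial>lborel)"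
  proof (rule nn_integral_mono_AE, rule eventually_mono[OF rpos])
    fix t assume rt: "t \<in> {a..b} \<longrightarrow> 0 < r t"
    show "e t \<le> (\<Sum>j. ennreal (2 ^ j * (r t * (D (Suc j) t - D j t)\<^sup>2))) * indicator {a..b} t +
     (\<Sum>j. ennreal ((1/2) ^ j)) * (inverse (ennreal (r t)) * indicator {a..b} t)"
    proof (cases "t \<in> {a..b}")
      case True
      with rt have r0: "0 < r t" by simp
      (* AM-GM, weighted so that the errors are summable *)
      have *: "\<bar>q\<bar> \<le> 2 ^ j * (r t * q\<^sup>2) + (1/2) ^ j * inverse (r t)" for q :: real and j
      proof -
        define A where "A = 2 ^ j * r t"
        have A: "A > 0" using r0 by (simp add: A_def)
        have "0 \<le> (A * \<bar>q\<bar> - 1)\<^sup>2 + A * \<bar>q\<bar>" using A by simp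
        then have "A * \<bar>q\<bar> \<le> A * (A * q\<^sup>2) + 1" by (simp add: power2_eq_square algebra_simps)
        then have "A * \<bar>q\<bar> \<le> A * (A * q\<^sup>2 + inverse A)" using A by (simp add: algebra_simps)
        then have "\<bar>q\<bar> \<le> A * q\<^sup>2 + inverse A" using A by simp
        then show ?thesis by (simp add: A_def power_one_over mult.assoc inverse_eq_divide)
      qed
      have "e t \<le> (\<Sum>j. ennreal (2 ^ j * (r t * (D (Suc j) t - D j t)\<^sup>2)) + ennreal ((1/2) ^ j) * inverse (ennreal (r t)))"
        unfolding e_def
      proof (intro suminf_le)
        fix j
        have "ennreal \<bar>D (Suc j) t - D j t\<bar> \<le> ennreal (2 ^ j * (r t * (D (Suc j) t - D j t)\<^sup>2) + (1/2) ^ j * inverse (r t))"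
          by (intro ennreal_leI *)
        also have "\<dots> = ennreal (2 ^ j * (r t * (D (Suc j) t - D j t)\<^sup>2)) + ennreal ((1/2) ^ j) * inverse (ennreal (r t))"
          using r0 by (simp add: ennreal_plus ennreal_mult inverse_ennreal)
        finally show "ennreal \<bar>D (Suc j) t - D j t\<bar> \<le> ennreal (2 ^ j * (r t * (D (Suc j) t - D j t)\<^sup>2)) + ennreal ((1/2) ^ j) * inverse (ennreal (r t))" .
      qed auto
      also have "\<dots> = (\<Sum>j. ennreal (2 ^ j * (r t * (D (Suc j) t - D j t)\<^sup>2))) + (\<Sum>j. ennreal ((1/2) ^ j)) * inverse (ennreal (r t))"
        by (subst suminf_add[symmetric]) auto
      finally show ?thesis using True by simp
    next
      case False
      then show ?thesis by (simp add: e_def D_out)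
    qed
  qed
  also have "\<dots> = (\<integral>\<^sup>+t. (\<Sum>j. ennreal (2 ^ j * (r t * (D (Suc j) t - D j t)\<^sup>2))) * indicator {a..b} t \<partial>lborel) +
     (\<Sum>j. ennreal ((1/2) ^ j)) * (\<integral>\<^sup>+t\<in>{a..b}. inverse (ennreal (r t)) \<partial>lborel)"
    by (subst nn_integral_add) (auto simp: nn_integral_cmult)
  also have "(\<integral>\<^sup>+t. (\<Sum>j. ennreal (2 ^ j * (r t * (D (Suc j) t - D j t)\<^sup>2))) * indicator {a..b} t \<partial>lborel)
     = (\<integral>\<^sup>+t\<in>{a..b}. (\<Sum>j. ennreal (2 ^ j * (r t * (d\<phi> (Suc j) t - d\<phi> j t)\<^sup>2))) \<partial>lborel)"
    by (intro nn_integral_cong) (auto simp: indicator_def D_in)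
  also have "(\<Sum>j. ennreal ((1/2) ^ j)) = ennreal (\<Sum>j. (1/2) ^ j)"
    by (intro suminf_ennreal2) (auto intro!: summable_geometric)
  finally have e_fin: "(\<integral>\<^sup>+t. e t \<partial>lborel) < \<infinity>"
    using S inv by (auto simp: ennreal_mult_less_top elim!: order_le_less_trans)
  have e_AE: "AE t in lborel. e t \<noteq> \<infinity>"
    using e_fin by (intro nn_integral_PInf_AE) auto
  have sm: "summable (\<lambda>j. D (Suc j) t - D j t)" and sn: "(\<Sum>j<n. \<bar>D (Suc j) t - D j t\<bar>) \<le> enn2real (e t)"
    if "e t \<noteq> \<infinity>" for t n
  proof -
    have s: "summable (\<lambda>j. \<bar>D (Suc j) t - D j t\<bar>)"
      by (rule summable_suminf_not_top) (use that in \<open>auto simp: e_def\<close>)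
    show "summable (\<lambda>j. D (Suc j) t - D j t)" by (rule summable_rabs_cancel[OF s])
    have "e t = ennreal (\<Sum>j. \<bar>D (Suc j) t - D j t\<bar>)"
      unfolding e_def by (intro suminf_ennreal2 s) auto
    then show "(\<Sum>j<n. \<bar>D (Suc j) t - D j t\<bar>) \<le> enn2real (e t)"
      using sum_le_suminf[OF s, of "{..<n}"] by (simp add: suminf_nonneg[OF s])
  qed
  define w where "w t = lim (\<lambda>j. D j t)" for t
  have [measurable]: "w \<in> borel_measurable borel" unfolding w_def by measurable
  have tel: "D n t = D 0 t + (\<Sum>j<n. D (Suc j) t - D j t)" for n t
    by (simp add: sum_lessThan_telescope[of "\<lambda>j. D j t"])
  have Dw: "(\<lambda>j. D j t) \<longlonglongrightarrow> w t" if "e t \<noteq> \<infinity>" for t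
  proof -
    have "(\<lambda>n. D 0 t + (\<Sum>j<n. D (Suc j) t - D j t)) \<longlonglongrightarrow> D 0 t + (\<Sum>j. D (Suc j) t - D j t)"
      by (intro tendsto_intros summable_LIMSEQ sm that)
    then have "(\<lambda>n. D n t) \<longlonglongrightarrow> D 0 t + (\<Sum>j. D (Suc j) t - D j t)" by (simp only: tel[symmetric])
    then show ?thesis unfolding w_def by (simp add: limI)
  qed
  \<comment> \<open>Telescoping bounds every \<open>D n\<close> by the first term plus the sum of
    all increments; this majorant is used for both limits under the integral.\<close>
  define W where "W t = \<bar>D 0 t\<bar> + enn2real (e t)" for t
  have e_int: "integrable lborel (\<lambda>t. enn2real (e t))"
  proof (rule integrableI_nonneg)
    have "(\<integral>\<^sup>+t. ennreal (enn2real (e t)) \<partial>lborel) \<le> (\<integral>\<^sup>+t. e t \<partial>lborel)"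
      using e_AE by (intro nn_integral_mono_AE) (auto elim!: eventually_mono simp: ennreal_enn2real_if)
    then show "(\<integral>\<^sup>+t. ennreal (enn2real (e t)) \<partial>lborel) < \<infinity>" using e_fin by (rule order_le_less_trans)
  qed auto
  have W_int: "integrable lborel W"
    unfolding W_def using D_int[of 0] e_int by auto
  have DW: "\<bar>D n t\<bar> \<le> W t" if "e t \<noteq> \<infinity>" for n t
  proof -
    have "\<bar>D n t\<bar> \<le> \<bar>D 0 t\<bar> + \<bar>\<Sum>j<n. D (Suc j) t - D j t\<bar>" unfolding tel[of n] by (rule abs_triangle_ineq)
    also have "\<bar>\<Sum>j<n. D (Suc j) t - D j t\<bar> \<le> (\<Sum>j<n. \<bar>D (Suc j) t - D j t\<bar>)" by (rule sum_abs)
    also have "\<dots> \<le> enn2real (e t)" by (rule sn[OF that])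
    finally show ?thesis by (simp add: W_def)
  qed
  have w_int: "integrable lborel w"
    by (rule integrable_dominated_convergence[OF _ _ W_int, where s = D])
      (use e_AE in \<open>auto elim!: eventually_mono intro: Dw DW\<close>)
  have w_out: "w t = 0" if "t \<notin> {a..b}" for t
    unfolding w_def D_out[OF that] by simp
  define w' where "w' t = w t * indicator {a<..<b} t" for t
  have w'_int: "integrable lborel w'" unfolding w'_def using w_int by (intro integrable_real_mult_indicator) auto
  have "AE t in lborel. w' t = 0"
  proof (rule interval_integrals_zero_AE[OF ab w'_int, where A = "{t. (\<lambda>j. \<phi> j t) \<longlonglongrightarrow> 0}"])
    show "AE t in lborel. a < t \<longrightarrow> t < b \<longrightarrow> t \<in> {t. (\<lambda>j. \<phi> j t) \<longlonglongrightarrow> 0}"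
      using lim rpos by eventually_elim auto
  next
    fix c d assume cd: "c \<in> {t. (\<lambda>j. \<phi> j t) \<longlonglongrightarrow> 0}" "d \<in> {t. (\<lambda>j. \<phi> j t) \<longlonglongrightarrow> 0}" "a < c" "c < d" "d < b"
    have F: "(\<integral>t. indicator {c..d} t *\<^sub>R d\<phi> j t \<partial>lborel) = \<phi> j d - \<phi> j c" for j
    proof (rule integral_FTC_atLeastAtMost)
      show "continuous_on {c..d} (d\<phi> j)" using cd by (intro continuous_on_subset[OF cont]) auto
      show "(\<phi> j has_vector_derivative d\<phi> j x) (at x within {c..d})" if "c \<le> x" "x \<le> d" for x
        using has_vector_derivative_at_within[OF der[of x j, unfolded has_real_derivative_iff_has_vector_derivative]] that cd
        by simp
    qed (use cd in auto)
    have F': "(\<integral>t. D j t * indicator {c..d} t \<partial>lborel) = \<phi> j d - \<phi> j c" for j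
      unfolding F[symmetric] using cd by (intro Bochner_Integration.integral_cong) (auto simp: indicator_def D_in)
    have "(\<lambda>j. \<integral>t. D j t * indicator {c..d} t \<partial>lborel) \<longlonglongrightarrow> (\<integral>t. w t * indicator {c..d} t \<partial>lborel)"
    proof (rule integral_dominated_convergence[OF _ _ W_int])
      show "AE t in lborel. (\<lambda>j. D j t * indicator {c..d} t) \<longlonglongrightarrow> w t * indicator {c..d} t"
        using e_AE by (auto elim!: eventually_mono intro!: tendsto_mult_right Dw)
      show "AE t in lborel. norm (D j t * indicator {c..d} t) \<le> W t" for j
        using e_AE
      proof (rule eventually_mono)
        fix t assume "e t \<noteq> \<infinity>"
        from DW[OF this, of j] show "norm (D j t * indicator {c..d} t) \<le> W t" by (auto simp: indicator_def)
      qed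
    qed auto
    moreover have "(\<lambda>j. \<phi> j d - \<phi> j c) \<longlonglongrightarrow> 0 - 0" using cd by (intro tendsto_diff) auto
    ultimately have "(\<integral>t. w t * indicator {c..d} t \<partial>lborel) = 0"
      unfolding F' using LIMSEQ_unique by fastforce
    moreover have "(\<lambda>t. w' t * indicator {c..d} t) = (\<lambda>t. w t * indicator {c..d} t)"
      using cd by (intro ext) (auto simp: w'_def indicator_def)
    ultimately show "(\<integral>t. w' t * indicator {c..d} t \<partial>lborel) = 0" by simp
  qed (simp add: w'_def)
  moreover have "AE t in lborel. t \<noteq> a" "AE t in lborel. t \<noteq> b" by (rule AE_lborel_singleton)+
  ultimately show ?thesis using e_AE
  proof eventually_elim
    fix t assume t: "w' t = 0" "t \<noteq> a" "t \<noteq> b" "e t \<noteq> \<infinity>"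
    show "t \<in> {a..b} \<longrightarrow> (\<lambda>j. d\<phi> j t) \<longlonglongrightarrow> 0"
    proof
      assume "t \<in> {a..b}"
      then have "w t = 0" using t by (auto simp: w'_def)
      then show "(\<lambda>j. d\<phi> j t) \<longlonglongrightarrow> 0" using Dw[OF t(4)] D_in[OF \<open>t \<in> {a..b}\<close>] by simp
    qed
  qed
qed

text \<open>Every regular point in \<open>U\<close> lies in an interval with rational endpoints that
  is contained in \<open>U\<close> and on which \<open>1/r\<close> is integrable. There are
  countably many such intervals, so their exceptional sets form a null set.\<close>

lemma Hamza_open:
  fixes \<phi> d\<phi> :: "nat \<Rightarrow> real \<Rightarrow> real" and r :: "real \<Rightarrow> real"
  assumes U: "open U"
    and der: "\<And>j t. t \<in> U \<Longrightarrow> (\<phi> j has_real_derivative d\<phi> j t) (at t)"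
    and cont: "\<And>j. continuous_on U (d\<phi> j)"
    and r[measurable]: "r \<in> borel_measurable borel"
    and S: "(\<integral>\<^sup>+t\<in>U. (\<Sum>j. ennreal (2 ^ j * (r t * (d\<phi> (Suc j) t - d\<phi> j t)\<^sup>2))) \<partial>lborel) < \<infinity>"
    and lim: "AE t in lborel. t \<in> U \<longrightarrow> 0 < r t \<longrightarrow> (\<lambda>j. \<phi> j t) \<longlonglongrightarrow> 0"
  shows "AE t in lborel. t \<in> U \<longrightarrow> t \<in> regular_points r \<longrightarrow> (\<lambda>j. d\<phi> j t) \<longlonglongrightarrow> 0"
proof -
  let ?ok = "\<lambda>a b. a < b \<and> {a..b} \<subseteq> U \<and> (\<integral>\<^sup>+t\<in>{a..b}. inverse (ennreal (r t)) \<partial>lborel) < \<infinity>"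
  have "AE t in lborel. ?ok (real_of_rat a) (real_of_rat b) \<longrightarrow> t \<in> {real_of_rat a..real_of_rat b} \<longrightarrow> (\<lambda>j. d\<phi> j t) \<longlonglongrightarrow> 0" for a b
  proof (cases "?ok (real_of_rat a) (real_of_rat b)")
    case True
    then have "AE t in lborel. t \<in> {real_of_rat a..real_of_rat b} \<longrightarrow> (\<lambda>j. d\<phi> j t) \<longlonglongrightarrow> 0"
    proof (intro Hamza_interval[where r = r and \<phi> = \<phi>])
      have "(\<integral>\<^sup>+t\<in>{real_of_rat a..real_of_rat b}. (\<Sum>j. ennreal (2 ^ j * (r t * (d\<phi> (Suc j) t - d\<phi> j t)\<^sup>2))) \<partial>lborel)
        \<le> (\<integral>\<^sup>+t\<in>U. (\<Sum>j. ennreal (2 ^ j * (r t * (d\<phi> (Suc j) t - d\<phi> j t)\<^sup>2))) \<partial>lborel)"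
        using True by (intro nn_integral_mono) (auto simp: indicator_def)
      then show "(\<integral>\<^sup>+t\<in>{real_of_rat a..real_of_rat b}. (\<Sum>j. ennreal (2 ^ j * (r t * (d\<phi> (Suc j) t - d\<phi> j t)\<^sup>2))) \<partial>lborel) < \<infinity>"
        using S by (rule order_le_less_trans)
      show "AE t in lborel. t \<in> {real_of_rat a..real_of_rat b} \<longrightarrow> 0 < r t \<longrightarrow> (\<lambda>j. \<phi> j t) \<longlonglongrightarrow> 0"
        using lim True by (auto elim!: eventually_mono)
    qed (use True der r in \<open>auto intro: continuous_on_subset[OF cont]\<close>)
    then show ?thesis by (rule eventually_mono) simp
  qed auto
  then have "AE t in lborel. \<forall>a b. ?ok (real_of_rat a) (real_of_rat b) \<longrightarrow> t \<in> {real_of_rat a..real_of_rat b} \<longrightarrow> (\<lambda>j. d\<phi> j t) \<longlonglongrightarrow> 0"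
    by (simp add: AE_all_countable)
  then show ?thesis
  proof (rule eventually_mono, intro impI)
    fix t assume *: "\<forall>a b. ?ok (real_of_rat a) (real_of_rat b) \<longrightarrow> t \<in> {real_of_rat a..real_of_rat b} \<longrightarrow> (\<lambda>j. d\<phi> j t) \<longlonglongrightarrow> 0"
      and t: "t \<in> U" "t \<in> regular_points r"
    from t(2) obtain \<epsilon> where \<epsilon>: "\<epsilon> > 0" "(\<integral>\<^sup>+s\<in>{t - \<epsilon>..t + \<epsilon>}. inverse (ennreal (r s)) \<partial>lborel) < \<infinity>"
      unfolding regular_points_def by blast
    from U t(1) obtain \<delta> where \<delta>: "\<delta> > 0" "ball t \<delta> \<subseteq> U" unfolding open_contains_ball by blast
    define \<eta> where "\<eta> = min \<epsilon> \<delta>"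
    have \<eta>: "\<eta> > 0" "\<eta> \<le> \<epsilon>" "\<eta> \<le> \<delta>" using \<epsilon>(1) \<delta>(1) by (auto simp: \<eta>_def)
    from of_rat_dense[of "t - \<eta>" t] obtain a where a: "t - \<eta> < real_of_rat a" "real_of_rat a < t" using \<eta>(1) by auto
    from of_rat_dense[of t "t + \<eta>"] obtain b where b: "t < real_of_rat b" "real_of_rat b < t + \<eta>" using \<eta>(1) by auto
    have "(\<integral>\<^sup>+s\<in>{real_of_rat a..real_of_rat b}. inverse (ennreal (r s)) \<partial>lborel) \<le> (\<integral>\<^sup>+s\<in>{t - \<epsilon>..t + \<epsilon>}. inverse (ennreal (r s)) \<partial>lborel)"
      using a b \<eta> by (intro nn_integral_mono) (auto simp: indicator_def)
    then have "(\<integral>\<^sup>+s\<in>{real_of_rat a..real_of_rat b}. inverse (ennreal (r s)) \<partial>lborel) < \<infinity>" using \<epsilon>(2) by (rule order_le_less_trans)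
    moreover have "{real_of_rat a..real_of_rat b} \<subseteq> U"
      using a b \<eta> by (intro subset_trans[OF _ \<delta>(2)]) (auto simp: dist_real_def)
    ultimately show "(\<lambda>j. d\<phi> j t) \<longlonglongrightarrow> 0" using *[rule_format, of a b] a b by auto
  qed
qed


lemma measurable_tendsto_0:
  fixes f :: "nat \<Rightarrow> 'b \<Rightarrow> real"
  assumes [measurable]: "\<And>j. f j \<in> borel_measurable N"
  shows "Measurable.pred N (\<lambda>x. (\<lambda>j. f j x) \<longlonglongrightarrow> 0)"
proof -
  have "(\<lambda>j. f j x) \<longlonglongrightarrow> 0 \<longleftrightarrow> (\<forall>k. \<exists>n0. \<forall>n\<ge>n0. \<bar>f n x\<bar> < 1 / real (Suc k))" for x
  proof
    assume l: "(\<lambda>j. f j x) \<longlonglongrightarrow> 0"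
    show "\<forall>k. \<exists>n0. \<forall>n\<ge>n0. \<bar>f n x\<bar> < 1 / real (Suc k)"
      using LIMSEQ_D[OF l, of "1 / real (Suc k)" for k] by simp
  next
    assume r: "\<forall>k. \<exists>n0. \<forall>n\<ge>n0. \<bar>f n x\<bar> < 1 / real (Suc k)"
    show "(\<lambda>j. f j x) \<longlonglongrightarrow> 0"
    proof (rule LIMSEQ_I)
      fix e :: real assume "e > 0"
      then obtain k where k: "1 / real (Suc k) < e" using nat_approx_posE by metis
      from r obtain n0 where "\<forall>n\<ge>n0. \<bar>f n x\<bar> < 1 / real (Suc k)" by blast
      then show "\<exists>n0. \<forall>n\<ge>n0. norm (f n x - 0) < e" using k by force
    qed
  qed
  then show ?thesis by simp
qed

section \<open>Fubini along coordinate lines\<close>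

abbreviation line_base :: "'n \<Rightarrow> ('n \<Rightarrow> real) measure" where
  "line_base l \<equiv> Pi\<^sub>M (UNIV - {l}) (\<lambda>_. lborel)"

definition line_point :: "'n \<Rightarrow> ('n \<Rightarrow> real) \<Rightarrow> real \<Rightarrow> real ^ 'n::finite" where
  "line_point l x s = (\<chi> j. if j = l then s else x j)"

lemma slice_eq: "slice r l x s = r (line_point l x s)"
  by (simp add: slice_def line_point_def)

lemma line_point_eq: "line_point l x s = line_point l x t + (s - t) *\<^sub>R axis l 1"
  by (simp add: vec_eq_iff line_point_def axis_def)

lemma measurable_line_point [measurable]:
  "(\<lambda>(x, s). line_point l x s) \<in> line_base l \<Otimes>\<^sub>M lborel \<rightarrow>\<^sub>M borel"
proof -
  have *: "(\<lambda>p. if j = l then snd p else fst p j) \<in> borel_measurable (line_base l \<Otimes>\<^sub>M (lborel :: real measure))" for j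
  proof (cases "j = l")
    case False
    then have "(\<lambda>x. x j) \<in> line_base l \<rightarrow>\<^sub>M lborel"
      by (intro measurable_component_singleton) simp
    from measurable_compose[OF measurable_fst this] show ?thesis using False by simp
  qed simp
  have "(\<lambda>p. (line_point l (fst p) (snd p)) \<bullet> b) \<in> borel_measurable (line_base l \<Otimes>\<^sub>M lborel)"
    if "b \<in> Basis" for b
    using that * by (auto simp: Basis_vec_def inner_axis line_point_def)
  then show ?thesis
    unfolding split_beta' by (subst borel_measurable_euclidean_space) blast
qed

interpretation line_product: product_sigma_finite "\<lambda>_. lborel :: real measure" by standard

text \<open>Lebesgue measure is determined by its values on boxes, whose preimages are products of
  intervals. In dimension one the base is the product over an empty index set, a unit point
  mass.\<close>

lemma distr_line_point:
  "distr (line_base l \<Otimes>\<^sub>M lborel) borel (\<lambda>(x, s). line_point l x s) = (lborel :: (real ^ 'n::finite) measure)"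
proof (rule lborel_eqI[symmetric])
  let ?P = "line_base l"
  fix a b :: "real ^ 'n" assume ab: "\<And>k. k \<in> Basis \<Longrightarrow> a \<bullet> k \<le> b \<bullet> k"
  have ab': "a $ j \<le> b $ j" for j using ab[of "axis j 1"] by (force simp: Basis_vec_def inner_axis)
  have all_split: "(\<forall>j. R j) \<longleftrightarrow> (\<forall>j\<in>UNIV - {l}. R j) \<and> R l" for R by auto
  have "line_point l x s \<in> box a b \<longleftrightarrow> (\<forall>j\<in>UNIV - {l}. x j \<in> {a $ j<..<b $ j}) \<and> s \<in> {a $ l<..<b $ l}" for x s
    unfolding mem_box_cart by (subst all_split) (simp add: line_point_def)
  then have "(\<lambda>(x, s). line_point l x s) -` box a b \<inter> space (?P \<Otimes>\<^sub>M lborel)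
    = (\<Pi>\<^sub>E j\<in>UNIV - {l}. {a $ j<..<b $ j}) \<times> {a $ l<..<b $ l}"
    by (auto simp: space_pair_measure space_PiM PiE_iff)
  then have "emeasure (distr (?P \<Otimes>\<^sub>M lborel) borel (\<lambda>(x, s). line_point l x s)) (box a b)
    = emeasure (?P \<Otimes>\<^sub>M lborel) ((\<Pi>\<^sub>E j\<in>UNIV - {l}. {a $ j<..<b $ j}) \<times> {a $ l<..<b $ l})"
    by (subst emeasure_distr) auto
  also have "\<dots> = (\<Prod>j\<in>UNIV - {l}. ennreal (b $ j - a $ j)) * ennreal (b $ l - a $ l)"
    using ab' by (subst lborel.emeasure_pair_measure_Times) (auto simp: line_product.emeasure_PiM intro!: sets_PiM_I_finite)
  also have "\<dots> = (\<Prod>j\<in>UNIV. ennreal (b $ j - a $ j))"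
    by (subst prod.remove[of UNIV l]) (auto simp: mult.commute)
  also have "\<dots> = ennreal (\<Prod>j\<in>UNIV. b $ j - a $ j)" using ab' by (subst prod_ennreal) auto
  also have "(\<Prod>j\<in>UNIV. b $ j - a $ j) = (\<Prod>k\<in>Basis. (b - a) \<bullet> k)"
  proof -
    have B: "Basis = range (\<lambda>j. axis j 1 :: real ^ 'n)" by (auto simp: Basis_vec_def)
    have "inj (\<lambda>j. axis j 1 :: real ^ 'n)" by (auto simp: inj_on_def axis_eq_axis)
    then show ?thesis unfolding B by (subst prod.reindex) (auto simp: inner_axis)
  qed
  finally show "emeasure (distr (?P \<Otimes>\<^sub>M lborel) borel (\<lambda>(x, s). line_point l x s)) (box a b) = ennreal (\<Prod>k\<in>Basis. (b - a) \<bullet> k)" .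
qed simp

lemma sigma_finite_lines: "sigma_finite_measure (line_base (l :: 'n::finite))"
  by (intro line_product.sigma_finite) simp

lemma nn_integral_lines:
  fixes f :: "real ^ 'n::finite \<Rightarrow> ennreal"
  assumes [measurable]: "f \<in> borel_measurable borel"
  shows "(\<integral>\<^sup>+y. f y \<partial>lborel) = (\<integral>\<^sup>+x. \<integral>\<^sup>+s. f (line_point l x s) \<partial>lborel \<partial>line_base l)"
  apply (subst distr_line_point[of l, symmetric], subst nn_integral_distr)
  apply (auto simp: split_beta' lborel.nn_integral_fst[symmetric])
  done

lemma AE_lines:
  fixes P :: "real ^ 'n::finite \<Rightarrow> bool"
  assumes "AE y in lborel. P y"
  shows "AE x in line_base l. AE s in lborel. P (line_point l x s)"
proof -
  let ?P = "line_base l \<Otimes>\<^sub>M (lborel :: real measure)"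
  obtain N where N: "{y. \<not> P y} \<subseteq> N" "emeasure lborel N = 0" "N \<in> sets borel"
    using AE_E[OF assms] by (auto simp: null_sets_def)
  have [measurable]: "Measurable.pred borel (\<lambda>y. y \<notin> N)" using N(3) by measurable
  have "AE y in distr ?P borel (\<lambda>(x, s). line_point l x s). y \<notin> N"
    unfolding distr_line_point using N by (intro AE_not_in) (auto simp: null_sets_def)
  then have "AE p in ?P. line_point l (fst p) (snd p) \<notin> N"
    by (subst (asm) AE_distr_iff) (auto simp: split_beta')
  from pair_sigma_finite.AE_pair[OF pair_sigma_finite.intro[OF sigma_finite_lines lborel.sigma_finite_measure_axioms] this] show ?thesis
    by (rule eventually_mono) (use N(1) in \<open>auto elim!: eventually_mono\<close>)
qed

text \<open>Measurability of \<open>P\<close> is essential in this direction: null sections of a set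
  that is not measurable would not make it a null set.\<close>

lemma AE_linesI:
  fixes P :: "real ^ 'n::finite \<Rightarrow> bool"
  assumes [measurable]: "Measurable.pred borel P"
    and "AE x in line_base l. AE s in lborel. P (line_point l x s)"
  shows "AE y in lborel. P y"
proof -
  have "(\<integral>\<^sup>+y. indicator {y. \<not> P y} y \<partial>lborel) = 0"
  proof (subst nn_integral_lines[of _ l], measurable, subst nn_integral_0_iff_AE)
    show "(\<lambda>x. \<integral>\<^sup>+s. indicator {y. \<not> P y} (line_point l x s) \<partial>lborel) \<in> borel_measurable (line_base l)"
      by (intro lborel.borel_measurable_nn_integral) measurable
    show "AE x in line_base l. (\<integral>\<^sup>+s. indicator {y. \<not> P y} (line_point l x s) \<partial>lborel) = 0"
      using assms(2)
    proof (rule eventually_mono)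
      fix x assume "AE s in lborel. P (line_point l x s)"
      then have "AE s in lborel. indicator {y. \<not> P y} (line_point l x s) = (0 :: ennreal)"
        by (rule eventually_mono) simp
      then have "(\<integral>\<^sup>+s. indicator {y. \<not> P y} (line_point l x s) \<partial>lborel) = (\<integral>\<^sup>+(s::real). 0 \<partial>lborel)"
        by (rule nn_integral_cong_AE)
      then show "(\<integral>\<^sup>+s. indicator {y. \<not> P y} (line_point l x s) \<partial>lborel) = 0" by simp
    qed
  qed
  then have "emeasure lborel {y. \<not> P y} = 0" by simp
  then show ?thesis by (intro AE_I[of _ _ "{y. \<not> P y}"]) auto
qed

text \<open>The common consequence of the two Hamza conditions, localised to \<open>Q\<close>. The
  conclusion \<open>r \<le> 0\<close> is the negation of the condition \<open>0 < r\<close> under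
  which convergence of the derivatives is claimed.\<close>

definition line_condition :: "'n \<Rightarrow> (real ^ 'n::finite) set \<Rightarrow> (real ^ 'n \<Rightarrow> real) \<Rightarrow> bool" where
  "line_condition l Q r \<longleftrightarrow> (AE x in line_base l. AE s in lborel.
     line_point l x s \<in> Q \<longrightarrow> s \<notin> regular_points (slice r l x) \<longrightarrow> r (line_point l x s) \<le> 0)"

text \<open>On almost every line parallel to the axis \<open>l\<close> the weighted sum of squares
  is finite and the values converge, so the one-dimensional statement applies at regular points; at
  the others \<open>r\<close> is not positive by \<open>line_condition\<close>.\<close>

lemma Hamza_domain:
  fixes u p :: "nat \<Rightarrow> real ^ 'n::finite \<Rightarrow> real" and r :: "real ^ 'n \<Rightarrow> real"
  assumes Q: "open Q"
    and der: "\<And>j y. y \<in> Q \<Longrightarrow> ((\<lambda>t. u j (y + t *\<^sub>R axis l 1)) has_real_derivative p j y) (at 0)"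
    and cont: "\<And>j. continuous_on Q (p j)"
    and r[measurable]: "r \<in> borel_measurable borel"
    and S: "(\<integral>\<^sup>+y\<in>Q. (\<Sum>j. ennreal (2 ^ j * (r y * (p (Suc j) y - p j y)\<^sup>2))) \<partial>lborel) < \<infinity>"
    and lim: "AE y in lborel. y \<in> Q \<longrightarrow> 0 < r y \<longrightarrow> (\<lambda>j. u j y) \<longlonglongrightarrow> 0"
    and line: "line_condition l Q r"
  shows "AE y in lborel. y \<in> Q \<longrightarrow> 0 < r y \<longrightarrow> (\<lambda>j. p j y) \<longlonglongrightarrow> 0"
proof -
  have [measurable]: "Q \<in> sets borel" using Q by simp
  \<comment> \<open>The extension by 0 turns derivatives that are continuous on \<open>Q\<close>
    only into Borel functions on the whole space, as is needed for integrating over lines.\<close>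
  define D where "D j y = indicator Q y *\<^sub>R p j y" for j y
  have D[measurable]: "D j \<in> borel_measurable borel" for j
    unfolding D_def by (intro borel_measurable_continuous_on_indicator cont) auto
  have D_in: "D j y = p j y" if "y \<in> Q" for j y using that by (simp add: D_def)
  note [measurable] = measurable_tendsto_0[of D]
  have "AE y in lborel. y \<in> Q \<longrightarrow> 0 < r y \<longrightarrow> (\<lambda>j. D j y) \<longlonglongrightarrow> 0"
  proof (rule AE_linesI[where l = l])
    define f where "f y = (\<Sum>j. ennreal (2 ^ j * (r y * (D (Suc j) y - D j y)\<^sup>2))) * indicator Q y" for y
    have [measurable]: "f \<in> borel_measurable borel" unfolding f_def by measurable
    have f: "f y = (\<Sum>j. ennreal (2 ^ j * (r y * (p (Suc j) y - p j y)\<^sup>2))) * indicator Q y" for y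
      by (cases "y \<in> Q") (simp_all add: f_def D_in)
    have "(\<integral>\<^sup>+y. f y \<partial>lborel) < \<infinity>" using S by (simp add: f)
    then have "AE x in line_base l. (\<integral>\<^sup>+s. f (line_point l x s) \<partial>lborel) \<noteq> \<infinity>"
      by (intro nn_integral_PInf_AE lborel.borel_measurable_nn_integral) (auto simp: nn_integral_lines[of f l])
    with AE_lines[OF lim, of l] line[unfolded line_condition_def]
    show "AE x in line_base l. AE s in lborel.
      line_point l x s \<in> Q \<longrightarrow> 0 < r (line_point l x s) \<longrightarrow> (\<lambda>j. D j (line_point l x s)) \<longlonglongrightarrow> 0"
    proof eventually_elim
      case (elim x)
      define U where "U = {s. line_point l x s \<in> Q}"
      have lc: "continuous_on A (line_point l x)" for A
        unfolding line_point_def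
      proof (intro continuous_on_vec_lambda)
        show "continuous_on A (\<lambda>s. if j = l then s else x j)" for j by (cases "j = l") auto
      qed
      have "open U" unfolding U_def using open_vimage[OF Q, of "line_point l x"] lc by (simp add: vimage_def)
      have "AE s in lborel. s \<in> U \<longrightarrow> s \<in> regular_points (slice r l x) \<longrightarrow> (\<lambda>j. p j (line_point l x s)) \<longlonglongrightarrow> 0"
      proof (rule Hamza_open[OF \<open>open U\<close>, where \<phi> = "\<lambda>j s. u j (line_point l x s)"])
        fix j t assume "t \<in> U"
        then have "((\<lambda>h. u j (line_point l x t + h *\<^sub>R axis l 1)) has_real_derivative p j (line_point l x t)) (at 0)"
          by (intro der) (simp add: U_def)
        then have "((\<lambda>h. u j (line_point l x (t + h))) has_real_derivative p j (line_point l x t)) (at 0)"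
          by (subst line_point_eq[of l x _ t]) simp
        then show "((\<lambda>s. u j (line_point l x s)) has_real_derivative p j (line_point l x t)) (at t)"
          using DERIV_at_within_shift[of "\<lambda>s. u j (line_point l x s)" "p j (line_point l x t)" t 0 UNIV] by (simp add: add.commute)
      next
        show "continuous_on U (\<lambda>s. p j (line_point l x s))" for j
          by (intro continuous_on_compose2[OF cont lc]) (auto simp: U_def)
        show "slice r l x \<in> borel_measurable borel"
          unfolding slice_eq[abs_def] by (intro measurable_compose[OF borel_measurable_continuous_onI[OF lc] r])
        have "(\<integral>\<^sup>+t\<in>U. (\<Sum>j. ennreal (2 ^ j * (slice r l x t * (p (Suc j) (line_point l x t) - p j (line_point l x t))\<^sup>2))) \<partial>lborel)
          = (\<integral>\<^sup>+s. f (line_point l x s) \<partial>lborel)"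
          by (intro nn_integral_cong) (simp add: f slice_eq U_def indicator_def)
        then show "(\<integral>\<^sup>+t\<in>U. (\<Sum>j. ennreal (2 ^ j * (slice r l x t * (p (Suc j) (line_point l x t) - p j (line_point l x t))\<^sup>2))) \<partial>lborel) < \<infinity>"
          using elim(3) by (simp add: top.not_eq_extremum)
        show "AE t in lborel. t \<in> U \<longrightarrow> 0 < slice r l x t \<longrightarrow> (\<lambda>j. u j (line_point l x t)) \<longlonglongrightarrow> 0"
          using elim(1) by (simp add: slice_eq U_def)
      qed
      with elim(2) show ?case
        by eventually_elim (auto simp: U_def D_in not_le[symmetric])
    qed
  qed measurable
  then show ?thesis by (rule eventually_mono) (simp add: D_in)
qed

section \<open>Cylinder functions\<close>

lemma tendsto_fun:
  fixes f :: "'b \<Rightarrow> nat \<Rightarrow> real"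
  assumes "\<And>i. ((\<lambda>t. f t i) \<longlongrightarrow> l i) F"
  shows "(f \<longlongrightarrow> l) F"
proof -
  have "limitin (product_topology (\<lambda>_. euclidean) UNIV) f l F"
    unfolding limitin_componentwise using assms by simp
  then show ?thesis by (simp add: euclidean_product_topology)
qed

lemma MVT_between:
  fixes f :: "real \<Rightarrow> real"
  assumes "\<And>x. (f has_real_derivative f' x) (at x)"
  shows "\<exists>\<xi>. \<bar>\<xi> - a\<bar> \<le> \<bar>b - a\<bar> \<and> f b - f a = (b - a) * f' \<xi>"
proof (cases a b rule: linorder_cases)
  case less
  from MVT2[OF less, of f f'] assms obtain z where "a < z" "z < b" "f b - f a = (b - a) * f' z" by blast
  then show ?thesis by (intro exI[of _ z]) auto
next
  case greater
  from MVT2[OF greater, of f f'] assms obtain z where "b < z" "z < a" "f a - f b = (a - b) * f' z" by blast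
  then show ?thesis by (intro exI[of _ z]) (auto simp: algebra_simps)
qed (auto intro: exI[of _ a])

text \<open>Only partial derivatives of \<open>g\<close> are given, so the coordinates are moved one
  after another. The change in the last coordinate is a partial derivative at an intermediate value,
  which converges by continuity of the partial derivative; the first \<open>N\<close> coordinates
  are covered by the induction hypothesis.\<close>

lemma chain_rule_partials:
  fixes g :: "(nat \<Rightarrow> real) \<Rightarrow> real" and \<phi> :: "nat \<Rightarrow> real \<Rightarrow> real"
  assumes "\<And>i y. i < N \<Longrightarrow> (\<lambda>t. g (y(i := t))) field_differentiable (at (y i))"
    and "\<And>i. i < N \<Longrightarrow> continuous_on UNIV (partial_deriv i g)"
    and "\<And>i. i < N \<Longrightarrow> (\<phi> i has_real_derivative \<phi>' i) (at 0)"
  shows "((\<lambda>t. g (\<lambda>i. if i < N then \<phi> i t else c i)) has_real_derivative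
    (\<Sum>i<N. partial_deriv i g (\<lambda>i. if i < N then \<phi> i 0 else c i) * \<phi>' i)) (at 0)"
  using assms
proof (induction N arbitrary: c)
  case (Suc N)
  define Y where "Y t s = (\<lambda>i. if i < N then \<phi> i t else (c(N := s)) i)" for t s
  have Y: "(\<lambda>i. if i < Suc N then \<phi> i t else c i) = Y t (\<phi> N t)" for t
    by (auto simp: Y_def less_Suc_eq)
  have Y_upd: "(Y t s)(N := u) = Y t u" "Y t s N = s" for t s u by (auto simp: Y_def)
  have 1: "((\<lambda>t. g (Y t (\<phi> N 0))) has_real_derivative
      (\<Sum>i<N. partial_deriv i g (Y 0 (\<phi> N 0)) * \<phi>' i)) (at 0)"
    unfolding Y_def by (rule Suc.IH) (use Suc.prems in auto)
  have D: "((\<lambda>s. g (Y t s)) has_real_derivative partial_deriv N g (Y t s)) (at s)" for t s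
    using Suc.prems(1)[of N "Y t s"] by (simp add: Y_upd partial_deriv_def field_differentiable_derivI)
  \<comment> \<open>The intermediate value depends on \<open>t\<close> and its position relative to
    the endpoints is unknown; only its distance from \<open>\<phi> N 0\<close> is controlled, and
    this tends to 0 with \<open>t\<close>.\<close>
  from MVT_between[OF D] have "\<forall>t. \<exists>\<xi>. \<bar>\<xi> - \<phi> N 0\<bar> \<le> \<bar>\<phi> N t - \<phi> N 0\<bar> \<and>
    g (Y t (\<phi> N t)) - g (Y t (\<phi> N 0)) = (\<phi> N t - \<phi> N 0) * partial_deriv N g (Y t \<xi>)" by blast
  then obtain \<xi> where \<xi>: "\<And>t. \<bar>\<xi> t - \<phi> N 0\<bar> \<le> \<bar>\<phi> N t - \<phi> N 0\<bar>"
    "\<And>t. g (Y t (\<phi> N t)) - g (Y t (\<phi> N 0)) = (\<phi> N t - \<phi> N 0) * partial_deriv N g (Y t (\<xi> t))" by metis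
  have \<phi>_lim: "(\<phi> i \<longlongrightarrow> \<phi> i 0) (at 0)" if "i < Suc N" for i
    using Suc.prems(3)[OF that] DERIV_isCont isCont_def by blast
  have "((\<lambda>t. \<xi> t - \<phi> N 0) \<longlongrightarrow> 0) (at 0)"
  proof (rule Lim_null_comparison)
    show "\<forall>\<^sub>F t in at 0. norm (\<xi> t - \<phi> N 0) \<le> \<bar>\<phi> N t - \<phi> N 0\<bar>" using \<xi>(1) by simp
    show "((\<lambda>t. \<bar>\<phi> N t - \<phi> N 0\<bar>) \<longlongrightarrow> 0) (at 0)"
      using \<phi>_lim[of N] by (simp add: LIM_zero tendsto_rabs_zero)
  qed
  then have \<xi>_lim: "(\<xi> \<longlongrightarrow> \<phi> N 0) (at 0)" by (simp add: LIM_zero_iff)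
  have "((\<lambda>t. Y t (\<xi> t)) \<longlongrightarrow> Y 0 (\<phi> N 0)) (at 0)"
  proof (rule tendsto_fun)
    show "((\<lambda>t. Y t (\<xi> t) i) \<longlongrightarrow> Y 0 (\<phi> N 0) i) (at 0)" for i
      using \<phi>_lim[of i] \<xi>_lim by (auto simp: Y_def)
  qed
  moreover have "isCont (partial_deriv N g) (Y 0 (\<phi> N 0))"
    using Suc.prems(2)[of N] by (simp add: continuous_on_eq_continuous_at)
  ultimately have "((\<lambda>t. partial_deriv N g (Y t (\<xi> t))) \<longlongrightarrow> partial_deriv N g (Y 0 (\<phi> N 0))) (at 0)"
    by (rule isCont_tendsto_compose[rotated])
  moreover have "((\<lambda>t. (\<phi> N t - \<phi> N 0) / t) \<longlongrightarrow> \<phi>' N) (at 0)"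
    using Suc.prems(3)[of N] by (simp add: DERIV_def)
  ultimately have "((\<lambda>t. partial_deriv N g (Y t (\<xi> t)) * ((\<phi> N t - \<phi> N 0) / t)) \<longlongrightarrow>
    partial_deriv N g (Y 0 (\<phi> N 0)) * \<phi>' N) (at 0)" by (rule tendsto_mult)
  then have 2: "((\<lambda>t. g (Y t (\<phi> N t)) - g (Y t (\<phi> N 0))) has_real_derivative partial_deriv N g (Y 0 (\<phi> N 0)) * \<phi>' N) (at 0)"
    unfolding DERIV_def \<xi>(2) by (simp add: mult.commute)
  from DERIV_add[OF 2 1] show ?case unfolding Y by (simp add: add.commute)
qed simp

section \<open>Cylinder functions and their representations\<close>

definition depends_below :: "nat \<Rightarrow> ((nat \<Rightarrow> real) \<Rightarrow> real) \<Rightarrow> bool" where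
  "depends_below N g \<longleftrightarrow> (\<forall>y z. (\<forall>i<N. y i = z i) \<longrightarrow> g y = g z)"

lemma Cb_inf_iff: "g \<in> Cb_inf N \<longleftrightarrow> depends_below N g \<and> (\<forall>k. Ckb k N g)"
  by (simp add: Cb_inf_def depends_below_def)

lemma depends_belowD: "depends_below N g \<Longrightarrow> (\<And>i. i < N \<Longrightarrow> y i = z i) \<Longrightarrow> g y = g z"
  by (auto simp: depends_below_def)

lemma partial_deriv_beyond:
  assumes "depends_below N g" "N \<le> i"
  shows "(\<lambda>t. g (y(i := t))) = (\<lambda>t. g y)" "partial_deriv i g = (\<lambda>_. 0)"
proof -
  show *: "(\<lambda>t. g (y(i := t))) = (\<lambda>t. g y)" for y
    using assms(2) by (intro ext depends_belowD[OF assms(1)]) auto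
  show "partial_deriv i g = (\<lambda>_. 0)" unfolding partial_deriv_def * by simp
qed

lemma depends_below_partial_deriv:
  assumes "depends_below N g"
  shows "depends_below N (partial_deriv i g)"
proof (cases "i < N")
  case True
  have "partial_deriv i g y = partial_deriv i g z" if "\<forall>i<N. y i = z i" for y z
  proof -
    have "(\<lambda>t. g (y(i := t))) = (\<lambda>t. g (z(i := t)))"
      using that by (intro ext depends_belowD[OF assms]) auto
    then show ?thesis using that True by (simp add: partial_deriv_def)
  qed
  then show ?thesis by (simp add: depends_below_def)
next
  case False
  then show ?thesis using partial_deriv_beyond(2)[OF assms, of i] by (simp add: depends_below_def)
qed

lemma Ckb_zero: "Ckb k N (\<lambda>_. 0)"
proof (induction k)
  case (Suc k)
  have "partial_deriv i (\<lambda>_. 0) = (\<lambda>_. 0)" for i by (auto simp: fun_eq_iff partial_deriv_def)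
  then show ?case using Suc by simp
qed simp

lemma Ckb_extend:
  assumes "depends_below N g" "Ckb k N g"
  shows "Ckb k N' g"
  using assms
proof (induction k arbitrary: g)
  case (Suc k)
  have "Ckb k N' (partial_deriv i g) \<and> (\<forall>y. (\<lambda>t. g (y(i := t))) field_differentiable (at (y i)))" for i
  proof (cases "i < N")
    case True
    then show ?thesis using Suc by (auto intro: depends_below_partial_deriv)
  next
    case False
    then have i: "N \<le> i" by simp
    show ?thesis unfolding partial_deriv_beyond[OF Suc.prems(1) i] by (simp add: Ckb_zero)
  qed
  then show ?case using Suc.prems by simp
qed simp

lemma Ckb_shift:
  assumes "Ckb k N g"
  shows "Ckb k (K + N) (\<lambda>y. g (\<lambda>i. y (i + K)))"
  using assms
proof (induction k arbitrary: g)
  case 0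
  then show ?case
    by (auto intro!: continuous_on_compose2[of UNIV g] continuous_on_coordinatewise_then_product continuous_on_product_coordinates
        intro: bounded_subset)
next
  case (Suc k)
  have "Ckb 0 (K + N) (\<lambda>y. g (\<lambda>i. y (i + K)))"
    using Suc.prems by (auto intro!: continuous_on_compose2[of UNIV g] continuous_on_coordinatewise_then_product continuous_on_product_coordinates
        intro: bounded_subset)
  moreover have "Ckb k (K + N) (partial_deriv i (\<lambda>y. g (\<lambda>i. y (i + K)))) \<and>
    (\<forall>y. (\<lambda>t. g (\<lambda>j. (y(i := t)) (j + K))) field_differentiable (at (y i)))" if "i < K + N" for i
  proof (cases "i < K")
    case True
    then have *: "(\<lambda>j. (y(i := t)) (j + K)) = (\<lambda>j. y (j + K))" for y :: "nat \<Rightarrow> real" and t by auto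
    have "partial_deriv i (\<lambda>y. g (\<lambda>i. y (i + K))) = (\<lambda>_. 0)" unfolding partial_deriv_def * by simp
    then show ?thesis unfolding * by (simp add: Ckb_zero)
  next
    case False
    then have *: "(\<lambda>j. (y(i := t)) (j + K)) = (\<lambda>j. y (j + K))(i - K := t)" for y :: "nat \<Rightarrow> real" and t by (intro ext) auto
    have i: "i - K < N" "i - K + K = i" using False that by auto
    have "partial_deriv i (\<lambda>y. g (\<lambda>i. y (i + K))) = (\<lambda>y. partial_deriv (i - K) g (\<lambda>j. y (j + K)))"
      unfolding partial_deriv_def * using i by simp
    moreover have "(\<lambda>t. g ((\<lambda>j. y (j + K))(i - K := t))) field_differentiable (at (y i))" for y
      using Suc.prems i by (auto dest!: spec[of _ "i - K"] spec[of _ "\<lambda>j. y (j + K)"])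
    ultimately show ?thesis unfolding * using Suc.IH[of "partial_deriv (i - K) g"] Suc.prems i by simp
  qed
  ultimately show ?case by simp
qed

lemma Ckb_diff:
  assumes "Ckb k N g" "Ckb k N h"
  shows "Ckb k N (\<lambda>y. g y - h y)"
  using assms
proof (induction k arbitrary: g h)
  case 0
  then show ?case by (auto intro: continuous_on_diff bounded_minus_comp)
next
  case (Suc k)
  have "partial_deriv i (\<lambda>y. g y - h y) = (\<lambda>y. partial_deriv i g y - partial_deriv i h y)" if "i < N" for i
    unfolding partial_deriv_def using Suc.prems that by (intro ext deriv_diff) auto
  then show ?case using Suc by (auto intro: continuous_on_diff bounded_minus_comp field_differentiable_diff)
qed

text \<open>The variables of both representations are put side by side: the second block is shifted
  by \<open>N\<close>, and the first function is regarded as one of \<open>N + N'\<close>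
  variables.\<close>

lemma cylinder_rep_diff:
  assumes 1: "cylinder_rep M F N g f" and 2: "cylinder_rep M F' N' g' f'"
  shows "cylinder_rep M (\<lambda>\<gamma>. F \<gamma> - F' \<gamma>) (N + N') (\<lambda>y. g y - g' (\<lambda>i. y (i + N))) (\<lambda>i. if i < N then f i else f' (i - N))"
proof -
  have g: "depends_below N g" "\<And>k. Ckb k N g" and g': "depends_below N' g'" "\<And>k. Ckb k N' g'"
    using 1 2 by (auto simp: cylinder_rep_def Cb_inf_iff)
  have "depends_below (N + N') (\<lambda>y. g y - g' (\<lambda>i. y (i + N)))"
    unfolding depends_below_def
  proof (intro allI impI)
    fix y z :: "nat \<Rightarrow> real" assume "\<forall>i<N + N'. y i = z i"
    then have "g y = g z" "g' (\<lambda>i. y (i + N)) = g' (\<lambda>i. z (i + N))"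
      by (auto intro!: depends_belowD[OF g(1)] depends_belowD[OF g'(1)])
    then show "g y - g' (\<lambda>i. y (i + N)) = g z - g' (\<lambda>i. z (i + N))" by simp
  qed
  then have "(\<lambda>y. g y - g' (\<lambda>i. y (i + N))) \<in> Cb_inf (N + N')"
    unfolding Cb_inf_iff using Ckb_extend[OF g] Ckb_shift[OF g'(2)] by (auto intro: Ckb_diff)
  moreover have "g (\<lambda>i. pairing (if i < N then f i else f' (i - N)) \<gamma>) = g (\<lambda>i. pairing (f i) \<gamma>)" for \<gamma>
    by (rule depends_belowD[OF g(1)]) simp
  ultimately show ?thesis using 1 2 by (auto simp: cylinder_rep_def)
qed

lemma FCb_inf_diff: "F \<in> FCb_inf M \<Longrightarrow> F' \<in> FCb_inf M \<Longrightarrow> (\<lambda>\<gamma>. F \<gamma> - F' \<gamma>) \<in> FCb_inf M"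
  unfolding FCb_inf_def using cylinder_rep_diff by blast

lemma Cb_inf_chain:
  assumes g: "g \<in> Cb_inf N" and \<phi>: "\<And>i. i < N \<Longrightarrow> (\<phi> i has_real_derivative \<phi>' i) (at 0)"
  shows "((\<lambda>t. g (\<lambda>i. \<phi> i t)) has_real_derivative (\<Sum>i<N. partial_deriv i g (\<lambda>i. \<phi> i 0) * \<phi>' i)) (at 0)"
proof -
  from g have dep: "depends_below N g" and C: "Ckb (Suc (Suc 0)) N g" unfolding Cb_inf_iff by blast+
  have "((\<lambda>t. g (\<lambda>i. if i < N then \<phi> i t else 0)) has_real_derivative
    (\<Sum>i<N. partial_deriv i g (\<lambda>i. if i < N then \<phi> i 0 else 0) * \<phi>' i)) (at 0)"
    using C unfolding Ckb.simps by (intro chain_rule_partials \<phi>) blast+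
  moreover have "g (\<lambda>i. if i < N then \<phi> i t else 0) = g (\<lambda>i. \<phi> i t)" for t
    by (rule depends_belowD[OF dep]) simp
  moreover have "partial_deriv k g (\<lambda>i. if i < N then \<phi> i 0 else 0) = partial_deriv k g (\<lambda>i. \<phi> i 0)" for k
    by (rule depends_belowD[OF depends_below_partial_deriv[OF dep]]) simp
  ultimately show ?thesis by simp
qed

section \<open>The gradient as a derivative under displacement of one point\<close>

definition config_gradient ::
    "('a, 'n::finite) chart \<Rightarrow> nat \<Rightarrow> ((nat \<Rightarrow> real) \<Rightarrow> real) \<Rightarrow> (nat \<Rightarrow> 'a \<Rightarrow> real) \<Rightarrow> 'a set \<Rightarrow> 'a \<Rightarrow> real ^ 'n" where
  "config_gradient c N g f \<gamma> x =
     (\<Sum>i<N. partial_deriv i g (\<lambda>j. pairing (f j) \<gamma>) *\<^sub>R chart_gradient c (f i) (snd c x))"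

lemma cylinder_line_derivative:
  fixes M :: "('a::topological_space, 'n::finite) riemannian"
  assumes M: "smooth_atlas M" and c: "nice_chart M c" and g: "g \<in> Cb_inf N"
    and f: "\<And>i. i < N \<Longrightarrow> f i \<in> C0_inf M" and y: "y \<in> chart_range c"
  shows "((\<lambda>t. g (\<lambda>i. a i + f i (chart_inv c (y + t *\<^sub>R axis l 1)))) has_real_derivative
    (\<Sum>i<N. partial_deriv i g (\<lambda>i. a i + f i (chart_inv c y)) * chart_gradient c (f i) y $ l)) (at 0)"
proof -
  have "((\<lambda>t. a i + f i (chart_inv c (y + t *\<^sub>R axis l 1))) has_real_derivative chart_gradient c (f i) y $ l) (at 0)"
    if "i < N" for i
  proof -
    have d: "(f i \<circ> chart_inv c) differentiable (at y)"
      using smooth_fun_chart_C1(1)[OF M c _ y] f[OF that] by (simp add: C0_inf_def)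
    have "((f i \<circ> chart_inv c) has_derivative (\<lambda>v. v \<bullet> chart_gradient c (f i) y)) (at (y + 0 *\<^sub>R axis l 1))"
    proof -
      have "frechet_derivative (f i \<circ> chart_inv c) (at y) = (\<lambda>v. v \<bullet> chart_gradient c (f i) y)"
        by (rule ext) (rule chart_gradient_eq[OF d])
      then show ?thesis using d[unfolded frechet_derivative_works] by simp
    qed
    moreover have "((\<lambda>t. y + t *\<^sub>R axis l 1) has_derivative (\<lambda>t. t *\<^sub>R axis l 1)) (at 0)"
      by (auto intro!: derivative_eq_intros)
    ultimately have "((\<lambda>t. (f i \<circ> chart_inv c) (y + t *\<^sub>R axis l 1)) has_derivative (\<lambda>t. (t *\<^sub>R axis l 1) \<bullet> chart_gradient c (f i) y)) (at 0)"
      by (rule has_derivative_compose[rotated])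
    then have "((\<lambda>t. f i (chart_inv c (y + t *\<^sub>R axis l 1))) has_real_derivative chart_gradient c (f i) y $ l) (at 0)"
      by (simp add: has_field_derivative_def inner_axis' mult_commute_abs)
    then show ?thesis by (auto intro!: derivative_eq_intros)
  qed
  from Cb_inf_chain[OF g this] show ?thesis by simp
qed

lemma cylinder_rep_insert:
  fixes M :: "('a::{t2_space,second_countable_topology}, 'n::finite) riemannian"
  assumes M: "smooth_atlas M" and r: "cylinder_rep M F N g f" and \<gamma>: "\<gamma> \<in> configs" "x \<notin> \<gamma>"
  shows "F (insert x \<gamma>) = g (\<lambda>i. pairing (f i) \<gamma> + f i x)"
    and "partial_deriv k g (\<lambda>i. pairing (f i) (insert x \<gamma>)) = partial_deriv k g (\<lambda>i. pairing (f i) \<gamma> + f i x)"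
proof -
  have g: "depends_below N g" and f: "\<And>i. i < N \<Longrightarrow> f i \<in> C0_inf M" using r by (auto simp: cylinder_rep_def Cb_inf_iff)
  have p: "pairing (f i) (insert x \<gamma>) = pairing (f i) \<gamma> + f i x" if "i < N" for i
    using pairing_insert[OF M f[OF that] \<gamma>] by simp
  have "F (insert x \<gamma>) = g (\<lambda>i. pairing (f i) (insert x \<gamma>))"
    using r configs_insert[OF \<gamma>(1)] by (simp add: cylinder_rep_def)
  also have "\<dots> = g (\<lambda>i. pairing (f i) \<gamma> + f i x)" by (rule depends_belowD[OF g]) (rule p)
  finally show "F (insert x \<gamma>) = g (\<lambda>i. pairing (f i) \<gamma> + f i x)" .
  show "partial_deriv k g (\<lambda>i. pairing (f i) (insert x \<gamma>)) = partial_deriv k g (\<lambda>i. pairing (f i) \<gamma> + f i x)"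
    by (rule depends_belowD[OF depends_below_partial_deriv[OF g]]) (rule p)
qed

text \<open>The coordinate gradient at \<open>x\<close> is the derivative of \<open>F\<close> when
  only the point \<open>x\<close> moves. The left-hand side refers to the values of \<open>F\<close>
  and not to \<open>N\<close>, \<open>g\<close>, \<open>f\<close>; independence of the
  representation follows from this.\<close>

lemma insertion_derivative:
  fixes M :: "('a::{t2_space,second_countable_topology}, 'n::finite) riemannian"
  assumes M: "smooth_atlas M" and c: "nice_chart M c" and r: "cylinder_rep M F N g f"
    and \<gamma>: "\<gamma> \<in> configs" "x \<notin> \<gamma>" and x: "x \<in> fst c"
  shows "((\<lambda>t. F (insert (chart_inv c (snd c x + t *\<^sub>R axis l 1)) \<gamma>)) has_real_derivative
    config_gradient c N g f (insert x \<gamma>) x $ l) (at 0)"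
proof -
  note C = is_chartD[OF nice_chart_is_chart[OF c]]
  have g: "g \<in> Cb_inf N" and f: "\<And>i. i < N \<Longrightarrow> f i \<in> C0_inf M" using r by (auto simp: cylinder_rep_def)
  \<comment> \<open>As configurations are sets, the moving point must not meet other points of
    \<open>\<gamma>\<close>. In \<open>U\<close> there are none, because
    \<open>x \<notin> \<gamma>\<close>, and the pairings with the enlarged configuration split
    there.\<close>
  from configs_closed_discrete[OF M \<gamma>(1)] obtain U where U: "open U" "x \<in> U" "U \<inter> \<gamma> \<subseteq> {x}" by metis
  define Q where "Q = chart_range c \<inter> chart_inv c -` U"
  have "open Q" unfolding Q_def by (rule open_chart_vimage[OF nice_chart_is_chart[OF c] U(1)])
  then have "open ((\<lambda>t. snd c x + t *\<^sub>R axis l 1) -` Q)"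
    by (rule open_vimage) (intro continuous_intros)
  moreover have "0 \<in> (\<lambda>t. snd c x + t *\<^sub>R axis l 1) -` Q" using C(5,6)[OF x] U(2) by (simp add: Q_def)
  ultimately have ev: "\<forall>\<^sub>F t in nhds 0. snd c x + t *\<^sub>R axis l 1 \<in> Q"
    unfolding eventually_nhds by (intro exI[of _ "(\<lambda>t. snd c x + t *\<^sub>R axis l 1) -` Q"]) auto
  have eq: "F (insert (chart_inv c y) \<gamma>) = g (\<lambda>i. pairing (f i) \<gamma> + f i (chart_inv c y))" if "y \<in> Q" for y
    using that U(3) \<gamma>(2) by (intro cylinder_rep_insert(1)[OF M r \<gamma>(1)]) (auto simp: Q_def)
  have "((\<lambda>t. g (\<lambda>i. pairing (f i) \<gamma> + f i (chart_inv c (snd c x + t *\<^sub>R axis l 1)))) has_real_derivative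
    (\<Sum>i<N. partial_deriv i g (\<lambda>i. pairing (f i) \<gamma> + f i (chart_inv c (snd c x))) * chart_gradient c (f i) (snd c x) $ l)) (at 0)"
    by (rule cylinder_line_derivative[OF M c g f C(6)[OF x]])
  then have "((\<lambda>t. F (insert (chart_inv c (snd c x + t *\<^sub>R axis l 1)) \<gamma>)) has_real_derivative
    (\<Sum>i<N. partial_deriv i g (\<lambda>i. pairing (f i) \<gamma> + f i (chart_inv c (snd c x))) * chart_gradient c (f i) (snd c x) $ l)) (at 0)"
    by (subst DERIV_cong_ev[OF refl _ refl]) (use ev eq in \<open>auto elim!: eventually_mono\<close>)
  then show ?thesis
    by (simp add: config_gradient_def C(5)[OF x] cylinder_rep_insert(2)[OF M r \<gamma>])
qed

text \<open>Remove \<open>x\<close> from \<open>\<gamma>\<close>, move it as a free point, and use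
  uniqueness of derivatives on the real line; no relation between the three representations is
  required.\<close>

lemma config_gradient_diff:
  fixes M :: "('a::{t2_space,second_countable_topology}, 'n::finite) riemannian"
  assumes M: "smooth_atlas M" and c: "nice_chart M c" and r: "cylinder_rep M F N g f" "cylinder_rep M F' N' g' f'"
    "cylinder_rep M H N'' g'' f''" and H: "\<And>\<gamma>. \<gamma> \<in> configs \<Longrightarrow> H \<gamma> = F \<gamma> - F' \<gamma>"
    and \<gamma>: "\<gamma> \<in> configs" "x \<in> \<gamma>" "x \<in> fst c"
  shows "config_gradient c N'' g'' f'' \<gamma> x = config_gradient c N g f \<gamma> x - config_gradient c N' g' f' \<gamma> x"
proof -
  have "config_gradient c N'' g'' f'' \<gamma> x $ l = config_gradient c N g f \<gamma> x $ l - config_gradient c N' g' f' \<gamma> x $ l" for l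
  proof -
    have \<gamma>': "\<gamma> - {x} \<in> configs" "x \<notin> \<gamma> - {x}" using \<gamma> by (auto intro: configs_subset)
    have i: "insert x (\<gamma> - {x}) = \<gamma>" using \<gamma>(2) by auto
    note d = insertion_derivative[OF M c _ \<gamma>' \<gamma>(3), unfolded i, where l = l]
    have "H (insert z (\<gamma> - {x})) = F (insert z (\<gamma> - {x})) - F' (insert z (\<gamma> - {x}))" for z
      by (intro H configs_insert \<gamma>')
    with DERIV_unique[OF d[OF r(3)]] DERIV_diff[OF d[OF r(1)] d[OF r(2)]] show ?thesis by simp
  qed
  then show ?thesis by (simp add: vec_eq_iff)
qed

text \<open>The difference of a function with itself is 0, which has a representation with no
  variables and hence zero gradient.\<close>

lemma config_gradient_unique:
  fixes M :: "('a::{t2_space,second_countable_topology}, 'n::finite) riemannian"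
  assumes M: "smooth_atlas M" and c: "nice_chart M c" and r: "cylinder_rep M F N g f" "cylinder_rep M F N' g' f'"
    and \<gamma>: "\<gamma> \<in> configs" "x \<in> \<gamma>" "x \<in> fst c"
  shows "config_gradient c N g f \<gamma> x = config_gradient c N' g' f' \<gamma> x"
proof -
  have z: "cylinder_rep M (\<lambda>_. 0) 0 (\<lambda>_. 0) f" by (simp add: cylinder_rep_def Cb_inf_def Ckb_zero)
  have "config_gradient c 0 (\<lambda>_. 0) f \<gamma> x = config_gradient c N g f \<gamma> x - config_gradient c N' g' f' \<gamma> x"
    by (rule config_gradient_diff[OF M c r z _ \<gamma>]) simp
  then show ?thesis by (simp add: config_gradient_def)
qed

section \<open>The squared gradient of a cylinder function\<close>

lemma FCb_inf_rep:
  assumes "F \<in> FCb_inf M"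
  obtains N g f where "(SOME (N, g, f). cylinder_rep M F N g f) = (N, g, f)" "cylinder_rep M F N g f"
proof -
  have "\<exists>p. (case p of (N, g, f) \<Rightarrow> cylinder_rep M F N g f)" using assms by (auto simp: FCb_inf_def)
  from someI_ex[OF this] show thesis by (cases "SOME (N, g, f). cylinder_rep M F N g f") (auto intro: that)
qed

definition grad_sq :: "('a::topological_space, 'n::finite) riemannian \<Rightarrow> ('a set \<Rightarrow> real) \<Rightarrow> 'a \<Rightarrow> 'a set \<Rightarrow> real" where
  "grad_sq M F x \<gamma> = metric M x (grad_conf M F \<gamma> x) (grad_conf M F \<gamma> x)"

text \<open>Uses the same choice of a representation as \<open>grad_conf\<close>. The squared
  gradient is then the quadratic form of this vector at every \<open>x\<close> and
  \<open>\<gamma>\<close>, also for \<open>x\<close> outside \<open>\<gamma>\<close>, where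
  representations may disagree.\<close>

definition chart_grad_conf ::
    "('a::topological_space, 'n::finite) riemannian \<Rightarrow> ('a, 'n) chart \<Rightarrow> ('a set \<Rightarrow> real) \<Rightarrow> 'a set \<Rightarrow> 'a \<Rightarrow> real ^ 'n" where
  "chart_grad_conf M c F \<gamma> x =
     (let (N, g, f) = (SOME (N, g, f). cylinder_rep M F N g f) in config_gradient c N g f \<gamma> x)"

lemma chart_grad_conf_eq:
  fixes M :: "('a::{t2_space,second_countable_topology}, 'n::finite) riemannian"
  assumes M: "smooth_atlas M" and c: "nice_chart M c" and r: "cylinder_rep M F N g f"
    and \<gamma>: "\<gamma> \<in> configs" "x \<in> \<gamma>" "x \<in> fst c"
  shows "chart_grad_conf M c F \<gamma> x = config_gradient c N g f \<gamma> x"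
proof -
  have "F \<in> FCb_inf M" using r by (auto simp: FCb_inf_def)
  from FCb_inf_rep[OF this] obtain N' g' f' where 1: "(SOME (N, g, f). cylinder_rep M F N g f) = (N', g', f')"
    and 2: "cylinder_rep M F N' g' f'" by blast
  show ?thesis unfolding chart_grad_conf_def 1 using config_gradient_unique[OF M c 2 r \<gamma>] by simp
qed

lemma chart_grad_conf_diff:
  fixes M :: "('a::{t2_space,second_countable_topology}, 'n::finite) riemannian"
  assumes M: "smooth_atlas M" and c: "nice_chart M c" and F: "F \<in> FCb_inf M" "F' \<in> FCb_inf M"
    and \<gamma>: "\<gamma> \<in> configs" "x \<in> \<gamma>" "x \<in> fst c"
  shows "chart_grad_conf M c (\<lambda>\<gamma>. F \<gamma> - F' \<gamma>) \<gamma> x = chart_grad_conf M c F \<gamma> x - chart_grad_conf M c F' \<gamma> x"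
proof -
  from F obtain N g f N' g' f' where r: "cylinder_rep M F N g f" "cylinder_rep M F' N' g' f'"
    by (auto simp: FCb_inf_def)
  note r' = cylinder_rep_diff[OF r]
  show ?thesis
    unfolding chart_grad_conf_eq[OF M c r(1) \<gamma>] chart_grad_conf_eq[OF M c r(2) \<gamma>] chart_grad_conf_eq[OF M c r' \<gamma>]
    by (rule config_gradient_diff[OF M c r r' _ \<gamma>]) simp
qed

lemma grad_sq_chart:
  fixes M :: "('a::{t2_space,second_countable_topology}, 'n::finite) riemannian"
  assumes M: "smooth_atlas M" and c: "nice_chart M c" and F: "F \<in> FCb_inf M" and x: "x \<in> fst c"
  shows "grad_sq M F x \<gamma> = chart_grad_conf M c F \<gamma> x \<bullet> (matrix_inv (gram_matrix M c (snd c x)) *v chart_grad_conf M c F \<gamma> x)"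
proof -
  from FCb_inf_rep[OF F] obtain N g f where 1: "(SOME (N, g, f). cylinder_rep M F N g f) = (N, g, f)"
    and 2: "cylinder_rep M F N g f" by blast
  have "(f i \<circ> chart_inv c) differentiable (at (snd c x))" if "i < N" for i
    using smooth_fun_chart_C1(1)[OF M c _ is_chartD(6)[OF nice_chart_is_chart[OF c] x]] 2 that
    by (auto simp: cylinder_rep_def C0_inf_def)
  from metric_grad_combination[OF M c x this this] show ?thesis
    unfolding grad_sq_def grad_conf_def chart_grad_conf_def 1 config_gradient_def by simp
qed

lemma nice_chart_exists:
  assumes "smooth_atlas M" "riemannian_metric M"
  obtains c where "nice_chart M c" "x \<in> fst c"
  using smooth_atlasD(1)[OF assms(1)] nice_chart_charts[OF assms] by blast

lemma grad_sq_nonneg: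
  fixes M :: "('a::{t2_space,second_countable_topology}, 'n::finite) riemannian"
  assumes M: "smooth_atlas M" "riemannian_metric M" and F: "F \<in> FCb_inf M"
  shows "0 \<le> grad_sq M F x \<gamma>"
proof -
  obtain c where c: "nice_chart M c" "x \<in> fst c" by (rule nice_chart_exists[OF M])
  interpret spd_matrix "gram_matrix M c (snd c x)"
    by (rule spd_gram_matrix(1)[OF c(1) is_chartD(6)[OF nice_chart_is_chart[OF c(1)] c(2)]])
  show ?thesis unfolding grad_sq_chart[OF M(1) c(1) F c(2)] by (rule inv_nonneg)
qed

lemma grad_sq_le:
  fixes M :: "('a::{t2_space,second_countable_topology}, 'n::finite) riemannian"
  assumes M: "smooth_atlas M" "riemannian_metric M" and F: "F \<in> FCb_inf M" "F' \<in> FCb_inf M"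
    and \<gamma>: "\<gamma> \<in> configs" "x \<in> \<gamma>"
  shows "grad_sq M F x \<gamma> \<le> 2 * grad_sq M (\<lambda>\<gamma>. F \<gamma> - F' \<gamma>) x \<gamma> + 2 * grad_sq M F' x \<gamma>"
proof -
  obtain c where c: "nice_chart M c" "x \<in> fst c" by (rule nice_chart_exists[OF M])
  define G where "G = matrix_inv (gram_matrix M c (snd c x))"
  interpret spd_matrix "gram_matrix M c (snd c x)"
    by (rule spd_gram_matrix(1)[OF c(1) is_chartD(6)[OF nice_chart_is_chart[OF c(1)] c(2)]])
  define p q where "p = chart_grad_conf M c F \<gamma> x" and "q = chart_grad_conf M c F' \<gamma> x"
  \<comment> \<open>The inequality is \<open>|p - 2 q|^2 \<ge> 0\<close>, rewritten as
    \<open>2 |p - q|^2 + 2 |q|^2 - |p|^2 \<ge> 0\<close>.\<close>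
  have "0 \<le> (p - 2 *\<^sub>R q) \<bullet> (G *v (p - 2 *\<^sub>R q))" unfolding G_def by (rule inv_nonneg)
  also have "\<dots> = 2 * ((p - q) \<bullet> (G *v (p - q))) + 2 * (q \<bullet> (G *v q)) - p \<bullet> (G *v p)"
    by (simp add: matrix_vector_mult_diff_distrib matrix_vector_mult_scaleR inner_diff_left inner_diff_right algebra_simps)
  finally show ?thesis
    unfolding grad_sq_chart[OF M(1) c(1) F(1) c(2)] grad_sq_chart[OF M(1) c(1) F(2) c(2)]
      grad_sq_chart[OF M(1) c(1) FCb_inf_diff[OF F] c(2)] chart_grad_conf_diff[OF M(1) c(1) F \<gamma> c(2)]
    by (simp add: p_def q_def G_def)
qed

lemma grad_sq_tendsto_0:
  fixes M :: "('a::{t2_space,second_countable_topology}, 'n::finite) riemannian"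
  assumes M: "smooth_atlas M" and c: "nice_chart M c" and F: "\<And>j. F j \<in> FCb_inf M" and x: "x \<in> fst c"
    and lim: "\<And>l. (\<lambda>j::nat. chart_grad_conf M c (F j) \<gamma> x $ l) \<longlonglongrightarrow> 0"
  shows "(\<lambda>j. grad_sq M (F j) x \<gamma>) \<longlonglongrightarrow> 0"
proof -
  have "(\<lambda>j. chart_grad_conf M c (F j) \<gamma> x) \<longlonglongrightarrow> 0" by (rule vec_tendstoI) (simp add: lim)
  then have "(\<lambda>j. chart_grad_conf M c (F j) \<gamma> x \<bullet> (matrix_inv (gram_matrix M c (snd c x)) *v chart_grad_conf M c (F j) \<gamma> x)) \<longlonglongrightarrow>
    0 \<bullet> (matrix_inv (gram_matrix M c (snd c x)) *v 0)"
    by (intro tendsto_intros bounded_linear.tendsto[OF matrix_vector_mul_bounded_linear])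
  then show ?thesis by (simp add: grad_sq_chart[OF M c F x])
qed

text \<open>Relates the Riemannian quantity that enters the form to the single partial derivative
  that is studied on lines.\<close>

lemma chart_grad_conf_bound:
  fixes M :: "('a::{t2_space,second_countable_topology}, 'n::finite) riemannian"
  assumes M: "smooth_atlas M" and c: "nice_chart M c" and F: "F \<in> FCb_inf M" and x: "x \<in> fst c"
  shows "(chart_grad_conf M c F \<gamma> x $ l)\<^sup>2 \<le> grad_sq M F x \<gamma> * gram_matrix M c (snd c x) $ l $ l"
proof -
  interpret spd_matrix "gram_matrix M c (snd c x)"
    by (rule spd_gram_matrix(1)[OF c is_chartD(6)[OF nice_chart_is_chart[OF c] x]])
  show ?thesis unfolding grad_sq_chart[OF M c F x] by (rule component_bound)
qed


lemma measurable_cylinder: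
  fixes M :: "('a::{t2_space,second_countable_topology}, 'n::finite) riemannian"
  assumes M: "smooth_atlas M" and h: "continuous_on UNIV h" "depends_below N h" and f: "\<And>i. i < N \<Longrightarrow> f i \<in> C0_inf M"
  shows "(\<lambda>\<gamma>. h (\<lambda>j. pairing (f j) \<gamma>)) \<in> borel_measurable (local_borel UNIV)"
proof -
  have "(\<lambda>\<gamma>. (\<lambda>j. if j < N then pairing (f j) \<gamma> else 0)) \<in> borel_measurable (local_borel UNIV)"
  proof (rule measurable_coordinatewise_then_product)
    show "(\<lambda>\<gamma>. if j < N then pairing (f j) \<gamma> else 0) \<in> borel_measurable (local_borel UNIV)" for j
      using measurable_pairing_local_borel[OF M f, of j] by (cases "j < N") auto
  qed
  from measurable_compose[OF this borel_measurable_continuous_onI[OF h(1)]]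
  have "(\<lambda>\<gamma>. h (\<lambda>j. if j < N then pairing (f j) \<gamma> else 0)) \<in> borel_measurable (local_borel UNIV)" .
  moreover have "h (\<lambda>j. if j < N then pairing (f j) \<gamma> else 0) = h (\<lambda>j. pairing (f j) \<gamma>)" for \<gamma>
    by (rule depends_belowD[OF h(2)]) simp
  ultimately show ?thesis by simp
qed

lemma FCb_inf_measurable:
  fixes M :: "('a::{t2_space,second_countable_topology}, 'n::finite) riemannian"
  assumes M: "smooth_atlas M" and F: "F \<in> FCb_inf M"
  shows "F \<in> borel_measurable (local_borel UNIV)" "\<exists>b. \<forall>\<gamma>\<in>configs. \<bar>F \<gamma>\<bar> \<le> b"
proof -
  from F obtain N g f where r: "cylinder_rep M F N g f" by (auto simp: FCb_inf_def)
  then have "g \<in> Cb_inf N" by (simp add: cylinder_rep_def)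
  then have "depends_below N g" "Ckb 0 N g" unfolding Cb_inf_iff by blast+
  then have g: "depends_below N g" "continuous_on UNIV g" "bounded (range g)" by auto
  have F_eq: "F \<gamma> = g (\<lambda>i. pairing (f i) \<gamma>)" if "\<gamma> \<in> configs" for \<gamma> using r that by (simp add: cylinder_rep_def)
  have "(\<lambda>\<gamma>. g (\<lambda>j. pairing (f j) \<gamma>)) \<in> borel_measurable (local_borel UNIV)"
    using r by (intro measurable_cylinder[OF M g(2,1)]) (auto simp: cylinder_rep_def)
  then show "F \<in> borel_measurable (local_borel UNIV)"
    by (subst measurable_cong[where g = "\<lambda>\<gamma>. g (\<lambda>j. pairing (f j) \<gamma>)"]) (simp_all add: F_eq)
  from g(3) obtain b where "\<And>y. \<bar>g y\<bar> \<le> b" unfolding bounded_iff by auto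
  then show "\<exists>b. \<forall>\<gamma>\<in>configs. \<bar>F \<gamma>\<bar> \<le> b" using F_eq by auto
qed

lemma metric_grad_zero:
  fixes M :: "('a::{t2_space,second_countable_topology}, 'n::finite) riemannian"
  assumes M: "smooth_atlas M" "riemannian_metric M" and f: "smooth_fun M f" "smooth_fun M h"
    and U: "open U" "x \<in> U" "\<And>z. z \<in> U \<Longrightarrow> f z = 0"
  shows "metric M x (grad M f x) (grad M h x) = 0"
proof -
  obtain c where c: "nice_chart M c" "x \<in> fst c" by (rule nice_chart_exists[OF M])
  note C = is_chartD[OF nice_chart_is_chart[OF c(1)]]
  define Q where "Q = chart_range c \<inter> chart_inv c -` U"
  have Q: "open Q" "snd c x \<in> Q"
    unfolding Q_def using open_chart_vimage[OF nice_chart_is_chart[OF c(1)] U(1)] C(5,6)[OF c(2)] U(2) by auto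
  have "frechet_derivative (f \<circ> chart_inv c) (at (snd c x)) = frechet_derivative (\<lambda>_. 0) (at (snd c x))"
    by (rule frechet_derivative_cong_open(2)[OF Q]) (auto simp: Q_def U(3))
  then have "chart_gradient c f (snd c x) = 0" by (simp add: chart_gradient_def vec_eq_iff)
  then show ?thesis
    using metric_grad[OF M(1) c smooth_fun_chart_C1(1)[OF M(1) c(1) f(1) C(6)[OF c(2)]]
        smooth_fun_chart_C1(1)[OF M(1) c(1) f(2) C(6)[OF c(2)]]] by simp
qed

lemma grad_sq_rep:
  fixes M :: "('a::{t2_space,second_countable_topology}, 'n::finite) riemannian"
  assumes M: "smooth_atlas M" "riemannian_metric M" and F: "F \<in> FCb_inf M"
  obtains N g f where "cylinder_rep M F N g f"
    "\<And>x \<gamma>. grad_sq M F x \<gamma> = (\<Sum>i<N. \<Sum>k<N. partial_deriv i g (\<lambda>j. pairing (f j) \<gamma>) * partial_deriv k g (\<lambda>j. pairing (f j) \<gamma>)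
      * metric M x (grad M (f i) x) (grad M (f k) x))"
proof -
  from FCb_inf_rep[OF F] obtain N g f where 1: "(SOME (N, g, f). cylinder_rep M F N g f) = (N, g, f)"
    and 2: "cylinder_rep M F N g f" by blast
  have "grad_sq M F x \<gamma> = (\<Sum>i<N. \<Sum>k<N. partial_deriv i g (\<lambda>j. pairing (f j) \<gamma>) * partial_deriv k g (\<lambda>j. pairing (f j) \<gamma>)
      * metric M x (grad M (f i) x) (grad M (f k) x))" for x \<gamma>
  proof -
    obtain c where c: "nice_chart M c" "x \<in> fst c" by (rule nice_chart_exists[OF M])
    define b where "b i = partial_deriv i g (\<lambda>j. pairing (f j) \<gamma>)" for i
    define G where "G = matrix_inv (gram_matrix M c (snd c x))"
    have d: "(f i \<circ> chart_inv c) differentiable (at (snd c x))" if "i < N" for i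
      using smooth_fun_chart_C1(1)[OF M(1) c(1) _ is_chartD(6)[OF nice_chart_is_chart[OF c(1)] c(2)]] 2 that
      by (auto simp: cylinder_rep_def C0_inf_def)
    have "grad_sq M F x \<gamma> = (\<Sum>i<N. b i *\<^sub>R chart_gradient c (f i) (snd c x)) \<bullet> (G *v (\<Sum>k<N. b k *\<^sub>R chart_gradient c (f k) (snd c x)))"
      unfolding grad_sq_chart[OF M(1) c(1) F c(2)] chart_grad_conf_def 1 config_gradient_def by (simp add: b_def G_def)
    also have "\<dots> = (\<Sum>i<N. \<Sum>k<N. b i * b k * (chart_gradient c (f i) (snd c x) \<bullet> (G *v chart_gradient c (f k) (snd c x))))"
      by (simp add: linear_sum[OF matrix_vector_mul_linear] matrix_vector_mult_scaleR inner_sum_left inner_sum_right mult_ac sum_distrib_left)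
        (subst sum.swap, intro sum.cong refl, simp add: mult_ac)
    also have "\<dots> = (\<Sum>i<N. \<Sum>k<N. b i * b k * metric M x (grad M (f i) x) (grad M (f k) x))"
      by (intro sum.cong refl) (simp add: metric_grad[OF M(1) c d d] G_def)
    finally show ?thesis by (simp add: b_def)
  qed
  with 2 show thesis by (rule that)
qed

lemma measurable_grad_sq:
  fixes M :: "('a::{t2_space,second_countable_topology}, 'n::finite) riemannian"
  assumes M: "smooth_atlas M" "riemannian_metric M" and F: "F \<in> FCb_inf M"
  shows "(\<lambda>(x, \<gamma>). grad_sq M F x \<gamma>) \<in> borel_measurable (borel \<Otimes>\<^sub>M local_borel UNIV)"
proof -
  obtain N g f where r: "cylinder_rep M F N g f"
    and eq: "\<And>x \<gamma>. grad_sq M F x \<gamma> = (\<Sum>i<N. \<Sum>k<N. partial_deriv i g (\<lambda>j. pairing (f j) \<gamma>) * partial_deriv k g (\<lambda>j. pairing (f j) \<gamma>)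
      * metric M x (grad M (f i) x) (grad M (f k) x))"
    by (rule grad_sq_rep[OF M F]) (rule that; assumption)
  have g: "g \<in> Cb_inf N" and f: "\<And>i. i < N \<Longrightarrow> f i \<in> C0_inf M" using r by (auto simp: cylinder_rep_def)
  have dep: "depends_below N g" and C: "Ckb (Suc 0) N g" using g unfolding Cb_inf_iff by blast+
  have "(\<lambda>\<gamma>. partial_deriv i g (\<lambda>j. pairing (f j) \<gamma>)) \<in> borel_measurable (local_borel UNIV)" if "i < N" for i
    using C that by (intro measurable_cylinder[OF M(1) _ depends_below_partial_deriv[OF dep] f]) auto
  from measurable_compose[OF measurable_snd this]
  have 1: "(\<lambda>p. partial_deriv i g (\<lambda>j. pairing (f j) (snd p))) \<in> borel_measurable (borel \<Otimes>\<^sub>M local_borel UNIV)" if "i < N" for i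
    using that by blast
  have "(\<lambda>x. metric M x (grad M (f i) x) (grad M (f k) x)) \<in> borel_measurable borel" if "i < N" "k < N" for i k
    using f that by (intro borel_measurable_continuous_onI continuous_on_metric_grad[OF M]) (auto simp: C0_inf_def)
  from measurable_compose[OF measurable_fst this]
  have 2: "(\<lambda>p. metric M (fst p) (grad M (f i) (fst p)) (grad M (f k) (fst p))) \<in> borel_measurable (borel \<Otimes>\<^sub>M local_borel UNIV)"
    if "i < N" "k < N" for i k using that by blast
  show ?thesis
    unfolding split_beta' eq using 1 2 by (intro borel_measurable_sum borel_measurable_times) auto
qed

text \<open>The functions in a representation vanish off a compact \<open>K\<close>, hence near
  every point of its open complement, and so do their gradients. On \<open>K\<close> the gradients
  are bounded by continuity and the partial derivatives of \<open>g\<close> by definition of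
  \<open>Cb_inf\<close>.\<close>

lemma grad_sq_bound:
  fixes M :: "('a::{t2_space,second_countable_topology}, 'n::finite) riemannian"
  assumes M: "smooth_atlas M" "riemannian_metric M" and F: "F \<in> FCb_inf M"
  obtains K C where "compact K" "0 \<le> C" "\<And>x \<gamma>. grad_sq M F x \<gamma> \<le> C * indicator K x"
proof -
  obtain N g f where r: "cylinder_rep M F N g f"
    and eq: "\<And>x \<gamma>. grad_sq M F x \<gamma> = (\<Sum>i<N. \<Sum>k<N. partial_deriv i g (\<lambda>j. pairing (f j) \<gamma>) * partial_deriv k g (\<lambda>j. pairing (f j) \<gamma>)
      * metric M x (grad M (f i) x) (grad M (f k) x))"
    by (rule grad_sq_rep[OF M F]) (rule that; assumption)
  have g: "g \<in> Cb_inf N" and f: "\<And>i. i < N \<Longrightarrow> f i \<in> C0_inf M" using r by (auto simp: cylinder_rep_def)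
  have sm: "smooth_fun M (f i)" if "i < N" for i using f[OF that] by (simp add: C0_inf_def)
  have C: "Ckb (Suc 0) N g" using g unfolding Cb_inf_iff by blast
  have "\<exists>K. compact K \<and> (\<forall>x. x \<notin> K \<longrightarrow> f i x = 0)" if "i < N" for i
    using f[OF that] compact_supportE[of "f i"] unfolding C0_inf_def by blast
  then obtain S where S: "\<And>i. i < N \<Longrightarrow> compact (S i)" "\<And>i x. i < N \<Longrightarrow> x \<notin> S i \<Longrightarrow> f i x = 0" by metis
  define K where "K = (\<Union>i<N. S i)"
  have K: "compact K" unfolding K_def using S(1) by (intro compact_UN) auto
  have z: "metric M x (grad M (f i) x) (grad M (f k) x) = 0" if "i < N" "k < N" "x \<notin> K" for i k x
    using that S(1)[of i] S(2)[of i] by (intro metric_grad_zero[OF M sm sm, where U = "- S i"]) (auto simp: K_def compact_imp_closed open_Compl)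
  have "\<exists>b. \<forall>x\<in>K. \<bar>metric M x (grad M (f i) x) (grad M (f k) x)\<bar> \<le> b" if "i < N" "k < N" for i k
  proof -
    have "compact ((\<lambda>x. metric M x (grad M (f i) x) (grad M (f k) x)) ` K)"
      by (intro compact_continuous_image continuous_on_subset[OF continuous_on_metric_grad[OF M sm sm]] K that) auto
    from compact_imp_bounded[OF this] show ?thesis unfolding bounded_iff by auto
  qed
  then obtain b where b: "\<And>i k x. i < N \<Longrightarrow> k < N \<Longrightarrow> x \<in> K \<Longrightarrow> \<bar>metric M x (grad M (f i) x) (grad M (f k) x)\<bar> \<le> b i k" by metis
  have "\<exists>a. \<forall>y. \<bar>partial_deriv i g y\<bar> \<le> a" if "i < N" for i
  proof -
    from C that have "bounded (range (partial_deriv i g))" by simp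
    then show ?thesis unfolding bounded_iff by auto
  qed
  then obtain a where a: "\<And>i y. i < N \<Longrightarrow> \<bar>partial_deriv i g y\<bar> \<le> a i" by metis
  define C where "C = (\<Sum>i<N. \<Sum>k<N. \<bar>a i\<bar> * \<bar>a k\<bar> * \<bar>b i k\<bar>)"
  show thesis
  proof (rule that[OF K, of C])
    show "0 \<le> C" unfolding C_def by (intro sum_nonneg) auto
    fix x \<gamma>
    show "grad_sq M F x \<gamma> \<le> C * indicator K x"
    proof (cases "x \<in> K")
      case True
      have "grad_sq M F x \<gamma> \<le> C"
        unfolding eq C_def
      proof (intro sum_mono)
        fix i k assume "i \<in> {..<N}" "k \<in> {..<N}"
        then have ik: "i < N" "k < N" by auto
        define P where "P i = partial_deriv i g (\<lambda>j. pairing (f j) \<gamma>)" for i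
        have "P i * P k * metric M x (grad M (f i) x) (grad M (f k) x) \<le> \<bar>P i\<bar> * \<bar>P k\<bar> * \<bar>metric M x (grad M (f i) x) (grad M (f k) x)\<bar>"
          by (simp add: abs_mult[symmetric])
        also have "\<dots> \<le> \<bar>a i\<bar> * \<bar>a k\<bar> * \<bar>b i k\<bar>"
          unfolding P_def using a[OF ik(1)] a[OF ik(2)] b[OF ik True]
          by (intro mult_mono) (auto intro: order_trans[OF _ abs_ge_self])
        finally show "partial_deriv i g (\<lambda>j. pairing (f j) \<gamma>) * partial_deriv k g (\<lambda>j. pairing (f j) \<gamma>)
          * metric M x (grad M (f i) x) (grad M (f k) x) \<le> \<bar>a i\<bar> * \<bar>a k\<bar> * \<bar>b i k\<bar>" by (simp add: P_def)
      qed
      then show ?thesis using True by simp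
    next
      case False
      then show ?thesis unfolding eq by (simp add: z)
    qed
  qed
qed

text \<open>The first moment condition on \<open>\<mu>\<close> makes the integrand integrable,
  because the sum over \<open>\<gamma>\<close> is at most \<open>C\<close> times the number of
  points in \<open>K\<close>. Without this the real-valued integral could be 0 by default instead of
  infinite.\<close>

lemma dirichlet_form_nn_integral:
  fixes M :: "('a::{t2_space,second_countable_topology}, 'n::finite) riemannian"
  assumes M: "smooth_atlas M" "riemannian_metric M" and F: "F \<in> FCb_inf M"
    and \<mu>: "sets \<mu> = sets config_borel" "\<And>K. compact K \<Longrightarrow> (\<integral>\<^sup>+\<gamma>. of_nat (card (\<gamma> \<inter> K)) \<partial>\<mu>) < \<infinity>"
  shows "ennreal (dirichlet_form M \<mu> F F) = (\<integral>\<^sup>+\<gamma>. \<integral>\<^sup>+x. ennreal (grad_sq M F x \<gamma>) \<partial>count_space \<gamma> \<partial>\<mu>)"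
proof -
  obtain K C where K: "compact K" and C: "0 \<le> C" and bd: "\<And>x \<gamma>. grad_sq M F x \<gamma> \<le> C * indicator K x"
    by (rule grad_sq_bound[OF M F]) (rule that; assumption)
  note nn = grad_sq_nonneg[OF M F]
  have z: "grad_sq M F x \<gamma> = 0" if "x \<notin> K" for x \<gamma> using bd[of x \<gamma>] nn[of x \<gamma>] that by simp
  have Kc: "K \<in> borel_c" using K by (simp add: borel_c_def compact_imp_closed closure_closed borel_closed)
  have sp: "space \<mu> = configs" using sets_eq_imp_space_eq[OF \<mu>(1)] by simp
  define s where "s \<gamma> = (\<Sum>\<^sub>\<infinity>x\<in>\<gamma>. metric M x (grad_conf M F \<gamma> x) (grad_conf M F \<gamma> x))" for \<gamma>
  have s: "s \<gamma> = (\<Sum>x\<in>\<gamma> \<inter> K. grad_sq M F x \<gamma>)" if "\<gamma> \<in> configs" for \<gamma>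
    using pairing_eq_sum[OF that Kc, of "\<lambda>x. grad_sq M F x \<gamma>"] z by (simp add: s_def pairing_def grad_sq_def)
  have s_nn: "s \<gamma> \<ge> 0" if "\<gamma> \<in> configs" for \<gamma> unfolding s[OF that] by (intro sum_nonneg nn)
  have es: "ennreal (s \<gamma>) = (\<integral>\<^sup>+x. ennreal (grad_sq M F x \<gamma>) \<partial>count_space \<gamma>)" if "\<gamma> \<in> configs" for \<gamma>
  proof -
    have "(\<integral>\<^sup>+x. ennreal (grad_sq M F x \<gamma>) \<partial>count_space \<gamma>) = (\<integral>\<^sup>+x. ennreal (grad_sq M F x \<gamma>) \<partial>count_space (\<gamma> \<inter> K))"
      unfolding nn_integral_count_space_restrict[where X = \<gamma>] nn_integral_count_space_restrict[where X = "\<gamma> \<inter> K"]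
      using z by (intro nn_integral_cong) (auto simp: indicator_def)
    also have "\<dots> = (\<Sum>x\<in>\<gamma> \<inter> K. ennreal (grad_sq M F x \<gamma>))"
      using configs_finite_Int[OF that Kc] by (simp add: nn_integral_count_space_finite)
    also have "\<dots> = ennreal (s \<gamma>)" unfolding s[OF that] by (simp add: sum_ennreal nn)
    finally show ?thesis by simp
  qed
  have "(\<lambda>p. ennreal (grad_sq M F (fst p) (snd p))) \<in> borel_measurable (borel \<Otimes>\<^sub>M local_borel UNIV)"
    using measurable_grad_sq[OF M F] by (simp add: split_beta')
  from measurable_sum_points[OF M(1) this]
  have "(\<lambda>\<gamma>. \<integral>\<^sup>+x. ennreal (grad_sq M F x \<gamma>) \<partial>count_space \<gamma>) \<in> borel_measurable (local_borel UNIV)" by simp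
  then have "(\<lambda>\<gamma>. \<integral>\<^sup>+x. ennreal (grad_sq M F x \<gamma>) \<partial>count_space \<gamma>) \<in> borel_measurable config_borel"
    by (rule measurable_compose[OF measurable_config_borel[OF M(1)]])
  then have "(\<lambda>\<gamma>. \<integral>\<^sup>+x. ennreal (grad_sq M F x \<gamma>) \<partial>count_space \<gamma>) \<in> borel_measurable \<mu>"
    using measurable_cong_sets[OF \<mu>(1) refl] by blast
  then have "(\<lambda>\<gamma>. enn2real (\<integral>\<^sup>+x. ennreal (grad_sq M F x \<gamma>) \<partial>count_space \<gamma>)) \<in> borel_measurable \<mu>" by measurable
  then have sm: "s \<in> borel_measurable \<mu>"
    by (subst measurable_cong[where g = "\<lambda>\<gamma>. enn2real (\<integral>\<^sup>+x. ennreal (grad_sq M F x \<gamma>) \<partial>count_space \<gamma>)"])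
      (simp_all add: sp es[symmetric] s_nn)
  have "(\<integral>\<^sup>+\<gamma>. ennreal (s \<gamma>) \<partial>\<mu>) \<le> (\<integral>\<^sup>+\<gamma>. ennreal C * of_nat (card (\<gamma> \<inter> K)) \<partial>\<mu>)"
  proof (rule nn_integral_mono)
    fix \<gamma> assume "\<gamma> \<in> space \<mu>"
    then have \<gamma>: "\<gamma> \<in> configs" by (simp add: sp)
    have "s \<gamma> \<le> (\<Sum>x\<in>\<gamma> \<inter> K. C)" unfolding s[OF \<gamma>] using bd[of _ \<gamma>] by (intro sum_mono) (metis IntD2 indicator_simps(1) mult.right_neutral)
    then have "ennreal (s \<gamma>) \<le> ennreal (C * real (card (\<gamma> \<inter> K)))" by (intro ennreal_leI) (simp add: mult.commute)
    also have "\<dots> = ennreal C * of_nat (card (\<gamma> \<inter> K))" using C by (simp add: ennreal_mult ennreal_of_nat_eq_real_of_nat)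
    finally show "ennreal (s \<gamma>) \<le> ennreal C * of_nat (card (\<gamma> \<inter> K))" .
  qed
  also have "\<dots> = ennreal C * (\<integral>\<^sup>+\<gamma>. of_nat (card (\<gamma> \<inter> K)) \<partial>\<mu>)"
  proof (rule nn_integral_cmult)
    have "(\<lambda>\<gamma>. card (\<gamma> \<inter> K)) \<in> local_borel UNIV \<rightarrow>\<^sub>M count_space UNIV" by (rule measurable_card_local_borel[OF Kc]) simp
    then have "(\<lambda>\<gamma>. of_nat (card (\<gamma> \<inter> K)) :: ennreal) \<in> borel_measurable (local_borel UNIV)" by measurable
    then have "(\<lambda>\<gamma>. of_nat (card (\<gamma> \<inter> K)) :: ennreal) \<in> borel_measurable config_borel"
      by (rule measurable_compose[OF measurable_config_borel[OF M(1)]])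
    then show "(\<lambda>\<gamma>. of_nat (card (\<gamma> \<inter> K)) :: ennreal) \<in> borel_measurable \<mu>"
      using measurable_cong_sets[OF \<mu>(1) refl] by blast
  qed
  also have "\<dots> < \<infinity>" using \<mu>(2)[OF K] by (simp add: ennreal_mult_less_top)
  finally have fin: "(\<integral>\<^sup>+\<gamma>. ennreal (s \<gamma>) \<partial>\<mu>) < \<infinity>" .
  have "dirichlet_form M \<mu> F F = enn2real (\<integral>\<^sup>+\<gamma>. ennreal (s \<gamma>) \<partial>\<mu>)"
    unfolding dirichlet_form_def s_def[symmetric] by (rule integral_eq_nn_integral[OF sm]) (rule AE_I2, simp add: sp s_nn)
  then have "ennreal (dirichlet_form M \<mu> F F) = (\<integral>\<^sup>+\<gamma>. ennreal (s \<gamma>) \<partial>\<mu>)" using fin by simp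
  also have "\<dots> = (\<integral>\<^sup>+\<gamma>. \<integral>\<^sup>+x. ennreal (grad_sq M F x \<gamma>) \<partial>count_space \<gamma> \<partial>\<mu>)"
    by (intro nn_integral_cong) (simp add: sp es)
  finally show ?thesis .
qed

section \<open>Closability\<close>

lemma continuous_on_line_point: "continuous_on A (line_point l x)"
  unfolding line_point_def
proof (intro continuous_on_vec_lambda)
  show "continuous_on A (\<lambda>s. if j = l then s else x j)" for j by (cases "j = l") auto
qed

lemma measurable_slice: "r \<in> borel_measurable borel \<Longrightarrow> slice r l x \<in> borel_measurable borel"
  unfolding slice_eq[abs_def] by (rule measurable_compose[OF borel_measurable_continuous_onI[OF continuous_on_line_point]])

text \<open>The condition is assumed only on lines with positive mass. On a line with zero mass
  \<open>r\<close> is nonpositive almost everywhere, so the conclusion holds there as well.\<close>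

lemma line_condition_hamza_lines:
  assumes "hamza_condition_lines r" and r: "r \<in> borel_measurable borel"
  shows "line_condition l Q r"
proof -
  from assms(1) have "AE x in line_base l.
     (\<integral>\<^sup>+s. ennreal (slice r l x s) \<partial>lborel) > 0 \<longrightarrow>
     (AE s in lborel. s \<notin> regular_points (slice r l x) \<longrightarrow> slice r l x s = 0)"
    unfolding hamza_condition_lines_def by blast
  then show ?thesis
    unfolding line_condition_def
  proof (rule eventually_mono)
    fix x assume *: "(\<integral>\<^sup>+s. ennreal (slice r l x s) \<partial>lborel) > 0 \<longrightarrow>
     (AE s in lborel. s \<notin> regular_points (slice r l x) \<longrightarrow> slice r l x s = 0)"
    show "AE s in lborel. line_point l x s \<in> Q \<longrightarrow> s \<notin> regular_points (slice r l x) \<longrightarrow> r (line_point l x s) \<le> 0"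
    proof (cases "(\<integral>\<^sup>+s. ennreal (slice r l x s) \<partial>lborel) > 0")
      case True
      with * have "AE s in lborel. s \<notin> regular_points (slice r l x) \<longrightarrow> slice r l x s = 0" by blast
      then show ?thesis by (rule eventually_mono) (auto simp: slice_eq)
    next
      case False
      then have "(\<integral>\<^sup>+s. ennreal (slice r l x s) \<partial>lborel) = 0" by simp
      then have "AE s in lborel. ennreal (slice r l x s) = 0"
        using measurable_slice[OF r] by (subst (asm) nn_integral_0_iff_AE) auto
      then show ?thesis by (rule eventually_mono) (auto simp: slice_eq ennreal_eq_0_iff)
    qed
  qed
qed

abbreviation increment :: "(nat \<Rightarrow> 'b \<Rightarrow> real) \<Rightarrow> nat \<Rightarrow> 'b \<Rightarrow> real" where
  "increment H j \<equiv> (\<lambda>\<gamma>. H (Suc j) \<gamma> - H j \<gamma>)"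

text \<open>Two one-sided comparisons replace a change of variables: domination by a multiple of
  \<open>m\<close> carries finite integrals and null sets from the manifold into the chart, and
  \<open>null\<close> carries null sets back.\<close>

locale chart_comparison =
  fixes c :: "('a::{t2_space,second_countable_topology}, 'n::finite) chart" and B :: "'a set" and m :: "'a measure" and C :: real
  assumes chart: "is_chart c" and B: "open B" "B \<subseteq> fst c" and sets_m: "sets m = sets borel" and C_pos: "0 < C"
    and up: "\<And>A. A \<in> sets borel \<Longrightarrow> A \<subseteq> B \<Longrightarrow> emeasure lborel (snd c ` A) \<le> ennreal C * emeasure m A"
    and null: "\<And>A. A \<in> sets borel \<Longrightarrow> A \<subseteq> B \<Longrightarrow> emeasure lborel (snd c ` A) = 0 \<Longrightarrow> emeasure m A = 0"
begin

abbreviation "Q \<equiv> snd c ` B"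

lemma open_Q: "open Q" "Q \<subseteq> chart_range c"
  using open_chart_vimage[OF chart B(1)] unfolding chart_image_eq[OF chart B(2)] by auto

lemma Q_iff: "y \<in> Q \<longleftrightarrow> y \<in> chart_range c \<and> chart_inv c y \<in> B"
  unfolding chart_image_eq[OF chart B(2)] by auto

lemma chart_image_Int: "snd c ` (A \<inter> B) = Q \<inter> chart_inv c -` A"
  using chart_image_eq[OF chart, of "A \<inter> B"] B(2) chart_image_eq[OF chart B(2)] by auto

lemma nn_integral_comparison:
  assumes f[measurable]: "f \<in> borel_measurable borel"
  shows "(\<integral>\<^sup>+y\<in>Q. f (chart_inv c y) \<partial>lborel) \<le> ennreal C * (\<integral>\<^sup>+x\<in>B. f x \<partial>m)"
proof -
  have [measurable]: "Q \<in> sets borel" "B \<in> sets borel" "B \<in> sets m" using open_Q(1) B(1) sets_m by auto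
  have [measurable]: "chart_inv c \<in> restrict_space lborel Q \<rightarrow>\<^sub>M borel"
    using measurable_restrict_mono[OF borel_measurable_chart_inv[OF chart] open_Q(2)]
    by (simp add: measurable_cong_sets[OF sets_restrict_space_cong[of lborel borel] refl])
  have fm[measurable]: "g \<in> borel_measurable borel \<Longrightarrow> g \<in> borel_measurable m" for g :: "'a \<Rightarrow> ennreal"
    using measurable_cong_sets[OF sets_m refl] by blast
  define \<nu> where "\<nu> = distr (restrict_space lborel Q) borel (chart_inv c)"
  define \<kappa> where "\<kappa> = density m (\<lambda>x. ennreal C * indicator B x)"
  have "\<nu> \<le> \<kappa>"
  proof (subst le_measure)
    show "sets \<nu> = sets \<kappa>" by (simp add: \<nu>_def \<kappa>_def sets_m)
    show "\<forall>A\<in>sets \<nu>. emeasure \<nu> A \<le> emeasure \<kappa> A"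
    proof
      fix A assume "A \<in> sets \<nu>"
      then have A[measurable]: "A \<in> sets borel" "A \<in> sets m" by (auto simp: \<nu>_def sets_m)
      have "emeasure \<nu> A = emeasure (restrict_space lborel Q) (chart_inv c -` A \<inter> Q)"
        unfolding \<nu>_def by (subst emeasure_distr) (auto simp: space_restrict_space)
      also have "\<dots> = emeasure lborel (snd c ` (A \<inter> B))"
        unfolding chart_image_Int by (subst emeasure_restrict_space) (auto simp: Int_commute)
      also have "\<dots> \<le> ennreal C * emeasure m (A \<inter> B)" by (rule up) auto
      also have "\<dots> = emeasure \<kappa> A"
      proof -
        have "emeasure \<kappa> A = (\<integral>\<^sup>+x. ennreal C * indicator (A \<inter> B) x \<partial>m)"
          unfolding \<kappa>_def by (subst emeasure_density) (auto intro!: nn_integral_cong simp: indicator_def)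
        then show ?thesis by (simp add: nn_integral_cmult_indicator)
      qed
      finally show "emeasure \<nu> A \<le> emeasure \<kappa> A" .
    qed
  qed
  then have "nn_integral \<nu> f \<le> nn_integral \<kappa> f"
    by (intro nn_integral_mono_measure) (simp add: \<nu>_def \<kappa>_def sets_m)
  also have "nn_integral \<nu> f = (\<integral>\<^sup>+y\<in>Q. f (chart_inv c y) \<partial>lborel)"
    unfolding \<nu>_def by (subst nn_integral_distr) (auto simp: nn_integral_restrict_space)
  also have "nn_integral \<kappa> f = (\<integral>\<^sup>+x. ennreal C * (f x * indicator B x) \<partial>m)"
    unfolding \<kappa>_def by (subst nn_integral_density) (auto simp: mult_ac)
  also have "\<dots> = ennreal C * (\<integral>\<^sup>+x\<in>B. f x \<partial>m)" by (rule nn_integral_cmult) measurable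
  finally show ?thesis .
qed

lemma AE_chart:
  assumes "AE x in m. x \<in> B \<longrightarrow> P x"
  shows "AE y in lborel. y \<in> Q \<longrightarrow> P (chart_inv c y)"
proof -
  obtain N where N: "{x \<in> space m. \<not> (x \<in> B \<longrightarrow> P x)} \<subseteq> N" "emeasure m N = 0" "N \<in> sets m" by (rule AE_E[OF assms]) (rule that)
  have N': "N \<inter> B \<in> sets borel" using N(3) B(1) by (auto simp: sets_m)
  have "emeasure m (N \<inter> B) \<le> emeasure m N" using N(3) by (intro emeasure_mono) auto
  then have "emeasure m (N \<inter> B) = 0" using N(2) by simp
  then have "emeasure lborel (snd c ` (N \<inter> B)) = 0" using up[OF N'] by simp
  moreover have "snd c ` (N \<inter> B) \<in> sets borel" using N' B(2) by (intro borel_chart_image[OF chart]) auto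
  ultimately have "AE y in lborel. y \<notin> snd c ` (N \<inter> B)" by (intro AE_not_in) (auto simp: null_sets_def)
  then show ?thesis
  proof (rule eventually_mono, intro impI)
    fix y assume y: "y \<notin> snd c ` (N \<inter> B)" "y \<in> Q"
    have "space m = UNIV" using sets_eq_imp_space_eq[OF sets_m] by simp
    then show "P (chart_inv c y)" using y N(1) Q_iff[of y] unfolding chart_image_Int by auto
  qed
qed

lemma AE_chart_conv:
  assumes "AE y in lborel. y \<in> Q \<longrightarrow> P y"
  shows "AE x in m. x \<in> B \<longrightarrow> P (snd c x)"
proof -
  obtain N where N: "{y \<in> space lborel. \<not> (y \<in> Q \<longrightarrow> P y)} \<subseteq> N" "emeasure lborel N = 0" "N \<in> sets lborel" by (rule AE_E[OF assms]) (rule that)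
  define A where "A = B \<inter> snd c -` N"
  have "snd c \<in> borel_measurable (restrict_space borel B)"
    by (intro borel_measurable_continuous_on_restrict continuous_on_subset[OF is_chartD(3)[OF chart] B(2)])
  from measurable_sets[OF this] N(3) have "snd c -` N \<inter> B \<in> sets (restrict_space borel B)" by (simp add: space_restrict_space)
  then have A: "A \<in> sets borel" "A \<subseteq> B" using B(1) by (auto simp: A_def sets_restrict_space_iff Int_commute)
  have "emeasure lborel (snd c ` A) \<le> emeasure lborel N" using N(3) by (intro emeasure_mono) (auto simp: A_def)
  then have "emeasure m A = 0" using N(2) by (intro null A) simp
  then have "AE x in m. x \<notin> A" using A by (intro AE_not_in) (auto simp: null_sets_def sets_m)
  then show ?thesis
    by (rule eventually_mono) (use N(1) in \<open>auto simp: A_def\<close>)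
qed

text \<open>Where \<open>r\<close> is positive, almost every point lies in a set from a countable
  base over which \<open>1/r\<close> is integrable. By Fubini, on almost every line the integrals
  over the traces of all these sets are finite simultaneously, and a line point in such an open
  trace is regular.\<close>

lemma line_condition_hamza:
  assumes hz: "hamza_condition m w" and w[measurable]: "w \<in> borel_measurable borel"
    and r[measurable]: "r \<in> borel_measurable borel" and rw: "\<And>y. y \<in> Q \<Longrightarrow> r y = w (chart_inv c y)"
  shows "line_condition l Q r"
proof -
  obtain \<B> :: "(real ^ 'n) set set" where \<B>: "countable \<B>" "topological_basis \<B>" using ex_countable_basis by blast
  have \<B>_open[measurable]: "W \<in> sets borel" "open W" if "W \<in> \<B>" for W
    using topological_basis_open[OF \<B>(2) that] by auto
  define good where "good W \<longleftrightarrow> (\<integral>\<^sup>+y\<in>W. inverse (ennreal (r y)) \<partial>lborel) < \<infinity>" for W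
  have "AE y in lborel. y \<in> Q \<longrightarrow> (\<exists>W\<in>\<B>. good W \<and> y \<in> W) \<or> r y \<le> 0"
  proof -
    from hz have "AE x in m. x \<in> B \<longrightarrow>
        (\<exists>\<Lambda>. open \<Lambda> \<and> x \<in> \<Lambda> \<and> (\<integral>\<^sup>+y\<in>\<Lambda>. inverse (ennreal (w y)) \<partial>m) < \<infinity>) \<or> w x = 0"
      unfolding hamza_condition_def by (rule eventually_mono) auto
    from AE_chart[OF this] show ?thesis
    proof (rule eventually_mono, intro impI)
      fix y assume *: "y \<in> Q \<longrightarrow> (\<exists>\<Lambda>. open \<Lambda> \<and> chart_inv c y \<in> \<Lambda> \<and> (\<integral>\<^sup>+y\<in>\<Lambda>. inverse (ennreal (w y)) \<partial>m) < \<infinity>) \<or> w (chart_inv c y) = 0"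
        and y: "y \<in> Q"
      show "(\<exists>W\<in>\<B>. good W \<and> y \<in> W) \<or> r y \<le> 0"
      proof (cases "w (chart_inv c y) = 0")
        case False
        with * y obtain \<Lambda> where L: "open \<Lambda>" "chart_inv c y \<in> \<Lambda>" "(\<integral>\<^sup>+y\<in>\<Lambda>. inverse (ennreal (w y)) \<partial>m) < \<infinity>" by blast
        have [measurable]: "\<Lambda> \<in> sets borel" using L(1) by simp
        have "open (Q \<inter> chart_inv c -` \<Lambda>)"
        proof -
          have "\<Lambda> \<inter> B \<subseteq> fst c" using B(2) by auto
          from chart_image_eq[OF chart this] show ?thesis
            unfolding chart_image_Int[symmetric] using open_chart_vimage[OF chart open_Int[OF L(1) B(1)]] by simp
        qed
        from topological_basisE[OF \<B>(2) this, of y] y L(2) obtain W where W: "W \<in> \<B>" "y \<in> W" "W \<subseteq> Q \<inter> chart_inv c -` \<Lambda>" by auto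
        have "(\<integral>\<^sup>+y\<in>W. inverse (ennreal (r y)) \<partial>lborel) \<le>
          (\<integral>\<^sup>+y\<in>Q. inverse (ennreal (w (chart_inv c y))) * indicator \<Lambda> (chart_inv c y) \<partial>lborel)"
          using W(3) rw by (intro nn_integral_mono) (auto simp: indicator_def)
        also have "\<dots> \<le> ennreal C * (\<integral>\<^sup>+x\<in>B. inverse (ennreal (w x)) * indicator \<Lambda> x \<partial>m)"
          by (rule nn_integral_comparison[where f = "\<lambda>x. inverse (ennreal (w x)) * indicator \<Lambda> x"]) measurable
        also have "\<dots> \<le> ennreal C * (\<integral>\<^sup>+x\<in>\<Lambda>. inverse (ennreal (w x)) \<partial>m)"
          by (intro mult_left_mono nn_integral_mono) (auto simp: indicator_def)
        also have "\<dots> < \<infinity>" using L(3) by (simp add: ennreal_mult_less_top)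
        finally show ?thesis using W by (auto simp: good_def)
      qed (use rw y in auto)
    qed
  qed
  from AE_lines[OF this, of l]
  have 1: "AE x in line_base l. AE s in lborel. line_point l x s \<in> Q \<longrightarrow>
    (\<exists>W\<in>\<B>. good W \<and> line_point l x s \<in> W) \<or> r (line_point l x s) \<le> 0" .
  \<comment> \<open>Countability of the base allows the quantifier over \<open>W\<close> inside the
    almost everywhere statement; arbitrary neighbourhoods would not.\<close>
  have "AE x in line_base l. \<forall>W\<in>\<B>. good W \<longrightarrow>
    (\<integral>\<^sup>+s. inverse (ennreal (r (line_point l x s))) * indicator W (line_point l x s) \<partial>lborel) \<noteq> \<infinity>"
  proof (subst AE_ball_countable[OF \<B>(1)], rule ballI)
    fix W assume W: "W \<in> \<B>"
    note [measurable] = \<B>_open(1)[OF W]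
    show "AE x in line_base l. good W \<longrightarrow>
      (\<integral>\<^sup>+s. inverse (ennreal (r (line_point l x s))) * indicator W (line_point l x s) \<partial>lborel) \<noteq> \<infinity>"
    proof (cases "good W")
      case True
      have "AE x in line_base l.
        (\<integral>\<^sup>+s. inverse (ennreal (r (line_point l x s))) * indicator W (line_point l x s) \<partial>lborel) \<noteq> \<infinity>"
      proof (rule nn_integral_PInf_AE)
        show "(\<lambda>x. \<integral>\<^sup>+s. inverse (ennreal (r (line_point l x s))) * indicator W (line_point l x s) \<partial>lborel)
          \<in> borel_measurable (line_base l)"
          by (intro lborel.borel_measurable_nn_integral) measurable
        show "(\<integral>\<^sup>+x. \<integral>\<^sup>+s. inverse (ennreal (r (line_point l x s))) * indicator W (line_point l x s) \<partial>lborel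
            \<partial>line_base l) \<noteq> \<infinity>"
          using True nn_integral_lines[of "\<lambda>y. inverse (ennreal (r y)) * indicator W y" l] by (simp add: good_def)
      qed
      then show ?thesis by (rule eventually_mono) simp
    qed simp
  qed
  with 1 show ?thesis
    unfolding line_condition_def
  proof eventually_elim
    case (elim x)
    from elim(1) show ?case
    proof (rule eventually_mono, intro impI)
      fix s assume s: "line_point l x s \<in> Q \<longrightarrow> (\<exists>W\<in>\<B>. good W \<and> line_point l x s \<in> W) \<or> r (line_point l x s) \<le> 0"
        "line_point l x s \<in> Q" "s \<notin> regular_points (slice r l x)"
      show "r (line_point l x s) \<le> 0"
      proof (rule ccontr)
        assume "\<not> r (line_point l x s) \<le> 0"
        with s obtain W where W: "W \<in> \<B>" "good W" "line_point l x s \<in> W" by blast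
        have "open (line_point l x -` W)" by (rule open_vimage[OF \<B>_open(2)[OF W(1)] continuous_on_line_point])
        then obtain \<epsilon> where \<epsilon>: "\<epsilon> > 0" "cball s \<epsilon> \<subseteq> line_point l x -` W"
          using W(3) unfolding open_contains_cball by blast
        have "(\<integral>\<^sup>+t\<in>{s - \<epsilon>..s + \<epsilon>}. inverse (ennreal (slice r l x t)) \<partial>lborel) \<le>
          (\<integral>\<^sup>+t. inverse (ennreal (r (line_point l x t))) * indicator W (line_point l x t) \<partial>lborel)"
          using \<epsilon>(2) by (intro nn_integral_mono) (auto simp: indicator_def slice_eq cball_eq_atLeastAtMost subset_eq)
        also have "\<dots> < \<infinity>" using elim(2) W by (auto simp: top.not_eq_extremum)
        finally have "s \<in> regular_points (slice r l x)" unfolding regular_points_def using \<epsilon>(1) by blast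
        with s(3) show False by simp
      qed
    qed
  qed
qed


text \<open>The classical weighted gradient form for a fixed configuration \<open>\<gamma>\<close>:
  in the chart, \<open>H j\<close> as a function of the added point is smooth and the weight is
  \<open>r\<close>. Convergence is obtained for each coordinate derivative separately and then
  reassembled into the Riemannian length.\<close>

lemma gradient_convergence:
  fixes M :: "('a, 'n) riemannian" and w :: "'a \<Rightarrow> real" and r :: "real ^ 'n \<Rightarrow> real"
  assumes M: "smooth_atlas M" and c: "nice_chart M c"
    and gram: "\<And>x l. x \<in> B \<Longrightarrow> gram_matrix M c (snd c x) $ l $ l \<le> C"
    and \<gamma>: "\<gamma> \<in> configs" "AE x in m. x \<notin> \<gamma>" and H: "\<And>j. H j \<in> FCb_inf M"
    and nn: "\<And>F x \<gamma>. F \<in> FCb_inf M \<Longrightarrow> 0 \<le> grad_sq M F x \<gamma>"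
    and gm[measurable]: "\<And>j. (\<lambda>x. grad_sq M (increment H j) x (insert x \<gamma>)) \<in> borel_measurable borel"
    and w[measurable]: "w \<in> borel_measurable borel" and w_nn: "\<And>x. 0 \<le> w x"
    and r[measurable]: "r \<in> borel_measurable borel" and rw: "\<And>y. y \<in> Q \<Longrightarrow> r y = w (chart_inv c y)"
    and line: "\<And>l. line_condition l Q r"
    and S: "(\<integral>\<^sup>+x. (\<Sum>j. ennreal (2 ^ j * (w x * grad_sq M (increment H j) x (insert x \<gamma>)))) \<partial>m) < \<infinity>"
    and lim: "AE x in m. 0 < w x \<longrightarrow> (\<lambda>j. H j (insert x \<gamma>)) \<longlonglongrightarrow> 0"
  shows "AE x in m. x \<in> B \<longrightarrow> 0 < w x \<longrightarrow> (\<lambda>j. grad_sq M (H j) x (insert x \<gamma>)) \<longlonglongrightarrow> 0"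
proof -
  define S where "S x = (\<Sum>j. ennreal (2 ^ j * (w x * grad_sq M (increment H j) x (insert x \<gamma>))))" for x
  have Sm[measurable]: "S \<in> borel_measurable borel" unfolding S_def[abs_def] by measurable
  have "\<exists>N g f. cylinder_rep M (H j) N g f" for j using H[of j] by (auto simp: FCb_inf_def)
  then obtain N g f where rep: "\<And>j. cylinder_rep M (H j) (N j) (g j) (f j)" by metis
  have g: "\<And>j. g j \<in> Cb_inf (N j)" and f: "\<And>j i. i < N j \<Longrightarrow> f j i \<in> C0_inf M"
    using rep by (auto simp: cylinder_rep_def)
  \<comment> \<open>This formula is smooth on all of \<open>Q\<close>. It agrees with
    \<open>H j\<close> at the configuration with the point inserted only off
    \<open>\<gamma>\<close>, since inserting a point already present changes nothing; the
    exceptional set is null.\<close>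
  define u where "u j y = g j (\<lambda>i. pairing (f j i) \<gamma> + f j i (chart_inv c y))" for j y
  define p where "p l j y = (\<Sum>i<N j. partial_deriv i (g j) (\<lambda>i. pairing (f j i) \<gamma> + f j i (chart_inv c y)) * chart_gradient c (f j i) y $ l)"
    for l j y
  have u: "u j y = H j (insert (chart_inv c y) \<gamma>)" if "chart_inv c y \<notin> \<gamma>" for j y
    unfolding u_def cylinder_rep_insert(1)[OF M rep \<gamma>(1) that] ..
  have p: "p l j y = chart_grad_conf M c (H j) (insert (chart_inv c y) \<gamma>) (chart_inv c y) $ l"
    if "chart_inv c y \<notin> \<gamma>" "y \<in> Q" for l j y
  proof -
    have y: "chart_inv c y \<in> fst c" "snd c (chart_inv c y) = y"
      using that(2) Q_iff[of y] is_chartD(7,8)[OF chart] by auto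
    show ?thesis
      unfolding chart_grad_conf_eq[OF M c rep configs_insert[OF \<gamma>(1)] insertI1 y(1)] config_gradient_def
      by (simp add: p_def y(2) cylinder_rep_insert(2)[OF M rep \<gamma>(1) that(1)])
  qed
  have notin: "AE y in lborel. y \<in> Q \<longrightarrow> chart_inv c y \<notin> \<gamma>"
    by (rule AE_chart) (use \<gamma>(2) in \<open>auto elim!: eventually_mono\<close>)
  have "AE y in lborel. y \<in> Q \<longrightarrow> 0 < r y \<longrightarrow> (\<lambda>j. p l j y) \<longlonglongrightarrow> 0" for l
  proof (rule Hamza_domain[OF open_Q(1) _ _ r _ _ line])
    show "((\<lambda>t. u j (y + t *\<^sub>R axis l 1)) has_real_derivative p l j y) (at 0)" if "y \<in> Q" for j y
      unfolding u_def p_def using open_Q(2) that by (intro cylinder_line_derivative[OF M c g f]) auto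
    show "continuous_on Q (p l j)" for j
    proof -
      have dep: "depends_below (N j) (g j)" and Ck: "Ckb (Suc 0) (N j) (g j)" using g[of j] unfolding Cb_inf_iff by blast+
      have fc: "continuous_on Q (\<lambda>y. f j i (chart_inv c y))" if "i < N j" for i
        using C0_inf_continuous[OF M f[OF that]]
        by (intro continuous_on_compose2[of UNIV "f j i" Q "chart_inv c"] continuous_on_subset[OF is_chartD(4)[OF chart] open_Q(2)]) auto
      define z where "z y = (\<lambda>i. if i < N j then pairing (f j i) \<gamma> + f j i (chart_inv c y) else 0)" for y
      have "continuous_on Q (\<lambda>y. z y i)" for i
        using fc[of i] by (cases "i < N j") (auto simp: z_def intro: continuous_intros)
      then have zc: "continuous_on Q z" by (rule continuous_on_coordinatewise_then_product)
      have pz: "p l j y = (\<Sum>i<N j. partial_deriv i (g j) (z y) * chart_gradient c (f j i) y $ l)" for y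
        unfolding p_def by (intro sum.cong refl arg_cong2[where f = "(*)"] depends_belowD[OF depends_below_partial_deriv[OF dep]])
          (simp add: z_def)
      show ?thesis
        unfolding pz[abs_def]
      proof (intro continuous_on_sum continuous_on_mult)
        fix i assume "i \<in> {..<N j}"
        then have i: "i < N j" by simp
        show "continuous_on Q (\<lambda>y. partial_deriv i (g j) (z y))"
          using Ck i by (intro continuous_on_compose2[OF _ zc, of UNIV]) auto
        show "continuous_on Q (\<lambda>y. chart_gradient c (f j i) y $ l)"
          using f[OF i] by (intro continuous_on_component continuous_on_subset[OF smooth_fun_chart_C1(2)[OF M c] open_Q(2)])
            (simp add: C0_inf_def)
      qed
    qed
    \<comment> \<open>One factor \<open>C\<close> is the bound for the Gram entry that converts a
      partial derivative into the Riemannian gradient; a second one appears in the comparison of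
      Lebesgue measure with \<open>m\<close>.\<close>
    have "(\<integral>\<^sup>+y\<in>Q. (\<Sum>j. ennreal (2 ^ j * (r y * (p l (Suc j) y - p l j y)\<^sup>2))) \<partial>lborel) \<le>
      (\<integral>\<^sup>+y\<in>Q. (ennreal C * S (chart_inv c y)) \<partial>lborel)"
    proof (rule nn_integral_mono_AE, rule eventually_mono[OF notin])
      fix y assume y: "y \<in> Q \<longrightarrow> chart_inv c y \<notin> \<gamma>"
      show "(\<Sum>j. ennreal (2 ^ j * (r y * (p l (Suc j) y - p l j y)\<^sup>2))) * indicator Q y \<le>
        ennreal C * S (chart_inv c y) * indicator Q y"
      proof (cases "y \<in> Q")
        case True
        define x where "x = chart_inv c y"
        have x: "x \<notin> \<gamma>" "x \<in> B" "x \<in> fst c" using y True Q_iff[of y] B(2) by (auto simp: x_def)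
        define D where "D j = increment H j" for j
        have D: "D j \<in> FCb_inf M" for j unfolding D_def by (intro FCb_inf_diff H)
        have "(p l (Suc j) y - p l j y)\<^sup>2 \<le> C * grad_sq M (D j) x (insert x \<gamma>)" for j
        proof -
          have "p l (Suc j) y - p l j y = chart_grad_conf M c (D j) (insert x \<gamma>) x $ l"
            unfolding D_def chart_grad_conf_diff[OF M c H H configs_insert[OF \<gamma>(1)] insertI1 x(3)]
            using p[OF x(1)[unfolded x_def] True] by (simp add: x_def)
          then have "(p l (Suc j) y - p l j y)\<^sup>2 \<le> grad_sq M (D j) x (insert x \<gamma>) * gram_matrix M c (snd c x) $ l $ l"
            using chart_grad_conf_bound[OF M c D x(3)] by simp
          also have "\<dots> \<le> grad_sq M (D j) x (insert x \<gamma>) * C"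
            by (intro mult_left_mono gram x nn D)
          finally show ?thesis by (simp add: mult.commute)
        qed
        then have "2 ^ j * (w x * (p l (Suc j) y - p l j y)\<^sup>2) \<le> C * (2 ^ j * (w x * grad_sq M (D j) x (insert x \<gamma>)))" for j
          using mult_left_mono[of "(p l (Suc j) y - p l j y)\<^sup>2" "C * grad_sq M (D j) x (insert x \<gamma>)" "2 ^ j * w x"] w_nn[of x]
          by (simp add: mult_ac)
        then have "ennreal (2 ^ j * (w x * (p l (Suc j) y - p l j y)\<^sup>2)) \<le> ennreal C * ennreal (2 ^ j * (w x * grad_sq M (D j) x (insert x \<gamma>)))" for j
          using C_pos w_nn[of x] nn[OF D] by (subst ennreal_mult[symmetric]) (auto intro: ennreal_leI)
        then have "(\<Sum>j. ennreal (2 ^ j * (w x * (p l (Suc j) y - p l j y)\<^sup>2))) \<le> (\<Sum>j. ennreal C * ennreal (2 ^ j * (w x * grad_sq M (D j) x (insert x \<gamma>))))"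
          by (intro suminf_le) auto
        then show ?thesis using True rw[OF True] by (simp add: x_def D_def S_def)
      qed simp
    qed
    also have "\<dots> \<le> ennreal C * (\<integral>\<^sup>+x\<in>B. (ennreal C * S x) \<partial>m)"
      by (rule nn_integral_comparison) measurable
    also have "\<dots> \<le> ennreal C * (\<integral>\<^sup>+x. ennreal C * S x \<partial>m)"
      by (intro mult_left_mono nn_integral_mono) (auto simp: indicator_def)
    also have "(\<integral>\<^sup>+x. ennreal C * S x \<partial>m) =
      ennreal C * (\<integral>\<^sup>+x. S x \<partial>m)"
      using measurable_cong_sets[OF sets_m refl] Sm by (intro nn_integral_cmult) blast
    finally show "(\<integral>\<^sup>+y\<in>Q. (\<Sum>j. ennreal (2 ^ j * (r y * (p l (Suc j) y - p l j y)\<^sup>2))) \<partial>lborel) < \<infinity>"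
      using S by (auto simp: S_def ennreal_mult_less_top elim!: order_le_less_trans)
    have "AE x in m. x \<in> B \<longrightarrow> x \<notin> \<gamma> \<and> (0 < w x \<longrightarrow> (\<lambda>j. H j (insert x \<gamma>)) \<longlonglongrightarrow> 0)"
      using lim \<gamma>(2) by eventually_elim auto
    from AE_chart[OF this] show "AE y in lborel. y \<in> Q \<longrightarrow> 0 < r y \<longrightarrow> (\<lambda>j. u j y) \<longlonglongrightarrow> 0"
      by (rule eventually_mono) (auto simp: rw u)
  qed
  then have "AE y in lborel. \<forall>l. y \<in> Q \<longrightarrow> 0 < r y \<longrightarrow> (\<lambda>j. p l j y) \<longlonglongrightarrow> 0"
    by (subst AE_all_countable) blast
  then have "AE y in lborel. y \<in> Q \<longrightarrow> (\<forall>l. 0 < r y \<longrightarrow> (\<lambda>j. p l j y) \<longlonglongrightarrow> 0)"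
    by (rule eventually_mono) blast
  from AE_chart_conv[OF this] \<gamma>(2) show ?thesis
  proof eventually_elim
    case (elim x)
    show ?case
    proof (intro impI)
      assume x: "x \<in> B" "0 < w x"
      have xc: "x \<in> fst c" "chart_inv c (snd c x) = x" "snd c x \<in> Q"
        using x(1) B(2) is_chartD(5)[OF chart] by auto
      show "(\<lambda>j. grad_sq M (H j) x (insert x \<gamma>)) \<longlonglongrightarrow> 0"
      proof (rule grad_sq_tendsto_0[OF M c H xc(1)])
        fix l
        have "(\<lambda>j. p l j (snd c x)) \<longlonglongrightarrow> 0" using elim(1) x rw[OF xc(3)] by (simp add: xc(2))
        then show "(\<lambda>j. chart_grad_conf M c (H j) (insert x \<gamma>) x $ l) \<longlonglongrightarrow> 0"
          using p[OF _ xc(3)] elim(2) by (simp add: xc(2))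
      qed
    qed
  qed
qed

end

lemma dirichlet_form_nonneg:
  fixes M :: "('a::{t2_space,second_countable_topology}, 'n::finite) riemannian"
  assumes M: "smooth_atlas M" "riemannian_metric M" and F: "F \<in> FCb_inf M"
  shows "0 \<le> dirichlet_form M \<mu> F F"
  unfolding dirichlet_form_def
proof (intro Bochner_Integration.integral_nonneg infsum_nonneg)
  show "0 \<le> metric M x (grad_conf M F \<gamma> x) (grad_conf M F \<gamma> x)" for x \<gamma>
    using grad_sq_nonneg[OF M F, of x \<gamma>] by (simp add: grad_sq_def)
qed

section \<open>From fixed configurations to almost every configuration\<close>

context gibbs_setup
begin

text \<open>The identity for Gibbs measures is used three times: to bring the summability of
  energies and the convergence of values to pairs consisting of \<open>\<gamma>\<close> and an added
  point, and to bring the resulting convergence of gradients back to the points of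
  \<open>\<gamma>\<close> itself.\<close>

lemma gradient_limit:
  fixes m :: "'a measure" and \<rho> :: "'a \<Rightarrow> real"
  assumes R: "riemannian_metric M" and vol: "volume_element M m"
    and \<rho>_nn: "\<And>x. 0 \<le> \<rho> x" and \<rho>[measurable]: "\<rho> \<in> borel_measurable borel"
    and \<sigma>_eq: "\<sigma> = density m (\<lambda>x. ennreal (\<rho> x))"
    and H: "\<And>j. H j \<in> FCb_inf M" and conv: "AE \<gamma> in \<mu>. (\<lambda>j. H j \<gamma>) \<longlonglongrightarrow> 0"
    and fast: "(\<Sum>j. ennreal (2 ^ j) * (\<integral>\<^sup>+\<gamma>. \<integral>\<^sup>+x. ennreal (grad_sq M (increment H j) x \<gamma>) \<partial>count_space \<gamma> \<partial>\<mu>)) < \<infinity>"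
    and hz: "AE \<gamma> in \<mu>. hamza_condition m (rho_conf \<Phi> \<rho> \<gamma>) \<or>
      (\<exists>\<psi>. euclidean_identification M \<psi> \<and> hamza_condition_lines (rho_conf \<Phi> \<rho> \<gamma> \<circ> inv \<psi>))"
  shows "AE \<gamma> in \<mu>. \<forall>x\<in>\<gamma>. (\<lambda>j. grad_sq M (H j) x \<gamma>) \<longlonglongrightarrow> 0"
proof -
  let ?w = "rho_conf \<Phi> \<rho>"
  have sets_m: "sets m = sets borel" using vol by (simp add: volume_element_def)
  have m_iff: "measurable m N = measurable borel N" for N :: "'z measure" using measurable_cong_sets[OF sets_m refl] by blast
  define D where "D j = increment H j" for j
  have D: "D j \<in> FCb_inf M" for j unfolding D_def by (intro FCb_inf_diff H)
  define e where "e p = exp_neg (point_energy \<Phi> (fst p) (snd p))" for p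
  have e[measurable]: "e \<in> borel_measurable BC" using measurable_point_energy[OF M potential] by (simp add: e_def[abs_def] split_beta')
  have e_nn: "0 \<le> e p" for p by (simp add: e_def exp_neg_nonneg)
  have w_eq: "?w \<gamma> x = e (x, \<gamma>) * \<rho> x" for x \<gamma> by (simp add: rho_conf_def e_def)
  have gs: "(\<lambda>p. grad_sq M F (fst p) (snd p)) \<in> borel_measurable BC" if "F \<in> FCb_inf M" for F
    using measurable_grad_sq[OF M R that] by (simp add: split_beta')
  note gsD[measurable] = gs[OF D]
  define T where "T p = (\<Sum>j. ennreal (2 ^ j * grad_sq M (D j) (fst p) (snd p)))" for p
  have T[measurable]: "T \<in> borel_measurable BC" unfolding T_def[abs_def] by measurable
  have meas_ins[measurable]: "(\<lambda>p. u (fst p, insert (fst p) (snd p))) \<in> borel_measurable BC"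
    if "u \<in> borel_measurable BC" for u :: "'a \<times> 'a set \<Rightarrow> 'b::topological_space"
    by (rule measurable_compose[OF measurable_insert_point that])
  note sec = measurable_section
  have \<sigma>_int: "(\<integral>\<^sup>+x. u x \<partial>\<sigma>) = (\<integral>\<^sup>+x. ennreal (\<rho> x) * u x \<partial>m)" if "u \<in> borel_measurable borel" for u
    unfolding \<sigma>_eq using that by (intro nn_integral_density) (auto simp: m_iff)
  \<comment> \<open>With \<open>\<sigma> = \<rho> m\<close> the density of \<open>\<sigma>\<close>
    and the point energy combine to \<open>rho_conf\<close>, the weight appearing in the Hamza
    conditions.\<close>
  have GNZ': "(\<integral>\<^sup>+\<gamma>. \<integral>\<^sup>+x. f (x, \<gamma>) \<partial>count_space \<gamma> \<partial>\<mu>) =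
      (\<integral>\<^sup>+\<gamma>. \<integral>\<^sup>+x. f (x, insert x \<gamma>) * ennreal (?w \<gamma> x) \<partial>m \<partial>\<mu>)"
    and GNZ_m: "(\<lambda>\<gamma>. \<integral>\<^sup>+x. f (x, insert x \<gamma>) * ennreal (?w \<gamma> x) \<partial>m) \<in> borel_measurable \<mu>"
    if f[measurable]: "f \<in> borel_measurable BC" for f
  proof -
    define F where "F p = f (fst p, insert (fst p) (snd p)) * ennreal (e p)" for p
    have F[measurable]: "F \<in> borel_measurable BC" unfolding F_def[abs_def] by measurable
    have eq: "(\<integral>\<^sup>+x. F (x, \<gamma>) \<partial>\<sigma>) = (\<integral>\<^sup>+x. f (x, insert x \<gamma>) * ennreal (?w \<gamma> x) \<partial>m)" if "\<gamma> \<in> space \<mu>" for \<gamma>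
      using that by (subst \<sigma>_int[OF sec[OF F]])
        (auto intro!: nn_integral_cong simp: space_\<mu> F_def w_eq ennreal_mult e_nn \<rho>_nn mult_ac)
    have "(\<integral>\<^sup>+\<gamma>. \<integral>\<^sup>+x. f (x, \<gamma>) \<partial>count_space \<gamma> \<partial>\<mu>) = (\<integral>\<^sup>+\<gamma>. \<integral>\<^sup>+x. F (x, \<gamma>) \<partial>\<sigma> \<partial>\<mu>)"
      unfolding GNZ[OF f] by (simp add: F_def e_def)
    also have "\<dots> = (\<integral>\<^sup>+\<gamma>. \<integral>\<^sup>+x. f (x, insert x \<gamma>) * ennreal (?w \<gamma> x) \<partial>m \<partial>\<mu>)"
      by (intro nn_integral_cong eq)
    finally show "(\<integral>\<^sup>+\<gamma>. \<integral>\<^sup>+x. f (x, \<gamma>) \<partial>count_space \<gamma> \<partial>\<mu>) =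
      (\<integral>\<^sup>+\<gamma>. \<integral>\<^sup>+x. f (x, insert x \<gamma>) * ennreal (?w \<gamma> x) \<partial>m \<partial>\<mu>)" .
    have "(\<lambda>\<gamma>. \<integral>\<^sup>+x. F (x, \<gamma>) \<partial>\<sigma>) \<in> borel_measurable \<mu>" by (intro measurable_\<mu> measurable_\<sigma>_integral F)
    then show "(\<lambda>\<gamma>. \<integral>\<^sup>+x. f (x, insert x \<gamma>) * ennreal (?w \<gamma> x) \<partial>m) \<in> borel_measurable \<mu>"
      by (subst measurable_cong[OF eq[symmetric]])
  qed
  have configs: "AE \<gamma> in \<mu>. \<gamma> \<in> configs" using AE_space[of \<mu>] by (simp add: space_\<mu>)
  have w_m: "?w \<gamma> \<in> borel_measurable borel" if "\<gamma> \<in> configs" for \<gamma>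
    unfolding w_eq[abs_def] using sec[OF e that] by measurable
  have w_nn: "0 \<le> ?w \<gamma> x" for \<gamma> x unfolding w_eq by (simp add: e_nn \<rho>_nn)
  have A1: "AE \<gamma> in \<mu>. (\<integral>\<^sup>+x. (\<Sum>j. ennreal (2 ^ j * (?w \<gamma> x * grad_sq M (D j) x (insert x \<gamma>)))) \<partial>m) < \<infinity>"
  proof -
    have gD: "(\<lambda>\<gamma>. \<integral>\<^sup>+x. ennreal (2 ^ j * grad_sq M (D j) x \<gamma>) \<partial>count_space \<gamma>) \<in> borel_measurable \<mu>" for j
      by (rule measurable_\<mu>) (rule measurable_sum_points[OF M, of "\<lambda>p. ennreal (2 ^ j * grad_sq M (D j) (fst p) (snd p))", simplified], measurable)
    have gD': "(\<lambda>\<gamma>. \<integral>\<^sup>+x. ennreal (grad_sq M (D j) x \<gamma>) \<partial>count_space \<gamma>) \<in> borel_measurable \<mu>" for j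
      by (rule measurable_\<mu>) (rule measurable_sum_points[OF M, of "\<lambda>p. ennreal (grad_sq M (D j) (fst p) (snd p))", simplified], measurable)
    have "(\<integral>\<^sup>+\<gamma>. \<integral>\<^sup>+x. T (x, \<gamma>) \<partial>count_space \<gamma> \<partial>\<mu>) = (\<integral>\<^sup>+\<gamma>. (\<Sum>j. \<integral>\<^sup>+x. ennreal (2 ^ j * grad_sq M (D j) x \<gamma>) \<partial>count_space \<gamma>) \<partial>\<mu>)"
      unfolding T_def by (intro nn_integral_cong) (simp add: nn_integral_suminf)
    also have "\<dots> = (\<Sum>j. \<integral>\<^sup>+\<gamma>. \<integral>\<^sup>+x. ennreal (2 ^ j * grad_sq M (D j) x \<gamma>) \<partial>count_space \<gamma> \<partial>\<mu>)"
      by (rule nn_integral_suminf[OF gD])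
    also have "\<dots> = (\<Sum>j. ennreal (2 ^ j) * (\<integral>\<^sup>+\<gamma>. \<integral>\<^sup>+x. ennreal (grad_sq M (D j) x \<gamma>) \<partial>count_space \<gamma> \<partial>\<mu>))"
      by (simp add: ennreal_mult grad_sq_nonneg[OF M R D] nn_integral_cmult nn_integral_cmult[OF gD'])
    finally have "(\<integral>\<^sup>+\<gamma>. \<integral>\<^sup>+x. T (x, insert x \<gamma>) * ennreal (?w \<gamma> x) \<partial>m \<partial>\<mu>) < \<infinity>"
      using fast unfolding GNZ'[OF T] D_def by simp
    then have "AE \<gamma> in \<mu>. (\<integral>\<^sup>+x. T (x, insert x \<gamma>) * ennreal (?w \<gamma> x) \<partial>m) \<noteq> \<infinity>"
      by (intro nn_integral_PInf_AE GNZ_m T) auto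
    then show ?thesis
    proof (rule eventually_mono)
      fix \<gamma> assume *: "(\<integral>\<^sup>+x. T (x, insert x \<gamma>) * ennreal (?w \<gamma> x) \<partial>m) \<noteq> \<infinity>"
      have "(\<integral>\<^sup>+x. (\<Sum>j. ennreal (2 ^ j * (?w \<gamma> x * grad_sq M (D j) x (insert x \<gamma>)))) \<partial>m) =
        (\<integral>\<^sup>+x. T (x, insert x \<gamma>) * ennreal (?w \<gamma> x) \<partial>m)"
        unfolding T_def fst_conv snd_conv ennreal_suminf_multc[symmetric]
        by (intro nn_integral_cong suminf_cong) (simp add: ennreal_mult w_nn grad_sq_nonneg[OF M R D] mult_ac)
      then show "(\<integral>\<^sup>+x. (\<Sum>j. ennreal (2 ^ j * (?w \<gamma> x * grad_sq M (D j) x (insert x \<gamma>)))) \<partial>m) < \<infinity>"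
        using * by (simp add: top.not_eq_extremum)
    qed
  qed
  \<comment> \<open>If the set of bad points has zero weighted measure, then \<open>m\<close>-almost
    every point of positive weight is good.\<close>
  have m_zero: "AE x in m. 0 < ?w \<gamma> x \<longrightarrow> P x"
    if "\<gamma> \<in> configs" "(\<integral>\<^sup>+x. indicator {p. \<not> P' p} (x, insert x \<gamma>) * ennreal (?w \<gamma> x) \<partial>m) = 0"
      "Measurable.pred BC P'" "\<And>x. P' (x, insert x \<gamma>) \<Longrightarrow> P x" for \<gamma> P P'
  proof -
    note [measurable] = that(3) w_m[OF that(1)]
    have "(\<lambda>p. indicator {p. \<not> P' p} (fst p, insert (fst p) (snd p)) :: ennreal) \<in> borel_measurable BC"
      by (rule meas_ins) measurable
    from sec[OF this that(1)] have "(\<lambda>x. indicator {p. \<not> P' p} (x, insert x \<gamma>) * ennreal (?w \<gamma> x)) \<in> borel_measurable m"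
      unfolding m_iff by simp
    with that(2) have "AE x in m. indicator {p. \<not> P' p} (x, insert x \<gamma>) * ennreal (?w \<gamma> x) = 0"
      by (subst (asm) nn_integral_0_iff_AE) auto
    then show ?thesis
      by (rule eventually_mono) (use that(4) in \<open>auto simp: indicator_def ennreal_eq_0_iff split: if_splits\<close>)
  qed
  have A2: "AE \<gamma> in \<mu>. AE x in m. 0 < ?w \<gamma> x \<longrightarrow> (\<lambda>j. H j (insert x \<gamma>)) \<longlonglongrightarrow> 0"
  proof -
    define P where "P p \<longleftrightarrow> (\<lambda>j. H j (snd p)) \<longlonglongrightarrow> 0" for p :: "'a \<times> 'a set"
    have P: "Measurable.pred BC P"
      unfolding P_def[abs_def]
      by (rule measurable_tendsto_0) (rule measurable_compose[OF measurable_snd FCb_inf_measurable(1)[OF M H]])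
    then have Pm: "(\<lambda>p. indicator {p. \<not> P p} p :: ennreal) \<in> borel_measurable BC" by measurable
    have "(\<integral>\<^sup>+\<gamma>. \<integral>\<^sup>+x. indicator {p. \<not> P p} (x, \<gamma>) \<partial>count_space \<gamma> \<partial>\<mu>) = (\<integral>\<^sup>+\<gamma>. 0 \<partial>\<mu>)"
      using conv by (intro nn_integral_cong_AE) (auto elim!: eventually_mono simp: P_def)
    then have "(\<integral>\<^sup>+\<gamma>. \<integral>\<^sup>+x. indicator {p. \<not> P p} (x, insert x \<gamma>) * ennreal (?w \<gamma> x) \<partial>m \<partial>\<mu>) = 0"
      unfolding GNZ'[OF Pm] by simp
    then have "AE \<gamma> in \<mu>. (\<integral>\<^sup>+x. indicator {p. \<not> P p} (x, insert x \<gamma>) * ennreal (?w \<gamma> x) \<partial>m) = 0"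
      by (subst (asm) nn_integral_0_iff_AE[OF GNZ_m[OF Pm]])
    with configs show ?thesis
    proof eventually_elim
      case (elim \<gamma>)
      show ?case by (rule m_zero[OF elim P]) (simp add: P_def)
    qed
  qed
  obtain \<D> where \<D>: "\<D> \<subseteq> chart_balls M" "countable \<D>" "\<Union>\<D> = UNIV"
    by (rule open_eq_countable_chart_balls[OF M open_UNIV]) (rule that; assumption)
  have A3: "AE \<gamma> in \<mu>. AE x in m. 0 < ?w \<gamma> x \<longrightarrow> (\<lambda>j. grad_sq M (H j) x (insert x \<gamma>)) \<longlonglongrightarrow> 0"
    using configs A1 A2 hz
  proof eventually_elim
    case (elim \<gamma>)
    have notin: "AE x in m. x \<notin> \<gamma>"
    proof -
      have "(\<Union>x\<in>\<gamma>. {x}) \<in> null_sets m"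
        using configs_countable[OF M elim(1)] volume_element_point[OF M vol]
        by (intro null_sets_UN') (auto simp: null_sets_def sets_m)
      then show ?thesis using AE_not_in by fastforce
    qed
    have gsm: "(\<lambda>x. grad_sq M (increment H j) x (insert x \<gamma>)) \<in> borel_measurable borel" for j
      using sec[OF meas_ins[OF gsD[of j]] elim(1)] by (simp add: D_def)
    have "AE x in m. x \<in> B \<longrightarrow> 0 < ?w \<gamma> x \<longrightarrow> (\<lambda>j. grad_sq M (H j) x (insert x \<gamma>)) \<longlonglongrightarrow> 0" if "B \<in> \<D>" for B
    proof -
      from that \<D>(1) obtain c0 a r0 where B: "B = chart_inv c0 ` ball a r0" "c0 \<in> charts M" "0 < r0" "cball a r0 \<subseteq> chart_range c0"
        unfolding chart_balls_def by blast
      have B_open: "open B" using chart_balls_open_c(2)[OF M] that \<D>(1) by blast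
      \<comment> \<open>Common to both alternatives: only the chart and the origin of the line
        condition differ. For the first the chart is \<open>c0\<close> itself, for the second the
        global Euclidean chart, while the ball always comes from a listed chart.\<close>
      have concl: ?thesis if c: "nice_chart M c" and sub: "chart_inv c0 ` cball a r0 \<subseteq> fst c"
        and ex: "\<And>C. chart_comparison c B m C \<Longrightarrow> \<exists>r. r \<in> borel_measurable borel \<and>
          (\<forall>y\<in>snd c ` B. r y = ?w \<gamma> (chart_inv c y)) \<and> (\<forall>l. line_condition l (snd c ` B) r)" for c
      proof -
        obtain C where C: "C > 0"
          "\<And>A. A \<in> sets borel \<Longrightarrow> A \<subseteq> B \<Longrightarrow> emeasure lborel (snd c ` A) \<le> ennreal C * emeasure m A"
          "\<And>A. A \<in> sets borel \<Longrightarrow> A \<subseteq> B \<Longrightarrow> emeasure lborel (snd c ` A) = 0 \<Longrightarrow> emeasure m A = 0"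
          "\<And>x l. x \<in> B \<Longrightarrow> gram_matrix M c (snd c x) $ l $ l \<le> C"
          by (rule chart_ball_comparison[OF M R vol B(2,4) c sub, folded B(1)]) (rule that; assumption)
        have "B \<subseteq> fst c" using sub ball_subset_cball[of a r0] unfolding B(1) by blast
        then have cc: "chart_comparison c B m C"
          by (unfold_locales) (use C B_open sets_m nice_chart_is_chart[OF c] in auto)
        from ex[OF cc] obtain r where r: "r \<in> borel_measurable borel"
          "\<And>y. y \<in> snd c ` B \<Longrightarrow> r y = ?w \<gamma> (chart_inv c y)" "\<And>l. line_condition l (snd c ` B) r" by blast
        show ?thesis
          by (rule chart_comparison.gradient_convergence[where H = H and w = "?w \<gamma>" and \<gamma> = \<gamma>, OF cc M c C(4) elim(1) notin H grad_sq_nonneg[OF M R] gsm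
                w_m[OF elim(1)] w_nn r])
            (use elim(2,3) in \<open>simp_all add: D_def\<close>)
      qed
      from elim(4) show ?thesis
      proof
        assume hc: "hamza_condition m (?w \<gamma>)"
        have nc: "nice_chart M c0" by (rule nice_chart_charts[OF M R B(2)])
        show ?thesis
        proof (rule concl[OF nc])
          show "chart_inv c0 ` cball a r0 \<subseteq> fst c0" using B(4) is_chartD(8)[OF nice_chart_is_chart[OF nc]] by auto
          fix C assume cc: "chart_comparison c0 B m C"
          interpret chart_comparison c0 B m C by (rule cc)
          \<comment> \<open>Extended by 0 because the inverse chart is meaningful, and measurable,
            only on its range.\<close>
          define r where "r y = indicator (snd c0 ` B) y * ?w \<gamma> (chart_inv c0 y)" for y
          have "chart_inv c0 \<in> restrict_space borel (snd c0 ` B) \<rightarrow>\<^sub>M borel"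
            by (rule measurable_restrict_mono[OF borel_measurable_chart_inv[OF chart] open_Q(2)])
          from measurable_compose[OF this w_m[OF elim(1)]] have r: "r \<in> borel_measurable borel"
            unfolding r_def[abs_def] using open_Q(1)
            by (subst (asm) borel_measurable_restrict_space_iff) auto
          have rw: "r y = ?w \<gamma> (chart_inv c0 y)" if "y \<in> snd c0 ` B" for y using that by (simp add: r_def)
          show "\<exists>r. r \<in> borel_measurable borel \<and> (\<forall>y\<in>snd c0 ` B. r y = ?w \<gamma> (chart_inv c0 y)) \<and>
            (\<forall>l. line_condition l (snd c0 ` B) r)"
            using r rw line_condition_hamza[OF hc w_m[OF elim(1)] r rw] by blast
        qed
      next
        assume "\<exists>\<psi>. euclidean_identification M \<psi> \<and> hamza_condition_lines (?w \<gamma> \<circ> inv \<psi>)"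
        then obtain \<psi> where \<psi>: "euclidean_identification M \<psi>" "hamza_condition_lines (?w \<gamma> \<circ> inv \<psi>)" by blast
        have nc: "nice_chart M (UNIV, \<psi>)" by (rule nice_chart_euclidean[OF \<psi>(1)])
        have ci: "chart_inv (UNIV, \<psi>) = inv \<psi>" by (simp add: chart_inv_def)
        have "chart_range (UNIV, \<psi>) = UNIV" using \<psi>(1) by (simp add: chart_range_def euclidean_identification_def)
        then have "inv \<psi> \<in> borel_measurable borel"
          using is_chartD(4)[OF nice_chart_is_chart[OF nc]] by (simp add: ci borel_measurable_continuous_onI)
        then have r: "?w \<gamma> \<circ> inv \<psi> \<in> borel_measurable borel"
          unfolding comp_def using w_m[OF elim(1)] by (rule measurable_compose)
        show ?thesis
          by (rule concl[OF nc]) (use r line_condition_hamza_lines[OF \<psi>(2) r] in \<open>auto simp: ci intro!: exI[of _ "?w \<gamma> \<circ> inv \<psi>"]\<close>)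
      qed
    qed
    then have "AE x in m. \<forall>B\<in>\<D>. x \<in> B \<longrightarrow> 0 < ?w \<gamma> x \<longrightarrow> (\<lambda>j. grad_sq M (H j) x (insert x \<gamma>)) \<longlonglongrightarrow> 0"
      by (subst AE_ball_countable[OF \<D>(2)]) blast
    then show ?case
      by (rule eventually_mono) (use \<D>(3) in blast)
  qed
  define P where "P p \<longleftrightarrow> (\<lambda>j. grad_sq M (H j) (fst p) (snd p)) \<longlonglongrightarrow> 0" for p
  have P: "Measurable.pred BC P" unfolding P_def[abs_def] by (intro measurable_tendsto_0 gs H)
  then have Pm: "(\<lambda>p. indicator {p. \<not> P p} p :: ennreal) \<in> borel_measurable BC" by measurable
  \<comment> \<open>Read backwards, the identity says that the expected number of bad points of
    \<open>\<gamma>\<close> is 0, so almost every configuration has none.\<close>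
  have "(\<integral>\<^sup>+\<gamma>. \<integral>\<^sup>+x. indicator {p. \<not> P p} (x, insert x \<gamma>) * ennreal (?w \<gamma> x) \<partial>m \<partial>\<mu>) = (\<integral>\<^sup>+\<gamma>. 0 \<partial>\<mu>)"
  proof (rule nn_integral_cong_AE, rule eventually_mono[OF A3])
    fix \<gamma> assume "AE x in m. 0 < ?w \<gamma> x \<longrightarrow> (\<lambda>j. grad_sq M (H j) x (insert x \<gamma>)) \<longlonglongrightarrow> 0"
    then have "AE x in m. indicator {p. \<not> P p} (x, insert x \<gamma>) * ennreal (?w \<gamma> x) = 0"
      by (rule eventually_mono) (auto simp: P_def ennreal_eq_0_iff not_less)
    then have "(\<integral>\<^sup>+x. indicator {p. \<not> P p} (x, insert x \<gamma>) * ennreal (?w \<gamma> x) \<partial>m) = (\<integral>\<^sup>+x. 0 \<partial>m)"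
      by (rule nn_integral_cong_AE)
    then show "(\<integral>\<^sup>+x. indicator {p. \<not> P p} (x, insert x \<gamma>) * ennreal (?w \<gamma> x) \<partial>m) = 0" by simp
  qed
  then have "(\<integral>\<^sup>+\<gamma>. \<integral>\<^sup>+x. indicator {p. \<not> P p} (x, \<gamma>) \<partial>count_space \<gamma> \<partial>\<mu>) = 0"
    unfolding GNZ'[OF Pm] by simp
  then have "AE \<gamma> in \<mu>. (\<integral>\<^sup>+x. indicator {p. \<not> P p} (x, \<gamma>) \<partial>count_space \<gamma>) = 0"
    by (subst (asm) nn_integral_0_iff_AE[OF measurable_\<mu>[OF measurable_sum_points[OF M Pm]]])
  then show ?thesis
  proof (rule eventually_mono)
    fix \<gamma> assume "(\<integral>\<^sup>+x. indicator {p. \<not> P p} (x, \<gamma>) \<partial>count_space \<gamma>) = (0 :: ennreal)"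
    then have "AE x in count_space \<gamma>. indicator {p. \<not> P p} (x, \<gamma>) = (0 :: ennreal)"
      by (subst (asm) nn_integral_0_iff_AE) auto
    then show "\<forall>x\<in>\<gamma>. (\<lambda>j. grad_sq M (H j) x \<gamma>) \<longlonglongrightarrow> 0"
      by (simp add: AE_count_space P_def indicator_def)
  qed
qed


end

text \<open>The bound is kept for all pairs of indices beyond \<open>r i\<close>, because the limit
  argument compares arbitrary \<open>F n\<close> with the subsequence. The rate \<open>4^-i\<close>
  leaves a summable \<open>2^-i\<close> after multiplication by the weight
  \<open>2^i\<close>.\<close>

lemma fast_subsequence:
  fixes E :: "nat \<Rightarrow> nat \<Rightarrow> real"
  assumes "((\<lambda>(n, k). E n k) \<longlongrightarrow> 0) (sequentially \<times>\<^sub>F sequentially)"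
  obtains r :: "nat \<Rightarrow> nat" where "strict_mono r" "\<And>i n k. r i \<le> n \<Longrightarrow> r i \<le> k \<Longrightarrow> E n k < (1/4) ^ i"
proof -
  have "\<exists>N. \<forall>n\<ge>N. \<forall>k\<ge>N. E n k < (1/4) ^ i" for i :: nat
  proof -
    have "\<forall>\<^sub>F p in sequentially \<times>\<^sub>F sequentially. (\<lambda>(n, k). E n k) p < (1/4) ^ i"
      by (rule order_tendstoD(2)[OF assms]) simp
    then show ?thesis unfolding eventually_prod_sequentially by auto
  qed
  then obtain N where N: "\<And>i n k. N i \<le> n \<Longrightarrow> N i \<le> k \<Longrightarrow> E n k < (1/4) ^ i" by metis
  \<comment> \<open>Partial sums of positive numbers are strictly increasing and dominate their last
    term \<open>N i\<close>.\<close>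
  define r where "r i = (\<Sum>l\<le>i. Suc (N l))" for i :: nat
  have "strict_mono r" by (auto simp: strict_mono_Suc_iff r_def)
  moreover have "E n k < (1/4) ^ i" if "r i \<le> n" "r i \<le> k" for i n k
  proof -
    have "N i \<le> r i" using member_le_sum[of i "{..i}" "\<lambda>l. Suc (N l)"] by (simp add: r_def)
    then show ?thesis using that by (intro N) auto
  qed
  ultimately show thesis by (rule that)
qed

theorem theorem6p13:
  fixes M :: "('a::{t2_space, second_countable_topology}, 'n::finite) riemannian"
    and m :: "'a measure" and \<rho> :: "'a \<Rightarrow> real"
    and \<Phi> :: "'a set \<Rightarrow> ereal" and \<mu> :: "'a set measure"
  assumes "oriented_riemannian_manifold M" and "connected (UNIV :: 'a set)"
    and "volume_element M m"
    and "\<And>x. 0 \<le> \<rho> x" and "\<rho> \<in> L1_loc m" and "(\<lambda>x. sqrt (\<rho> x)) \<in> H12_loc M"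
    and "potential \<Phi>"
    and "\<mu> \<in> gibbs_gc1 M (density m (\<lambda>x. ennreal (\<rho> x))) \<Phi>"
    and "(AE \<gamma> in \<mu>. hamza_condition m (rho_conf \<Phi> \<rho> \<gamma>)) \<or>
         (\<exists>\<psi>. euclidean_identification M \<psi> \<and>
              (AE \<gamma> in \<mu>. hamza_condition_lines (rho_conf \<Phi> \<rho> \<gamma> \<circ> inv \<psi>)))"
  shows "closable_on_L2 \<mu> (FCb_inf M) (dirichlet_form M \<mu>)"
proof -
  have M: "smooth_atlas M" and R: "riemannian_metric M"
    using assms(1) by (auto simp: oriented_riemannian_manifold_def)
  note vol = assms(3) and \<rho>_nn = assms(4)
  have sets_m: "sets m = sets borel" using vol by (simp add: volume_element_def)
  have \<rho>_m: "\<rho> \<in> borel_measurable m" and \<rho>_loc: "\<And>K. compact K \<Longrightarrow> set_integrable m K \<rho>"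
    using assms(5) by (auto simp: L1_loc_def)
  have \<rho>_b: "\<rho> \<in> borel_measurable borel" using \<rho>_m measurable_cong_sets[OF sets_m refl] by blast
  define \<sigma> where "\<sigma> = density m (\<lambda>x. ennreal (\<rho> x))"
  have K_sets: "K \<in> sets m" if "compact K" for K using compact_imp_closed[OF that] by (simp add: sets_m borel_closed)
  have em: "emeasure \<sigma> A = (\<integral>\<^sup>+x\<in>A. ennreal (\<rho> x) \<partial>m)" if "A \<in> sets m" for A
    unfolding \<sigma>_def using \<rho>_m that by (intro emeasure_density) auto
  from assms(8) obtain \<pi> where \<mu>: "prob_space \<mu>" "sets \<mu> = sets config_borel"
    "\<And>K. compact K \<Longrightarrow> (\<integral>\<^sup>+\<gamma>. of_nat (card (\<gamma> \<inter> K)) \<partial>\<mu>) < \<infinity>" and \<pi>: "poisson_measure M \<sigma> \<pi>"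
    "\<And>\<Lambda> \<Delta>. \<Lambda> \<in> open_c \<Longrightarrow> \<Delta> \<in> sets config_borel \<Longrightarrow> (\<integral>\<^sup>+\<gamma>. specification_kernel \<pi> \<Phi> \<Lambda> \<gamma> \<Delta> \<partial>\<mu>) = emeasure \<mu> \<Delta>"
    unfolding gibbs_gc1_def gibbs_gc_def \<sigma>_def by auto
  interpret G: gibbs_setup M \<sigma> \<pi> \<Phi> \<mu>
  proof (intro gibbs_setup.intro poisson_setup.intro gibbs_setup_axioms.intro)
    show "sets \<sigma> = sets borel" by (simp add: \<sigma>_def sets_m)
    show "emeasure \<sigma> {x} = 0" for x
      using volume_element_point[OF M vol, of x] em[of "{x}"]
      by (simp add: sets_m nn_integral_null_set null_sets_def)
    show "emeasure \<sigma> K < \<infinity>" if "compact K" for K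
    proof -
      have "(\<integral>\<^sup>+x\<in>K. ennreal (\<rho> x) \<partial>m) = (\<integral>\<^sup>+x. ennreal (norm (indicator K x *\<^sub>R \<rho> x)) \<partial>m)"
        using \<rho>_nn by (intro nn_integral_cong) (auto simp: indicator_def)
      also have "\<dots> < \<infinity>" using \<rho>_loc[OF that] by (auto simp: set_integrable_def integrable_iff_bounded)
      finally show ?thesis using em[OF K_sets[OF that]] by simp
    qed
  qed (rule M assms(7) \<mu>(1,2) \<pi> | assumption)+
  \<comment> \<open>From here on the alternative is decided separately for each configuration, so
    both hypotheses on \<open>\<mu>\<close>-almost every \<open>\<gamma>\<close> are covered by one
    statement.\<close>
  have hz: "AE \<gamma> in \<mu>. hamza_condition m (rho_conf \<Phi> \<rho> \<gamma>) \<or>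
      (\<exists>\<psi>. euclidean_identification M \<psi> \<and> hamza_condition_lines (rho_conf \<Phi> \<rho> \<gamma> \<circ> inv \<psi>))"
    using assms(9)
  proof
    assume "\<exists>\<psi>. euclidean_identification M \<psi> \<and> (AE \<gamma> in \<mu>. hamza_condition_lines (rho_conf \<Phi> \<rho> \<gamma> \<circ> inv \<psi>))"
    then obtain \<psi> where "euclidean_identification M \<psi>" "AE \<gamma> in \<mu>. hamza_condition_lines (rho_conf \<Phi> \<rho> \<gamma> \<circ> inv \<psi>)" by blast
    then show ?thesis by (auto elim!: eventually_mono)
  qed (auto elim!: eventually_mono)
  let ?E = "dirichlet_form M \<mu>"
  show ?thesis
    unfolding closable_on_L2_def
  proof (intro allI impI)
    fix F :: "nat \<Rightarrow> 'a set \<Rightarrow> real"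
    assume "\<forall>n. F n \<in> FCb_inf M" and L2: "(\<lambda>n. LINT \<gamma>|\<mu>. (F n \<gamma>)\<^sup>2) \<longlonglongrightarrow> 0"
      and E: "((\<lambda>(n, k). ?E (\<lambda>\<gamma>. F n \<gamma> - F k \<gamma>) (\<lambda>\<gamma>. F n \<gamma> - F k \<gamma>)) \<longlongrightarrow> 0) (sequentially \<times>\<^sub>F sequentially)"
    then have F: "F n \<in> FCb_inf M" for n by blast
    have E_eq: "ennreal (?E F F) = (\<integral>\<^sup>+\<gamma>. \<integral>\<^sup>+x. ennreal (grad_sq M F x \<gamma>) \<partial>count_space \<gamma> \<partial>\<mu>)"
      if "F \<in> FCb_inf M" for F
      by (rule dirichlet_form_nn_integral[OF M R that \<mu>(2,3)])
    obtain r where r: "strict_mono r"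
      "\<And>i n k. r i \<le> n \<Longrightarrow> r i \<le> k \<Longrightarrow> ?E (\<lambda>\<gamma>. F n \<gamma> - F k \<gamma>) (\<lambda>\<gamma>. F n \<gamma> - F k \<gamma>) < (1/4) ^ i"
      by (rule fast_subsequence[OF E]) (rule that; assumption)
    have F_int: "integrable \<mu> (\<lambda>\<gamma>. (F n \<gamma>)\<^sup>2)" for n
    proof -
      obtain b where b: "\<And>\<gamma>. \<gamma> \<in> configs \<Longrightarrow> \<bar>F n \<gamma>\<bar> \<le> b" using FCb_inf_measurable(2)[OF M F] by blast
      have [measurable]: "F n \<in> borel_measurable \<mu>" by (rule G.measurable_\<mu>[OF FCb_inf_measurable(1)[OF M F]])
      have "(F n \<gamma>)\<^sup>2 \<le> b\<^sup>2" if "\<gamma> \<in> configs" for \<gamma> using power_mono[OF b[OF that], of 2] by simp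
      then show ?thesis
        by (intro finite_measure.integrable_const_bound[of _ _ "b\<^sup>2"] prob_space.finite_measure \<mu>(1) AE_I2) (auto simp: G.space_\<mu>)
    qed
    have "(\<lambda>i. \<integral>\<gamma>. norm ((F (r i) \<gamma>)\<^sup>2) \<partial>\<mu>) \<longlonglongrightarrow> 0"
      using LIMSEQ_subseq_LIMSEQ[OF L2 r(1)] by (simp add: comp_def)
    \<comment> \<open>A further subsequence converges almost everywhere. It preserves the rates,
      since \<open>s j \<ge> j\<close> and the bounds hold for all larger indices.\<close>
    from tendsto_L1_AE_subseq[OF F_int this] obtain s where s: "strict_mono s" "AE \<gamma> in \<mu>. (\<lambda>j. (F (r (s j)) \<gamma>)\<^sup>2) \<longlonglongrightarrow> 0" by blast
    define H where "H j = F (r (s j))" for j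
    have H: "H j \<in> FCb_inf M" for j by (simp add: H_def F)
    have conv: "AE \<gamma> in \<mu>. (\<lambda>j. H j \<gamma>) \<longlonglongrightarrow> 0"
      using s(2)
    proof (rule eventually_mono)
      fix \<gamma> assume "(\<lambda>j. (F (r (s j)) \<gamma>)\<^sup>2) \<longlonglongrightarrow> 0"
      from tendsto_real_sqrt[OF this] show "(\<lambda>j. H j \<gamma>) \<longlonglongrightarrow> 0" by (simp add: H_def tendsto_rabs_zero_iff)
    qed
    have "(\<Sum>j. ennreal (2 ^ j) * (\<integral>\<^sup>+\<gamma>. \<integral>\<^sup>+x. ennreal (grad_sq M (increment H j) x \<gamma>) \<partial>count_space \<gamma> \<partial>\<mu>))
      \<le> (\<Sum>j. ennreal ((1/2) ^ j))"
    proof (intro suminf_le)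
      fix j
      have "r (s j) \<le> r (s (Suc j))" using r(1) s(1) by (simp add: strict_mono_less_eq)
      then have "?E (increment H j) (increment H j) \<le> (1/4) ^ s j"
        unfolding H_def by (intro less_imp_le[OF r(2)]) auto
      also have "\<dots> \<le> (1/4) ^ j" using seq_suble[OF s(1), of j] by (intro power_decreasing) auto
      finally have "2 ^ j * ?E (increment H j) (increment H j) \<le> 2 ^ j * (1/4) ^ j"
        by (intro mult_left_mono) auto
      also have "\<dots> = (1/2) ^ j" by (simp add: power_mult_distrib[symmetric])
      finally show "ennreal (2 ^ j) * (\<integral>\<^sup>+\<gamma>. \<integral>\<^sup>+x. ennreal (grad_sq M (increment H j) x \<gamma>) \<partial>count_space \<gamma> \<partial>\<mu>)
        \<le> ennreal ((1/2) ^ j)"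
      proof -
        assume le: "2 ^ j * ?E (increment H j) (increment H j) \<le> (1/2) ^ j"
        have eq: "ennreal (?E (increment H j) (increment H j)) =
          (\<integral>\<^sup>+\<gamma>. \<integral>\<^sup>+x. ennreal (grad_sq M (increment H j) x \<gamma>) \<partial>count_space \<gamma> \<partial>\<mu>)"
          by (rule E_eq[OF FCb_inf_diff[OF H H]])
        show ?thesis
          unfolding eq[symmetric] by (subst ennreal_mult'[symmetric]) (use le in \<open>auto intro: ennreal_leI\<close>)
      qed
    qed auto
    also have "\<dots> = ennreal (\<Sum>j. (1/2) ^ j)" by (intro suminf_ennreal2) (auto intro: summable_geometric)
    also have "\<dots> < \<infinity>" by simp
    finally have lim: "AE \<gamma> in \<mu>. \<forall>x\<in>\<gamma>. (\<lambda>j. grad_sq M (H j) x \<gamma>) \<longlonglongrightarrow> 0"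
      by (rule G.gradient_limit[OF R vol \<rho>_nn \<rho>_b \<sigma>_def H conv _ hz])
    \<comment> \<open>Compares a fixed \<open>F n\<close> with \<open>H j\<close> for
      \<open>j\<close> tending to infinity: the gradient of \<open>H j\<close> disappears in the
      limit, and the energy of \<open>F n - H j\<close> is controlled by the Cauchy
      property.\<close>
    have bound: "?E (F n) (F n) \<le> 2 * (1/4) ^ i" if n: "r i \<le> n" for n i
    proof -
      have Dn: "(\<lambda>\<gamma>. F n \<gamma> - H j \<gamma>) \<in> FCb_inf M" for j by (intro FCb_inf_diff F H)
      define u where "u j x \<gamma> = ennreal (2 * grad_sq M (\<lambda>\<gamma>. F n \<gamma> - H j \<gamma>) x \<gamma>)" for j x \<gamma>
      have um: "(\<lambda>p. u j (fst p) (snd p)) \<in> borel_measurable (borel \<Otimes>\<^sub>M local_borel UNIV)" for j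
        unfolding u_def using measurable_grad_sq[OF M R Dn[of j]] by (simp add: split_beta')
      from G.measurable_\<mu>[OF measurable_sum_points[OF M um]]
      have um': "(\<lambda>\<gamma>. \<integral>\<^sup>+x. u j x \<gamma> \<partial>count_space \<gamma>) \<in> borel_measurable \<mu>" for j by simp
      have gm': "(\<lambda>\<gamma>. \<integral>\<^sup>+x. ennreal (grad_sq M (\<lambda>\<gamma>. F n \<gamma> - H j \<gamma>) x \<gamma>) \<partial>count_space \<gamma>) \<in> borel_measurable \<mu>" for j
        using G.measurable_\<mu>[OF measurable_sum_points[OF M, of "\<lambda>p. ennreal (grad_sq M (\<lambda>\<gamma>. F n \<gamma> - H j \<gamma>) (fst p) (snd p))"]]
          measurable_grad_sq[OF M R Dn[of j]] by (simp add: split_beta')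
      have "ennreal (?E (F n) (F n)) = (\<integral>\<^sup>+\<gamma>. \<integral>\<^sup>+x. ennreal (grad_sq M (F n) x \<gamma>) \<partial>count_space \<gamma> \<partial>\<mu>)"
        by (rule E_eq[OF F])
      also have "\<dots> \<le> (\<integral>\<^sup>+\<gamma>. liminf (\<lambda>j. \<integral>\<^sup>+x. u j x \<gamma> \<partial>count_space \<gamma>) \<partial>\<mu>)"
      proof (rule nn_integral_mono_AE)
        have "AE \<gamma> in \<mu>. \<gamma> \<in> configs" using AE_space[of \<mu>] by (simp add: G.space_\<mu>)
        with lim show "AE \<gamma> in \<mu>. (\<integral>\<^sup>+x. ennreal (grad_sq M (F n) x \<gamma>) \<partial>count_space \<gamma>) \<le> liminf (\<lambda>j. \<integral>\<^sup>+x. u j x \<gamma> \<partial>count_space \<gamma>)"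
        proof eventually_elim
          case (elim \<gamma>)
          have "(\<integral>\<^sup>+x. ennreal (grad_sq M (F n) x \<gamma>) \<partial>count_space \<gamma>) \<le> (\<integral>\<^sup>+x. liminf (\<lambda>j. u j x \<gamma>) \<partial>count_space \<gamma>)"
          proof (rule nn_integral_mono)
            fix x assume "x \<in> space (count_space \<gamma>)"
            then have x: "x \<in> \<gamma>" by simp
            \<comment> \<open>The inequality \<open>|p|^2 \<le> 2 |p - q|^2 + 2 |q|^2\<close> is
              used with the last term on the left. The real difference may be negative and is then
              cut off by \<open>ennreal\<close>, but its limit is the nonnegative squared gradient
              of \<open>F n\<close>.\<close>
            have "(\<lambda>j. ennreal (grad_sq M (F n) x \<gamma> - 2 * grad_sq M (H j) x \<gamma>)) \<longlonglongrightarrow> ennreal (grad_sq M (F n) x \<gamma> - 2 * 0)"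
              using elim(1) x by (intro tendsto_ennrealI tendsto_intros) auto
            then have "ennreal (grad_sq M (F n) x \<gamma>) = liminf (\<lambda>j. ennreal (grad_sq M (F n) x \<gamma> - 2 * grad_sq M (H j) x \<gamma>))"
              by (simp add: lim_imp_Liminf)
            also have "\<dots> \<le> liminf (\<lambda>j. u j x \<gamma>)"
              unfolding u_def
            proof (intro Liminf_mono always_eventually allI ennreal_leI)
              show "grad_sq M (F n) x \<gamma> - 2 * grad_sq M (H j) x \<gamma> \<le> 2 * grad_sq M (\<lambda>\<gamma>. F n \<gamma> - H j \<gamma>) x \<gamma>" for j
                using grad_sq_le[OF M R F H elim(2) x, of n j] by simp
            qed
            finally show "ennreal (grad_sq M (F n) x \<gamma>) \<le> liminf (\<lambda>j. u j x \<gamma>)" .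
          qed
          also have "\<dots> \<le> liminf (\<lambda>j. \<integral>\<^sup>+x. u j x \<gamma> \<partial>count_space \<gamma>)" by (rule nn_integral_liminf) simp
          finally show ?case .
        qed
      qed
      also have "\<dots> \<le> liminf (\<lambda>j. \<integral>\<^sup>+\<gamma>. \<integral>\<^sup>+x. u j x \<gamma> \<partial>count_space \<gamma> \<partial>\<mu>)" by (rule nn_integral_liminf[OF um'])
      also have "\<dots> \<le> limsup (\<lambda>j. \<integral>\<^sup>+\<gamma>. \<integral>\<^sup>+x. u j x \<gamma> \<partial>count_space \<gamma> \<partial>\<mu>)" by (rule Liminf_le_Limsup) simp
      also have "\<dots> \<le> ennreal (2 * (1/4) ^ i)"
      proof (rule Limsup_bounded, rule eventually_mono[OF eventually_ge_at_top[of i]])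
        \<comment> \<open>Only large \<open>j\<close> matter for the upper limit; then
          \<open>r (s j) \<ge> r i\<close>, so the pair of indices is in the range where the bound
          \<open>4^-i\<close> holds.\<close>
        fix j assume "i \<le> j"
        then have "r i \<le> r (s j)" using seq_suble[OF s(1), of j] r(1) by (simp add: strict_mono_less_eq)
        then have "?E (\<lambda>\<gamma>. F n \<gamma> - H j \<gamma>) (\<lambda>\<gamma>. F n \<gamma> - H j \<gamma>) \<le> (1/4) ^ i"
          unfolding H_def by (intro less_imp_le[OF r(2)] n)
        moreover have "(\<integral>\<^sup>+\<gamma>. \<integral>\<^sup>+x. u j x \<gamma> \<partial>count_space \<gamma> \<partial>\<mu>) = ennreal 2 * ennreal (?E (\<lambda>\<gamma>. F n \<gamma> - H j \<gamma>) (\<lambda>\<gamma>. F n \<gamma> - H j \<gamma>))"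
          unfolding E_eq[OF Dn] u_def
          by (simp add: ennreal_mult grad_sq_nonneg[OF M R Dn] nn_integral_cmult nn_integral_cmult[OF gm'])
        ultimately show "(\<integral>\<^sup>+\<gamma>. \<integral>\<^sup>+x. u j x \<gamma> \<partial>count_space \<gamma> \<partial>\<mu>) \<le> ennreal (2 * (1/4) ^ i)"
          by (simp only: ennreal_mult'[symmetric] ennreal_leI mult_left_mono zero_le_numeral)
      qed
      finally show ?thesis by (subst (asm) ennreal_le_iff) auto
    qed
    show "(\<lambda>n. ?E (F n) (F n)) \<longlonglongrightarrow> 0"
    proof (rule LIMSEQ_I)
      fix \<epsilon> :: real assume "0 < \<epsilon>"
      then obtain i where i: "(1/4) ^ i < \<epsilon> / 2" using real_arch_pow_inv[of "\<epsilon> / 2" "1/4"] by auto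
      show "\<exists>n0. \<forall>n\<ge>n0. norm (?E (F n) (F n) - 0) < \<epsilon>"
      proof (intro exI[of _ "r i"] allI impI)
        fix n assume "r i \<le> n"
        from bound[OF this] show "norm (?E (F n) (F n) - 0) < \<epsilon>"
          using i dirichlet_form_nonneg[OF M R F, of \<mu> n] by simp
      qed
    qed
  qed
qed

end
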